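(* Let $Q$ be a quiver having an arrow $\rho_0:x\to y$, let $\kappa$ be an infinite cardinal such that $\kappa\geq\max\{\mathrm{rccn}(Q),\mathrm{ltccn}(Q)\}$ and $\kappa>\max\{|Q_0|,|Q_1|\}$, and let $\mathcal{C}\neq 0$ be an $AB4(\kappa)$ abelian category. Consider the following conditions: (a) $x\neq y$; (b) $x=y$ and $\mathcal{C}$ is $AB3^{*}(\aleph_1)$. If (a) or (b) holds true, then $\mathrm{gl.dim}(\mathrm{Rep}(Q,\mathcal{C}))=\mathrm{gl.dim}(\mathcal{C})+1$.
   Context: A quiver $Q$ consists of (possibly infinite) sets $Q_0$ of vertices and $Q_1$ of arrows with source and target maps. $Q(i,j)$ is the set of paths from $i$ to $j$ (including the trivial path if $i=j$), $Q(-,j)=\bigcup_{i}Q(i,j)$. $\mathrm{Rep}(Q,\mathcal{C})$ is the abelian category of $\mathcal{C}$-valued representations of $Q$. For a set $X$ of cardinals, $\mathrm{size}(X):=\sup X$ if $x<\sup X$ for all $x\in X$, and $\mathrm{size}(X):=(\sup X)^+$ otherwise. Put $\mathrm{rccn}(Q):=\sup_{i\in Q_0}\mathrm{size}(\{|Q(i,j)|\}_{j\in Q_0})$ and $\mathrm{ltccn}(Q):=\mathrm{size}(\{|Q(-,i)|\}_{i\in Q_0})$. An abelian category is $AB3(\kappa)$ (resp. $AB3^*(\kappa)$) if it has coproducts (resp. products) of families indexed by sets of cardinality $<\kappa$; it is $AB4(\kappa)$ if it is $AB3(\kappa)$ and such coproducts are exact. $\mathrm{Ext}^n$ denotes Yoneda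 Ext (enough projectives or injectives are not assumed). The projective dimension of an object $C$ is $\mathrm{pd}(C):=\min\{n\in\mathbb{N}:\mathrm{Ext}^k_{\mathcal{C}}(C,-)=0\ \forall k>n\}$ ($\infty$ if there is no such $n$), and $\mathrm{gl.dim}(\mathcal{C}):=\sup_{C\in\mathcal{C}}\mathrm{pd}(C)$; the equality is in $\mathbb{N}\cup\{\infty\}$. *)

theory Defs
  imports
    "Graph_Theory.Arc_Walk"
    "HOL-Algebra.Group"
    "HOL-Library.FuncSet"
    "HOL-Library.Extended_Nat"
begin

unbundle cardinal_syntax

section \<open>Cardinals\<close>

text \<open>
  Cardinals are well-order relations, as in \<^theory>\<open>HOL.BNF_Cardinal_Order_Relation\<close>. A set of
  cardinals on a type always has a supremum representable on the same type, because the cardinal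
  of the whole type is an upper bound and cardinals are well-ordered.
\<close>

definition is_csup :: "'a rel set \<Rightarrow> 'a rel \<Rightarrow> bool" where
  "is_csup X s \<longleftrightarrow> Card_order s \<and> (\<forall>x\<in>X. x \<le>o s) \<and>
     (\<forall>t::'a rel. Card_order t \<and> (\<forall>x\<in>X. x \<le>o t) \<longrightarrow> s \<le>o t)"

definition csup :: "'a rel set \<Rightarrow> 'a rel" where
  "csup X = (SOME s. is_csup X s)"

lemma is_csup_csup:
  fixes X :: "'a rel set"
  assumes "\<And>x. x \<in> X \<Longrightarrow> Card_order x"
  shows "is_csup X (csup X)"
proof -
  define U where "U = {s::'a rel. Card_order s \<and> (\<forall>x\<in>X. x \<le>o s)}"
  have "card_of (UNIV :: 'a set) \<in> U"
    unfolding U_def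
    using assms by (auto intro: ordIso_ordLeq_trans[OF ordIso_symmetric[OF card_of_Field_ordIso]]
        card_of_mono1 card_of_Card_order)
  hence "U \<noteq> {}" by blast
  moreover have "\<forall>r\<in>U. Card_order r" by (simp add: U_def)
  ultimately obtain s where "s \<in> U" "\<forall>t\<in>U. s \<le>o t"
    using exists_minim_Card_order[of U] by blast
  hence "is_csup X s" by (auto simp: is_csup_def U_def)
  thus ?thesis unfolding csup_def by (rule someI)
qed

text \<open>
  The successor of a cardinal on \<^typ>\<open>'a\<close> lives on \<^typ>\<open>'a set\<close>; in the other case \<open>csup X\<close> is
  transported there along \<open>a \<mapsto> {a}\<close>.
\<close>

definition csize :: "'a rel set \<Rightarrow> 'a set rel" where
  "csize X = (if \<forall>x\<in>X. x <o csup X then card_of ((\<lambda>a. {a}) ` Field (csup X))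
              else cardSuc (csup X))"

definition aleph1 :: "nat set rel" where
  "aleph1 = cardSuc natLeq"


section \<open>Quivers\<close>

text \<open>
  A quiver is a \<^locale>\<open>wf_digraph\<close> (no finiteness, loops and multiple arrows allowed); an arrow \<open>e\<close>
  goes from \<open>tail Q e\<close> to \<open>head Q e\<close>. Paths are lists of arrows. The trivial path is the empty list,
  which belongs to \<open>paths Q i j\<close> only for \<open>i = j\<close>; so for a fixed target \<open>j\<close> a list in
  \<open>paths_to Q j\<close> determines its source and the union is disjoint.
\<close>

definition paths :: "('v, 'e) pre_digraph \<Rightarrow> 'v \<Rightarrow> 'v \<Rightarrow> 'e list set" where
  "paths Q i j = {p. pre_digraph.awalk Q i p j}"

definition paths_to :: "('v, 'e) pre_digraph \<Rightarrow> 'v \<Rightarrow> 'e list set" where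
  "paths_to Q j = (\<Union>i\<in>verts Q. paths Q i j)"

definition rccn :: "('v, 'e) pre_digraph \<Rightarrow> 'e list set rel" where
  "rccn Q = csup ((\<lambda>i. csize ((\<lambda>j. card_of (paths Q i j)) ` verts Q)) ` verts Q)"

definition ltccn :: "('v, 'e) pre_digraph \<Rightarrow> 'e list set rel" where
  "ltccn Q = csize ((\<lambda>i. card_of (paths_to Q i)) ` verts Q)"


section \<open>Abelian categories\<close>

text \<open>
  \<open>g \<cdot> f\<close> is "first \<open>f\<close>, then \<open>g\<close>". The operations are meaningful only on composable, respectively
  parallel, arrows.
\<close>

record ('o, 'm) precat =
  Obj :: "'o set"
  Arr :: "'m set"
  Dom :: "'m \<Rightarrow> 'o"
  Cod :: "'m \<Rightarrow> 'o"
  Ident :: "'o \<Rightarrow> 'm"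
  Comp :: "'m \<Rightarrow> 'm \<Rightarrow> 'm" (infixl \<open>\<cdot>\<index>\<close> 70)
  Zero :: "'o \<Rightarrow> 'o \<Rightarrow> 'm"
  Plus :: "'m \<Rightarrow> 'm \<Rightarrow> 'm"

definition Hom :: "('o, 'm) precat \<Rightarrow> 'o \<Rightarrow> 'o \<Rightarrow> 'm set" where
  "Hom C A B = {f \<in> Arr C. Dom C f = A \<and> Cod C f = B}"

definition hom_group :: "('o, 'm) precat \<Rightarrow> 'o \<Rightarrow> 'o \<Rightarrow> 'm monoid" where
  "hom_group C A B = \<lparr>carrier = Hom C A B, mult = Plus C, one = Zero C A B\<rparr>"

locale cat =
  fixes C :: "('o, 'm) precat" (structure)
  assumes Dom_Obj: "f \<in> Arr C \<Longrightarrow> Dom C f \<in> Obj C"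
    and Cod_Obj: "f \<in> Arr C \<Longrightarrow> Cod C f \<in> Obj C"
    and Ident_Hom: "A \<in> Obj C \<Longrightarrow> Ident C A \<in> Hom C A A"
    and Comp_Hom: "\<lbrakk>f \<in> Hom C A B; g \<in> Hom C B D\<rbrakk> \<Longrightarrow> g \<cdot> f \<in> Hom C A D"
    and Comp_Ident: "f \<in> Hom C A B \<Longrightarrow> f \<cdot> Ident C A = f"
    and Ident_Comp: "f \<in> Hom C A B \<Longrightarrow> Ident C B \<cdot> f = f"
    and Comp_assoc: "\<lbrakk>f \<in> Hom C A B; g \<in> Hom C B D; h \<in> Hom C D E\<rbrakk>
      \<Longrightarrow> h \<cdot> (g \<cdot> f) = (h \<cdot> g) \<cdot> f"

locale preadditive_cat = cat +
  assumes hom_comm_group: "\<lbrakk>A \<in> Obj C; B \<in> Obj C\<rbrakk> \<Longrightarrow> comm_group (hom_group C A B)"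
    and Comp_Plus: "\<lbrakk>f \<in> Hom C A B; g \<in> Hom C A B; h \<in> Hom C B D\<rbrakk>
      \<Longrightarrow> h \<cdot> Plus C f g = Plus C (h \<cdot> f) (h \<cdot> g)"
    and Plus_Comp: "\<lbrakk>h \<in> Hom C A B; f \<in> Hom C B D; g \<in> Hom C B D\<rbrakk>
      \<Longrightarrow> Plus C f g \<cdot> h = Plus C (f \<cdot> h) (g \<cdot> h)"

definition is_zero_obj :: "('o, 'm) precat \<Rightarrow> 'o \<Rightarrow> bool" where
  "is_zero_obj C Z \<longleftrightarrow> Z \<in> Obj C \<and>
     (\<forall>A\<in>Obj C. (\<exists>!f. f \<in> Hom C A Z) \<and> (\<exists>!f. f \<in> Hom C Z A))"

definition is_product ::
  "('o, 'm) precat \<Rightarrow> 'i set \<Rightarrow> ('i \<Rightarrow> 'o) \<Rightarrow> 'o \<Rightarrow> ('i \<Rightarrow> 'm) \<Rightarrow> bool" where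
  "is_product C I X P \<pi> \<longleftrightarrow> P \<in> Obj C \<and> (\<forall>i\<in>I. \<pi> i \<in> Hom C P (X i)) \<and>
     (\<forall>T\<in>Obj C. \<forall>f. (\<forall>i\<in>I. f i \<in> Hom C T (X i)) \<longrightarrow>
       (\<exists>!u. u \<in> Hom C T P \<and> (\<forall>i\<in>I. \<pi> i \<cdot>\<^bsub>C\<^esub> u = f i)))"

definition is_coproduct ::
  "('o, 'm) precat \<Rightarrow> 'i set \<Rightarrow> ('i \<Rightarrow> 'o) \<Rightarrow> 'o \<Rightarrow> ('i \<Rightarrow> 'm) \<Rightarrow> bool" where
  "is_coproduct C I X S \<iota> \<longleftrightarrow> S \<in> Obj C \<and> (\<forall>i\<in>I. \<iota> i \<in> Hom C (X i) S) \<and>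
     (\<forall>T\<in>Obj C. \<forall>f. (\<forall>i\<in>I. f i \<in> Hom C (X i) T) \<longrightarrow>
       (\<exists>!u. u \<in> Hom C S T \<and> (\<forall>i\<in>I. u \<cdot>\<^bsub>C\<^esub> \<iota> i = f i)))"

definition is_mono :: "('o, 'm) precat \<Rightarrow> 'm \<Rightarrow> bool" where
  "is_mono C f \<longleftrightarrow> f \<in> Arr C \<and>
     (\<forall>A. \<forall>g\<in>Hom C A (Dom C f). \<forall>h\<in>Hom C A (Dom C f). f \<cdot>\<^bsub>C\<^esub> g = f \<cdot>\<^bsub>C\<^esub> h \<longrightarrow> g = h)"

definition is_epi :: "('o, 'm) precat \<Rightarrow> 'm \<Rightarrow> bool" where
  "is_epi C f \<longleftrightarrow> f \<in> Arr C \<and>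
     (\<forall>B. \<forall>g\<in>Hom C (Cod C f) B. \<forall>h\<in>Hom C (Cod C f) B. g \<cdot>\<^bsub>C\<^esub> f = h \<cdot>\<^bsub>C\<^esub> f \<longrightarrow> g = h)"

definition is_kernel :: "('o, 'm) precat \<Rightarrow> 'm \<Rightarrow> 'm \<Rightarrow> bool" where
  "is_kernel C f k \<longleftrightarrow> f \<in> Arr C \<and> k \<in> Arr C \<and> Cod C k = Dom C f \<and>
     f \<cdot>\<^bsub>C\<^esub> k = Zero C (Dom C k) (Cod C f) \<and>
     (\<forall>T. \<forall>h\<in>Hom C T (Dom C f). f \<cdot>\<^bsub>C\<^esub> h = Zero C T (Cod C f) \<longrightarrow>
       (\<exists>!u. u \<in> Hom C T (Dom C k) \<and> k \<cdot>\<^bsub>C\<^esub> u = h))"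

definition is_cokernel :: "('o, 'm) precat \<Rightarrow> 'm \<Rightarrow> 'm \<Rightarrow> bool" where
  "is_cokernel C f c \<longleftrightarrow> f \<in> Arr C \<and> c \<in> Arr C \<and> Dom C c = Cod C f \<and>
     c \<cdot>\<^bsub>C\<^esub> f = Zero C (Dom C f) (Cod C c) \<and>
     (\<forall>T. \<forall>h\<in>Hom C (Cod C f) T. h \<cdot>\<^bsub>C\<^esub> f = Zero C (Dom C f) T \<longrightarrow>
       (\<exists>!u. u \<in> Hom C (Cod C c) T \<and> u \<cdot>\<^bsub>C\<^esub> c = h))"

locale abelian_cat = preadditive_cat +
  assumes ex_zero_obj: "\<exists>Z. is_zero_obj C Z"
    and ex_binary_product: "\<lbrakk>A \<in> Obj C; B \<in> Obj C\<rbrakk>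
      \<Longrightarrow> \<exists>P \<pi>. is_product C (UNIV :: bool set) (\<lambda>b. if b then A else B) P \<pi>"
    and ex_kernel: "f \<in> Arr C \<Longrightarrow> \<exists>k. is_kernel C f k"
    and ex_cokernel: "f \<in> Arr C \<Longrightarrow> \<exists>c. is_cokernel C f c"
    and mono_normal: "is_mono C f \<Longrightarrow> \<exists>g. is_kernel C g f"
    and epi_normal: "is_epi C f \<Longrightarrow> \<exists>g. is_cokernel C g f"

text \<open>The image is the kernel of the cokernel.\<close>

definition is_image :: "('o, 'm) precat \<Rightarrow> 'm \<Rightarrow> 'm \<Rightarrow> bool" where
  "is_image C f m \<longleftrightarrow> (\<exists>c. is_cokernel C f c \<and> is_kernel C c m)"

definition exact_at :: "('o, 'm) precat \<Rightarrow> 'm \<Rightarrow> 'm \<Rightarrow> bool" where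
  "exact_at C f g \<longleftrightarrow> (\<exists>m. is_image C f m \<and> is_kernel C g m)"

definition short_exact :: "('o, 'm) precat \<Rightarrow> 'm \<Rightarrow> 'm \<Rightarrow> bool" where
  "short_exact C f g \<longleftrightarrow> is_mono C f \<and> exact_at C f g \<and> is_epi C g"


section \<open>Coproducts and products of bounded size\<close>

text \<open>
  Every set of cardinality less than \<open>\<kappa>\<close> is in bijection with a subset of \<open>Field \<kappa>\<close>, so it suffices
  to consider index sets on the type underlying \<open>\<kappa>\<close>.
\<close>

definition AB3 :: "'k rel \<Rightarrow> ('o, 'm) precat \<Rightarrow> bool" where
  "AB3 \<kappa> C \<longleftrightarrow> (\<forall>(I::'k set) X. card_of I <o \<kappa> \<and> (\<forall>i\<in>I. X i \<in> Obj C) \<longrightarrow>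
     (\<exists>S \<iota>. is_coproduct C I X S \<iota>))"

definition AB3_star :: "'k rel \<Rightarrow> ('o, 'm) precat \<Rightarrow> bool" where
  "AB3_star \<kappa> C \<longleftrightarrow> (\<forall>(I::'k set) X. card_of I <o \<kappa> \<and> (\<forall>i\<in>I. X i \<in> Obj C) \<longrightarrow>
     (\<exists>P \<pi>. is_product C I X P \<pi>))"

definition is_coproduct_map ::
  "('o, 'm) precat \<Rightarrow> 'i set \<Rightarrow> 'o \<Rightarrow> ('i \<Rightarrow> 'm) \<Rightarrow> 'o \<Rightarrow> ('i \<Rightarrow> 'm) \<Rightarrow> ('i \<Rightarrow> 'm) \<Rightarrow> 'm \<Rightarrow> bool" where
  "is_coproduct_map C I S \<iota> S' \<iota>' f u \<longleftrightarrow>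
     u \<in> Hom C S S' \<and> (\<forall>i\<in>I. u \<cdot>\<^bsub>C\<^esub> \<iota> i = \<iota>' i \<cdot>\<^bsub>C\<^esub> f i)"

definition AB4 :: "'k rel \<Rightarrow> ('o, 'm) precat \<Rightarrow> bool" where
  "AB4 \<kappa> C \<longleftrightarrow> AB3 \<kappa> C \<and>
     (\<forall>(I::'k set) f g S\<^sub>1 \<iota>\<^sub>1 S\<^sub>2 \<iota>\<^sub>2 S\<^sub>3 \<iota>\<^sub>3 u v.
        card_of I <o \<kappa> \<and> (\<forall>i\<in>I. short_exact C (f i) (g i)) \<and>
        is_coproduct C I (\<lambda>i. Dom C (f i)) S\<^sub>1 \<iota>\<^sub>1 \<and>
        is_coproduct C I (\<lambda>i. Cod C (f i)) S\<^sub>2 \<iota>\<^sub>2 \<and>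
        is_coproduct C I (\<lambda>i. Cod C (g i)) S\<^sub>3 \<iota>\<^sub>3 \<and>
        is_coproduct_map C I S\<^sub>1 \<iota>\<^sub>1 S\<^sub>2 \<iota>\<^sub>2 f u \<and>
        is_coproduct_map C I S\<^sub>2 \<iota>\<^sub>2 S\<^sub>3 \<iota>\<^sub>3 g v
        \<longrightarrow> short_exact C u v)"


section \<open>Yoneda Ext and homological dimensions\<close>

text \<open>
  For \<open>n \<ge> 1\<close>, an \<open>n\<close>-extension of \<open>A\<close> by \<open>B\<close> is an exact sequence
  \<open>0 \<rightarrow> B \<rightarrow> E\<^sub>n \<rightarrow> \<dots> \<rightarrow> E\<^sub>1 \<rightarrow> A \<rightarrow> 0\<close>, given by the list of its \<open>n + 1\<close> nontrivial arrows from left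
  to right. \<open>Ext\<close> is the quotient by the equivalence relation generated by the morphisms of
  extensions which are the identity on \<open>B\<close> and on \<open>A\<close>.
\<close>

definition is_extension :: "('o, 'm) precat \<Rightarrow> nat \<Rightarrow> 'o \<Rightarrow> 'o \<Rightarrow> 'm list \<Rightarrow> bool" where
  "is_extension C n A B fs \<longleftrightarrow> length fs = Suc n \<and> set fs \<subseteq> Arr C \<and>
     Dom C (fs ! 0) = B \<and> Cod C (fs ! n) = A \<and>
     is_mono C (fs ! 0) \<and> is_epi C (fs ! n) \<and>
     (\<forall>i<n. Cod C (fs ! i) = Dom C (fs ! Suc i) \<and> exact_at C (fs ! i) (fs ! Suc i))"

definition extension_map ::
  "('o, 'm) precat \<Rightarrow> nat \<Rightarrow> 'o \<Rightarrow> 'o \<Rightarrow> 'm list \<Rightarrow> 'm list \<Rightarrow> bool" where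
  "extension_map C n A B fs gs \<longleftrightarrow> is_extension C n A B fs \<and> is_extension C n A B gs \<and>
     (\<exists>h :: nat \<Rightarrow> 'm. h 0 = Ident C B \<and> h (Suc n) = Ident C A \<and>
        (\<forall>i\<le>n. h i \<in> Hom C (Dom C (fs ! i)) (Dom C (gs ! i)) \<and>
                h (Suc i) \<cdot>\<^bsub>C\<^esub> (fs ! i) = (gs ! i) \<cdot>\<^bsub>C\<^esub> h i))"

definition Ext :: "('o, 'm) precat \<Rightarrow> nat \<Rightarrow> 'o \<Rightarrow> 'o \<Rightarrow> 'm list set set" where
  "Ext C n A B = {fs. is_extension C n A B fs} //
     {(fs, gs). is_extension C n A B fs \<and> is_extension C n A B gs \<and>
                equivclp (extension_map C n A B) fs gs}"

text \<open>
  The Baer sum makes \<open>Ext C n A B\<close> an abelian group for \<open>n \<ge> 1\<close>; it is zero iff its underlying set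
  has exactly one element. In \<open>pd\<close> only degrees \<open>k \<ge> 1\<close> occur, and \<open>Inf {} = \<infinity>\<close>.
\<close>

definition pd :: "('o, 'm) precat \<Rightarrow> 'o \<Rightarrow> enat" where
  "pd C A = Inf {enat n | n. \<forall>k>n. \<forall>B\<in>Obj C. is_singleton (Ext C k A B)}"

definition gldim :: "('o, 'm) precat \<Rightarrow> enat" where
  "gldim C = (SUP A\<in>Obj C. pd C A)"


section \<open>Representations of a quiver\<close>

text \<open>
  A representation is a pair of an object function on vertices and an arrow function on arrows of
  the quiver. Functions are extensional, so that equality of representations and of their morphisms
  is equality of pairs and triples \<open>(source, target, components)\<close>.
\<close>

type_synonym ('v, 'e, 'o, 'm) repr = "('v \<Rightarrow> 'o) \<times> ('e \<Rightarrow> 'm)"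
type_synonym ('v, 'e, 'o, 'm) repr_map =
  "('v, 'e, 'o, 'm) repr \<times> ('v, 'e, 'o, 'm) repr \<times> ('v \<Rightarrow> 'm)"

definition reprs ::
  "('v, 'e) pre_digraph \<Rightarrow> ('o, 'm) precat \<Rightarrow> ('v, 'e, 'o, 'm) repr set" where
  "reprs Q C = {(X, \<phi>). X \<in> verts Q \<rightarrow>\<^sub>E Obj C \<and>
     \<phi> \<in> (\<Pi>\<^sub>E e\<in>arcs Q. Hom C (X (tail Q e)) (X (head Q e)))}"

definition repr_maps ::
  "('v, 'e) pre_digraph \<Rightarrow> ('o, 'm) precat \<Rightarrow> ('v, 'e, 'o, 'm) repr_map set" where
  "repr_maps Q C = {((X, \<phi>), (Y, \<psi>), f). (X, \<phi>) \<in> reprs Q C \<and> (Y, \<psi>) \<in> reprs Q C \<and>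
     f \<in> (\<Pi>\<^sub>E v\<in>verts Q. Hom C (X v) (Y v)) \<and>
     (\<forall>e\<in>arcs Q. \<psi> e \<cdot>\<^bsub>C\<^esub> f (tail Q e) = f (head Q e) \<cdot>\<^bsub>C\<^esub> \<phi> e)}"

definition Rep ::
  "('v, 'e) pre_digraph \<Rightarrow> ('o, 'm) precat \<Rightarrow>
    (('v, 'e, 'o, 'm) repr, ('v, 'e, 'o, 'm) repr_map) precat" where
  "Rep Q C = \<lparr>
     Obj = reprs Q C,
     Arr = repr_maps Q C,
     Dom = (\<lambda>(M, N, f). M),
     Cod = (\<lambda>(M, N, f). N),
     Ident = (\<lambda>M. (M, M, \<lambda>v\<in>verts Q. Ident C (fst M v))),
     Comp = (\<lambda>(N', P, g) (M, N, f). (M, P, \<lambda>v\<in>verts Q. g v \<cdot>\<^bsub>C\<^esub> f v)),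
     Zero = (\<lambda>M N. (M, N, \<lambda>v\<in>verts Q. Zero C (fst M v) (fst N v))),
     Plus = (\<lambda>(M, N, f) (M', N', g). (M, N, \<lambda>v\<in>verts Q. Plus C (f v) (g v)))\<rparr>"

end

theory Submission
  imports Defs
begin

text \<open>
  Neither enough projectives nor the Baer sum are available, so \<open>Ext\<close> is handled by a criterion
  for the pullback of a Yoneda class \<open>0 \<rightarrow> B \<rightarrow> E\<^sub>n \<rightarrow> \<dots> \<rightarrow> E\<^sub>1 \<rightarrow> A \<rightarrow> 0\<close> along \<open>u : T \<rightarrow> A\<close> to be zero: for
  some epimorphism \<open>p : F \<rightarrow> T\<close> the arrow \<open>u p\<close> lifts to \<open>f : F \<rightarrow> E\<^sub>1\<close>, and the pullback of the
  remaining sequence along the restriction of \<open>f\<close> to \<open>ker p\<close> is zero in the same sense. The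
  mapping cone turns such data for a subobject into a new exact sequence, and this replaces the
  long exact sequence.

  For the upper bound, let \<open>F\<^sub>v\<close> be left adjoint to evaluation at the vertex \<open>v\<close>. A representation
  \<open>M\<close> has the standard resolution
  \<open>0 \<rightarrow> \<Coprod>\<^sub>e F\<^bsub>head e\<^esub> M(tail e) \<rightarrow> \<Coprod>\<^sub>v F\<^sub>v M(v) \<rightarrow> M \<rightarrow> 0\<close>, which splits at every vertex. Its first two
  terms are coproducts of objects of \<open>C\<close> indexed by paths; as these coproducts are exact, the
  vanishing of \<open>Ext\<^sup>n\<close> on \<open>C\<close> passes to them, and \<open>M\<close> costs one more degree.

  For the lower bound, let \<open>\<rho> : x \<rightarrow> y\<close> and let \<open>S\<^sub>x\<close>, \<open>S\<^sub>y\<close> be the functors of representations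
  concentrated at one vertex with zero arrows. Splice \<open>S\<^sub>y\<close> of an \<open>n\<close>-extension of \<open>A\<close> with the extension
  \<open>0 \<rightarrow> S\<^sub>y A \<rightarrow> X \<rightarrow> S\<^sub>x A \<rightarrow> 0\<close> in which \<open>\<rho>\<close> maps the copy of \<open>A\<close> at \<open>x\<close> identically to the one at \<open>y\<close>. If the
  result is zero, the covers witnessing it may be refined by free representations, on which \<open>\<rho>\<close> acts
  by monomorphisms. Taking cokernels of \<open>\<rho>\<close> then keeps the witnessing sequences exact and yields
  a witness that the given extension is zero.
\<close>

section \<open>Additive categories\<close>

text \<open>Why the criterion detects the class: put I = ker(E_1 -> A), so that the class is the
  splice of an extension of A by I with a class eta on I. On K = ker p the lift f restricts to an
  arrow K -> I, and the pullback of the class along u is, up to sign, the image of the pulled-back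
  eta under the connecting map of 0 -> K -> F -> T -> 0. It vanishes as soon as the pulled-back eta
  does. Conversely, if it vanishes, then eta on K extends to F, and a class on F is killed by a
  finer cover (for n = 1 it is an arrow and is absorbed into f). Such data can be pulled back,
  refined and added one term at a time, so the arguments become inductions along the sequence. The
  delicate point is always the left end: it must stay B while every other term may change. This is
  why maps of sequences are classified by their effect on the last kernel, and why the mapping cone
  is corrected at its last term.\<close>

context cat
begin

lemma in_Hom [simp]: "f \<in> Hom C A B \<longleftrightarrow> f \<in> Arr C \<and> Dom C f = A \<and> Cod C f = B"
  by (simp add: Hom_def)

lemma Dom_in_Obj [simp]: "f \<in> Arr C \<Longrightarrow> Dom C f \<in> Obj C"
  and Cod_in_Obj [simp]: "f \<in> Arr C \<Longrightarrow> Cod C f \<in> Obj C"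
  by (rule Dom_Obj Cod_Obj, assumption)+

lemma HomD:
  assumes "f \<in> Hom C A B"
  shows "f \<in> Arr C" "Dom C f = A" "Cod C f = B" "A \<in> Obj C" "B \<in> Obj C"
  using assms Dom_Obj Cod_Obj by (auto simp: Hom_def)

lemma comp_typing [simp]:
  assumes "f \<in> Arr C" "g \<in> Arr C" "Cod C f = Dom C g"
  shows "g \<cdot> f \<in> Arr C" "Dom C (g \<cdot> f) = Dom C f" "Cod C (g \<cdot> f) = Cod C g"
  using Comp_Hom[of f "Dom C f" "Cod C f" g "Cod C g"] assms by auto

lemma ident_typing [simp]:
  assumes "A \<in> Obj C"
  shows "Ident C A \<in> Arr C" "Dom C (Ident C A) = A" "Cod C (Ident C A) = A"
  using Ident_Hom[OF assms] by auto

lemma comp_ident [simp]: "\<lbrakk>f \<in> Arr C; Dom C f = A\<rbrakk> \<Longrightarrow> f \<cdot> Ident C A = f"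
  using Comp_Ident[of f A "Cod C f"] by simp

lemma ident_comp [simp]: "\<lbrakk>f \<in> Arr C; Cod C f = A\<rbrakk> \<Longrightarrow> Ident C A \<cdot> f = f"
  using Ident_Comp[of f "Dom C f" A] by simp

lemma comp_assoc [simp]:
  "\<lbrakk>f \<in> Arr C; g \<in> Arr C; h \<in> Arr C; Cod C f = Dom C g; Cod C g = Dom C h\<rbrakk>
    \<Longrightarrow> (h \<cdot> g) \<cdot> f = h \<cdot> (g \<cdot> f)"
  using Comp_assoc[of f "Dom C f" "Cod C f" g "Cod C g" h "Cod C h"] by simp

text \<open>The simplifier brackets composites to the right, where the left side of an equation
  \<open>g \<cdot> f = w\<close> need no longer be a subterm. Composing the equation with a further
  arrow \<open>x\<close> restores it as a rewrite rule; most diagram chases below run on such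
  rules.\<close>

lemma comp_reduce:
  "\<lbrakk>g \<cdot> f = w; f \<in> Arr C; g \<in> Arr C; x \<in> Arr C; Cod C f = Dom C g; Cod C x = Dom C f\<rbrakk>
    \<Longrightarrow> g \<cdot> (f \<cdot> x) = w \<cdot> x"
  using comp_assoc[of x f g] by simp

lemma comp_expand_left:
  "\<lbrakk>v \<cdot> c = g; c \<cdot> h = w; c \<in> Arr C; v \<in> Arr C; h \<in> Arr C; Cod C c = Dom C v; Cod C h = Dom C c\<rbrakk>
    \<Longrightarrow> g \<cdot> h = v \<cdot> w"
  using comp_assoc[of h c v] by simp

lemma comp_expand_right:
  "\<lbrakk>k \<cdot> v = g; h \<cdot> k = w; k \<in> Arr C; v \<in> Arr C; h \<in> Arr C; Cod C v = Dom C k; Cod C k = Dom C h\<rbrakk>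
    \<Longrightarrow> h \<cdot> g = w \<cdot> v"
  using comp_assoc[of v k h] by simp

lemma is_monoD:
  "\<lbrakk>is_mono C f; f \<cdot> g = f \<cdot> h; g \<in> Arr C; h \<in> Arr C; Cod C g = Dom C f; Cod C h = Dom C f;
    Dom C g = Dom C h\<rbrakk> \<Longrightarrow> g = h"
  unfolding is_mono_def by (metis in_Hom)

lemma is_epiD:
  "\<lbrakk>is_epi C f; g \<cdot> f = h \<cdot> f; g \<in> Arr C; h \<in> Arr C; Dom C g = Cod C f; Dom C h = Cod C f;
    Cod C g = Cod C h\<rbrakk> \<Longrightarrow> g = h"
  unfolding is_epi_def by (metis in_Hom)

lemma is_mono_Arr [simp]: "is_mono C f \<Longrightarrow> f \<in> Arr C"
  and is_epi_Arr [simp]: "is_epi C f \<Longrightarrow> f \<in> Arr C"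
  by (simp_all add: is_mono_def is_epi_def)

lemma is_epi_comp:
  assumes "is_epi C f" "is_epi C g" "Cod C f = Dom C g"
  shows "is_epi C (g \<cdot> f)"
  unfolding is_epi_def
proof (intro conjI allI ballI impI)
  fix B h k assume a: "h \<in> Hom C (Cod C (g \<cdot> f)) B" "k \<in> Hom C (Cod C (g \<cdot> f)) B"
    "h \<cdot> (g \<cdot> f) = k \<cdot> (g \<cdot> f)"
  have "h \<cdot> g = k \<cdot> g"
    by (rule is_epiD[OF assms(1)]) (use a assms in auto)
  then show "h = k" by (rule is_epiD[OF assms(2)]) (use a assms in auto)
qed (use assms in auto)

lemma is_mono_comp:
  assumes "is_mono C f" "is_mono C g" "Cod C f = Dom C g"
  shows "is_mono C (g \<cdot> f)"
  unfolding is_mono_def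
proof (intro conjI allI ballI impI)
  fix B h k assume a: "h \<in> Hom C B (Dom C (g \<cdot> f))" "k \<in> Hom C B (Dom C (g \<cdot> f))"
    "(g \<cdot> f) \<cdot> h = (g \<cdot> f) \<cdot> k"
  have "f \<cdot> h = f \<cdot> k"
    by (rule is_monoD[OF assms(2)]) (use a assms in auto)
  then show "h = k" by (rule is_monoD[OF assms(1)]) (use a assms in auto)
qed (use assms in auto)

lemma is_epi_cancel:
  assumes "is_epi C (g \<cdot> f)" "f \<in> Arr C" "g \<in> Arr C" "Cod C f = Dom C g"
  shows "is_epi C g"
  unfolding is_epi_def
proof (intro conjI allI ballI impI)
  fix B h k assume a: "h \<in> Hom C (Cod C g) B" "k \<in> Hom C (Cod C g) B" "h \<cdot> g = k \<cdot> g"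
  have "h \<cdot> (g \<cdot> f) = k \<cdot> (g \<cdot> f)"
    using a assms by (simp add: comp_reduce[OF a(3)])
  then show "h = k" by (rule is_epiD[OF assms(1)]) (use a assms in auto)
qed (use assms in auto)

lemma is_mono_cancel:
  assumes "is_mono C (g \<cdot> f)" "f \<in> Arr C" "g \<in> Arr C" "Cod C f = Dom C g"
  shows "is_mono C f"
  unfolding is_mono_def
proof (intro conjI allI ballI impI)
  fix B h k assume a: "h \<in> Hom C B (Dom C f)" "k \<in> Hom C B (Dom C f)" "f \<cdot> h = f \<cdot> k"
  have "(g \<cdot> f) \<cdot> h = (g \<cdot> f) \<cdot> k" using a assms by simp
  then show "h = k" by (rule is_monoD[OF assms(1)]) (use a assms in auto)
qed (use assms in auto)

lemma is_epi_ident [simp]: "A \<in> Obj C \<Longrightarrow> is_epi C (Ident C A)"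
  unfolding is_epi_def by (metis comp_ident ident_typing in_Hom)

lemma is_epi_split:
  assumes "f \<cdot> s = Ident C A" "f \<in> Hom C B A" "s \<in> Hom C A B"
  shows "is_epi C f"
proof (rule is_epi_cancel[of f s])
  have "A \<in> Obj C" using assms(3) Dom_Obj by auto
  then show "is_epi C (f \<cdot> s)" unfolding assms(1) by simp
qed (use assms in auto)

lemma is_mono_split:
  assumes "r \<cdot> f = Ident C A" "f \<in> Hom C A B" "r \<in> Hom C B A"
  shows "is_mono C f"
proof (rule is_mono_cancel[of r f])
  have "A \<in> Obj C" using assms(2) Dom_Obj by auto
  then show "is_mono C (r \<cdot> f)" 
    unfolding assms(1) is_mono_def by (metis ident_comp ident_typing in_Hom)
qed (use assms in auto)

end

section \<open>Sums of arrows, kernels, cokernels and biproducts\<close>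

context preadditive_cat
begin

lemma carrier_hom_group [simp]: "carrier (hom_group C A B) = Hom C A B"
  and one_hom_group [simp]: "one (hom_group C A B) = Zero C A B"
  and mult_hom_group [simp]: "mult (hom_group C A B) = Plus C"
  by (simp_all add: hom_group_def)

abbreviation plus (infixl \<open>\<boxplus>\<close> 65) where "f \<boxplus> g \<equiv> Plus C f g"

definition neg :: "'b \<Rightarrow> 'b" where "neg f = m_inv (hom_group C (Dom C f) (Cod C f)) f"

abbreviation minus (infixl \<open>\<boxminus>\<close> 65) where "f \<boxminus> g \<equiv> f \<boxplus> neg g"

lemma hom_grp: "f \<in> Arr C \<Longrightarrow> comm_group (hom_group C (Dom C f) (Cod C f))"
  using hom_comm_group by simp

lemma zero_typing [simp]:
  assumes "A \<in> Obj C" "B \<in> Obj C"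
  shows "Zero C A B \<in> Arr C" "Dom C (Zero C A B) = A" "Cod C (Zero C A B) = B"
proof -
  interpret comm_group "hom_group C A B" using hom_comm_group assms .
  show "Zero C A B \<in> Arr C" "Dom C (Zero C A B) = A" "Cod C (Zero C A B) = B"
    using one_closed by auto
qed

lemma plus_typing [simp]:
  assumes "f \<in> Arr C" "g \<in> Arr C" "Dom C f = Dom C g" "Cod C f = Cod C g"
  shows "f \<boxplus> g \<in> Arr C" "Dom C (f \<boxplus> g) = Dom C g" "Cod C (f \<boxplus> g) = Cod C g"
proof -
  interpret comm_group "hom_group C (Dom C f) (Cod C f)" using hom_grp assms(1) .
  show "f \<boxplus> g \<in> Arr C" "Dom C (f \<boxplus> g) = Dom C g" "Cod C (f \<boxplus> g) = Cod C g"
    using m_closed[of f g] assms by auto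
qed

lemma neg_typing [simp]:
  assumes "f \<in> Arr C"
  shows "neg f \<in> Arr C" "Dom C (neg f) = Dom C f" "Cod C (neg f) = Cod C f"
proof -
  interpret comm_group "hom_group C (Dom C f) (Cod C f)" using hom_grp assms(1) .
  show "neg f \<in> Arr C" "Dom C (neg f) = Dom C f" "Cod C (neg f) = Cod C f"
    unfolding neg_def using inv_closed[of f] assms by auto
qed

lemma plus_zero [simp]:
  assumes "f \<in> Arr C" "Dom C f = A" "Cod C f = B"
  shows "f \<boxplus> Zero C A B = f" "Zero C A B \<boxplus> f = f"
proof -
  interpret comm_group "hom_group C A B" using hom_grp assms by auto
  show "f \<boxplus> Zero C A B = f" "Zero C A B \<boxplus> f = f"
    using r_one[of f] l_one[of f] assms by auto
qed

lemma plus_neg [simp]: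
  assumes "f \<in> Arr C"
  shows "f \<boxplus> neg f = Zero C (Dom C f) (Cod C f)" "neg f \<boxplus> f = Zero C (Dom C f) (Cod C f)"
proof -
  interpret comm_group "hom_group C (Dom C f) (Cod C f)" using hom_grp assms by auto
  show "f \<boxplus> neg f = Zero C (Dom C f) (Cod C f)" "neg f \<boxplus> f = Zero C (Dom C f) (Cod C f)"
    unfolding neg_def using r_inv[of f] l_inv[of f] assms by auto
qed

lemma plus_commute:
  assumes "f \<in> Arr C" "g \<in> Arr C" "Dom C f = Dom C g" "Cod C f = Cod C g"
  shows "f \<boxplus> g = g \<boxplus> f"
proof -
  interpret comm_group "hom_group C (Dom C f) (Cod C f)" using hom_grp assms(1) .
  show ?thesis using m_comm[of f g] assms by auto
qed

lemma plus_assoc: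
  assumes "f \<in> Arr C" "g \<in> Arr C" "h \<in> Arr C" "Dom C f = Dom C g" "Cod C f = Cod C g"
    "Dom C g = Dom C h" "Cod C g = Cod C h"
  shows "(f \<boxplus> g) \<boxplus> h = f \<boxplus> (g \<boxplus> h)"
proof -
  interpret comm_group "hom_group C (Dom C f) (Cod C f)" using hom_grp assms(1) .
  show ?thesis using m_assoc[of f g h] assms by auto
qed

lemma plus_left_commute:
  assumes "f \<in> Arr C" "g \<in> Arr C" "h \<in> Arr C" "Dom C f = Dom C g" "Cod C f = Cod C g"
    "Dom C g = Dom C h" "Cod C g = Cod C h"
  shows "f \<boxplus> (g \<boxplus> h) = g \<boxplus> (f \<boxplus> h)"
  using plus_assoc[of f g h] plus_assoc[of g f h] plus_commute[of f g] assms by simp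

lemmas plus_ac = plus_assoc plus_commute plus_left_commute

lemma plus_neg_left [simp]:
  assumes "f \<in> Arr C" "h \<in> Arr C" "Dom C f = Dom C h" "Cod C f = Cod C h"
  shows "f \<boxplus> (neg f \<boxplus> h) = h" "neg f \<boxplus> (f \<boxplus> h) = h"
  using plus_assoc[of f "neg f" h] plus_assoc[of "neg f" f h] assms by simp_all

lemma plus_cancel:
  assumes "f \<boxplus> h = g \<boxplus> h" "f \<in> Arr C" "g \<in> Arr C" "h \<in> Arr C" "Dom C f = Dom C g"
    "Cod C f = Cod C g" "Dom C g = Dom C h" "Cod C g = Cod C h"
  shows "f = g"
proof -
  have "(f \<boxplus> h) \<boxplus> neg h = (g \<boxplus> h) \<boxplus> neg h" using assms(1) by simp
  then show ?thesis using assms(2-) by (simp add: plus_assoc)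
qed

lemma minus_eq_zero:
  assumes "f \<boxminus> g = Zero C A B" "f \<in> Arr C" "g \<in> Arr C" "Dom C f = Dom C g" "Cod C f = Cod C g"
    "Dom C g = A" "Cod C g = B"
  shows "f = g"
  by (rule plus_cancel[of f "neg g" g]) (use assms in auto)

lemma plus_eq_zero:
  assumes "f \<boxplus> g = Zero C A B" "f \<in> Arr C" "g \<in> Arr C" "Dom C f = Dom C g" "Cod C f = Cod C g"
    "Dom C g = A" "Cod C g = B"
  shows "f = neg g"
  by (rule plus_cancel[of f g "neg g"]) (use assms in auto)

lemma comp_plus [simp]:
  assumes "f \<in> Arr C" "g \<in> Arr C" "h \<in> Arr C" "Dom C f = Dom C g" "Cod C f = Cod C g"
    "Cod C g = Dom C h"
  shows "h \<cdot> (f \<boxplus> g) = h \<cdot> f \<boxplus> h \<cdot> g"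
  using Comp_Plus[of f "Dom C f" "Cod C f" g h "Cod C h"] assms by simp

lemma plus_comp [simp]:
  assumes "f \<in> Arr C" "g \<in> Arr C" "h \<in> Arr C" "Dom C f = Dom C g" "Cod C f = Cod C g"
    "Dom C g = Cod C h"
  shows "(f \<boxplus> g) \<cdot> h = f \<cdot> h \<boxplus> g \<cdot> h"
  using Plus_Comp[of h "Dom C h" "Cod C h" f "Cod C f" g] assms by simp

lemma idem_zero:
  assumes "f \<boxplus> f = f" "f \<in> Arr C"
  shows "f = Zero C (Dom C f) (Cod C f)"
  using plus_cancel[of f f "Zero C (Dom C f) (Cod C f)"] assms by simp

lemma comp_zero [simp]:
  assumes "h \<in> Arr C" "A \<in> Obj C" "Dom C h = B"
  shows "h \<cdot> Zero C A B = Zero C A (Cod C h)"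
proof -
  have B: "B \<in> Obj C" using assms by auto
  have "h \<cdot> (Zero C A B \<boxplus> Zero C A B) = h \<cdot> Zero C A B \<boxplus> h \<cdot> Zero C A B"
    by (rule comp_plus) (use assms B in simp_all)
  then show ?thesis using idem_zero[of "h \<cdot> Zero C A B"] assms B by simp
qed

lemma zero_comp [simp]:
  assumes "h \<in> Arr C" "B \<in> Obj C" "Cod C h = A"
  shows "Zero C A B \<cdot> h = Zero C (Dom C h) B"
proof -
  have A: "A \<in> Obj C" using assms by auto
  have "(Zero C A B \<boxplus> Zero C A B) \<cdot> h = Zero C A B \<cdot> h \<boxplus> Zero C A B \<cdot> h"
    by (rule plus_comp) (use assms A in simp_all)
  then show ?thesis using idem_zero[of "Zero C A B \<cdot> h"] assms A by simp
qed

lemma comp_neg [simp]: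
  assumes "f \<in> Arr C" "h \<in> Arr C" "Cod C f = Dom C h"
  shows "h \<cdot> neg f = neg (h \<cdot> f)"
proof (rule plus_eq_zero)
  show "h \<cdot> neg f \<boxplus> h \<cdot> f = Zero C (Dom C f) (Cod C h)"
    using comp_plus[of "neg f" f h] assms by simp
qed (use assms in auto)

lemma neg_comp [simp]:
  assumes "f \<in> Arr C" "h \<in> Arr C" "Cod C h = Dom C f"
  shows "neg f \<cdot> h = neg (f \<cdot> h)"
proof (rule plus_eq_zero)
  show "neg f \<cdot> h \<boxplus> f \<cdot> h = Zero C (Dom C h) (Cod C f)"
    by (subst plus_comp[symmetric]) (use assms in simp_all)
qed (use assms in auto)

lemma neg_neg [simp]: "f \<in> Arr C \<Longrightarrow> neg (neg f) = f"
  by (rule plus_eq_zero[symmetric]) auto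

lemma neg_zero [simp]: "\<lbrakk>A \<in> Obj C; B \<in> Obj C\<rbrakk> \<Longrightarrow> neg (Zero C A B) = Zero C A B"
  by (rule plus_eq_zero[symmetric]) auto

lemma is_monoI:
  assumes "f \<in> Arr C"
    and "\<And>x. \<lbrakk>x \<in> Arr C; Cod C x = Dom C f; f \<cdot> x = Zero C (Dom C x) (Cod C f)\<rbrakk>
      \<Longrightarrow> x = Zero C (Dom C x) (Dom C f)"
  shows "is_mono C f"
  unfolding is_mono_def
proof (intro conjI allI ballI impI)
  fix A g h assume a: "g \<in> Hom C A (Dom C f)" "h \<in> Hom C A (Dom C f)" "f \<cdot> g = f \<cdot> h"
  have "g \<boxminus> h = Zero C A (Dom C f)"
    using assms(2)[of "g \<boxminus> h"] a assms(1) by simp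
  then show "g = h" by (rule minus_eq_zero) (use a in auto)
qed (fact assms(1))

lemma is_epiI:
  assumes "f \<in> Arr C"
    and "\<And>x. \<lbrakk>x \<in> Arr C; Dom C x = Cod C f; x \<cdot> f = Zero C (Dom C f) (Cod C x)\<rbrakk>
      \<Longrightarrow> x = Zero C (Cod C f) (Cod C x)"
  shows "is_epi C f"
  unfolding is_epi_def
proof (intro conjI allI ballI impI)
  fix B g h assume a: "g \<in> Hom C (Cod C f) B" "h \<in> Hom C (Cod C f) B" "g \<cdot> f = h \<cdot> f"
  have "g \<boxminus> h = Zero C (Cod C f) B"
    using assms(2)[of "g \<boxminus> h"] a assms(1) by simp
  then show "g = h" by (rule minus_eq_zero) (use a in auto)
qed (fact assms(1))

lemma is_mono_zeroD:
  assumes "is_mono C f" "f \<cdot> x = Zero C A B" "x \<in> Arr C" "Cod C x = Dom C f" "Dom C x = A"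
    "Cod C f = B"
  shows "x = Zero C A (Dom C f)"
  by (rule is_monoD[OF assms(1)]) (use assms in auto)

lemma is_epi_zeroD:
  assumes "is_epi C f" "x \<cdot> f = Zero C A B" "x \<in> Arr C" "Dom C x = Cod C f" "Cod C x = B"
    "Dom C f = A"
  shows "x = Zero C (Cod C f) B"
  by (rule is_epiD[OF assms(1)]) (use assms in auto)

lemma is_kernelD:
  assumes "is_kernel C f k"
  shows "f \<in> Arr C" "k \<in> Arr C" "Cod C k = Dom C f" "f \<cdot> k = Zero C (Dom C k) (Cod C f)"
  using assms by (auto simp: is_kernel_def)

lemma is_kernel_lift:
  assumes "is_kernel C f k" "h \<in> Arr C" "Cod C h = Dom C f" "f \<cdot> h = Zero C (Dom C h) (Cod C f)"
  obtains u where "u \<in> Arr C" "Dom C u = Dom C h" "Cod C u = Dom C k" "k \<cdot> u = h"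
  using assms unfolding is_kernel_def by (metis in_Hom)

lemma is_kernel_unique:
  assumes "is_kernel C f k" "k \<cdot> g = k \<cdot> h" "g \<in> Hom C B (Dom C k)" "h \<in> Hom C B (Dom C k)"
  shows "g = h"
proof -
  note D = is_kernelD[OF assms(1)]
  have 1: "k \<cdot> g \<in> Hom C B (Dom C f)" using D assms(3) by simp
  have "f \<cdot> (k \<cdot> g) = Zero C (Dom C k) (Cod C f) \<cdot> g"
    by (rule comp_reduce) (use D assms(3) in auto)
  also have "\<dots> = Zero C B (Cod C f)"
    by (subst zero_comp) (use D assms(3) in auto)
  finally have "\<exists>!u. u \<in> Hom C B (Dom C k) \<and> k \<cdot> u = k \<cdot> g"
    using assms(1) 1 unfolding is_kernel_def by blast
  then show ?thesis using assms(2-4) by metis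
qed

lemma is_kernel_mono:
  assumes "is_kernel C f k" shows "is_mono C k"
  unfolding is_mono_def
  using is_kernelD(2)[OF assms] is_kernel_unique[OF assms] by blast

lemma is_kernelI:
  assumes "f \<in> Arr C" "is_mono C k" "Cod C k = Dom C f" "f \<cdot> k = Zero C (Dom C k) (Cod C f)"
    and "\<And>h. \<lbrakk>h \<in> Arr C; Cod C h = Dom C f; f \<cdot> h = Zero C (Dom C h) (Cod C f)\<rbrakk>
      \<Longrightarrow> \<exists>u. u \<in> Hom C (Dom C h) (Dom C k) \<and> k \<cdot> u = h"
  shows "is_kernel C f k"
  unfolding is_kernel_def
proof (intro conjI allI ballI impI)
  fix T h assume h: "h \<in> Hom C T (Dom C f)" "f \<cdot> h = Zero C T (Cod C f)"
  then obtain u where u: "u \<in> Hom C T (Dom C k)" "k \<cdot> u = h"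
    using assms(5)[of h] by auto
  show "\<exists>!u. u \<in> Hom C T (Dom C k) \<and> k \<cdot> u = h"
  proof (rule ex1I[of _ u])
    fix v assume v: "v \<in> Hom C T (Dom C k) \<and> k \<cdot> v = h"
    show "v = u" by (rule is_monoD[OF assms(2)]) (use u v assms(2) in auto)
  qed (use u in blast)
qed (use assms(1-4) in auto)

text \<open>A variant of \<open>is_kernel_lift\<close> with domains and codomains as separate
  variables, so that an equation whose zero arrow is already normalised can be passed in
  directly.\<close>

lemma kernel_lift:
  assumes "is_kernel C f k" "f \<cdot> h = Zero C A B" "h \<in> Arr C" "Dom C h = A" "Cod C h = Dom C f"
    "Cod C f = B"
  obtains u where "u \<in> Arr C" "Dom C u = A" "Cod C u = Dom C k" "k \<cdot> u = h"
  by (rule is_kernel_lift[OF assms(1,3,5)]) (use assms(2,4,6) that in simp_all)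

lemma is_cokernelD:
  assumes "is_cokernel C f c"
  shows "f \<in> Arr C" "c \<in> Arr C" "Dom C c = Cod C f" "c \<cdot> f = Zero C (Dom C f) (Cod C c)"
  using assms by (auto simp: is_cokernel_def)

lemma is_cokernel_factor:
  assumes "is_cokernel C f c" "h \<in> Arr C" "Dom C h = Cod C f" "h \<cdot> f = Zero C (Dom C f) (Cod C h)"
  obtains u where "u \<in> Arr C" "Dom C u = Cod C c" "Cod C u = Cod C h" "u \<cdot> c = h"
  using assms unfolding is_cokernel_def by (metis in_Hom)

lemma cokernel_factor:
  assumes "is_cokernel C f c" "h \<cdot> f = Zero C A B" "h \<in> Arr C" "Dom C h = Cod C f" "Dom C f = A"
    "Cod C h = B"
  obtains u where "u \<in> Arr C" "Dom C u = Cod C c" "Cod C u = B" "u \<cdot> c = h"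
  by (rule is_cokernel_factor[OF assms(1,3,4)]) (use assms(2,5,6) that in simp_all)

lemma is_cokernel_epi:
  assumes "is_cokernel C f c" shows "is_epi C c"
  unfolding is_epi_def
proof (intro conjI allI ballI impI)
  note D = is_cokernelD[OF assms(1)]
  show "c \<in> Arr C" using D by simp
  fix B g h assume a: "g \<in> Hom C (Cod C c) B" "h \<in> Hom C (Cod C c) B" "g \<cdot> c = h \<cdot> c"
  have 1: "g \<cdot> c \<in> Hom C (Cod C f) B" using D a by simp
  have "(g \<cdot> c) \<cdot> f = Zero C (Dom C f) B"
    using D a by (subst comp_assoc) auto
  then have "\<exists>!u. u \<in> Hom C (Cod C c) B \<and> u \<cdot> c = g \<cdot> c"
    using assms(1) 1 unfolding is_cokernel_def by blast
  then show "g = h" using a by metis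
qed

lemma is_cokernelI:
  assumes "f \<in> Arr C" "is_epi C c" "Dom C c = Cod C f" "c \<cdot> f = Zero C (Dom C f) (Cod C c)"
    and "\<And>h. \<lbrakk>h \<in> Arr C; Dom C h = Cod C f; h \<cdot> f = Zero C (Dom C f) (Cod C h)\<rbrakk>
      \<Longrightarrow> \<exists>u. u \<in> Hom C (Cod C c) (Cod C h) \<and> u \<cdot> c = h"
  shows "is_cokernel C f c"
  unfolding is_cokernel_def
proof (intro conjI allI ballI impI)
  fix T h assume h: "h \<in> Hom C (Cod C f) T" "h \<cdot> f = Zero C (Dom C f) T"
  then obtain u where u: "u \<in> Hom C (Cod C c) T" "u \<cdot> c = h"
    using assms(5)[of h] by auto
  show "\<exists>!u. u \<in> Hom C (Cod C c) T \<and> u \<cdot> c = h"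
  proof (rule ex1I[of _ u])
    fix v assume v: "v \<in> Hom C (Cod C c) T \<and> v \<cdot> c = h"
    show "v = u" by (rule is_epiD[OF assms(2)]) (use u v assms(2) in auto)
  qed (use u in blast)
qed (use assms(1-4) in auto)

text \<open>The equational form covers product and coproduct at once and lets the simplifier compute
  with components, which the universal properties do not.\<close>

definition biprod :: "'a \<Rightarrow> 'a \<Rightarrow> 'a \<Rightarrow> 'b \<Rightarrow> 'b \<Rightarrow> 'b \<Rightarrow> 'b \<Rightarrow> bool" where
  "biprod A B P i\<^sub>1 i\<^sub>2 p\<^sub>1 p\<^sub>2 \<longleftrightarrow> A \<in> Obj C \<and> B \<in> Obj C \<and> P \<in> Obj C \<and>
     i\<^sub>1 \<in> Hom C A P \<and> i\<^sub>2 \<in> Hom C B P \<and> p\<^sub>1 \<in> Hom C P A \<and> p\<^sub>2 \<in> Hom C P B \<and>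
     p\<^sub>1 \<cdot> i\<^sub>1 = Ident C A \<and> p\<^sub>2 \<cdot> i\<^sub>2 = Ident C B \<and> p\<^sub>1 \<cdot> i\<^sub>2 = Zero C B A \<and>
     p\<^sub>2 \<cdot> i\<^sub>1 = Zero C A B \<and> i\<^sub>1 \<cdot> p\<^sub>1 \<boxplus> i\<^sub>2 \<cdot> p\<^sub>2 = Ident C P"

lemma biprodD:
  assumes "biprod A B P i\<^sub>1 i\<^sub>2 p\<^sub>1 p\<^sub>2"
  shows "A \<in> Obj C" "B \<in> Obj C" "P \<in> Obj C" "i\<^sub>1 \<in> Arr C" "i\<^sub>2 \<in> Arr C" "p\<^sub>1 \<in> Arr C" "p\<^sub>2 \<in> Arr C"
    "Dom C i\<^sub>1 = A" "Cod C i\<^sub>1 = P" "Dom C i\<^sub>2 = B" "Cod C i\<^sub>2 = P"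
    "Dom C p\<^sub>1 = P" "Cod C p\<^sub>1 = A" "Dom C p\<^sub>2 = P" "Cod C p\<^sub>2 = B"
    "p\<^sub>1 \<cdot> i\<^sub>1 = Ident C A" "p\<^sub>2 \<cdot> i\<^sub>2 = Ident C B" "p\<^sub>1 \<cdot> i\<^sub>2 = Zero C B A" "p\<^sub>2 \<cdot> i\<^sub>1 = Zero C A B"
    "\<And>x. \<lbrakk>x \<in> Arr C; Cod C x = A\<rbrakk> \<Longrightarrow> p\<^sub>1 \<cdot> (i\<^sub>1 \<cdot> x) = x"
    "\<And>x. \<lbrakk>x \<in> Arr C; Cod C x = B\<rbrakk> \<Longrightarrow> p\<^sub>2 \<cdot> (i\<^sub>2 \<cdot> x) = x"
    "\<And>x. \<lbrakk>x \<in> Arr C; Cod C x = B\<rbrakk> \<Longrightarrow> p\<^sub>1 \<cdot> (i\<^sub>2 \<cdot> x) = Zero C (Dom C x) A"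
    "\<And>x. \<lbrakk>x \<in> Arr C; Cod C x = A\<rbrakk> \<Longrightarrow> p\<^sub>2 \<cdot> (i\<^sub>1 \<cdot> x) = Zero C (Dom C x) B"
  using assms by (simp_all add: biprod_def comp_reduce)

lemma biprod_decomp:
  assumes "biprod A B P i\<^sub>1 i\<^sub>2 p\<^sub>1 p\<^sub>2" "x \<in> Arr C" "Cod C x = P"
  shows "x = i\<^sub>1 \<cdot> (p\<^sub>1 \<cdot> x) \<boxplus> i\<^sub>2 \<cdot> (p\<^sub>2 \<cdot> x)"
proof -
  note [simp] = biprodD[OF assms(1)] assms(2,3)
  have "x = (i\<^sub>1 \<cdot> p\<^sub>1 \<boxplus> i\<^sub>2 \<cdot> p\<^sub>2) \<cdot> x"
    using assms(1) unfolding biprod_def by simp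
  also have "\<dots> = i\<^sub>1 \<cdot> (p\<^sub>1 \<cdot> x) \<boxplus> i\<^sub>2 \<cdot> (p\<^sub>2 \<cdot> x)" by simp
  finally show ?thesis .
qed

lemma biprod_eqI:
  assumes "biprod A B P i\<^sub>1 i\<^sub>2 p\<^sub>1 p\<^sub>2" "x \<in> Arr C" "Cod C x = P" "y \<in> Arr C" "Cod C y = P"
    "p\<^sub>1 \<cdot> x = p\<^sub>1 \<cdot> y" "p\<^sub>2 \<cdot> x = p\<^sub>2 \<cdot> y"
  shows "x = y"
  using biprod_decomp[OF assms(1-3)] biprod_decomp[OF assms(1,4,5)] assms(6,7) by simp

text \<open>Exactness in the internal language: lifts exist after passing to an epimorphic cover.\<close>

definition exct :: "'b \<Rightarrow> 'b \<Rightarrow> bool" where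
  "exct f g \<longleftrightarrow> f \<in> Arr C \<and> g \<in> Arr C \<and> Cod C f = Dom C g \<and> g \<cdot> f = Zero C (Dom C f) (Cod C g) \<and>
    (\<forall>u. u \<in> Arr C \<and> Cod C u = Dom C g \<and> g \<cdot> u = Zero C (Dom C u) (Cod C g) \<longrightarrow>
      (\<exists>r e. is_epi C r \<and> Cod C r = Dom C u \<and> e \<in> Hom C (Dom C r) (Dom C f) \<and> f \<cdot> e = u \<cdot> r))"

lemma exctD:
  assumes "exct f g"
  shows "f \<in> Arr C" "g \<in> Arr C" "Cod C f = Dom C g" "g \<cdot> f = Zero C (Dom C f) (Cod C g)"
  using assms by (simp_all add: exct_def)

lemma exct_lift:
  assumes "exct f g" "u \<in> Arr C" "Cod C u = Dom C g" "g \<cdot> u = Zero C (Dom C u) (Cod C g)"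
  obtains r e T where "is_epi C r" "r \<in> Arr C" "Dom C r = T" "Cod C r = Dom C u" "e \<in> Arr C"
    "Dom C e = T" "Cod C e = Dom C f" "f \<cdot> e = u \<cdot> r"
  using assms unfolding exct_def by (metis in_Hom is_epi_Arr)

end

section \<open>Pullbacks, images and exactness in an abelian category\<close>

context abelian_cat
begin

lemma obtain_kernel:
  assumes "f \<in> Arr C"
  obtains k K where "is_kernel C f k" "k \<in> Arr C" "Dom C k = K" "Cod C k = Dom C f" "K \<in> Obj C"
    "f \<cdot> k = Zero C K (Cod C f)"
  using ex_kernel[OF assms] is_kernelD by (metis Dom_in_Obj)

lemma obtain_cokernel:
  assumes "f \<in> Arr C"
  obtains c Q where "is_cokernel C f c" "c \<in> Arr C" "Cod C c = Q" "Dom C c = Cod C f" "Q \<in> Obj C"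
    "c \<cdot> f = Zero C (Dom C f) Q"
  using ex_cokernel[OF assms] is_cokernelD by (metis Cod_in_Obj)

lemma obtain_biprod:
  assumes A: "A \<in> Obj C" and B: "B \<in> Obj C"
  obtains P i\<^sub>1 i\<^sub>2 p\<^sub>1 p\<^sub>2 where "biprod A B P i\<^sub>1 i\<^sub>2 p\<^sub>1 p\<^sub>2"
proof -
  obtain P \<pi> where p: "is_product C (UNIV :: bool set) (\<lambda>b. if b then A else B) P \<pi>"
    using ex_binary_product[OF A B] by blast
  have P: "P \<in> Obj C" and pi: "\<And>b. \<pi> b \<in> Hom C P (if b then A else B)"
    using p unfolding is_product_def by blast+
  have [simp]: "\<pi> True \<in> Arr C" "\<pi> False \<in> Arr C" "Dom C (\<pi> True) = P" "Dom C (\<pi> False) = P"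
    "Cod C (\<pi> True) = A" "Cod C (\<pi> False) = B"
    using pi[of True] pi[of False] by auto
  note [simp] = A B P
  have ex: "\<exists>!u. u \<in> Hom C T P \<and> (\<forall>i. \<pi> i \<cdot> u = (if i then f else g))"
    if "f \<in> Hom C T A" "g \<in> Hom C T B" for T f g
  proof -
    have "T \<in> Obj C" using that by auto
    then have "(\<forall>i. (if i then f else g) \<in> Hom C T (if i then A else B)) \<longrightarrow>
       (\<exists>!u. u \<in> Hom C T P \<and> (\<forall>i. \<pi> i \<cdot> u = (if i then f else g)))"
      using p unfolding is_product_def by (simp del: in_Hom)
    then show ?thesis using that by presburger
  qed
  have pair: "\<exists>u. u \<in> Hom C T P \<and> \<pi> True \<cdot> u = f \<and> \<pi> False \<cdot> u = g"
    if "f \<in> Hom C T A" "g \<in> Hom C T B" for T f g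
    using ex[OF that] by (metis (full_types))
  have uniq: "u = v" if "u \<in> Hom C T P" "v \<in> Hom C T P" "\<pi> True \<cdot> u = \<pi> True \<cdot> v"
    "\<pi> False \<cdot> u = \<pi> False \<cdot> v" for T u v
  proof -
    have "\<pi> True \<cdot> v \<in> Hom C T A" "\<pi> False \<cdot> v \<in> Hom C T B" using that(2) by auto
    from ex[OF this] show ?thesis using that by (metis (full_types))
  qed
  obtain i\<^sub>1 where i1: "i\<^sub>1 \<in> Hom C A P" "\<pi> True \<cdot> i\<^sub>1 = Ident C A" "\<pi> False \<cdot> i\<^sub>1 = Zero C A B"
    using pair[of "Ident C A" A "Zero C A B"] by auto
  obtain i\<^sub>2 where i2: "i\<^sub>2 \<in> Hom C B P" "\<pi> True \<cdot> i\<^sub>2 = Zero C B A" "\<pi> False \<cdot> i\<^sub>2 = Ident C B"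
    using pair[of "Zero C B A" B "Ident C B"] by auto
  have "i\<^sub>1 \<cdot> \<pi> True \<boxplus> i\<^sub>2 \<cdot> \<pi> False = Ident C P"
    by (rule uniq) (use i1 i2 in \<open>simp_all add: comp_reduce[OF i1(2)] comp_reduce[OF i1(3)]
        comp_reduce[OF i2(2)] comp_reduce[OF i2(3)]\<close>)
  then have "biprod A B P i\<^sub>1 i\<^sub>2 (\<pi> True) (\<pi> False)"
    unfolding biprod_def using i1 i2 by simp
  then show thesis by (rule that)
qed

text \<open>Normality gives some \<open>g\<close> with kernel \<open>f\<close>. As \<open>g\<close>
  kills \<open>f\<close>, it factors through \<open>c\<close>; so whatever \<open>c\<close> kills is
  killed by \<open>g\<close> and lifts along \<open>f\<close>.\<close>

lemma mono_is_kernel: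
  assumes "is_mono C f" "is_cokernel C f c" shows "is_kernel C c f"
proof -
  note D = is_cokernelD[OF assms(2)]
  obtain g where g: "is_kernel C g f" using mono_normal[OF assms(1)] by blast
  note Dg = is_kernelD[OF g]
  obtain v where v: "v \<in> Arr C" "Dom C v = Cod C c" "Cod C v = Cod C g" "v \<cdot> c = g"
    by (rule is_cokernel_factor[OF assms(2), of g]) (use D Dg in auto)
  show ?thesis
  proof (rule is_kernelI)
    fix h assume h: "h \<in> Arr C" "Cod C h = Dom C c" "c \<cdot> h = Zero C (Dom C h) (Cod C c)"
    have "g \<cdot> h = Zero C (Dom C h) (Cod C g)"
      by (subst comp_expand_left[OF v(4) h(3)]) (use h v D in simp_all)
    then obtain u where "u \<in> Arr C" "Dom C u = Dom C h" "Cod C u = Dom C f" "f \<cdot> u = h"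
      by (rule is_kernel_lift[OF g h(1), rotated]) (use h D Dg in auto)
    then show "\<exists>u. u \<in> Hom C (Dom C h) (Dom C f) \<and> f \<cdot> u = h" by auto
  qed (use D assms(1) in auto)
qed

lemma epi_is_cokernel:
  assumes "is_epi C f" "is_kernel C f k" shows "is_cokernel C k f"
proof -
  note D = is_kernelD[OF assms(2)]
  obtain g where g: "is_cokernel C g f" using epi_normal[OF assms(1)] by blast
  note Dg = is_cokernelD[OF g]
  obtain v where v: "v \<in> Arr C" "Dom C v = Dom C g" "Cod C v = Dom C k" "k \<cdot> v = g"
    by (rule is_kernel_lift[OF assms(2), of g]) (use D Dg in auto)
  show ?thesis
  proof (rule is_cokernelI)
    fix h assume h: "h \<in> Arr C" "Dom C h = Cod C k" "h \<cdot> k = Zero C (Dom C k) (Cod C h)"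
    have "h \<cdot> g = Zero C (Dom C g) (Cod C h)"
      by (subst comp_expand_right[OF v(4) h(3)]) (use h v D in simp_all)
    then obtain u where "u \<in> Arr C" "Dom C u = Cod C f" "Cod C u = Cod C h" "u \<cdot> f = h"
      by (rule is_cokernel_factor[OF g h(1), rotated]) (use h D Dg in auto)
    then show "\<exists>u. u \<in> Hom C (Cod C f) (Cod C h) \<and> u \<cdot> f = h" by auto
  qed (use D assms(1) in auto)
qed

lemma epi_factor:
  assumes "is_epi C p" "is_kernel C p k" "f \<in> Arr C" "Dom C f = Dom C p"
    "f \<cdot> k = Zero C (Dom C k) (Cod C f)"
  obtains u where "u \<in> Arr C" "Dom C u = Cod C p" "Cod C u = Cod C f" "u \<cdot> p = f"
proof -
  have "Dom C f = Cod C k" using is_kernelD(3)[OF assms(2)] assms(4) by simp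
  from is_cokernel_factor[OF epi_is_cokernel[OF assms(1,2)] assms(3) this assms(5)]
  show thesis using that by blast
qed

definition is_pullback :: "'b \<Rightarrow> 'b \<Rightarrow> 'b \<Rightarrow> 'b \<Rightarrow> bool" where
  "is_pullback g u q p \<longleftrightarrow> g \<in> Arr C \<and> u \<in> Arr C \<and> q \<in> Arr C \<and> p \<in> Arr C \<and> Cod C g = Cod C u \<and>
     Dom C q = Dom C p \<and> Cod C q = Dom C g \<and> Cod C p = Dom C u \<and> g \<cdot> q = u \<cdot> p \<and>
     (\<forall>x y. x \<in> Arr C \<and> y \<in> Arr C \<and> Dom C x = Dom C y \<and> Cod C x = Dom C g \<and> Cod C y = Dom C u \<and>
        g \<cdot> x = u \<cdot> y \<longrightarrow> (\<exists>!z. z \<in> Hom C (Dom C y) (Dom C p) \<and> q \<cdot> z = x \<and> p \<cdot> z = y))"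

text \<open>The pullback is the kernel of the difference
  \<open>g \<cdot> p\<^sub>1 \<boxminus> u \<cdot> p\<^sub>2\<close> on the biproduct. If
  \<open>g\<close> is epi, so is this difference, which is then the cokernel of its kernel.\<close>

lemma obtain_pullback:
  assumes g: "g \<in> Hom C E A" and u: "u \<in> Hom C T A"
  obtains P q p where "is_pullback g u q p" "q \<in> Hom C P E" "p \<in> Hom C P T" "P \<in> Obj C"
    "g \<cdot> q = u \<cdot> p" "is_epi C g \<Longrightarrow> is_epi C p"
proof -
  have o [simp]: "E \<in> Obj C" "A \<in> Obj C" "T \<in> Obj C" using g u by auto
  obtain B i\<^sub>1 i\<^sub>2 p\<^sub>1 p\<^sub>2 where b: "biprod E T B i\<^sub>1 i\<^sub>2 p\<^sub>1 p\<^sub>2" by (rule obtain_biprod[OF o(1,3)])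
  note [simp] = biprodD[OF b]
  have t [simp]: "g \<in> Arr C" "Dom C g = E" "Cod C g = A" "u \<in> Arr C" "Dom C u = T" "Cod C u = A"
    using g u by auto
  define d where "d = g \<cdot> p\<^sub>1 \<boxminus> u \<cdot> p\<^sub>2"
  have d [simp]: "d \<in> Arr C" "Dom C d = B" "Cod C d = A" by (simp_all add: d_def)
  obtain k K where k: "is_kernel C d k" "Dom C k = K" "K \<in> Obj C"
    using obtain_kernel[OF d(1)] by metis
  note [simp] = is_kernelD(2,3)[OF k(1)] k(2,3)
  note K = k(3)
  have "d \<cdot> k = Zero C K A" using is_kernelD(4)[OF k(1)] by simp
  then have "g \<cdot> (p\<^sub>1 \<cdot> k) \<boxminus> u \<cdot> (p\<^sub>2 \<cdot> k) = Zero C K A"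
    by (simp add: d_def)
  then have gk: "g \<cdot> (p\<^sub>1 \<cdot> k) = u \<cdot> (p\<^sub>2 \<cdot> k)"
    by (rule minus_eq_zero) simp_all
  have "is_pullback g u (p\<^sub>1 \<cdot> k) (p\<^sub>2 \<cdot> k)"
    unfolding is_pullback_def
  proof (intro conjI allI impI)
    fix x y assume a: "x \<in> Arr C \<and> y \<in> Arr C \<and> Dom C x = Dom C y \<and> Cod C x = Dom C g \<and>
      Cod C y = Dom C u \<and> g \<cdot> x = u \<cdot> y"
    define w where "w = i\<^sub>1 \<cdot> x \<boxplus> i\<^sub>2 \<cdot> y"
    have x [simp]: "x \<in> Arr C" "y \<in> Arr C" "Dom C x = Dom C y" "Cod C x = E" "Cod C y = T"
      "g \<cdot> x = u \<cdot> y" using a by auto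
    have w [simp]: "w \<in> Arr C" "Dom C w = Dom C y" "Cod C w = B" "p\<^sub>1 \<cdot> w = x" "p\<^sub>2 \<cdot> w = y"
      unfolding w_def by simp_all
    have "d \<cdot> w = Zero C (Dom C w) (Cod C d)" unfolding d_def by simp
    then obtain z where z: "z \<in> Arr C" "Dom C z = Dom C w" "Cod C z = Dom C k" "k \<cdot> z = w"
      by (rule is_kernel_lift[OF k(1), rotated 2]) auto
    show "\<exists>!z. z \<in> Hom C (Dom C y) (Dom C (p\<^sub>2 \<cdot> k)) \<and> (p\<^sub>1 \<cdot> k) \<cdot> z = x \<and> (p\<^sub>2 \<cdot> k) \<cdot> z = y"
    proof (rule ex1I[of _ z])
      show "z \<in> Hom C (Dom C y) (Dom C (p\<^sub>2 \<cdot> k)) \<and> (p\<^sub>1 \<cdot> k) \<cdot> z = x \<and> (p\<^sub>2 \<cdot> k) \<cdot> z = y"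
        using z by simp
      fix z' assume z': "z' \<in> Hom C (Dom C y) (Dom C (p\<^sub>2 \<cdot> k)) \<and> (p\<^sub>1 \<cdot> k) \<cdot> z' = x \<and> (p\<^sub>2 \<cdot> k) \<cdot> z' = y"
      then have z'': "z' \<in> Arr C" "Dom C z' = Dom C y" "Cod C z' = K" by simp_all
      have "p\<^sub>1 \<cdot> (k \<cdot> z') = x" "p\<^sub>2 \<cdot> (k \<cdot> z') = y" using z' z'' by simp_all
      with z'' have "k \<cdot> z' = w" by (intro biprod_eqI[OF b, of "k \<cdot> z'" w]) simp_all
      then have "k \<cdot> z' = k \<cdot> z" using z by simp
      then show "z' = z" by (rule is_kernel_unique[OF k(1)]) (use z z'' in simp_all)
    qed
  qed (use gk in auto)
  \<comment> \<open>If \<open>t\<close> kills the projection to \<open>T\<close>, then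
    \<open>t \<cdot> p\<^sub>2\<close> factors as \<open>v \<cdot> d\<close>. Restricted to the
    first summand this says that \<open>v \<cdot> g\<close> is zero; hence \<open>v\<close> is zero,
    and so is \<open>t\<close>.\<close>
  moreover have "is_epi C (p\<^sub>2 \<cdot> k)" if e: "is_epi C g"
  proof (rule is_epiI)
    fix t assume t: "t \<in> Arr C" "Dom C t = Cod C (p\<^sub>2 \<cdot> k)"
      "t \<cdot> (p\<^sub>2 \<cdot> k) = Zero C (Dom C (p\<^sub>2 \<cdot> k)) (Cod C t)"
    have ed: "is_epi C d"
    proof (rule is_epi_cancel[of d i\<^sub>1])
      show "is_epi C (d \<cdot> i\<^sub>1)" using e by (simp add: d_def)
    qed auto
    have tt [simp]: "Dom C t = T" "t \<in> Arr C" using t by auto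
    have "(t \<cdot> p\<^sub>2) \<cdot> k = Zero C K (Cod C t)" using t(3) by simp
    then obtain v where v: "v \<in> Arr C" "Dom C v = A" "Cod C v = Cod C t" "v \<cdot> d = t \<cdot> p\<^sub>2"
      using epi_factor[OF ed k(1), of "t \<cdot> p\<^sub>2"] by auto
    have "v \<cdot> g = v \<cdot> (d \<cdot> i\<^sub>1)" by (simp add: d_def)
    also have "\<dots> = Zero C E (Cod C t)" using v by (simp add: comp_reduce[OF v(4)])
    finally have v0: "v = Zero C (Cod C g) (Cod C t)"
      by (rule is_epi_zeroD[OF e]) (use v in auto)
    have "t \<cdot> p\<^sub>2 = Zero C B (Cod C t)" using v(4) tt unfolding v0 by simp
    then have "t \<cdot> (p\<^sub>2 \<cdot> i\<^sub>2) = Zero C B (Cod C t) \<cdot> i\<^sub>2"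
      by (rule comp_reduce) auto
    then show "t = Zero C (Cod C (p\<^sub>2 \<cdot> k)) (Cod C t)" by simp
  qed auto
  moreover have "p\<^sub>1 \<cdot> k \<in> Hom C K E" "p\<^sub>2 \<cdot> k \<in> Hom C K T" by simp_all
  ultimately show thesis using that gk K by blast
qed

lemma pullback_epi:
  assumes "is_epi C g" "g \<in> Hom C E A" "u \<in> Hom C T A"
  obtains P q p where "is_epi C p" "p \<in> Arr C" "Dom C p = P" "Cod C p = T" "q \<in> Arr C"
    "Dom C q = P" "Cod C q = E" "g \<cdot> q = u \<cdot> p" "P \<in> Obj C"
proof (rule obtain_pullback[OF assms(2,3)])
  fix P q p
  assume "q \<in> Hom C P E" "p \<in> Hom C P T" "P \<in> Obj C" "g \<cdot> q = u \<cdot> p" "is_epi C g \<Longrightarrow> is_epi C p"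
  then show thesis using assms(1) by (intro that[of p P q]) simp_all
qed

text \<open>Write \<open>f = m \<cdot> e\<close> with \<open>m\<close> the kernel of
  \<open>g\<close>. A local lift of \<open>m\<close> itself exhibits an epimorphism of the form
  \<open>e \<cdot> x\<close>, so \<open>e\<close> is epi. Conversely, an arrow killed by
  \<open>g\<close> lifts to the kernel, and pulling \<open>e\<close> back along this lift gives the
  required cover.\<close>

lemma exct_iff:
  "exct f g \<longleftrightarrow> (\<exists>m e. is_kernel C g m \<and> is_epi C e \<and> Cod C e = Dom C m \<and> f = m \<cdot> e)"
proof
  assume a: "exct f g"
  note D = exctD[OF a]
  obtain m K where m: "is_kernel C g m" "Dom C m = K" "m \<in> Arr C" "Cod C m = Dom C g" "K \<in> Obj C"
    "g \<cdot> m = Zero C K (Cod C g)"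
    using obtain_kernel[OF D(2)] by metis
  obtain e where e: "e \<in> Arr C" "Dom C e = Dom C f" "Cod C e = Dom C m" "m \<cdot> e = f"
    by (rule is_kernel_lift[OF m(1), of f]) (use D in auto)
  obtain r x T where r: "is_epi C r" "r \<in> Arr C" "Dom C r = T" "Cod C r = Dom C m" "x \<in> Arr C"
    "Dom C x = T" "Cod C x = Dom C f" "f \<cdot> x = m \<cdot> r"
    by (rule exct_lift[OF a, of m]) (use m in auto)
  have "m \<cdot> (e \<cdot> x) = m \<cdot> r" using r e m D by (simp add: comp_reduce[OF e(4)])
  then have "e \<cdot> x = r" by (rule is_kernel_unique[OF m(1)]) (use e r m in auto)
  then have "is_epi C e" using is_epi_cancel[of e x] r e by simp
  then show "\<exists>m e. is_kernel C g m \<and> is_epi C e \<and> Cod C e = Dom C m \<and> f = m \<cdot> e"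
    using m e by metis
next
  assume "\<exists>m e. is_kernel C g m \<and> is_epi C e \<and> Cod C e = Dom C m \<and> f = m \<cdot> e"
  then obtain m e where m: "is_kernel C g m" and e: "is_epi C e" "Cod C e = Dom C m" "f = m \<cdot> e"
    by blast
  note D = is_kernelD[OF m]
  show "exct f g"
    unfolding exct_def
  proof (intro conjI allI impI)
    fix u assume u: "u \<in> Arr C \<and> Cod C u = Dom C g \<and> g \<cdot> u = Zero C (Dom C u) (Cod C g)"
    then obtain v where v: "v \<in> Arr C" "Dom C v = Dom C u" "Cod C v = Dom C m" "m \<cdot> v = u"
      using is_kernel_lift[OF m, of u] by metis
    obtain P q p where "is_epi C p" "p \<in> Arr C" "Dom C p = P" "Cod C p = Dom C u" "q \<in> Arr C"
      "Dom C q = P" "Cod C q = Dom C e" "e \<cdot> q = v \<cdot> p"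
      by (rule pullback_epi[OF e(1), of _ "Dom C m" v "Dom C u"]) (use e v in auto)
    then show "\<exists>r ea. is_epi C r \<and> Cod C r = Dom C u \<and> ea \<in> Hom C (Dom C r) (Dom C f) \<and> f \<cdot> ea = u \<cdot> r"
      using D v e u by (intro exI[of _ p] exI[of _ q]) (simp add: comp_reduce[OF v(4)])
  next
    show "g \<cdot> f = Zero C (Dom C f) (Cod C g)"
      using D e by (simp add: comp_reduce[OF D(4)])
  qed (use D e in auto)
qed

text \<open>Suppose \<open>t\<close> kills \<open>e\<close>; then \<open>e\<close> factors through
  the kernel \<open>k\<close> of \<open>t\<close>. The cokernel of \<open>m \<cdot> k\<close> kills
  \<open>f\<close>, hence factors through \<open>c\<close> and kills \<open>m\<close>. So
  \<open>m\<close> factors through \<open>m \<cdot> k\<close>, which gives \<open>k\<close> a right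
  inverse and makes \<open>t\<close> zero.\<close>

lemma is_image_epi:
  assumes "is_cokernel C f c" "is_kernel C c m"
  obtains e where "is_epi C e" "Cod C e = Dom C m" "f = m \<cdot> e" "Dom C e = Dom C f"
proof -
  note D = is_cokernelD[OF assms(1)] is_kernelD[OF assms(2)]
  obtain e where e: "e \<in> Arr C" "Dom C e = Dom C f" "Cod C e = Dom C m" "m \<cdot> e = f"
    by (rule is_kernel_lift[OF assms(2), of f]) (use D in auto)
  have "is_epi C e"
  proof (rule is_epiI)
    fix t assume t: "t \<in> Arr C" "Dom C t = Cod C e" "t \<cdot> e = Zero C (Dom C e) (Cod C t)"
    obtain k K where k: "is_kernel C t k" "Dom C k = K" "k \<in> Arr C" "Cod C k = Dom C t"
      "t \<cdot> k = Zero C K (Cod C t)" "K \<in> Obj C"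
      using obtain_kernel[OF t(1)] by metis
    obtain e' where e': "e' \<in> Arr C" "Dom C e' = Dom C e" "Cod C e' = Dom C k" "k \<cdot> e' = e"
      by (rule is_kernel_lift[OF k(1), of e]) (use t e in auto)
    have mk: "is_mono C (m \<cdot> k)"
      by (rule is_mono_comp) (use k t e is_kernel_mono[OF k(1)] is_kernel_mono[OF assms(2)] in auto)
    obtain s S where s: "is_cokernel C (m \<cdot> k) s" "s \<in> Arr C" "Cod C s = S" "Dom C s = Cod C (m \<cdot> k)"
      "S \<in> Obj C" "s \<cdot> (m \<cdot> k) = Zero C (Dom C (m \<cdot> k)) S"
      using obtain_cokernel[of "m \<cdot> k"] mk by (metis is_mono_Arr)
    have tk [simp]: "m \<in> Arr C" "Cod C k = Dom C m" "Dom C s = Cod C m" "Dom C t = Dom C m"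
      using D k t e s by auto
    have "f = (m \<cdot> k) \<cdot> e'"
      using e' e k s t by simp
    then have "s \<cdot> f = Zero C (Dom C f) (Cod C s)"
      by (subst comp_expand_right[OF _ s(6), of e' f]) (use s e' k e in simp_all)
    then obtain v where v: "v \<in> Arr C" "Dom C v = Cod C c" "Cod C v = Cod C s" "v \<cdot> c = s"
      by (rule is_cokernel_factor[OF assms(1), of s, rotated 2]) (use s D in auto)
    have "s \<cdot> m = v \<cdot> (c \<cdot> m)" by (rule comp_expand_left[OF v(4) refl]) (use v D in auto)
    also have "\<dots> = Zero C (Dom C m) (Cod C s)" using v D by simp
    finally have "s \<cdot> m = Zero C (Dom C m) (Cod C s)" .
    then obtain w where w: "w \<in> Arr C" "Dom C w = Dom C m" "Cod C w = Dom C (m \<cdot> k)" "(m \<cdot> k) \<cdot> w = m"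
      by (rule is_kernel_lift[OF mono_is_kernel[OF mk s(1)], of m, rotated 2]) (use s D in auto)
    have "m \<cdot> (k \<cdot> w) = m \<cdot> Ident C (Dom C m)" using w k t by simp
    moreover have mo: "Ident C (Dom C m) \<in> Hom C (Dom C m) (Dom C m)" "Dom C m \<in> Obj C"
      using D by auto
    moreover have "k \<cdot> w \<in> Hom C (Dom C m) (Dom C m)" using w k t by simp
    ultimately have "k \<cdot> w = Ident C (Dom C m)"
      using is_kernel_unique[OF assms(2)] by blast
    from comp_expand_right[OF this k(5)] show "t = Zero C (Cod C e) (Cod C t)"
      using w k t e mo(2) by simp
  qed (fact e(1))
  then show thesis using that e(2-4) by metis
qed

text \<open>Precomposing with an epimorphism does not change the cokernel, so
  \<open>m \<cdot> e\<close> has the same image as the monomorphism \<open>m\<close>, which is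
  \<open>m\<close> itself.\<close>

lemma exact_at_iff: "exact_at C f g \<longleftrightarrow> exct f g"
proof
  assume "exact_at C f g"
  then obtain m c where m: "is_cokernel C f c" "is_kernel C c m" "is_kernel C g m"
    unfolding exact_at_def is_image_def by blast
  obtain e where "is_epi C e" "Cod C e = Dom C m" "f = m \<cdot> e" "Dom C e = Dom C f"
    using is_image_epi[OF m(1,2)] .
  then show "exct f g" using exct_iff m(3) by blast
next
  assume "exct f g"
  then obtain m e where m: "is_kernel C g m" and e: "is_epi C e" "Cod C e = Dom C m" "f = m \<cdot> e"
    unfolding exct_iff by blast
  note D = is_kernelD[OF m]
  obtain c Q where c: "is_cokernel C m c" "c \<in> Arr C" "Cod C c = Q" "Dom C c = Cod C m" "Q \<in> Obj C"
    "c \<cdot> m = Zero C (Dom C m) Q"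
    using obtain_cokernel[of m] D by metis
  have "is_cokernel C f c"
  proof (rule is_cokernelI)
    show "c \<cdot> f = Zero C (Dom C f) (Cod C c)"
      using c e D by (simp add: comp_reduce[OF c(6)])
    fix h assume h: "h \<in> Arr C" "Dom C h = Cod C f" "h \<cdot> f = Zero C (Dom C f) (Cod C h)"
    have "h \<cdot> m = Zero C (Dom C m) (Cod C h)"
      unfolding e(2)[symmetric] by (rule is_epi_zeroD[OF e(1), of _ "Dom C e"]) (use h e D in auto)
    then obtain u where "u \<in> Arr C" "Dom C u = Cod C c" "Cod C u = Cod C h" "u \<cdot> c = h"
      by (rule is_cokernel_factor[OF c(1), of h, rotated 2]) (use h e D in auto)
    then show "\<exists>u. u \<in> Hom C (Cod C c) (Cod C h) \<and> u \<cdot> c = h" by auto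
  qed (use e D c is_cokernel_epi[OF c(1)] in auto)
  moreover have "is_kernel C c m"
    by (rule mono_is_kernel[OF is_kernel_mono[OF m] c(1)])
  ultimately show "exact_at C f g"
    unfolding exact_at_def is_image_def using m by blast
qed

end

section \<open>Vanishing of pulled-back Yoneda classes\<close>

text \<open>
  Sequences are read from the right end: in \<open>chain h [g\<^sub>1, \<dots>, g\<^sub>n]\<close> the arrow \<open>g\<^sub>1\<close> ends at the source
  of \<open>h\<close>, the arrow \<open>g\<^sub>2\<close> at the source of \<open>g\<^sub>1\<close>, and so on. The kernel of \<open>g\<^sub>n\<close> is the object \<open>B\<close> of an
  \<open>n\<close>-extension, which is therefore not listed, and its right end is the case of \<open>h : A \<rightarrow> 0\<close>.
\<close>

context preadditive_cat
begin

primrec chain :: "'b \<Rightarrow> 'b list \<Rightarrow> bool" where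
  "chain h [] \<longleftrightarrow> True"
| "chain h (g # gs) \<longleftrightarrow> exct g h \<and> chain g gs"

text \<open>The empty list is degree 0: there a class is an arrow into the kernel of the arrow at
  the right end, and it vanishes if the arrow is zero. In the recursive case
  \<open>g \<cdot> (f \<cdot> k) = u \<cdot> (p \<cdot> k)\<close> is zero, so
  \<open>f \<cdot> k\<close> lands in the kernel of \<open>g\<close> and again stands for a class,
  of one degree less.\<close>

primrec vanishes :: "'b list \<Rightarrow> 'b \<Rightarrow> bool" where
  "vanishes [] u \<longleftrightarrow> u = Zero C (Dom C u) (Cod C u)"
| "vanishes (g # gs) u \<longleftrightarrow> g \<in> Arr C \<and> Cod C g = Cod C u \<and>
     (\<exists>p f k. is_epi C p \<and> Cod C p = Dom C u \<and> f \<in> Hom C (Dom C p) (Dom C g) \<and>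
        g \<cdot> f = u \<cdot> p \<and> is_kernel C p k \<and> vanishes gs (f \<cdot> k))"

declare vanishes.simps [simp del]

lemma vanishes_Nil: "u \<in> Hom C T A \<Longrightarrow> vanishes [] u \<longleftrightarrow> u = Zero C T A"
  by (simp add: vanishes.simps)

text \<open>A morphism of chains over \<open>a\<close>. The condition \<open>P\<close> is imposed on
  the last vertical arrow and the last arrows of both chains, the only place where the unlisted left
  ends are visible. It is instantiated by \<open>iso_ker\<close> and, for morphisms that are the
  identity on \<open>B\<close>, by an equation \<open>c \<cdot> m = m'\<close>.\<close>

fun ladder :: "('b \<Rightarrow> 'b \<Rightarrow> 'b \<Rightarrow> bool) \<Rightarrow> 'b \<Rightarrow> 'b list \<Rightarrow> 'b \<Rightarrow> 'b list \<Rightarrow> 'b \<Rightarrow> bool" where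
  "ladder P h [] h' [] a \<longleftrightarrow> P h h' a"
| "ladder P h (g # gs) h' (g' # gs') a \<longleftrightarrow>
     (\<exists>b. b \<in> Hom C (Dom C g) (Dom C g') \<and> a \<cdot> g = g' \<cdot> b \<and> ladder P g gs g' gs' b)"
| "ladder P h _ h' _ a \<longleftrightarrow> False"

text \<open>The arrow \<open>a\<close> induces an isomorphism \<open>ker h \<rightarrow> ker h'\<close>.\<close>

definition iso_ker :: "'b \<Rightarrow> 'b \<Rightarrow> 'b \<Rightarrow> bool" where
  "iso_ker h h' a \<longleftrightarrow>
     (\<forall>u. u \<in> Arr C \<and> Cod C u = Dom C h \<and> h \<cdot> u = Zero C (Dom C u) (Cod C h) \<and>
        a \<cdot> u = Zero C (Dom C u) (Cod C a) \<longrightarrow> u = Zero C (Dom C u) (Dom C h)) \<and>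
     (\<forall>v. v \<in> Arr C \<and> Cod C v = Dom C h' \<and> h' \<cdot> v = Zero C (Dom C v) (Cod C h') \<longrightarrow>
        (\<exists>r e. is_epi C r \<and> Cod C r = Dom C v \<and> e \<in> Hom C (Dom C r) (Dom C h) \<and>
           h \<cdot> e = Zero C (Dom C r) (Cod C h) \<and> a \<cdot> e = v \<cdot> r))"

lemma iso_ker_inj:
  assumes "iso_ker h h' a" "u \<in> Hom C T A" "Dom C h = A" "h \<cdot> u = Zero C T B" "Cod C h = B"
    "a \<cdot> u = Zero C T A'" "Cod C a = A'"
  shows "u = Zero C T A"
  using assms unfolding iso_ker_def by (metis in_Hom)

lemma iso_ker_surj:
  assumes "iso_ker h h' a" "v \<in> Arr C" "Cod C v = Dom C h'" "h' \<cdot> v = Zero C (Dom C v) (Cod C h')"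
  obtains r e T where "is_epi C r" "r \<in> Arr C" "Dom C r = T" "Cod C r = Dom C v" "e \<in> Arr C"
    "Dom C e = T" "Cod C e = Dom C h" "h \<cdot> e = Zero C T (Cod C h)" "a \<cdot> e = v \<cdot> r"
  using assms unfolding iso_ker_def by (metis in_Hom is_epi_Arr)

lemma ladder_length: "ladder P h gs h' gs' a \<Longrightarrow> length gs = length gs'"
  by (induction P h gs h' gs' a rule: ladder.induct) auto

end

section \<open>Calculus of vanishing classes\<close>

context abelian_cat
begin

lemma vanishes_ConsI:
  assumes "is_epi C p" "p \<in> Hom C F T" "f \<in> Hom C F E" "g \<in> Hom C E A" "u \<in> Hom C T A" "g \<cdot> f = u \<cdot> p"
    and "\<And>k K. \<lbrakk>is_kernel C p k; k \<in> Arr C; Dom C k = K; Cod C k = F; K \<in> Obj C;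
      p \<cdot> k = Zero C K T\<rbrakk> \<Longrightarrow> vanishes gs (f \<cdot> k)"
  shows "vanishes (g # gs) u"
proof -
  have p: "p \<in> Arr C" "Dom C p = F" "Cod C p = T" using assms(2) by simp_all
  obtain k K where k: "is_kernel C p k" "k \<in> Arr C" "Dom C k = K" "Cod C k = Dom C p" "K \<in> Obj C"
    "p \<cdot> k = Zero C K (Cod C p)"
    by (rule obtain_kernel[OF p(1)])
  have "vanishes gs (f \<cdot> k)" by (rule assms(7)) (use k p in simp_all)
  then show ?thesis
    unfolding vanishes.simps using assms(1-6) k(1) p by auto
qed

lemma vanishes_ConsE:
  assumes "vanishes (g # gs) u"
  obtains p F f k K where "g \<in> Arr C" "Cod C g = Cod C u" "is_epi C p" "p \<in> Arr C" "Dom C p = F" "Cod C p = Dom C u" "f \<in> Arr C"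
    "Dom C f = F" "Cod C f = Dom C g" "g \<cdot> f = u \<cdot> p" "is_kernel C p k" "k \<in> Arr C" "Cod C k = F"
    "Dom C k = K" "p \<cdot> k = Zero C K (Dom C u)" "K \<in> Obj C" "F \<in> Obj C" "vanishes gs (f \<cdot> k)"
proof -
  obtain p f k where p: "g \<in> Arr C" "Cod C g = Cod C u" "is_epi C p" "Cod C p = Dom C u" "f \<in> Hom C (Dom C p) (Dom C g)"
     "g \<cdot> f = u \<cdot> p" "is_kernel C p k" "vanishes gs (f \<cdot> k)"
    using assms unfolding vanishes.simps by blast
  note D = is_kernelD[OF p(7)]
  show thesis
    by (rule that[of p "Dom C p" f k "Dom C k"]) (use p D in simp_all)
qed

text \<open>Pull the cover \<open>p\<close> back along \<open>w\<close>. The kernel of the new cover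
  maps to the kernel of \<open>p\<close>, and the induction hypothesis applies to this map.\<close>

lemma vanishes_comp:
  assumes "vanishes gs u" "u \<in> Hom C T A" "w \<in> Hom C S T"
  shows "vanishes gs (u \<cdot> w)"
  using assms
proof (induction gs arbitrary: u w T S A)
  case Nil
  note [simp] = HomD[OF Nil(2)] HomD[OF Nil(3)]
  have "u = Zero C T A" using Nil vanishes_Nil by blast
  then have "u \<cdot> w = Zero C S A" by simp
  then show ?case using vanishes_Nil[of "u \<cdot> w" S A] by simp
next
  case (Cons g gs)
  note [simp] = HomD[OF Cons.prems(2)] HomD[OF Cons.prems(3)]
  obtain p F f k K where g: "g \<in> Arr C" "Cod C g = Cod C u" and
    p: "is_epi C p" "p \<in> Arr C" "Dom C p = F" "Cod C p = Dom C u" "f \<in> Arr C"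
    "Dom C f = F" "Cod C f = Dom C g" "g \<cdot> f = u \<cdot> p" "is_kernel C p k" "k \<in> Arr C" "Cod C k = F"
    "Dom C k = K" "p \<cdot> k = Zero C K (Dom C u)" "K \<in> Obj C" "F \<in> Obj C" "vanishes gs (f \<cdot> k)"
    using vanishes_ConsE[OF Cons.prems(1)] .
  obtain P p' q where q: "is_epi C p'" "p' \<in> Arr C" "Dom C p' = P" "Cod C p' = S" "q \<in> Arr C"
    "Dom C q = P" "Cod C q = F" "p \<cdot> q = w \<cdot> p'" "P \<in> Obj C"
    by (rule pullback_epi[OF p(1), of F T w S]) (use p in simp_all)
  show ?case
  proof (rule vanishes_ConsI[of p' P S "f \<cdot> q" "Dom C g" g A])
    show "g \<cdot> (f \<cdot> q) = (u \<cdot> w) \<cdot> p'"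
      using p q g by (simp add: comp_reduce[OF p(8)])
    fix k' K' assume k': "is_kernel C p' k'" "k' \<in> Arr C" "Dom C k' = K'" "Cod C k' = P" "K' \<in> Obj C"
      "p' \<cdot> k' = Zero C K' S"
    have "p \<cdot> (q \<cdot> k') = w \<cdot> (p' \<cdot> k')"
      using k' p q by (simp add: comp_reduce[OF q(8)])
    also have "\<dots> = Zero C K' T" using k' by simp
    finally obtain v where v: "v \<in> Arr C" "Dom C v = K'" "Cod C v = Dom C k" "k \<cdot> v = q \<cdot> k'"
      by (rule kernel_lift[OF p(9)]) (use k' p q in simp_all)
    have "vanishes gs ((f \<cdot> k) \<cdot> v)"
      by (rule Cons.IH[of _ K "Dom C g" _ K']) (use v k' p q in simp_all)
    then show "vanishes gs ((f \<cdot> q) \<cdot> k')" using v k' p q by simp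
  qed (use q p g in simp_all)
qed

text \<open>The two covers are refined to their fibre product, where the lifts can be added and
  whose kernel over \<open>T\<close> maps to both old kernels. This replaces the additivity of
  pullback with respect to the Baer sum.\<close>

lemma vanishes_plus:
  assumes "vanishes gs u" "vanishes gs v" "u \<in> Hom C T A" "v \<in> Hom C T A"
  shows "vanishes gs (u \<boxplus> v)"
  using assms
proof (induction gs arbitrary: u v T A)
  case Nil
  note [simp] = HomD[OF Nil(3)] HomD[OF Nil(4)]
  have "u = Zero C T A" "v = Zero C T A" using Nil vanishes_Nil by blast+
  then have "u \<boxplus> v = Zero C T A" by simp
  then show ?case using vanishes_Nil[of "u \<boxplus> v" T A] by simp
next
  case (Cons g gs)
  note [simp] = HomD[OF Cons.prems(3)] HomD[OF Cons.prems(4)]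
  obtain p F f k K where g: "g \<in> Arr C" "Cod C g = Cod C u" and
    p: "is_epi C p" "p \<in> Arr C" "Dom C p = F" "Cod C p = Dom C u" "f \<in> Arr C"
    "Dom C f = F" "Cod C f = Dom C g" "g \<cdot> f = u \<cdot> p" "is_kernel C p k" "k \<in> Arr C" "Cod C k = F"
    "Dom C k = K" "p \<cdot> k = Zero C K (Dom C u)" "K \<in> Obj C" "F \<in> Obj C" "vanishes gs (f \<cdot> k)"
    using vanishes_ConsE[OF Cons.prems(1)] .
  obtain p' F' f' k' K' where 
    p': "is_epi C p'" "p' \<in> Arr C" "Dom C p' = F'" "Cod C p' = Dom C v" "f' \<in> Arr C"
    "Dom C f' = F'" "Cod C f' = Dom C g" "g \<cdot> f' = v \<cdot> p'" "is_kernel C p' k'" "k' \<in> Arr C" "Cod C k' = F'"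
    "Dom C k' = K'" "p' \<cdot> k' = Zero C K' (Dom C v)" "K' \<in> Obj C" "F' \<in> Obj C" "vanishes gs (f' \<cdot> k')"
    using vanishes_ConsE[OF Cons.prems(2)] .
  obtain P q q' where q: "is_epi C q" "q \<in> Arr C" "Dom C q = P" "Cod C q = F" "q' \<in> Arr C"
    "Dom C q' = P" "Cod C q' = F'" "p' \<cdot> q' = p \<cdot> q" "P \<in> Obj C"
    by (rule pullback_epi[OF p'(1), of F' T p F]) (use p p' in simp_all)
  show ?case
  proof (rule vanishes_ConsI[of "p \<cdot> q" P T "f \<cdot> q \<boxplus> f' \<cdot> q'" "Dom C g" g A])
    show "is_epi C (p \<cdot> q)" by (rule is_epi_comp) (use p q in simp_all)
    show "g \<cdot> (f \<cdot> q \<boxplus> f' \<cdot> q') = (u \<boxplus> v) \<cdot> (p \<cdot> q)"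
      using p q p' g by (simp add: comp_reduce[OF p(8)] comp_reduce[OF p'(8)])
    fix j J assume j: "is_kernel C (p \<cdot> q) j" "j \<in> Arr C" "Dom C j = J" "Cod C j = P" "J \<in> Obj C"
      "(p \<cdot> q) \<cdot> j = Zero C J T"
    then have 1: "p \<cdot> (q \<cdot> j) = Zero C J T" using p q by simp
    then have 2: "p' \<cdot> (q' \<cdot> j) = Zero C J T" using p' p q j by (simp add: comp_reduce[OF q(8)])
    obtain w where w: "w \<in> Arr C" "Dom C w = J" "Cod C w = Dom C k" "k \<cdot> w = q \<cdot> j"
      using 1 by (rule kernel_lift[OF p(9)]) (use j p q in simp_all)
    obtain w' where w': "w' \<in> Arr C" "Dom C w' = J" "Cod C w' = Dom C k'" "k' \<cdot> w' = q' \<cdot> j"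
      using 2 by (rule kernel_lift[OF p'(9)]) (use j p' q in simp_all)
    have "vanishes gs ((f \<cdot> k) \<cdot> w \<boxplus> (f' \<cdot> k') \<cdot> w')"
    proof (rule Cons.IH)
      show "vanishes gs ((f \<cdot> k) \<cdot> w)"
        by (rule vanishes_comp[of _ _ K "Dom C g" _ J]) (use w p j in simp_all)
      show "vanishes gs ((f' \<cdot> k') \<cdot> w')"
        by (rule vanishes_comp[of _ _ K' "Dom C g" _ J]) (use w' p' j in simp_all)
      show "(f \<cdot> k) \<cdot> w \<in> Hom C J (Dom C g)" "(f' \<cdot> k') \<cdot> w' \<in> Hom C J (Dom C g)"
        using w w' p p' j q by simp_all
    qed
    then show "vanishes gs ((f \<cdot> q \<boxplus> f' \<cdot> q') \<cdot> j)" using w w' p p' j q by simp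
  qed (use q p p' g in simp_all)
qed

lemma vanishes_neg:
  assumes "vanishes gs u" "u \<in> Hom C T A"
  shows "vanishes gs (neg u)"
  using assms
proof (induction gs arbitrary: u T A)
  case Nil
  note [simp] = HomD[OF Nil(2)]
  have "u = Zero C T A" using Nil vanishes_Nil by blast
  then have "neg u = Zero C T A" by simp
  then show ?case using vanishes_Nil[of "neg u" T A] by simp
next
  case (Cons g gs)
  note [simp] = HomD[OF Cons.prems(2)]
  obtain p F f k K where g: "g \<in> Arr C" "Cod C g = Cod C u" and
    p: "is_epi C p" "p \<in> Arr C" "Dom C p = F" "Cod C p = Dom C u" "f \<in> Arr C"
    "Dom C f = F" "Cod C f = Dom C g" "g \<cdot> f = u \<cdot> p" "is_kernel C p k" "k \<in> Arr C" "Cod C k = F"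
    "Dom C k = K" "p \<cdot> k = Zero C K (Dom C u)" "K \<in> Obj C" "F \<in> Obj C" "vanishes gs (f \<cdot> k)"
    using vanishes_ConsE[OF Cons.prems(1)] .
  have "vanishes gs (neg (f \<cdot> k))"
    by (rule Cons.IH[of _ K "Dom C g"]) (use p in simp_all)
  then have 1: "vanishes gs (neg f \<cdot> k)" "g \<cdot> neg f = neg u \<cdot> p" "neg f \<in> Hom C (Dom C p) (Dom C g)"
    "Cod C g = Cod C (neg u)" "Cod C p = Dom C (neg u)"
    using p g by simp_all
  show ?case unfolding vanishes.simps using 1 p(1,9) g(1) by blast
qed

lemma vanishes_zero:
  assumes "chain h gs" "Dom C h = A" "A \<in> Obj C" "T \<in> Obj C"
  shows "vanishes gs (Zero C T A)"
  using assms
proof (induction gs arbitrary: h T A)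
  case Nil
  then show ?case using vanishes_Nil[of "Zero C T A" T A] by simp
next
  case (Cons g gs)
  have g: "g \<in> Arr C" "Cod C g = A" "exct g h" using Cons.prems exctD[of g h] by auto
  then have E: "Dom C g \<in> Obj C" by simp
  show ?case
  proof (rule vanishes_ConsI[of "Ident C T" T T "Zero C T (Dom C g)" "Dom C g" g A])
    fix k K assume k: "k \<in> Arr C" "Dom C k = K" "Cod C k = T" "K \<in> Obj C"
    have "vanishes gs (Zero C K (Dom C g))"
      by (rule Cons.IH[of g]) (use Cons.prems k g in auto)
    then show "vanishes gs (Zero C T (Dom C g) \<cdot> k)" using k E by simp
  qed (use g Cons.prems(3,4) E in simp_all)
qed

text \<open>Here \<open>e\<close> is a lift with the identity as cover, and the kernel arrow of an
  identity is zero, so only a zero class remains.\<close>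

lemma vanishes_exact:
  assumes "chain h (g # gs)" "e \<in> Hom C T (Dom C g)"
  shows "vanishes (g # gs) (g \<cdot> e)"
proof -
  have g: "g \<in> Arr C" "chain g gs" using assms exctD[of g h] by auto
  have e: "e \<in> Arr C" "Dom C e = T" "Cod C e = Dom C g" using assms(2) by auto
  have T: "T \<in> Obj C" using e by auto
  have E: "Dom C g \<in> Obj C" using g by simp
  show ?thesis
  proof (rule vanishes_ConsI[of "Ident C T" T T e "Dom C g" g "Cod C g"])
    fix k K assume k: "k \<in> Arr C" "Dom C k = K" "Cod C k = T" "K \<in> Obj C"
      "Ident C T \<cdot> k = Zero C K T"
    then have k0: "k = Zero C K T" by simp
    have "vanishes gs (Zero C K (Dom C g))"
      by (rule vanishes_zero[OF g(2)]) (use k E in auto)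
    then show "vanishes gs (e \<cdot> k)" unfolding k0 using k(4) e T by simp
  qed (use g e T in simp_all)
qed

text \<open>Composing each lift of the witness with the vertical arrow of the ladder gives a witness
  for the target; covers and kernels stay the same.\<close>

lemma vanishes_ladder:
  assumes "ladder P h gs h' gs' a" "vanishes gs u" "u \<in> Hom C T A" "a \<in> Hom C A A'"
    "chain h gs" "chain h' gs'" "Dom C h = A" "Dom C h' = A'"
  shows "vanishes gs' (a \<cdot> u)"
  using assms
proof (induction P h gs h' gs' a arbitrary: u T A A' rule: ladder.induct)
  case (1 P h h' a)
  note [simp] = HomD[OF 1(3)] HomD[OF 1(4)]
  have "u = Zero C T A" using 1 vanishes_Nil by blast
  then have "a \<cdot> u = Zero C T A'" by simp
  then show ?case using vanishes_Nil[of "a \<cdot> u" T A'] by simp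
next
  case (2 P h g gs h' g' gs' a)
  note [simp] = HomD[OF 2(4)] HomD[OF 2(5)]
  have g: "chain g gs" "chain g' gs'" "g' \<in> Arr C" "Cod C g' = A'"
    using 2(6-9) exctD[of g' h'] by auto
  obtain b where b: "b \<in> Arr C" "Dom C b = Dom C g" "Cod C b = Dom C g'" "a \<cdot> g = g' \<cdot> b"
    "ladder P g gs g' gs' b" using 2(2) by auto
  obtain p F f k K where g': "g \<in> Arr C" "Cod C g = Cod C u" and
    p: "is_epi C p" "p \<in> Arr C" "Dom C p = F" "Cod C p = Dom C u" "f \<in> Arr C"
    "Dom C f = F" "Cod C f = Dom C g" "g \<cdot> f = u \<cdot> p" "is_kernel C p k" "k \<in> Arr C" "Cod C k = F"
    "Dom C k = K" "p \<cdot> k = Zero C K (Dom C u)" "K \<in> Obj C" "F \<in> Obj C" "vanishes gs (f \<cdot> k)"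
    using vanishes_ConsE[OF 2(3)] .
  have "vanishes gs' (b \<cdot> (f \<cdot> k))"
    by (rule 2(1)[OF b(5) p(16), of K "Dom C g" "Dom C g'"]) (use g b p in simp_all)
  then have 1: "vanishes gs' ((b \<cdot> f) \<cdot> k)" using b p by simp
  have "g' \<cdot> (b \<cdot> f) = a \<cdot> (g \<cdot> f)"
    using b(1-3) p(5-7) g g' by (simp add: comp_reduce[OF b(4)[symmetric]])
  then have 2: "g' \<cdot> (b \<cdot> f) = (a \<cdot> u) \<cdot> p" using p by simp
  have 3: "b \<cdot> f \<in> Hom C (Dom C p) (Dom C g')" using b p by simp
  show ?case unfolding vanishes.simps
    using 1 2 3 p(1-4,9) g by (intro conjI exI[of _ p] exI[of _ "b \<cdot> f"] exI[of _ k]) simp_all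
qed simp_all

text \<open>A morphism of sequences that is an isomorphism at the left end does not change the
  class, so vanishing also travels backwards. The witness only lifts \<open>a \<cdot> u\<close> into
  the target sequence; \<open>u\<close> has to be lifted afresh by exactness, and the discrepancy of
  the two lifts is corrected one term further left.\<close>

lemma vanishes_ladder_iso:
  assumes "ladder iso_ker h gs h' gs' a" "vanishes gs' (a \<cdot> u)" "u \<in> Hom C T A" "a \<in> Hom C A A'"
    "h \<cdot> u = Zero C T B" "h \<in> Hom C A B" "h' \<in> Hom C A' B'" "chain h gs" "chain h' gs'"
  shows "vanishes gs u"
  using assms
proof (induction "iso_ker" h gs h' gs' a arbitrary: u T A A' B B' rule: ladder.induct)
  case (1 h h' a)
  note [simp] = HomD[OF 1(3)] HomD[OF 1(4)] HomD[OF 1(6)]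
  have "a \<cdot> u = Zero C T A'" using 1(2) vanishes_Nil[of "a \<cdot> u" T A'] by simp
  then have "u = Zero C T A"
    by (intro iso_ker_inj[of h h' a u T A B A']) (use 1(1,5) in simp_all)
  then show ?case using vanishes_Nil[of u T A] by simp
next
  case (2 h g gs h' g' gs' a)
  note [simp] = HomD[OF 2(4)] HomD[OF 2(5)] HomD[OF 2(7)] HomD[OF 2(8)]
  have ex: "exct g h" "exct g' h'" and ch: "chain g gs" "chain g' gs'" using 2(9,10) by auto
  define E E' where "E = Dom C g" and "E' = Dom C g'"
  have g [simp]: "g \<in> Arr C" "g' \<in> Arr C" "Dom C g = E" "Dom C g' = E'" "Cod C g = A" "Cod C g' = A'"
    using exctD[OF ex(1)] exctD[OF ex(2)] by (simp_all add: E_def E'_def)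
  have E [simp]: "E \<in> Obj C" "E' \<in> Obj C"
    using Dom_in_Obj[OF g(1)] Dom_in_Obj[OF g(2)] unfolding g(3,4) .
  obtain b where b [simp]: "b \<in> Arr C" "Dom C b = E" "Cod C b = E'" and b': "a \<cdot> g = g' \<cdot> b"
    "ladder iso_ker g gs g' gs' b" using 2(2) by auto
  obtain p F f k K where
    p: "is_epi C p" "p \<in> Arr C" "Dom C p = F" "Cod C p = Dom C (a \<cdot> u)" "f \<in> Arr C"
    "Dom C f = F" "Cod C f = Dom C g'" "g' \<cdot> f = (a \<cdot> u) \<cdot> p" "is_kernel C p k" "k \<in> Arr C" "Cod C k = F"
    "Dom C k = K" "p \<cdot> k = Zero C K (Dom C (a \<cdot> u))" "K \<in> Obj C" "F \<in> Obj C" "vanishes gs' (f \<cdot> k)"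
    using vanishes_ConsE[OF 2(3)] .
  have p' [simp]: "Cod C p = T" "Cod C f = E'" "p \<in> Arr C" "Dom C p = F" "f \<in> Arr C" "Dom C f = F"
    "F \<in> Obj C" "K \<in> Obj C" "k \<in> Arr C" "Dom C k = K" "Cod C k = F" using p by simp_all
  have gf: "g' \<cdot> f = a \<cdot> (u \<cdot> p)" using p(8) by simp
  have "h \<cdot> (u \<cdot> p) = Zero C (Dom C (u \<cdot> p)) (Cod C h)"
    by (simp add: comp_reduce[OF 2(6)])
  then obtain r\<^sub>1 s P where r1: "is_epi C r\<^sub>1" and [simp]: "r\<^sub>1 \<in> Arr C" "Dom C r\<^sub>1 = P" and
    r1c: "Cod C r\<^sub>1 = Dom C (u \<cdot> p)" and [simp]: "s \<in> Arr C" "Dom C s = P" and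
    sc: "Cod C s = Dom C g" and gs1: "g \<cdot> s = (u \<cdot> p) \<cdot> r\<^sub>1"
    by (rule exct_lift[OF ex(1), rotated 2]) simp_all
  have [simp]: "Cod C r\<^sub>1 = F" "Cod C s = E" using r1c sc by simp_all
  have gs2: "g \<cdot> s = u \<cdot> (p \<cdot> r\<^sub>1)" using gs1 by simp
  have P [simp]: "P \<in> Obj C" using \<open>Dom C s = P\<close> \<open>s \<in> Arr C\<close> Dom_in_Obj by blast
  \<comment> \<open>After a cover, \<open>s\<close> lifts \<open>u\<close> to the first term of the
    source and \<open>f\<close> lifts \<open>a \<cdot> u\<close> to that of the target. Their
    difference \<open>d\<close> lies in the kernel of \<open>g'\<close>.\<close>
  define d where "d = b \<cdot> s \<boxminus> f \<cdot> r\<^sub>1"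
  have d [simp]: "d \<in> Arr C" "Dom C d = P" "Cod C d = E'" by (simp_all add: d_def)
  have "g' \<cdot> (b \<cdot> s) = a \<cdot> (u \<cdot> (p \<cdot> r\<^sub>1))"
    by (simp add: comp_reduce[OF b'(1)[symmetric]] gs2)
  then have gd: "g' \<cdot> d = Zero C P A'"
    unfolding d_def by (simp add: comp_reduce[OF gf])
  \<comment> \<open>It is enough to find, on a further cover \<open>r\<close>, a lift
    \<open>s'\<close> equivalent to \<open>s\<close> modulo the kernel of \<open>g\<close> whose
    class vanishes on the kernel of the composite cover.\<close>
  have main: "vanishes (g # gs) u"
    if r2: "is_epi C r" "r \<in> Hom C P' P" and s': "s' \<in> Hom C P' E" "g \<cdot> s' = g \<cdot> (s \<cdot> r)"
      and van: "\<And>j J w. \<lbrakk>j \<in> Hom C J P'; g \<cdot> (s' \<cdot> j) = Zero C J A; w \<in> Hom C J K;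
        k \<cdot> w = r\<^sub>1 \<cdot> (r \<cdot> j)\<rbrakk> \<Longrightarrow> vanishes gs (s' \<cdot> j)"
    for r P' s'
  proof -
    note [simp] = HomD[OF r2(2)] HomD[OF s'(1)]
    have pe: "is_epi C (p \<cdot> (r\<^sub>1 \<cdot> r))"
      by (intro is_epi_comp p(1) r1 r2) simp_all
    show ?thesis
    proof (rule vanishes_ConsI[OF pe, of P' T s' E g A])
      show "g \<cdot> s' = u \<cdot> (p \<cdot> (r\<^sub>1 \<cdot> r))"
        using s'(2) by (simp add: comp_reduce[OF gs2])
      fix j J assume j: "is_kernel C (p \<cdot> (r\<^sub>1 \<cdot> r)) j" "j \<in> Arr C" "Dom C j = J" "Cod C j = P'" "J \<in> Obj C"
        "(p \<cdot> (r\<^sub>1 \<cdot> r)) \<cdot> j = Zero C J T"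
      then have 1: "p \<cdot> (r\<^sub>1 \<cdot> (r \<cdot> j)) = Zero C J T" by simp
      then obtain w where w: "w \<in> Arr C" "Dom C w = J" "Cod C w = Dom C k" "k \<cdot> w = r\<^sub>1 \<cdot> (r \<cdot> j)"
        by (rule kernel_lift[OF p(9)]) (use j(2-5) in simp_all)
      have "g \<cdot> (s' \<cdot> j) = u \<cdot> (p \<cdot> (r\<^sub>1 \<cdot> (r \<cdot> j)))"
        using s'(2) j(2-5) by (simp add: comp_reduce[OF s'(2)] comp_reduce[OF gs2])
      then have "g \<cdot> (s' \<cdot> j) = Zero C J A" using 1 j(2-5) by simp
      then show "vanishes gs (s' \<cdot> j)" using van[of j J w] w j by simp
    qed simp_all
  qed
  have dj: "b \<cdot> (s \<cdot> (r \<cdot> j)) = d \<cdot> (r \<cdot> j) \<boxplus> (f \<cdot> k) \<cdot> w"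
    if "r \<in> Hom C P' P" "j \<in> Hom C J P'" "w \<in> Hom C J K" "k \<cdot> w = r\<^sub>1 \<cdot> (r \<cdot> j)" for r P' j J w
  proof -
    note [simp] = HomD[OF that(1)] HomD[OF that(2)] HomD[OF that(3)] that(4)
    show ?thesis unfolding d_def by (simp add: plus_assoc)
  qed
  show ?case
  proof (cases gs)
    \<comment> \<open>With one term left, \<open>iso_ker\<close> lifts \<open>d\<close> locally to
      an arrow \<open>e\<close> into the kernel of \<open>g\<close>. The corrected lift
      \<open>s \<cdot> r \<boxminus> e\<close> is then zero on the kernel of the cover.\<close>
    case Nil
    then have gs': "gs' = []" using b'(2) by (cases gs') auto
    have iso: "iso_ker g g' b" using b'(2) Nil gs' by simp
    have fk: "f \<cdot> k = Zero C K E'" using p(16) gs' vanishes_Nil[of "f \<cdot> k" K E'] by simp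
    obtain r e P' where r: "is_epi C r" "r \<in> Arr C" "Dom C r = P'" "Cod C r = Dom C d" "e \<in> Arr C"
      "Dom C e = P'" "Cod C e = Dom C g" "g \<cdot> e = Zero C P' (Cod C g)" "b \<cdot> e = d \<cdot> r"
      by (rule iso_ker_surj[OF iso, of d]) (use gd in simp_all)
    have rt: "Cod C r = P" "Cod C e = E" "P' \<in> Obj C" using r Dom_in_Obj[of r] by simp_all
    note [simp] = r(2,3,5,6) rt
    show ?thesis
    proof (rule main[of r P' "s \<cdot> r \<boxminus> e"])
      show "g \<cdot> (s \<cdot> r \<boxminus> e) = g \<cdot> (s \<cdot> r)" using r(8) by simp
      fix j J w assume j: "j \<in> Hom C J P'" "g \<cdot> ((s \<cdot> r \<boxminus> e) \<cdot> j) = Zero C J A" "w \<in> Hom C J K"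
        "k \<cdot> w = r\<^sub>1 \<cdot> (r \<cdot> j)"
      note [simp] = HomD[OF j(1)] HomD[OF j(3)]
      have "b \<cdot> (s \<cdot> (r \<cdot> j)) = d \<cdot> (r \<cdot> j) \<boxplus> (f \<cdot> k) \<cdot> w"
        by (rule dj[OF _ j(1,3,4)]) simp
      also have "\<dots> = b \<cdot> (e \<cdot> j)" unfolding fk by (simp add: comp_reduce[OF r(9)])
      finally have "b \<cdot> ((s \<cdot> r \<boxminus> e) \<cdot> j) = Zero C J E'" by simp
      then have "(s \<cdot> r \<boxminus> e) \<cdot> j = Zero C J E"
        by (intro iso_ker_inj[OF iso, of _ J E A E']) (use j(2) in simp_all)
      then show "vanishes gs ((s \<cdot> r \<boxminus> e) \<cdot> j)"
        unfolding Nil using vanishes_Nil[of "(s \<cdot> r \<boxminus> e) \<cdot> j" J E] by simp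
    qed (use r(1) in simp_all)
  next
    \<comment> \<open>With more terms left, \<open>d\<close> lifts locally to the next term, so its
      class vanishes. Hence \<open>b \<cdot> s\<close> has a vanishing class on the kernel of the
      cover, and the induction hypothesis for \<open>b\<close> carries this back to
      \<open>s\<close>.\<close>
    case gs: (Cons g2 gs2)
    then obtain g2' gs2' where gs': "gs' = g2' # gs2'" using b'(2) by (cases gs') auto
    have ex2: "exct g2' g'" using ch(2) gs' by simp
    have "g' \<cdot> d = Zero C (Dom C d) (Cod C g')" using gd by simp
    then obtain r e P' where r: "is_epi C r" "r \<in> Arr C" "Dom C r = P'" "Cod C r = Dom C d" "e \<in> Arr C"
      "Dom C e = P'" "Cod C e = Dom C g2'" "g2' \<cdot> e = d \<cdot> r"
      by (rule exct_lift[OF ex2, rotated 2]) simp_all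
    have rt: "Cod C r = P" "P' \<in> Obj C" "g2' \<in> Arr C" "Cod C g2' = E'" 
      using r Dom_in_Obj[of r] exctD[OF ex2] by simp_all
    note [simp] = r(2,3,5,6,7) rt
    show ?thesis
    proof (rule main[of r P' "s \<cdot> r"])
      fix j J w assume j: "j \<in> Hom C J P'" "g \<cdot> ((s \<cdot> r) \<cdot> j) = Zero C J A" "w \<in> Hom C J K"
        "k \<cdot> w = r\<^sub>1 \<cdot> (r \<cdot> j)"
      note [simp] = HomD[OF j(1)] HomD[OF j(3)]
      have "vanishes gs' (g2' \<cdot> (e \<cdot> j))"
        unfolding gs' by (rule vanishes_exact[of g' _ _ _ J]) (use ch(2) gs' in simp_all)
      then have "vanishes gs' (d \<cdot> (r \<cdot> j))" by (simp add: comp_reduce[OF r(8)])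
      moreover have "vanishes gs' ((f \<cdot> k) \<cdot> w)"
        by (rule vanishes_comp[OF p(16), of K E' _ J]) simp_all
      ultimately have "vanishes gs' (d \<cdot> (r \<cdot> j) \<boxplus> (f \<cdot> k) \<cdot> w)"
        by (rule vanishes_plus[of _ _ _ J E']) simp_all
      then have "vanishes gs' (b \<cdot> (s \<cdot> (r \<cdot> j)))"
        by (subst dj[OF _ j(1,3,4)]) simp_all
      then have "vanishes gs' (b \<cdot> ((s \<cdot> r) \<cdot> j))" by simp
      then show "vanishes gs ((s \<cdot> r) \<cdot> j)"
        by (rule 2(1)[OF b'(2), of _ J E E' A A']) (use j(2) ch in simp_all)
    qed (use r(1) in simp_all)
  qed
qed (simp_all only: ladder.simps)

lemma ladder_ConsI:
  assumes "b \<in> Hom C (Dom C g) (Dom C g')" "a \<cdot> g = g' \<cdot> b" "ladder P g gs g' gs' b"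
  shows "ladder P h (g # gs) h' (g' # gs') a"
  using assms by (simp only: ladder.simps) blast

lemma obtain_zero:
  obtains Z where "Z \<in> Obj C" "\<And>f A. f \<in> Hom C A Z \<Longrightarrow> f = Zero C A Z"
    "\<And>f A. f \<in> Hom C Z A \<Longrightarrow> f = Zero C Z A"
proof -
  obtain Z where Z: "is_zero_obj C Z" using ex_zero_obj by blast
  then have Zo: "Z \<in> Obj C" by (simp add: is_zero_obj_def)
  have 1: "f = Zero C A Z" if "f \<in> Hom C A Z" for f A
  proof -
    have "Zero C A Z \<in> Hom C A Z" "A \<in> Obj C" using HomD[OF that] by simp_all
    then show ?thesis using Z that unfolding is_zero_obj_def by blast
  qed
  have 2: "f = Zero C Z A" if "f \<in> Hom C Z A" for f A
  proof -
    have "Zero C Z A \<in> Hom C Z A" "A \<in> Obj C" using HomD[OF that] by simp_all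
    then show ?thesis using Z that unfolding is_zero_obj_def by blast
  qed
  show thesis using that Zo 1 2 by blast
qed

section \<open>Pullback of sequences and vanishing of Ext in one degree\<close>

lemma pullback_pair:
  assumes "is_pullback g u q p" "x \<in> Hom C S (Dom C g)" "y \<in> Hom C S (Dom C u)" "g \<cdot> x = u \<cdot> y"
  obtains z where "z \<in> Arr C" "Dom C z = S" "Cod C z = Dom C p" "q \<cdot> z = x" "p \<cdot> z = y"
  using assms unfolding is_pullback_def by (metis in_Hom)

lemma pullback_eqI:
  assumes "is_pullback g u q p" "z \<in> Hom C S (Dom C p)" "z' \<in> Hom C S (Dom C p)"
    "q \<cdot> z = q \<cdot> z'" "p \<cdot> z = p \<cdot> z'"
  shows "z = z'"
proof -
  have t: "g \<in> Arr C" "u \<in> Arr C" "q \<in> Arr C" "p \<in> Arr C" "Cod C g = Cod C u"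
     "Dom C q = Dom C p" "Cod C q = Dom C g" "Cod C p = Dom C u" "g \<cdot> q = u \<cdot> p"
    using assms(1) by (simp_all add: is_pullback_def)
  note [simp] = HomD[OF assms(3)]
  have "g \<cdot> (q \<cdot> z') = u \<cdot> (p \<cdot> z')" using t by (simp add: comp_reduce[OF t(9)])
  moreover have "q \<cdot> z' \<in> Arr C" "p \<cdot> z' \<in> Arr C" "Dom C (q \<cdot> z') = S" "Dom C (p \<cdot> z') = S"
    "Cod C (q \<cdot> z') = Dom C g" "Cod C (p \<cdot> z') = Dom C u" using t by simp_all
  ultimately have "\<exists>!w. w \<in> Hom C S (Dom C p) \<and> q \<cdot> w = q \<cdot> z' \<and> p \<cdot> w = p \<cdot> z'"
    using assms(1) unfolding is_pullback_def by metis
  then show ?thesis using assms(2-5) by blast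
qed

lemma exctI:
  assumes "f \<in> Hom C X Y" "g \<in> Hom C Y W" "g \<cdot> f = Zero C X W"
    and "\<And>u S. \<lbrakk>u \<in> Hom C S Y; g \<cdot> u = Zero C S W\<rbrakk>
      \<Longrightarrow> \<exists>r e S'. is_epi C r \<and> r \<in> Hom C S' S \<and> e \<in> Hom C S' X \<and> f \<cdot> e = u \<cdot> r"
  shows "exct f g"
  unfolding exct_def
proof (intro conjI allI impI)
  fix u assume u: "u \<in> Arr C \<and> Cod C u = Dom C g \<and> g \<cdot> u = Zero C (Dom C u) (Cod C g)"
  then obtain r e S' where "is_epi C r" "r \<in> Hom C S' (Dom C u)" "e \<in> Hom C S' X" "f \<cdot> e = u \<cdot> r"
    using assms(4)[of u "Dom C u"] assms(2) by auto
  then show "\<exists>r e. is_epi C r \<and> Cod C r = Dom C u \<and> e \<in> Hom C (Dom C r) (Dom C f) \<and> f \<cdot> e = u \<cdot> r"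
    using assms(1) by auto
qed (use assms(1-3) in auto)

lemma exct_local_lift:
  assumes "exct f g" "u \<in> Hom C S Y" "f \<in> Hom C X Y" "g \<in> Hom C Y W" "g \<cdot> u = Zero C S W"
  obtains r e S' where "is_epi C r" "r \<in> Hom C S' S" "e \<in> Hom C S' X" "f \<cdot> e = u \<cdot> r"
proof -
  note D = HomD[OF assms(2)] HomD[OF assms(3)] HomD[OF assms(4)]
  have "g \<cdot> u = Zero C (Dom C u) (Cod C g)" using D assms(5) by simp
  then obtain r e T where "is_epi C r" "r \<in> Arr C" "Dom C r = T" "Cod C r = Dom C u" "e \<in> Arr C"
    "Dom C e = T" "Cod C e = Dom C f" "f \<cdot> e = u \<cdot> r"
    by (rule exct_lift[OF assms(1), rotated 2]) (use D in simp_all)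
  then show thesis using that[of r T e] D by simp
qed

lemma epi_local_lift:
  assumes "is_epi C p" "p \<in> Hom C F Y" "u \<in> Hom C S Y"
  obtains r e S' where "is_epi C r" "r \<in> Hom C S' S" "e \<in> Hom C S' F" "p \<cdot> e = u \<cdot> r"
  using pullback_epi[OF assms] by (metis in_Hom)

lemma epi_compH: "\<lbrakk>is_epi C f; is_epi C g; f \<in> Hom C X Y; g \<in> Hom C Y W\<rbrakk> \<Longrightarrow> is_epi C (g \<cdot> f)"
  using is_epi_comp by simp

text \<open>A chain sees the arrow at its right end only through the kernel of that arrow. This
  relation allows exchanging the arrow, typically for its composite with a monomorphism.\<close>

definition same_ker :: "'b \<Rightarrow> 'b \<Rightarrow> bool" where
  "same_ker h h' \<longleftrightarrow> h \<in> Arr C \<and> h' \<in> Arr C \<and> Dom C h = Dom C h' \<and>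
    (\<forall>x S. x \<in> Hom C S (Dom C h) \<longrightarrow> (h \<cdot> x = Zero C S (Cod C h) \<longleftrightarrow> h' \<cdot> x = Zero C S (Cod C h')))"

lemma same_ker_refl: "h \<in> Arr C \<Longrightarrow> same_ker h h"
  by (simp add: same_ker_def)

lemma chain_same_ker:
  assumes "same_ker h h'" "chain h gs" shows "chain h' gs"
proof (cases gs)
  case (Cons g gs')
  have e: "exct g h" using assms(2) Cons by simp
  note D = exctD[OF e]
  have h': "h' \<in> Arr C" "Dom C h' = Dom C h" using assms(1) by (simp_all add: same_ker_def)
  have "exct g h'"
  proof (rule exctI[of g "Dom C g" "Dom C h" h' "Cod C h'"])
    show "h' \<cdot> g = Zero C (Dom C g) (Cod C h')"
      using assms(1) D unfolding same_ker_def by simp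
    fix u S assume u: "u \<in> Hom C S (Dom C h)" "h' \<cdot> u = Zero C S (Cod C h')"
    then have "h \<cdot> u = Zero C S (Cod C h)" using assms(1) unfolding same_ker_def by blast
    then obtain r e S' where "is_epi C r" "r \<in> Hom C S' S" "e \<in> Hom C S' (Dom C g)" "g \<cdot> e = u \<cdot> r"
      by (rule exct_local_lift[OF e u(1), rotated 2]) (use D in simp_all)
    then show "\<exists>r e S'. is_epi C r \<and> r \<in> Hom C S' S \<and> e \<in> Hom C S' (Dom C g) \<and> g \<cdot> e = u \<cdot> r" by blast
  qed (use D h' in simp_all)
  then show ?thesis using assms(2) Cons by simp
qed simp

lemma iso_kerI:
  assumes "h \<in> Hom C A B" "h' \<in> Hom C A' B'" "a \<in> Hom C A A'"
    and "\<And>u S. \<lbrakk>u \<in> Hom C S A; h \<cdot> u = Zero C S B; a \<cdot> u = Zero C S A'\<rbrakk> \<Longrightarrow> u = Zero C S A"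
    and "\<And>v S. \<lbrakk>v \<in> Hom C S A'; h' \<cdot> v = Zero C S B'\<rbrakk>
      \<Longrightarrow> \<exists>r e S'. is_epi C r \<and> r \<in> Hom C S' S \<and> e \<in> Hom C S' A \<and> h \<cdot> e = Zero C S' B \<and> a \<cdot> e = v \<cdot> r"
  shows "iso_ker h h' a"
  unfolding iso_ker_def
proof (intro conjI allI impI)
  fix u assume "u \<in> Arr C \<and> Cod C u = Dom C h \<and> h \<cdot> u = Zero C (Dom C u) (Cod C h) \<and>
        a \<cdot> u = Zero C (Dom C u) (Cod C a)"
  then show "u = Zero C (Dom C u) (Dom C h)" using assms(1-3) assms(4)[of u "Dom C u"] by auto
next
  fix v assume "v \<in> Arr C \<and> Cod C v = Dom C h' \<and> h' \<cdot> v = Zero C (Dom C v) (Cod C h')"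
  then show "\<exists>r e. is_epi C r \<and> Cod C r = Dom C v \<and> e \<in> Hom C (Dom C r) (Dom C h) \<and>
           h \<cdot> e = Zero C (Dom C r) (Cod C h) \<and> a \<cdot> e = v \<cdot> r"
    using assms(1-3) assms(5)[of v "Dom C v"] by (metis in_Hom)
qed

lemma same_ker_iso_ker:
  assumes "same_ker h h'" shows "iso_ker h h' (Ident C (Dom C h))"
proof (rule iso_kerI[of h "Dom C h" "Cod C h" h' "Dom C h" "Cod C h'"])
  fix v S assume v: "v \<in> Hom C S (Dom C h)" "h' \<cdot> v = Zero C S (Cod C h')"
  then have "h \<cdot> v = Zero C S (Cod C h)" using assms unfolding same_ker_def by blast
  then show "\<exists>r e S'. is_epi C r \<and> r \<in> Hom C S' S \<and> e \<in> Hom C S' (Dom C h) \<and>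
      h \<cdot> e = Zero C S' (Cod C h) \<and> Ident C (Dom C h) \<cdot> e = v \<cdot> r"
    using HomD[OF v(1)] by (intro exI[of _ "Ident C S"] exI[of _ v] exI[of _ S]) simp
qed (use assms in \<open>simp_all add: same_ker_def\<close>)

lemma ladder_same_ker:
  assumes "same_ker h h'" "chain h gs"
  shows "ladder iso_ker h gs h' gs (Ident C (Dom C h))"
  using assms
proof (induction gs arbitrary: h h')
  case Nil
  then show ?case using same_ker_iso_ker by simp
next
  case (Cons g gs)
  have g: "g \<in> Arr C" "Cod C g = Dom C h" "chain g gs" using Cons.prems exctD[of g h] by auto
  then have "ladder iso_ker g gs g gs (Ident C (Dom C g))"
    using Cons.IH same_ker_refl by blast
  then show ?case by (rule ladder_ConsI[rotated 2]) (use g in simp_all)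
qed

text \<open>Only the right end changes. The first term becomes the pullback \<open>P\<close> of
  \<open>g\<close> and \<open>u\<close>, and the second arrow lifts to \<open>P\<close> as the pair
  of itself and zero, with the same kernel. The new chain is an extension of \<open>T\<close>,
  because the zero arrow kills all of \<open>T\<close>.\<close>

lemma chain_pullback:
  assumes "h \<in> Hom C A B" "chain h gs" "gs \<noteq> []" "u \<in> Hom C T A" "h \<cdot> u = Zero C T B" "Z \<in> Obj C"
  shows "\<exists>gs'. chain (Zero C T Z) gs' \<and> length gs' = length gs \<and> ladder iso_ker (Zero C T Z) gs' h gs u"
proof -
  obtain g gs1 where gs: "gs = g # gs1" using assms(3) by (cases gs) auto
  have ex: "exct g h" using assms(2) gs by simp
  note [simp] = HomD[OF assms(1)] HomD[OF assms(4)] assms(6)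
  define E where "E = Dom C g"
  have gE: "g \<in> Hom C E A" using exctD[OF ex] E_def by simp
  note [simp] = HomD[OF gE]
  obtain P q p where pb: "is_pullback g u q p" "q \<in> Hom C P E" "p \<in> Hom C P T" "P \<in> Obj C"
    "g \<cdot> q = u \<cdot> p" using obtain_pullback[OF gE assms(4)] by metis
  note [simp] = HomD[OF pb(2)] HomD[OF pb(3)]
  have 1: "exct p (Zero C T Z)"
  proof (rule exctI[of p P T _ Z])
    fix v S assume v: "v \<in> Hom C S T" "Zero C T Z \<cdot> v = Zero C S Z"
    note [simp] = HomD[OF v(1)]
    have "h \<cdot> (u \<cdot> v) = Zero C S B" by (simp add: comp_reduce[OF assms(5)])
    then obtain r e S' where r: "is_epi C r" "r \<in> Hom C S' S" "e \<in> Hom C S' E" "g \<cdot> e = (u \<cdot> v) \<cdot> r"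
      by (rule exct_local_lift[OF ex _ gE assms(1), rotated]) simp_all
    note [simp] = HomD[OF r(2)] HomD[OF r(3)]
    obtain z where "z \<in> Arr C" "Dom C z = S'" "Cod C z = Dom C p" "q \<cdot> z = e" "p \<cdot> z = v \<cdot> r"
      by (rule pullback_pair[OF pb(1), of e S' "v \<cdot> r"]) (use r(4) in simp_all)
    then show "\<exists>r e S'. is_epi C r \<and> r \<in> Hom C S' S \<and> e \<in> Hom C S' P \<and> p \<cdot> e = v \<cdot> r"
      using r(1,2) by (intro exI[of _ r] exI[of _ z] exI[of _ S']) simp
  qed simp_all
  show ?thesis
  proof (cases gs1)
    case Nil
    have "iso_ker p g q"
    proof (rule iso_kerI[OF pb(3) gE pb(2)])
      fix w S assume w: "w \<in> Hom C S P" "p \<cdot> w = Zero C S T" "q \<cdot> w = Zero C S E"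
      show "w = Zero C S P" by (rule pullback_eqI[OF pb(1), of _ S]) (use w HomD[OF w(1)] in simp_all)
    next
      fix v S assume v: "v \<in> Hom C S E" "g \<cdot> v = Zero C S A"
      note [simp] = HomD[OF v(1)]
      obtain z where "z \<in> Arr C" "Dom C z = S" "Cod C z = Dom C p" "q \<cdot> z = v" "p \<cdot> z = Zero C S T"
        by (rule pullback_pair[OF pb(1), of v S "Zero C S T"]) (use v(2) in simp_all)
      then show "\<exists>r e S'. is_epi C r \<and> r \<in> Hom C S' S \<and> e \<in> Hom C S' P \<and> p \<cdot> e = Zero C S' T \<and> q \<cdot> e = v \<cdot> r"
        by (intro exI[of _ "Ident C S"] exI[of _ z] exI[of _ S]) simp
    qed
    then have "ladder iso_ker (Zero C T Z) [p] h gs u"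
      unfolding gs Nil using pb(5) by (auto intro!: exI[of _ q])
    then show ?thesis using 1 gs Nil by (intro exI[of _ "[p]"]) simp
  next
    case (Cons g2 gs2)
    have ex2: "exct g2 g" and ch: "chain g2 gs2" using assms(2) gs Cons by simp_all
    define E2 where "E2 = Dom C g2"
    have g2: "g2 \<in> Hom C E2 E" using exctD[OF ex2] E2_def by simp
    have gg: "g \<cdot> g2 = Zero C E2 A" using exctD[OF ex2] HomD[OF g2] by simp
    note [simp] = HomD[OF g2]
    obtain z where z: "z \<in> Arr C" "Dom C z = E2" "Cod C z = Dom C p" "q \<cdot> z = g2" "p \<cdot> z = Zero C E2 T"
      by (rule pullback_pair[OF pb(1), of g2 E2 "Zero C E2 T"]) (use gg in simp_all)
    note [simp] = z(1,2) and zc [simp] = z(3)[simplified]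
    have 2: "exct z p"
    proof (rule exctI[of z E2 P p T])
      fix v S assume v: "v \<in> Hom C S P" "p \<cdot> v = Zero C S T"
      note [simp] = HomD[OF v(1)]
      have "g \<cdot> (q \<cdot> v) = Zero C S A" using v(2) by (simp add: comp_reduce[OF pb(5)])
      then obtain r e S' where r: "is_epi C r" "r \<in> Hom C S' S" "e \<in> Hom C S' E2" "g2 \<cdot> e = (q \<cdot> v) \<cdot> r"
        by (rule exct_local_lift[OF ex2 _ g2 gE, rotated]) simp_all
      note [simp] = HomD[OF r(2)] HomD[OF r(3)]
      have "z \<cdot> e = v \<cdot> r"
        by (rule pullback_eqI[OF pb(1), of _ S'])
          (use r(4) in \<open>simp_all add: comp_reduce[OF z(4)] comp_reduce[OF z(5)] comp_reduce[OF v(2)]\<close>)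
      then show "\<exists>r e S'. is_epi C r \<and> r \<in> Hom C S' S \<and> e \<in> Hom C S' E2 \<and> z \<cdot> e = v \<cdot> r"
        using r by blast
    qed (use z(5) in simp_all)
    have sk: "same_ker g2 z"
      unfolding same_ker_def
    proof (intro conjI allI impI iffI)
      fix x S assume x: "x \<in> Hom C S (Dom C g2)"
      note [simp] = HomD[OF x, simplified]
      { assume a: "g2 \<cdot> x = Zero C S (Cod C g2)"
        show "z \<cdot> x = Zero C S (Cod C z)"
          by (rule pullback_eqI[OF pb(1), of _ S])
            (use a in \<open>simp_all add: comp_reduce[OF z(4)] comp_reduce[OF z(5)]\<close>) }
      { assume a: "z \<cdot> x = Zero C S (Cod C z)"
        have "g2 \<cdot> x = q \<cdot> (z \<cdot> x)" by (simp add: comp_reduce[OF z(4)])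
        then show "g2 \<cdot> x = Zero C S (Cod C g2)" using a by simp }
    qed simp_all
    have sk': "same_ker z g2" using sk by (simp add: same_ker_def)
    have "chain z gs2" by (rule chain_same_ker[OF sk ch])
    moreover from this have "ladder iso_ker z gs2 g2 gs2 (Ident C E2)"
      using ladder_same_ker[OF sk'] by simp
    moreover from this have l1: "ladder iso_ker p (z # gs2) g (g2 # gs2) q"
      by (rule ladder_ConsI[rotated 2]) (use z(4) in simp_all)
    ultimately have "chain (Zero C T Z) (p # z # gs2)"
      using 1 2 by simp
    moreover from l1 have "ladder iso_ker (Zero C T Z) (p # z # gs2) h (g # g2 # gs2) u"
      by (rule ladder_ConsI[rotated 2]) (use pb(5) in simp_all)
    ultimately show ?thesis
      unfolding gs Cons by (intro exI[of _ "p # z # gs2"]) simp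
  qed
qed

text \<open>For positive \<open>n\<close> this says that Ext of \<open>T\<close> in degree
  \<open>n\<close> is zero against all left ends at once. The chains are extensions of the kernel of
  an arbitrary \<open>h\<close>, with \<open>u\<close> an arrow from \<open>T\<close> into this
  kernel, since that is the situation met inside the inductions.\<close>

definition ext_vanish :: "nat \<Rightarrow> 'a \<Rightarrow> bool" where
  "ext_vanish n T \<longleftrightarrow> (\<forall>h gs A B u. h \<in> Hom C A B \<and> chain h gs \<and> length gs = n \<and> u \<in> Hom C T A \<and>
     h \<cdot> u = Zero C T B \<longrightarrow> vanishes gs u)"

text \<open>\<open>chain_pullback\<close> turns a chain over \<open>h\<close> into an extension of
  \<open>T\<close>, and a witness for the identity of \<open>T\<close> is pushed forward along the
  resulting ladder.\<close>

lemma ext_vanishI: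
  assumes "n > 0" "T \<in> Obj C" "Z \<in> Obj C"
    and "\<And>gs. \<lbrakk>chain (Zero C T Z) gs; length gs = n\<rbrakk> \<Longrightarrow> vanishes gs (Ident C T)"
  shows "ext_vanish n T"
  unfolding ext_vanish_def
proof (intro allI impI)
  fix h gs A B u
  assume a: "h \<in> Hom C A B \<and> chain h gs \<and> length gs = n \<and> u \<in> Hom C T A \<and> h \<cdot> u = Zero C T B"
  then have a: "h \<in> Hom C A B" "chain h gs" "length gs = n" "u \<in> Hom C T A" "h \<cdot> u = Zero C T B"
    by blast+
  obtain gs' where g: "chain (Zero C T Z) gs'" "length gs' = length gs"
      "ladder iso_ker (Zero C T Z) gs' h gs u"
    using chain_pullback[OF a(1,2) _ a(4,5) assms(3)] a(3) assms(1) by auto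
  have "vanishes gs (u \<cdot> Ident C T)"
    by (rule vanishes_ladder[OF g(3) _ _ a(4) g(1) a(2), of _ T])
      (use assms(2-4) g(1,2) HomD[OF a(1)] a(3) in simp_all)
  then show "vanishes gs u" using HomD[OF a(4)] by simp
qed

section \<open>Mapping cones\<close>

lemma epi_zero:
  assumes "is_epi C p" "x \<cdot> p = Zero C F B" "p \<in> Hom C F Y" "x \<in> Hom C Y B"
  shows "x = Zero C Y B"
  using is_epi_zeroD[OF assms(1,2)] assms(3,4) by simp

lemma mono_zero:
  assumes "is_mono C m" "m \<cdot> x = Zero C S B" "m \<in> Hom C A B" "x \<in> Hom C S A"
  shows "x = Zero C S A"
  using is_mono_zeroD[OF assms(1,2)] assms(3,4) by simp

lemma monoI:
  assumes "m \<in> Hom C A B" "\<And>x S. \<lbrakk>x \<in> Hom C S A; m \<cdot> x = Zero C S B\<rbrakk> \<Longrightarrow> x = Zero C S A"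
  shows "is_mono C m"
  by (rule is_monoI) (use assms in auto)

lemma epiI:
  assumes "p \<in> Hom C A B" "\<And>x S. \<lbrakk>x \<in> Hom C B S; x \<cdot> p = Zero C A S\<rbrakk> \<Longrightarrow> x = Zero C B S"
  shows "is_epi C p"
  by (rule is_epiI) (use assms in auto)

lemma exct_epi_cancel:
  assumes "exct (g \<cdot> c) h" "is_epi C c" "c \<in> Hom C B E" "g \<in> Hom C E A"
  shows "exct g h"
proof -
  note [simp] = HomD[OF assms(3)] HomD[OF assms(4)]
  obtain W where h: "h \<in> Hom C A W" using exctD[OF assms(1)] by simp
  note [simp] = HomD[OF h]
  have gc: "g \<cdot> c \<in> Hom C B A" by simp
  show ?thesis
  proof (rule exctI[OF assms(4) h])
    have "(h \<cdot> g) \<cdot> c = Zero C B W" using exctD(4)[OF assms(1)] by simp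
    then show "h \<cdot> g = Zero C E W" by (rule epi_zero[OF assms(2) _ assms(3)]) simp
    fix u S assume u: "u \<in> Hom C S A" "h \<cdot> u = Zero C S W"
    obtain r e S' where r: "is_epi C r" "r \<in> Hom C S' S" "e \<in> Hom C S' B" "(g \<cdot> c) \<cdot> e = u \<cdot> r"
      using exct_local_lift[OF assms(1) u(1) gc h u(2)] .
    then show "\<exists>r e S'. is_epi C r \<and> r \<in> Hom C S' S \<and> e \<in> Hom C S' E \<and> g \<cdot> e = u \<cdot> r"
      using HomD[OF r(3)] r(1,2,4) by (intro exI[of _ r] exI[of _ "c \<cdot> e"] exI[of _ S']) simp
  qed
qed

text \<open>Locally, an arrow into the kernel of \<open>h'\<close> is
  \<open>\<phi> \<cdot> x \<boxplus> q \<cdot> u\<close> with \<open>u\<close> in the kernel of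
  \<open>h\<close>. As \<open>g\<close> covers that kernel, \<open>x\<close> together with a local
  lift of \<open>u\<close> is a lift along the differential of the cone.\<close>

lemma cone_exct:
  assumes h: "h \<in> Hom C A Y" and h': "h' \<in> Hom C A' Y'" and q: "q \<in> Hom C A A'" and \<phi>: "\<phi> \<in> Hom C F A'"
    and g: "g \<in> Hom C E A" "exct g h" and b: "biprod F E B i\<^sub>1 i\<^sub>2 p\<^sub>1 p\<^sub>2"
    and c1: "\<And>S u. \<lbrakk>u \<in> Hom C S A; h \<cdot> u = Zero C S Y\<rbrakk> \<Longrightarrow> h' \<cdot> (q \<cdot> u) = Zero C S Y'"
    and c2: "h' \<cdot> \<phi> = Zero C F Y'"
    and d: "\<And>S v. \<lbrakk>v \<in> Hom C S A'; h' \<cdot> v = Zero C S Y'\<rbrakk> \<Longrightarrow>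
      \<exists>S' r x u. is_epi C r \<and> r \<in> Hom C S' S \<and> x \<in> Hom C S' F \<and> u \<in> Hom C S' A \<and>
        h \<cdot> u = Zero C S' Y \<and> v \<cdot> r = \<phi> \<cdot> x \<boxplus> q \<cdot> u"
  shows "exct (\<phi> \<cdot> p\<^sub>1 \<boxplus> q \<cdot> (g \<cdot> p\<^sub>2)) h'"
proof -
  note [simp] = HomD[OF h] HomD[OF h'] HomD[OF q] HomD[OF \<phi>] HomD[OF g(1)] biprodD[OF b]
  have hg: "h \<cdot> g = Zero C E Y" using exctD[OF g(2)] by simp
  show ?thesis
  proof (rule exctI[of _ B A' h' Y'])
    have "h' \<cdot> (q \<cdot> g) = Zero C E Y'" by (rule c1[OF g(1) hg])
    then have "h' \<cdot> (q \<cdot> (g \<cdot> p\<^sub>2)) = Zero C B Y'" 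
      using comp_reduce[of h' "q \<cdot> g" "Zero C E Y'" p\<^sub>2] by simp
    then show "h' \<cdot> (\<phi> \<cdot> p\<^sub>1 \<boxplus> q \<cdot> (g \<cdot> p\<^sub>2)) = Zero C B Y'" by (simp add: comp_reduce[OF c2])
    fix v S assume v: "v \<in> Hom C S A'" "h' \<cdot> v = Zero C S Y'"
    note [simp] = HomD[OF v(1)]
    obtain S' r x u where r: "is_epi C r" "r \<in> Hom C S' S" "x \<in> Hom C S' F" "u \<in> Hom C S' A"
        "h \<cdot> u = Zero C S' Y" "v \<cdot> r = \<phi> \<cdot> x \<boxplus> q \<cdot> u" using d[OF v] by blast
    note [simp] = HomD[OF r(2)] HomD[OF r(3)] HomD[OF r(4)]
    obtain r' e S'' where e: "is_epi C r'" "r' \<in> Hom C S'' S'" "e \<in> Hom C S'' E" "g \<cdot> e = u \<cdot> r'"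
      using exct_local_lift[OF g(2) r(4) g(1) h r(5)] .
    note [simp] = HomD[OF e(2)] HomD[OF e(3)]
    have "(\<phi> \<cdot> p\<^sub>1 \<boxplus> q \<cdot> (g \<cdot> p\<^sub>2)) \<cdot> (i\<^sub>1 \<cdot> (x \<cdot> r') \<boxplus> i\<^sub>2 \<cdot> e) = v \<cdot> (r \<cdot> r')"
      using e(4) by (simp add: comp_reduce[OF r(6)])
    then show "\<exists>r e S'. is_epi C r \<and> r \<in> Hom C S' S \<and> e \<in> Hom C S' B \<and>
        (\<phi> \<cdot> p\<^sub>1 \<boxplus> q \<cdot> (g \<cdot> p\<^sub>2)) \<cdot> e = v \<cdot> r"
      using epi_compH[OF e(1) r(1) e(2) r(2)]
      by (intro exI[of _ "r \<cdot> r'"] exI[of _ "i\<^sub>1 \<cdot> (x \<cdot> r') \<boxplus> i\<^sub>2 \<cdot> e"] exI[of _ S'']) simp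
  qed simp_all
qed

text \<open>
  The cone of the vanishing data of \<open>l\<close>: if \<open>ker h'\<close> is the pushout of \<open>k\<close> and \<open>l : K \<rightarrow> ker h\<close>, the
  sequence over \<open>h\<close> maps to one over \<open>h'\<close> with the same left end.
\<close>

lemma chain_cone:
  assumes "h \<in> Hom C A Y" "h' \<in> Hom C A' Y'" "q \<in> Hom C A A'" "\<phi> \<in> Hom C F A'"
    and "k \<in> Hom C K F" "l \<in> Hom C K A"
    and "chain h gs" "gs \<noteq> []" "vanishes gs l"
    and "h \<cdot> l = Zero C K Y" "\<phi> \<cdot> k \<boxplus> q \<cdot> l = Zero C K A'"
    and "\<And>S w. \<lbrakk>w \<in> Hom C S K; k \<cdot> w = Zero C S F; l \<cdot> w = Zero C S A\<rbrakk> \<Longrightarrow> w = Zero C S K"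
    and "\<And>S x u. \<lbrakk>x \<in> Hom C S F; u \<in> Hom C S A; h \<cdot> u = Zero C S Y; \<phi> \<cdot> x \<boxplus> q \<cdot> u = Zero C S A'\<rbrakk>
      \<Longrightarrow> \<exists>S' r w. is_epi C r \<and> r \<in> Hom C S' S \<and> w \<in> Hom C S' K \<and> x \<cdot> r = k \<cdot> w \<and> u \<cdot> r = l \<cdot> w"
    and "\<And>S u. \<lbrakk>u \<in> Hom C S A; h \<cdot> u = Zero C S Y\<rbrakk> \<Longrightarrow> h' \<cdot> (q \<cdot> u) = Zero C S Y'"
    and "h' \<cdot> \<phi> = Zero C F Y'"
    and "\<And>S v. \<lbrakk>v \<in> Hom C S A'; h' \<cdot> v = Zero C S Y'\<rbrakk> \<Longrightarrow>
      \<exists>S' r x u. is_epi C r \<and> r \<in> Hom C S' S \<and> x \<in> Hom C S' F \<and> u \<in> Hom C S' A \<and>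
        h \<cdot> u = Zero C S' Y \<and> v \<cdot> r = \<phi> \<cdot> x \<boxplus> q \<cdot> u"
  shows "\<exists>gs'. chain h' gs' \<and> length gs' = length gs \<and> ladder iso_ker h gs h' gs' q"
  using assms
proof (induction gs arbitrary: h h' q \<phi> k l A A' Y Y' F K)
  case (Cons g gs1)
  note h = Cons.prems(1) and h' = Cons.prems(2) and q = Cons.prems(3) and \<phi> = Cons.prems(4)
    and k = Cons.prems(5) and l = Cons.prems(6) and a1 = Cons.prems(10) and a2 = Cons.prems(11)
    and a3 = Cons.prems(12) and b = Cons.prems(13) and c1 = Cons.prems(14) and c2 = Cons.prems(15)
    and d = Cons.prems(16)
  have ex: "exct g h" and ch: "chain g gs1" using Cons.prems(7) by simp_all
  note [simp] = HomD[OF h] HomD[OF h'] HomD[OF q] HomD[OF \<phi>] HomD[OF k] HomD[OF l]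
  define E where "E = Dom C g"
  have g: "g \<in> Hom C E A" using exctD[OF ex] E_def by simp
  note [simp] = HomD[OF g]
  have hg: "h \<cdot> g = Zero C E Y" using exctD[OF ex] by simp
  obtain B i\<^sub>1 i\<^sub>2 p\<^sub>1 p\<^sub>2 where bp: "biprod F E B i\<^sub>1 i\<^sub>2 p\<^sub>1 p\<^sub>2"
    by (rule obtain_biprod[of F E]) simp_all
  note [simp] = biprodD[OF bp]
  define \<gamma> where "\<gamma> = \<phi> \<cdot> p\<^sub>1 \<boxplus> q \<cdot> (g \<cdot> p\<^sub>2)"
  have \<gamma>: "\<gamma> \<in> Hom C B A'" by (simp add: \<gamma>_def)
  have \<gamma>ex: "exct \<gamma> h'" unfolding \<gamma>_def by (rule cone_exct[OF h h' q \<phi> g ex bp c1 c2 d])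
  have \<gamma>i: "\<gamma> \<cdot> i\<^sub>2 = q \<cdot> g" "\<gamma> \<cdot> i\<^sub>1 = \<phi>" by (simp_all add: \<gamma>_def)
  obtain p F1 f k1 K1 where
    p: "is_epi C p" "p \<in> Arr C" "Dom C p = F1" "Cod C p = Dom C l" "f \<in> Arr C"
    "Dom C f = F1" "Cod C f = Dom C g" "g \<cdot> f = l \<cdot> p" "is_kernel C p k1" "k1 \<in> Arr C" "Cod C k1 = F1"
    "Dom C k1 = K1" "p \<cdot> k1 = Zero C K1 (Dom C l)" "K1 \<in> Obj C" "F1 \<in> Obj C" "vanishes gs1 (f \<cdot> k1)"
    using vanishes_ConsE[OF Cons.prems(9)] .
  have pc [simp]: "p \<in> Arr C" "Dom C p = F1" "f \<in> Arr C" "Dom C f = F1" "k1 \<in> Arr C" "Cod C k1 = F1" "Dom C k1 = K1"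
    "K1 \<in> Obj C" "F1 \<in> Obj C" "Cod C p = K" "Cod C f = E" using p by simp_all
  have pk: "p \<cdot> k1 = Zero C K1 K" using p(13) by simp
  show ?case
  proof (cases gs1)
    case Nil
    have "f \<cdot> k1 = Zero C K1 E" using p(16) unfolding Nil using vanishes_Nil[of "f \<cdot> k1" K1 E] by simp
    then obtain f0 where f0: "f0 \<in> Arr C" "Dom C f0 = K" "Cod C f0 = E" "f0 \<cdot> p = f"
      using epi_factor[OF p(1,9), of f] pc by metis
    note [simp] = f0(1-3)
    have gf0: "g \<cdot> f0 = l"
      by (rule is_epiD[OF p(1)]) (use f0(4) p(8) in simp_all)
    \<comment> \<open>At the left end the plain cone would keep \<open>K\<close> as an additional
      part of the kernel. In this degree the witness amounts to an arrow \<open>f0\<close> with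
      \<open>g \<cdot> f0 = l\<close>; the pair \<open>\<kappa>\<close> of \<open>k\<close> and
      \<open>f0\<close> embeds \<open>K\<close> into the cone term, and dividing by it leaves
      exactly the kernel of \<open>g\<close> as left end.\<close>
    define \<kappa> where "\<kappa> = i\<^sub>1 \<cdot> k \<boxplus> i\<^sub>2 \<cdot> f0"
    have \<kappa> [simp]: "\<kappa> \<in> Arr C" "Dom C \<kappa> = K" "Cod C \<kappa> = B" by (simp_all add: \<kappa>_def)
    have p\<kappa>: "p\<^sub>1 \<cdot> \<kappa> = k" "p\<^sub>2 \<cdot> \<kappa> = f0" by (simp_all add: \<kappa>_def)
    have kf0: "w = Zero C S K" if "w \<in> Hom C S K" "k \<cdot> w = Zero C S F" "f0 \<cdot> w = Zero C S E" for w S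
      by (rule a3[OF that(1,2)]) (use HomD[OF that(1)] that(3) in \<open>simp flip: gf0\<close>)
    have \<kappa>m: "is_mono C \<kappa>"
    proof (rule monoI[of _ K B])
      fix x S assume x: "x \<in> Hom C S K" "\<kappa> \<cdot> x = Zero C S B"
      note [simp] = HomD[OF x(1)]
      have "k \<cdot> x = p\<^sub>1 \<cdot> Zero C S B" "f0 \<cdot> x = p\<^sub>2 \<cdot> Zero C S B"
        by (rule comp_expand_left[OF p\<kappa>(1) x(2)] comp_expand_left[OF p\<kappa>(2) x(2)]; simp)+
      then show "x = Zero C S K" by (intro kf0[OF x(1)]) simp_all
    qed simp
    obtain c E' where c: "is_cokernel C \<kappa> c" "c \<in> Arr C" "Cod C c = E'" "Dom C c = Cod C \<kappa>" "E' \<in> Obj C"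
      "c \<cdot> \<kappa> = Zero C (Dom C \<kappa>) E'" by (rule obtain_cokernel[OF \<kappa>(1)])
    have cc: "c \<in> Hom C B E'" using c by simp
    note [simp] = HomD[OF cc]
    have ce: "is_epi C c" by (rule is_cokernel_epi[OF c(1)])
    have ck: "is_kernel C c \<kappa>" by (rule mono_is_kernel[OF \<kappa>m c(1)])
    have "\<gamma> \<cdot> \<kappa> = Zero C K A'"
      using a2 p\<kappa> gf0 by (simp add: \<gamma>_def)
    then obtain g' where g': "g' \<in> Arr C" "Dom C g' = Cod C c" "Cod C g' = A'" "g' \<cdot> c = \<gamma>"
      by (rule cokernel_factor[OF c(1)]) (use HomD[OF \<gamma>] in simp_all)
    have g'H: "g' \<in> Hom C E' A'" using g' by simp
    note [simp] = HomD[OF g'H]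
    have ex': "exct g' h'" using exct_epi_cancel[OF _ ce cc g'H] g'(4) \<gamma>ex by simp
    have bb: "c \<cdot> i\<^sub>2 \<in> Hom C E E'" by simp
    have sq: "q \<cdot> g = g' \<cdot> (c \<cdot> i\<^sub>2)" using \<gamma>i(1) g'(4) by (simp add: comp_reduce[OF g'(4)])
    have "iso_ker g g' (c \<cdot> i\<^sub>2)"
    proof (rule iso_kerI[OF g g'H bb])
      fix u S assume u: "u \<in> Hom C S E" "g \<cdot> u = Zero C S A" "(c \<cdot> i\<^sub>2) \<cdot> u = Zero C S E'"
      note [simp] = HomD[OF u(1)]
      have "c \<cdot> (i\<^sub>2 \<cdot> u) = Zero C S E'" using u(3) by simp
      then obtain w where w: "w \<in> Arr C" "Dom C w = S" "Cod C w = Dom C \<kappa>" "\<kappa> \<cdot> w = i\<^sub>2 \<cdot> u"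
        by (rule kernel_lift[OF ck]) simp_all
      have wH: "w \<in> Hom C S K" using w by simp
      note [simp] = HomD[OF wH]
      have "k \<cdot> w = p\<^sub>1 \<cdot> (i\<^sub>2 \<cdot> u)" "f0 \<cdot> w = p\<^sub>2 \<cdot> (i\<^sub>2 \<cdot> u)"
        by (rule comp_expand_left[OF p\<kappa>(1) w(4)] comp_expand_left[OF p\<kappa>(2) w(4)]; simp)+
      then have kw: "k \<cdot> w = Zero C S F" and fw: "f0 \<cdot> w = u" by simp_all
      have "l \<cdot> w = g \<cdot> u" by (rule comp_expand_left[OF gf0 fw]) simp_all
      then have "l \<cdot> w = Zero C S A" using u(2) by simp
      then have "w = Zero C S K" using a3[OF wH kw] by simp
      then show "u = Zero C S E" using fw by simp
    next
      fix v S assume v: "v \<in> Hom C S E'" "g' \<cdot> v = Zero C S A'"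
      note [simp] = HomD[OF v(1)]
      obtain r y S' where r: "is_epi C r" "r \<in> Hom C S' S" "y \<in> Hom C S' B" "c \<cdot> y = v \<cdot> r"
        using epi_local_lift[OF ce cc v(1)] .
      note [simp] = HomD[OF r(2)] HomD[OF r(3)]
      have "\<gamma> \<cdot> y = g' \<cdot> (v \<cdot> r)" by (rule comp_expand_left[OF g'(4) r(4)]) simp_all
      also have "\<dots> = Zero C S' A'" by (simp add: comp_reduce[OF v(2)])
      finally have gy: "\<phi> \<cdot> (p\<^sub>1 \<cdot> y) \<boxplus> q \<cdot> (g \<cdot> (p\<^sub>2 \<cdot> y)) = Zero C S' A'" by (simp add: \<gamma>_def)
      have "h \<cdot> (g \<cdot> (p\<^sub>2 \<cdot> y)) = Zero C S' Y" by (simp add: comp_reduce[OF hg])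
      then obtain S'' r' w where w: "is_epi C r'" "r' \<in> Hom C S'' S'" "w \<in> Hom C S'' K"
        "(p\<^sub>1 \<cdot> y) \<cdot> r' = k \<cdot> w" "(g \<cdot> (p\<^sub>2 \<cdot> y)) \<cdot> r' = l \<cdot> w"
        using b[OF _ _ _ gy] by auto
      note [simp] = HomD[OF w(2)] HomD[OF w(3)]
      define e where "e = p\<^sub>2 \<cdot> (y \<cdot> r') \<boxminus> f0 \<cdot> w"
      have e [simp]: "e \<in> Arr C" "Dom C e = S''" "Cod C e = E" by (simp_all add: e_def)
      have "g \<cdot> e = Zero C S'' A" using w(5) by (simp add: e_def comp_reduce[OF gf0])
      moreover have "(c \<cdot> i\<^sub>2) \<cdot> e = v \<cdot> (r \<cdot> r')"
      proof -
        have "y \<cdot> r' = \<kappa> \<cdot> w \<boxplus> i\<^sub>2 \<cdot> e"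
          by (rule biprod_eqI[OF bp])
            (use w(4) in \<open>simp_all add: e_def comp_reduce[OF p\<kappa>(1)] comp_reduce[OF p\<kappa>(2)] plus_ac\<close>)
        then have "c \<cdot> (y \<cdot> r') = c \<cdot> (i\<^sub>2 \<cdot> e)"
          using c(6) by (simp add: comp_reduce[OF c(6)])
        then show ?thesis by (simp add: comp_reduce[OF r(4)])
      qed
      ultimately show "\<exists>r e S'. is_epi C r \<and> r \<in> Hom C S' S \<and> e \<in> Hom C S' E \<and> g \<cdot> e = Zero C S' A \<and>
          (c \<cdot> i\<^sub>2) \<cdot> e = v \<cdot> r"
        using epi_compH[OF w(1) r(1) w(2) r(2)]
        by (intro exI[of _ "r \<cdot> r'"] exI[of _ e] exI[of _ S'']) simp
    qed
    then have "ladder iso_ker h [g] h' [g'] q"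
      by (intro ladder_ConsI[of "c \<cdot> i\<^sub>2"]) (use sq in simp_all)
    then show ?thesis unfolding Nil using ex' by (intro exI[of _ "[g']"]) simp
  next
    case (Cons g2 gs2)
    note \<gamma>D [simp] = HomD[OF \<gamma>]
    \<comment> \<open>The recursion is applied to the inclusion \<open>i\<^sub>2\<close> of
      \<open>E\<close> into the cone term. The cover \<open>p\<close> of \<open>K\<close> supplies
      its data: \<open>\<psi>\<close> plays the role of \<open>\<phi>\<close> and \<open>k1\<close>
      that of \<open>k\<close>. The sign in \<open>neg (f \<cdot> k1)\<close> makes the two
      composites out of \<open>K1\<close> cancel.\<close>
    define \<psi> where "\<psi> = i\<^sub>1 \<cdot> (k \<cdot> p) \<boxplus> i\<^sub>2 \<cdot> f"
    have \<psi>: "\<psi> \<in> Hom C F1 B" by (simp add: \<psi>_def)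
    have p\<psi>: "p\<^sub>1 \<cdot> \<psi> = k \<cdot> p" "p\<^sub>2 \<cdot> \<psi> = f" by (simp_all add: \<psi>_def)
    note [simp] = HomD[OF \<psi>]
    have "\<exists>gs'. chain \<gamma> gs' \<and> length gs' = length gs1 \<and> ladder iso_ker g gs1 \<gamma> gs' i\<^sub>2"
    proof (rule Cons.IH[of g E A \<gamma> B A' i\<^sub>2 \<psi> F1 k1 K1 "neg (f \<cdot> k1)"])
      show "vanishes gs1 (neg (f \<cdot> k1))" by (rule vanishes_neg[OF p(16), of K1 E]) simp
      show "g \<cdot> neg (f \<cdot> k1) = Zero C K1 A" using pk by (simp add: comp_reduce[OF p(8)])
      show "\<psi> \<cdot> k1 \<boxplus> i\<^sub>2 \<cdot> neg (f \<cdot> k1) = Zero C K1 B" using pk by (simp add: \<psi>_def)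
      show "w = Zero C S K1" if "w \<in> Hom C S K1" "k1 \<cdot> w = Zero C S F1" for S w
        by (rule mono_zero[OF is_kernel_mono[OF p(9)] that(2) _ that(1)]) simp
      show "\<gamma> \<cdot> (i\<^sub>2 \<cdot> u) = Zero C S A'" if "u \<in> Hom C S E" "g \<cdot> u = Zero C S A" for S u
        using HomD[OF that(1)] that(2) by (simp add: comp_reduce[OF \<gamma>i(1)])
      have "\<gamma> \<cdot> \<psi> = (\<phi> \<cdot> k \<boxplus> q \<cdot> l) \<cdot> p" using p(8) by (simp add: \<gamma>_def \<psi>_def)
      then show "\<gamma> \<cdot> \<psi> = Zero C F1 A'" unfolding a2 by simp
      fix S x u assume x: "x \<in> Hom C S F1" "u \<in> Hom C S E" "g \<cdot> u = Zero C S A"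
        "\<psi> \<cdot> x \<boxplus> i\<^sub>2 \<cdot> u = Zero C S B"
      note [simp] = HomD[OF x(1)] HomD[OF x(2)]
      have "p\<^sub>1 \<cdot> (\<psi> \<cdot> x \<boxplus> i\<^sub>2 \<cdot> u) = Zero C S F" "p\<^sub>2 \<cdot> (\<psi> \<cdot> x \<boxplus> i\<^sub>2 \<cdot> u) = Zero C S E"
        unfolding x(4) by simp_all
      then have 1: "k \<cdot> (p \<cdot> x) = Zero C S F" "f \<cdot> x \<boxplus> u = Zero C S E"
        by (simp_all add: comp_reduce[OF p\<psi>(1)] comp_reduce[OF p\<psi>(2)])
      then have fx: "f \<cdot> x = neg u" using plus_eq_zero[of "f \<cdot> x" u S E] by simp
      have "l \<cdot> (p \<cdot> x) = g \<cdot> (f \<cdot> x)" by (simp add: comp_reduce[OF p(8)])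
      also have "\<dots> = Zero C S A" unfolding fx using x(3) by simp
      finally have "p \<cdot> x = Zero C S K" using a3[of "p \<cdot> x" S] 1(1) by simp
      then obtain w where w: "w \<in> Arr C" "Dom C w = S" "Cod C w = Dom C k1" "k1 \<cdot> w = x"
        by (rule kernel_lift[OF p(9)]) simp_all
      have wH: "w \<in> Hom C S K1" using w by simp
      note [simp] = HomD[OF wH]
      have "neg (f \<cdot> k1) \<cdot> w = u" using fx w(4) by simp
      then show "\<exists>S' r w. is_epi C r \<and> r \<in> Hom C S' S \<and> w \<in> Hom C S' K1 \<and> x \<cdot> r = k1 \<cdot> w \<and>
          u \<cdot> r = neg (f \<cdot> k1) \<cdot> w"
        using w(4) by (intro exI[of _ S] exI[of _ "Ident C S"] exI[of _ w]) simp
    next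
      fix S v assume v: "v \<in> Hom C S B" "\<gamma> \<cdot> v = Zero C S A'"
      note [simp] = HomD[OF v(1)]
      have gy: "\<phi> \<cdot> (p\<^sub>1 \<cdot> v) \<boxplus> q \<cdot> (g \<cdot> (p\<^sub>2 \<cdot> v)) = Zero C S A'" using v(2) by (simp add: \<gamma>_def)
      have "h \<cdot> (g \<cdot> (p\<^sub>2 \<cdot> v)) = Zero C S Y" by (simp add: comp_reduce[OF hg])
      then obtain S' r w where w: "is_epi C r" "r \<in> Hom C S' S" "w \<in> Hom C S' K"
        "(p\<^sub>1 \<cdot> v) \<cdot> r = k \<cdot> w" "(g \<cdot> (p\<^sub>2 \<cdot> v)) \<cdot> r = l \<cdot> w"
        using b[OF _ _ _ gy] by auto
      note [simp] = HomD[OF w(2)] HomD[OF w(3)]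
      have pH: "p \<in> Hom C F1 K" by simp
      obtain r' x S'' where x: "is_epi C r'" "r' \<in> Hom C S'' S'" "x \<in> Hom C S'' F1" "p \<cdot> x = w \<cdot> r'"
        using epi_local_lift[OF p(1) pH w(3)] .
      note [simp] = HomD[OF x(2)] HomD[OF x(3)]
      define u where "u = p\<^sub>2 \<cdot> (v \<cdot> (r \<cdot> r')) \<boxminus> f \<cdot> x"
      have u [simp]: "u \<in> Arr C" "Dom C u = S''" "Cod C u = E" by (simp_all add: u_def)
      have w4: "p\<^sub>1 \<cdot> (v \<cdot> r) = k \<cdot> w" and w5: "g \<cdot> (p\<^sub>2 \<cdot> (v \<cdot> r)) = l \<cdot> w" using w(4,5) by simp_all
      have w4': "p\<^sub>1 \<cdot> (v \<cdot> (r \<cdot> r')) = k \<cdot> (w \<cdot> r')" using comp_reduce[OF w4, of r'] by simp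
      have "g \<cdot> (p\<^sub>2 \<cdot> (v \<cdot> r)) \<cdot> r' = (l \<cdot> w) \<cdot> r'" unfolding w5 ..
      then have w5': "g \<cdot> (p\<^sub>2 \<cdot> (v \<cdot> (r \<cdot> r'))) = l \<cdot> (w \<cdot> r')" by simp
      have "g \<cdot> u = Zero C S'' A" using x(4) by (simp add: u_def comp_reduce[OF p(8)] w5')
      moreover have "v \<cdot> (r \<cdot> r') = \<psi> \<cdot> x \<boxplus> i\<^sub>2 \<cdot> u"
        by (rule biprod_eqI[OF bp])
          (use x(4) in \<open>simp_all add: u_def comp_reduce[OF p\<psi>(1)] comp_reduce[OF p\<psi>(2)] w4' plus_ac\<close>)
      ultimately show "\<exists>S' r x u. is_epi C r \<and> r \<in> Hom C S' S \<and> x \<in> Hom C S' F1 \<and> u \<in> Hom C S' E \<and>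
          g \<cdot> u = Zero C S' A \<and> v \<cdot> r = \<psi> \<cdot> x \<boxplus> i\<^sub>2 \<cdot> u"
        using epi_compH[OF x(1) w(1) x(2) w(2)]
        by (intro exI[of _ S''] exI[of _ "r \<cdot> r'"] exI[of _ x] exI[of _ u]) simp
    qed (use ch Cons in simp_all)
    then obtain gs' where gs': "chain \<gamma> gs'" "length gs' = length gs1" "ladder iso_ker g gs1 \<gamma> gs' i\<^sub>2"
      by blast
    have "ladder iso_ker h (g # gs1) h' (\<gamma> # gs') q"
      by (rule ladder_ConsI[OF _ _ gs'(3)]) (use \<gamma>i in simp_all)
    then show ?thesis using gs' \<gamma>ex by (intro exI[of _ "\<gamma> # gs'"]) simp
  qed
qed simp

text \<open>Middle exactness of Ext for 0 -> K -> N -> P -> 0: a class on \<open>N\<close> that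
  vanishes on \<open>K\<close> comes from \<open>P\<close>, where every class vanishes. The mapping
  cone over \<open>q\<close> constructs the class on \<open>P\<close>, and
  \<open>vanishes_ladder_iso\<close> brings its vanishing back to \<open>N\<close>.\<close>

lemma ext_vanish_extension:
  assumes i: "is_kernel C q i" "i \<in> Hom C K N" and q: "is_epi C q" "q \<in> Hom C N P"
    and P: "ext_vanish n P" "n > 0"
    and gs: "chain h gs" "length gs = n" and h: "h \<in> Hom C A B" and u: "u \<in> Hom C N A" "h \<cdot> u = Zero C N B"
    and van: "vanishes gs (u \<cdot> i)"
  shows "vanishes gs u"
proof -
  note [simp] = HomD[OF i(2)] HomD[OF q(2)] HomD[OF h] HomD[OF u(1)]
  obtain Z where Z: "Z \<in> Obj C" "\<And>f A. f \<in> Hom C A Z \<Longrightarrow> f = Zero C A Z"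
    "\<And>f A. f \<in> Hom C Z A \<Longrightarrow> f = Zero C Z A" by (rule obtain_zero) blast
  note [simp] = Z(1)
  have qi: "q \<cdot> i = Zero C K P" using is_kernelD(4)[OF i(1)] by simp
  have ne: "gs \<noteq> []" using gs(2) P(2) by auto
  obtain gs0 where gs0: "chain (Zero C N Z) gs0" "length gs0 = length gs"
      "ladder iso_ker (Zero C N Z) gs0 h gs u"
    using chain_pullback[OF h gs(1) ne u Z(1)] by blast
  have zN: "Zero C N Z \<in> Hom C N Z" and zP: "Zero C P Z \<in> Hom C P Z" and zZ: "Zero C Z P \<in> Hom C Z P"
    and zK: "Zero C K Z \<in> Hom C K Z" by simp_all
  have v0: "vanishes gs0 i"
    by (rule vanishes_ladder_iso[OF gs0(3) van i(2) u(1) _ zN h gs0(1) gs(1)]) simp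
  \<comment> \<open>The cone is taken with the zero object for \<open>F\<close>: as the cokernel of
    \<open>i\<close>, the object \<open>P\<close> is the pushout of \<open>i\<close> and the arrow
    from \<open>K\<close> to zero.\<close>
  have "\<exists>gs'. chain (Zero C P Z) gs' \<and> length gs' = length gs0 \<and>
      ladder iso_ker (Zero C N Z) gs0 (Zero C P Z) gs' q"
  proof (rule chain_cone[OF zN zP q(2) zZ zK i(2) gs0(1) _ v0])
    show "gs0 \<noteq> []" using ne gs0(2) by auto
    show "Zero C Z P \<cdot> Zero C K Z \<boxplus> q \<cdot> i = Zero C K P" using qi by simp
    fix S w assume w: "w \<in> Hom C S K" "i \<cdot> w = Zero C S N"
    show "w = Zero C S K" by (rule mono_zero[OF is_kernel_mono[OF i(1)] w(2) i(2) w(1)])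
  next
    fix S x v assume a: "x \<in> Hom C S Z" "v \<in> Hom C S N" "Zero C Z P \<cdot> x \<boxplus> q \<cdot> v = Zero C S P"
    note [simp] = HomD[OF a(1)] HomD[OF a(2)]
    have "q \<cdot> v = Zero C S P" using a(3) by simp
    then obtain w where w: "w \<in> Arr C" "Dom C w = S" "Cod C w = Dom C i" "i \<cdot> w = v"
      by (rule kernel_lift[OF i(1)]) simp_all
    have "x = Zero C S Z" by (rule Z(2)[OF a(1)])
    then show "\<exists>S' r w. is_epi C r \<and> r \<in> Hom C S' S \<and> w \<in> Hom C S' K \<and> x \<cdot> r = Zero C K Z \<cdot> w \<and> v \<cdot> r = i \<cdot> w"
      using w by (intro exI[of _ S] exI[of _ "Ident C S"] exI[of _ w]) simp
  next
    fix S v assume v: "v \<in> Hom C S P"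
    obtain r e S' where r: "is_epi C r" "r \<in> Hom C S' S" "e \<in> Hom C S' N" "q \<cdot> e = v \<cdot> r"
      using epi_local_lift[OF q v] .
    note [simp] = HomD[OF r(2)] HomD[OF r(3)] HomD[OF v]
    show "\<exists>S' r x u. is_epi C r \<and> r \<in> Hom C S' S \<and> x \<in> Hom C S' Z \<and> u \<in> Hom C S' N \<and>
        Zero C N Z \<cdot> u = Zero C S' Z \<and> v \<cdot> r = Zero C Z P \<cdot> x \<boxplus> q \<cdot> u"
      using r(1,4) by (intro exI[of _ S'] exI[of _ r] exI[of _ "Zero C S' Z"] exI[of _ e]) simp
  next
    fix S v assume v: "v \<in> Hom C S N"
    note [simp] = HomD[OF v]
    show "Zero C P Z \<cdot> (q \<cdot> v) = Zero C S Z" by simp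
  qed simp_all
  then obtain gs' where gs': "chain (Zero C P Z) gs'" "length gs' = length gs0"
    "ladder iso_ker (Zero C N Z) gs0 (Zero C P Z) gs' q" by blast
  have "vanishes gs' (Ident C P)"
    using P(1) gs'(1,2) gs0(2) gs(2) zP unfolding ext_vanish_def
    by (elim allE[of _ "Zero C P Z"] allE[of _ gs'] allE[of _ P] allE[of _ Z] allE[of _ "Ident C P"]) simp
  then have "vanishes gs' (Ident C P \<cdot> q)" by (rule vanishes_comp[OF _ _ q(2)]) simp
  then have "vanishes gs' (q \<cdot> Ident C N)" by simp
  then have "vanishes gs0 (Ident C N)"
    by (rule vanishes_ladder_iso[OF gs'(3) _ _ q(2) _ zN zP gs0(1) gs'(1)]) simp_all
  then have "vanishes gs (u \<cdot> Ident C N)"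
    by (rule vanishes_ladder[OF gs0(3) _ _ u(1) gs0(1) gs(1)]) simp_all
  then show ?thesis by simp
qed

text \<open>A witness on \<open>P\<^sub>0\<close> provides a cover \<open>p\<close> of
  \<open>P\<^sub>0\<close>, and \<open>\<epsilon> \<cdot> p\<close> covers \<open>M\<close> with the
  same lift \<open>f\<close>. The kernel \<open>J\<close> of this composite is an extension of
  \<open>P\<^sub>1\<close> by the kernel of \<open>p\<close>. On the latter the remaining class
  vanishes by the witness, hence on \<open>J\<close> by \<open>ext_vanish_extension\<close>.\<close>

lemma ext_vanish_quotient:
  assumes e: "is_epi C \<epsilon>" "\<epsilon> \<in> Hom C P\<^sub>0 M" and d: "is_kernel C \<epsilon> d" "d \<in> Hom C P\<^sub>1 P\<^sub>0"
    and P0: "ext_vanish (Suc n) P\<^sub>0" and P1: "ext_vanish n P\<^sub>1" "n > 0"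
  shows "ext_vanish (Suc n) M"
  unfolding ext_vanish_def
proof (intro allI impI, elim conjE)
  fix h gs A B u
  assume h: "h \<in> Hom C A B" and gs: "chain h gs" "length gs = Suc n" and u: "u \<in> Hom C M A" "h \<cdot> u = Zero C M B"
  note [simp] = HomD[OF e(2)] HomD[OF d(2)] HomD[OF h] HomD[OF u(1)]
  obtain g gs1 where g: "gs = g # gs1" using gs(2) by (cases gs) auto
  have vg: "vanishes gs (u \<cdot> \<epsilon>)"
  proof -
    have "u \<cdot> \<epsilon> \<in> Hom C P\<^sub>0 A" "h \<cdot> (u \<cdot> \<epsilon>) = Zero C P\<^sub>0 B" by (simp_all add: comp_reduce[OF u(2)])
    then show ?thesis using P0 h gs unfolding ext_vanish_def by blast
  qed
  obtain p F f k K where gH: "g \<in> Arr C" "Cod C g = Cod C (u \<cdot> \<epsilon>)" and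
    p: "is_epi C p" "p \<in> Arr C" "Dom C p = F" "Cod C p = Dom C (u \<cdot> \<epsilon>)" "f \<in> Arr C"
    "Dom C f = F" "Cod C f = Dom C g" "g \<cdot> f = (u \<cdot> \<epsilon>) \<cdot> p" "is_kernel C p k" "k \<in> Arr C" "Cod C k = F"
    "Dom C k = K" "p \<cdot> k = Zero C K (Dom C (u \<cdot> \<epsilon>))" "K \<in> Obj C" "F \<in> Obj C" "vanishes gs1 (f \<cdot> k)"
    using vanishes_ConsE[OF vg[unfolded g]] .
  obtain E where gE: "g \<in> Hom C E A" using gH by simp
  note [simp] = HomD[OF gE]
  have pH: "p \<in> Hom C F P\<^sub>0" and fH: "f \<in> Hom C F E" and kH: "k \<in> Hom C K F" using p by simp_all
  note [simp] = HomD[OF pH] HomD[OF fH] HomD[OF kH]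
  have gf: "g \<cdot> f = u \<cdot> (\<epsilon> \<cdot> p)" using p(8) by simp
  have ed: "\<epsilon> \<cdot> d = Zero C P\<^sub>1 M" using is_kernelD(4)[OF d(1)] by simp
  show "vanishes gs u"
    unfolding g
  proof (rule vanishes_ConsI[OF epi_compH[OF p(1) e(1) pH e(2)] _ fH gE u(1) gf])
    show "\<epsilon> \<cdot> p \<in> Hom C F M" by simp
    fix j J assume j: "is_kernel C (\<epsilon> \<cdot> p) j" "j \<in> Arr C" "Dom C j = J" "Cod C j = F" "J \<in> Obj C"
        "(\<epsilon> \<cdot> p) \<cdot> j = Zero C J M"
    have jH: "j \<in> Hom C J F" using j by simp
    note [simp] = HomD[OF jH]
    have epj: "\<epsilon> \<cdot> (p \<cdot> j) = Zero C J M" using j(6) by simp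
    then obtain q where q: "q \<in> Arr C" "Dom C q = J" "Cod C q = Dom C d" "d \<cdot> q = p \<cdot> j"
      by (rule kernel_lift[OF d(1)]) simp_all
    have qH: "q \<in> Hom C J P\<^sub>1" using q by simp
    note [simp] = HomD[OF qH]
    \<comment> \<open>\<open>J\<close> is the preimage of the subobject \<open>P\<^sub>1\<close>
      under the epimorphism \<open>p\<close>, so it covers \<open>P\<^sub>1\<close>.\<close>
    have qe: "is_epi C q"
    proof -
      obtain r x S where r: "is_epi C r" "r \<in> Hom C S P\<^sub>1" "x \<in> Hom C S F" "p \<cdot> x = d \<cdot> r"
        using epi_local_lift[OF p(1) pH d(2)] .
      note [simp] = HomD[OF r(2)] HomD[OF r(3)]
      have "(\<epsilon> \<cdot> p) \<cdot> x = Zero C S M" using r(4) by (simp add: comp_reduce[OF ed])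
      then obtain y where y: "y \<in> Arr C" "Dom C y = S" "Cod C y = Dom C j" "j \<cdot> y = x"
        by (rule kernel_lift[OF j(1)]) simp_all
      have yH: "y \<in> Hom C S J" using y by simp
      note [simp] = HomD[OF yH]
      have "d \<cdot> (q \<cdot> y) = p \<cdot> (j \<cdot> y)" by (simp add: comp_reduce[OF q(4)])
      also have "\<dots> = d \<cdot> r" using y(4) r(4) by simp
      finally have "q \<cdot> y = r"
        by (rule is_kernel_unique[OF d(1), of _ _ S]) simp_all
      then show ?thesis using is_epi_cancel[of q y] r(1) by simp
    qed
    obtain i I where i: "is_kernel C q i" "i \<in> Arr C" "Dom C i = I" "Cod C i = Dom C q" "I \<in> Obj C"
      "q \<cdot> i = Zero C I (Cod C q)" by (rule obtain_kernel[OF q(1)])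
    have iH: "i \<in> Hom C I J" using i by simp
    note [simp] = HomD[OF iH]
    have qi: "q \<cdot> i = Zero C I P\<^sub>1" using i(6) by simp
    have "p \<cdot> (j \<cdot> i) = d \<cdot> (q \<cdot> i)" by (simp add: comp_reduce[OF q(4)])
    also have "\<dots> = Zero C I P\<^sub>0" unfolding qi by simp
    finally obtain w where w: "w \<in> Arr C" "Dom C w = I" "Cod C w = Dom C k" "k \<cdot> w = j \<cdot> i"
      by (rule kernel_lift[OF p(9)]) simp_all
    have wH: "w \<in> Hom C I K" using w by simp
    note [simp] = HomD[OF wH]
    have "vanishes gs1 ((f \<cdot> k) \<cdot> w)" by (rule vanishes_comp[OF p(16) _ wH]) simp_all
    then have "vanishes gs1 ((f \<cdot> j) \<cdot> i)" using w(4) by simp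
    moreover have "g \<cdot> (f \<cdot> j) = Zero C J A" using epj by (simp add: comp_reduce[OF gf])
    moreover have "f \<cdot> j \<in> Hom C J E" by simp
    moreover have "chain g gs1" "length gs1 = n" using gs g by simp_all
    ultimately show "vanishes gs1 (f \<cdot> j)"
      using ext_vanish_extension[OF i(1) iH qe qH P1 _ _ gE] by blast
  qed
qed

section \<open>Yoneda Ext and the global dimension\<close>

lemma exct_zero: "\<lbrakk>p \<in> Hom C F T; Z \<in> Obj C\<rbrakk> \<Longrightarrow> exct p (Zero C T Z) \<longleftrightarrow> is_epi C p"
proof
  assume p: "p \<in> Hom C F T" and Z: "Z \<in> Obj C"
  note [simp] = HomD[OF p] Z
  have z: "Zero C T Z \<in> Hom C T Z" by simp
  { assume e: "exct p (Zero C T Z)"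
    have "Ident C T \<in> Hom C T T" "Zero C T Z \<cdot> Ident C T = Zero C T Z" by simp_all
    then obtain r x S where r: "is_epi C r" "r \<in> Hom C S T" "x \<in> Hom C S F" "p \<cdot> x = Ident C T \<cdot> r"
      by (rule exct_local_lift[OF e _ p z])
    note [simp] = HomD[OF r(2)] HomD[OF r(3)]
    show "is_epi C p" by (rule is_epi_cancel[of p x]) (use r in simp_all) }
  { assume e: "is_epi C p"
    show "exct p (Zero C T Z)"
    proof (rule exctI[OF p z])
      fix u S assume "u \<in> Hom C S T"
      from epi_local_lift[OF e p this]
      show "\<exists>r e S'. is_epi C r \<and> r \<in> Hom C S' S \<and> e \<in> Hom C S' F \<and> p \<cdot> e = u \<cdot> r" by metis
    qed simp }
qed

lemma exct_kernel: "is_kernel C g m \<Longrightarrow> exct m g"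
  unfolding exct_iff using is_kernelD(2)[of g m]
  by (intro exI[of _ m] exI[of _ "Ident C (Dom C m)"]) simp

text \<open>By \<open>exct_iff\<close> the arrow \<open>m\<close> is the kernel of \<open>g\<close>
  preceded by some \<open>e\<close>, which is both epi and mono. The cokernel of \<open>e\<close> is
  zero and \<open>e\<close> is the kernel of it, so the identity lifts along
  \<open>e\<close>.\<close>

lemma kernel_exct:
  assumes "exct m g" "is_mono C m" shows "is_kernel C g m"
proof -
  obtain k e where k: "is_kernel C g k" and e: "is_epi C e" "Cod C e = Dom C k" "m = k \<cdot> e"
    using assms(1) unfolding exct_iff by blast
  note D = is_kernelD[OF k]
  have em: "is_mono C e" using is_mono_cancel[of k e] e D assms(2) by simp
  obtain c Q where c: "is_cokernel C e c" "c \<in> Arr C" "Cod C c = Q" "Dom C c = Cod C e" "Q \<in> Obj C"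
    "c \<cdot> e = Zero C (Dom C e) Q" using obtain_cokernel[of e] e(1) by (metis is_epi_Arr)
  have ck: "is_kernel C c e" by (rule mono_is_kernel[OF em c(1)])
  have c0: "c = Zero C (Cod C e) Q" by (rule epi_zero[OF e(1) c(6)]) (use c e in simp_all)
  have o: "Cod C e \<in> Obj C" using e(1) by simp
  have c1: "c \<cdot> Ident C (Cod C e) = Zero C (Cod C e) Q"
    using c(2,4) c0 o by simp
  obtain s where s: "s \<in> Arr C" "Dom C s = Cod C e" "Cod C s = Dom C e" "e \<cdot> s = Ident C (Cod C e)"
    by (rule kernel_lift[OF ck c1]) (use c o in simp_all)
  show ?thesis
  proof (rule is_kernelI)
    show "g \<cdot> m = Zero C (Dom C m) (Cod C g)" using exctD[OF assms(1)] by simp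
    fix h assume h: "h \<in> Arr C" "Cod C h = Dom C g" "g \<cdot> h = Zero C (Dom C h) (Cod C g)"
    obtain u where u: "u \<in> Arr C" "Dom C u = Dom C h" "Cod C u = Dom C k" "k \<cdot> u = h"
      by (rule is_kernel_lift[OF k h])
    have "e \<cdot> (s \<cdot> u) = Ident C (Cod C e) \<cdot> u"
      by (rule comp_reduce[OF s(4)]) (use s u e in simp_all)
    then have "e \<cdot> (s \<cdot> u) = u" using u e by simp
    then have "m \<cdot> (s \<cdot> u) = h" unfolding e(3) using u s e D by simp
    then show "\<exists>u. u \<in> Hom C (Dom C h) (Dom C m) \<and> m \<cdot> u = h"
      using u s e D by (intro exI[of _ "s \<cdot> u"]) simp
  qed (use D assms exctD[OF assms(1)] in simp_all)
qed

lemma chain_successively: "chain h gs \<longleftrightarrow> successively (\<lambda>x y. exct y x) (h # gs)"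
  by (induction gs arbitrary: h) auto

text \<open>Extensions are listed from the left and include the monomorphism \<open>m\<close> out of
  \<open>B\<close>; chains are read from the right and omit it. Exactness at \<open>A\<close> is
  carried by the zero arrow to \<open>Z\<close>, and a monomorphism exact with the next arrow is its
  kernel.\<close>

lemma is_extension_iff:
  assumes "n > 0" "length gs = n" "A \<in> Obj C" "Z \<in> Obj C"
  shows "is_extension C n A B (m # rev gs) \<longleftrightarrow>
    chain (Zero C A Z) gs \<and> is_kernel C (last gs) m \<and> Dom C m = B"
proof -
  let ?fs = "m # rev gs"
  have ne: "gs \<noteq> []" using assms by auto
  have len: "length ?fs = Suc n" using assms(2) by simp
  have last: "?fs ! n = hd gs"
    using ne assms(2) by (cases gs) (auto simp: nth_append)
  have "is_extension C n A B ?fs \<longleftrightarrow> set ?fs \<subseteq> Arr C \<and> Dom C m = B \<and> Cod C (hd gs) = A \<and>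
      is_mono C m \<and> is_epi C (hd gs) \<and> (\<forall>i<n. Cod C (?fs ! i) = Dom C (?fs ! Suc i) \<and> exct (?fs ! i) (?fs ! Suc i))"
    unfolding is_extension_def last exact_at_iff using len by auto
  also have "\<dots> \<longleftrightarrow> Dom C m = B \<and> Cod C (hd gs) = A \<and>
      is_mono C m \<and> is_epi C (hd gs) \<and> (\<forall>i. Suc i < length ?fs \<longrightarrow> exct (?fs ! i) (?fs ! Suc i))"
  proof -
    have "set ?fs \<subseteq> Arr C" if a: "\<forall>i. Suc i < length ?fs \<longrightarrow> exct (?fs ! i) (?fs ! Suc i)" "is_epi C (hd gs)"
    proof
      fix x assume "x \<in> set ?fs"
      then obtain i where i: "i \<le> n" "x = ?fs ! i" using len by (metis in_set_conv_nth less_Suc_eq_le)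
      show "x \<in> Arr C"
      proof (cases "i = n")
        case True then show ?thesis using i a(2) last by simp
      next
        case False
        then have "Suc i < length ?fs" using i len by simp
        then show ?thesis unfolding i(2) using exctD(1) a(1) by blast
      qed
    qed
    moreover have "Cod C (?fs ! i) = Dom C (?fs ! Suc i)" if "exct (?fs ! i) (?fs ! Suc i)" for i
      using exctD(3)[OF that] .
    ultimately show ?thesis using len by (metis Suc_less_eq)
  qed
  also have "\<dots> \<longleftrightarrow> Dom C m = B \<and> Cod C (hd gs) = A \<and>
      is_mono C m \<and> is_epi C (hd gs) \<and> successively exct ?fs"
    by (simp only: successively_conv_nth)
  also have "successively exct ?fs \<longleftrightarrow> successively (\<lambda>x y. exct y x) (gs @ [m])"
    using successively_rev[of exct "gs @ [m]"] by simp
  also have "\<dots> \<longleftrightarrow> successively (\<lambda>x y. exct y x) gs \<and> exct m (last gs)"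
    using ne by (simp add: successively_append_iff)
  also have "Dom C m = B \<and> Cod C (hd gs) = A \<and> is_mono C m \<and> is_epi C (hd gs) \<and>
      successively (\<lambda>x y. exct y x) gs \<and> exct m (last gs) \<longleftrightarrow>
      chain (Zero C A Z) gs \<and> is_kernel C (last gs) m \<and> Dom C m = B"
  proof -
    have "is_mono C m \<and> exct m (last gs) \<longleftrightarrow> is_kernel C (last gs) m"
      using kernel_exct exct_kernel is_kernel_mono by blast
    moreover have "exct (hd gs) (Zero C A Z) \<longleftrightarrow> Cod C (hd gs) = A \<and> is_epi C (hd gs)"
    proof -
      have "exct (hd gs) (Zero C A Z) \<Longrightarrow> hd gs \<in> Hom C (Dom C (hd gs)) A"
        using exctD[of "hd gs" "Zero C A Z"] assms(3,4) by simp
      moreover have "Cod C (hd gs) = A \<and> is_epi C (hd gs) \<Longrightarrow> hd gs \<in> Hom C (Dom C (hd gs)) A" by simp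
      ultimately show ?thesis using exct_zero[of "hd gs" "Dom C (hd gs)" A Z, OF _ assms(4)]
        by (metis in_Hom)
    qed
    ultimately show ?thesis
      unfolding chain_successively using ne by (cases gs) auto
  qed
  finally show ?thesis .
qed

lemma extension_cases:
  assumes "is_extension C n A B fs" "n > 0"
  obtains m gs where "fs = m # rev gs" "length gs = n"
proof -
  have "length fs = Suc n" using assms by (simp add: is_extension_def)
  then show thesis using that[of "hd fs" "rev (tl fs)"] by (cases fs) auto
qed

lemma ladder_iff:
  assumes "length gs = length gs'"
  shows "ladder P h gs h' gs' a \<longleftrightarrow> (\<exists>f :: nat \<Rightarrow> 'b. f 0 = a \<and>
    (\<forall>i<length gs. f (Suc i) \<in> Hom C (Dom C (gs ! i)) (Dom C (gs' ! i)) \<and>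
       f i \<cdot> gs ! i = gs' ! i \<cdot> f (Suc i)) \<and>
    P (last (h # gs)) (last (h' # gs')) (f (length gs)))"
  using assms
proof (induction gs arbitrary: h h' gs' a)
  case Nil
  then show ?case by auto
next
  case (Cons g gs)
  then obtain g' gs1' where gs': "gs' = g' # gs1'" "length gs = length gs1'" by (cases gs') auto
  show ?case (is "_ \<longleftrightarrow> (\<exists>f. ?R f)")
  proof
    assume "ladder P h (g # gs) h' gs' a"
    then obtain b where b: "b \<in> Hom C (Dom C g) (Dom C g')" "a \<cdot> g = g' \<cdot> b" "ladder P g gs g' gs1' b"
      unfolding gs'(1) ladder.simps by blast
    obtain f where f: "f 0 = b" "\<forall>i<length gs. f (Suc i) \<in> Hom C (Dom C (gs ! i)) (Dom C (gs1' ! i)) \<and>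
       f i \<cdot> gs ! i = gs1' ! i \<cdot> f (Suc i)" "P (last (g # gs)) (last (g' # gs1')) (f (length gs))"
      using b(3) Cons.IH[OF gs'(2)] by blast
    have "?R (case_nat a f)"
      unfolding gs'(1) using b f by (auto simp: less_Suc_eq_0_disj simp del: in_Hom)
    then show "\<exists>f. ?R f" by blast
  next
    assume "\<exists>f. ?R f"
    then obtain f where f: "?R f" by blast
    have f1: "\<forall>i<Suc (length gs). f (Suc i) \<in> Hom C (Dom C ((g # gs) ! i)) (Dom C ((g' # gs1') ! i)) \<and>
       f i \<cdot> (g # gs) ! i = (g' # gs1') ! i \<cdot> f (Suc i)"
      and f2: "P (last (g # gs)) (last (g' # gs1')) (f (Suc (length gs)))"
      using f unfolding gs'(1) by simp_all
    have "f (Suc (Suc i)) \<in> Hom C (Dom C (gs ! i)) (Dom C (gs1' ! i)) \<and>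
       f (Suc i) \<cdot> gs ! i = gs1' ! i \<cdot> f (Suc (Suc i))" if "i < length gs" for i
      using f1[rule_format, of "Suc i"] that by simp
    then have "ladder P g gs g' gs1' (f 1)"
      unfolding Cons.IH[OF gs'(2)] using f2 by (intro exI[of _ "\<lambda>i. f (Suc i)"]) (simp del: in_Hom)
    moreover have "f 1 \<in> Hom C (Dom C g) (Dom C g')" "a \<cdot> g = g' \<cdot> f 1"
      using f unfolding gs'(1) by force+
    ultimately show "ladder P h (g # gs) h' gs' a" unfolding gs'(1) by (rule ladder_ConsI[rotated 2])
  qed
qed

text \<open>The two numberings run in opposite directions. The leftmost square, with the identity on
  \<open>B\<close>, turns into the condition \<open>c \<cdot> m = m'\<close> on the last vertical
  arrow of the ladder.\<close>

lemma extension_map_iff: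
  assumes "n > 0" "length gs = n" "length gs' = n"
    and e: "is_extension C n A B (m # rev gs)" "is_extension C n A B (m' # rev gs')"
  shows "extension_map C n A B (m # rev gs) (m' # rev gs') \<longleftrightarrow>
    ladder (\<lambda>_ _ c. c \<cdot> m = m') h gs h' gs' (Ident C A)"
proof -
  have m: "m' \<in> Arr C" "Dom C m' = B" "Dom C m = B" "m \<in> Arr C"
    using e assms(1) by (auto simp: is_extension_def)
  have BO: "B \<in> Obj C" using m by auto
  have len: "length gs = length gs'" using assms by simp
  have nth: "(x # rev xs) ! Suc j = xs ! (n - Suc j)" if "length xs = n" "j < n" for x :: 'b and xs j
    using that by (simp add: rev_nth)
  show ?thesis (is "?L \<longleftrightarrow> ?R")
  proof
    assume ?L
    then obtain f where f: "f 0 = Ident C B" "f (Suc n) = Ident C A"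
      "\<forall>i\<le>n. f i \<in> Hom C (Dom C ((m # rev gs) ! i)) (Dom C ((m' # rev gs') ! i)) \<and>
                f (Suc i) \<cdot> ((m # rev gs) ! i) = ((m' # rev gs') ! i) \<cdot> f i"
      unfolding extension_map_def by blast
    \<comment> \<open>Component \<open>i\<close> of the ladder sits at position
      \<open>Suc n - i\<close> of the map of extensions; in particular 0 corresponds to
      \<open>A\<close>.\<close>
    let ?f = "\<lambda>i. f (Suc n - i)"
    show ?R
      unfolding ladder_iff[OF len]
    proof (intro exI[of _ ?f] conjI allI impI)
      show "f (Suc n - length gs) \<cdot> m = m'"
        using f(1) f(3)[rule_format, of 0] assms(2) m by simp
      fix i assume i: "i < length gs"
      then have "Suc (n - Suc i) \<le> n" "n - Suc i < n" "n - Suc (n - Suc i) = i" using assms by auto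
      then have "f (Suc (n - Suc i)) \<in> Hom C (Dom C (gs ! i)) (Dom C (gs' ! i)) \<and>
          f (Suc (Suc (n - Suc i))) \<cdot> gs ! i = gs' ! i \<cdot> f (Suc (n - Suc i))"
        using f(3)[rule_format, of "Suc (n - Suc i)"] nth[OF assms(2)] nth[OF assms(3)] by metis
      moreover have "Suc (n - Suc i) = Suc n - Suc i" "Suc (Suc (n - Suc i)) = Suc n - i"
        using i assms by auto
      ultimately show "f (Suc n - Suc i) \<in> Hom C (Dom C (gs ! i)) (Dom C (gs' ! i))"
        "f (Suc n - i) \<cdot> gs ! i = gs' ! i \<cdot> f (Suc n - Suc i)" by metis+
    qed (use f in simp)
  next
    assume ?R
    then obtain f where f: "f 0 = Ident C A"
     "\<forall>i<length gs. f (Suc i) \<in> Hom C (Dom C (gs ! i)) (Dom C (gs' ! i)) \<and>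
       f i \<cdot> gs ! i = gs' ! i \<cdot> f (Suc i)" "f (length gs) \<cdot> m = m'"
      unfolding ladder_iff[OF len] by blast
    \<comment> \<open>The ladder has no component on \<open>B\<close>, so position 0 is filled in
      separately.\<close>
    let ?f = "\<lambda>i. if i = 0 then Ident C B else f (Suc n - i)"
    show ?L
      unfolding extension_map_def
    proof (intro conjI exI[of _ ?f] allI impI)
      fix i assume i: "i \<le> n"
      have "?f i \<in> Hom C (Dom C ((m # rev gs) ! i)) (Dom C ((m' # rev gs') ! i)) \<and>
                ?f (Suc i) \<cdot> ((m # rev gs) ! i) = ((m' # rev gs') ! i) \<cdot> ?f i"
      proof (cases i)
        case 0
        then show ?thesis using m f(3) assms BO by simp
      next
        case (Suc j)
        then have j: "j < n" using i by simp
        then have s: "Suc (n - Suc j) = n - j" "n - Suc j < n" by auto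
        have "f (n - j) \<in> Hom C (Dom C (gs ! (n - Suc j))) (Dom C (gs' ! (n - Suc j))) \<and>
          f (n - Suc j) \<cdot> gs ! (n - Suc j) = gs' ! (n - Suc j) \<cdot> f (n - j)"
          using f(2)[rule_format, of "n - Suc j"] s assms(2) by metis
        then show ?thesis unfolding Suc nth[OF assms(2) j] nth[OF assms(3) j] by simp
      qed
      then show "?f i \<in> Hom C (Dom C ((m # rev gs) ! i)) (Dom C ((m' # rev gs') ! i))"
        "?f (Suc i) \<cdot> ((m # rev gs) ! i) = ((m' # rev gs') ! i) \<cdot> ?f i" by blast+
    qed (use e f in simp_all)
  qed
qed

text \<open>The arrows \<open>m\<close> and \<open>m'\<close> are kernels of the two last arrows
  with a common domain, and \<open>c \<cdot> m = m'\<close> says that \<open>c\<close> matches these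
  kernels.\<close>

lemma ladder_iso_ker:
  assumes "ladder (\<lambda>_ _ c. c \<cdot> m = m') h gs h' gs' a" "is_kernel C (last (h # gs)) m"
    "is_kernel C (last (h' # gs')) m'" "Dom C m = Dom C m'" "a \<in> Hom C (Dom C h) (Dom C h')"
  shows "ladder iso_ker h gs h' gs' a"
  using assms
proof (induction gs arbitrary: h h' gs' a)
  case Nil
  then have gs': "gs' = []" using ladder_length by fastforce
  note k = Nil(2)[simplified] and k' = Nil(3)[unfolded gs', simplified]
  have am: "a \<cdot> m = m'" using Nil(1) gs' by simp
  obtain K where K: "m \<in> Hom C K (Dom C h)" "m' \<in> Hom C K (Dom C h')"
    using is_kernelD[OF k] is_kernelD[OF k'] Nil(4) by simp
  obtain A B A' B' where h: "h \<in> Hom C A B" "h' \<in> Hom C A' B'"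
    using is_kernelD(1)[OF k] is_kernelD(1)[OF k'] by simp
  note [simp] = HomD[OF h(1)] HomD[OF h(2)]
  have mH: "m \<in> Hom C K A" "m' \<in> Hom C K A'" "a \<in> Hom C A A'" using K Nil(5) by simp_all
  note [simp] = HomD[OF mH(1)] HomD[OF mH(2)] HomD[OF mH(3)]
  have "iso_ker h h' a"
  proof (rule iso_kerI[OF h mH(3)])
    fix u S assume u: "u \<in> Hom C S A" "h \<cdot> u = Zero C S B" "a \<cdot> u = Zero C S A'"
    note [simp] = HomD[OF u(1)]
    obtain w where w: "w \<in> Arr C" "Dom C w = S" "Cod C w = Dom C m" "m \<cdot> w = u"
      by (rule kernel_lift[OF k u(2)]) simp_all
    have wH: "w \<in> Hom C S K" using w by simp
    note [simp] = HomD[OF wH]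
    have "m' \<cdot> w = a \<cdot> u" by (rule comp_expand_left[OF am w(4)]) simp_all
    then have "m' \<cdot> w = Zero C S A'" using u(3) by simp
    then have "w = Zero C S K" by (rule mono_zero[OF is_kernel_mono[OF k'] _ mH(2) wH])
    then show "u = Zero C S A" using w(4) by simp
  next
    fix v S assume v: "v \<in> Hom C S A'" "h' \<cdot> v = Zero C S B'"
    note [simp] = HomD[OF v(1)]
    obtain w where w: "w \<in> Arr C" "Dom C w = S" "Cod C w = Dom C m'" "m' \<cdot> w = v"
      by (rule kernel_lift[OF k' v(2)]) simp_all
    have wH: "w \<in> Hom C S K" using w by simp
    note [simp] = HomD[OF wH]
    have hm: "h \<cdot> m = Zero C K B" using is_kernelD(4)[OF k] by simp
    show "\<exists>r e S'. is_epi C r \<and> r \<in> Hom C S' S \<and> e \<in> Hom C S' A \<and> h \<cdot> e = Zero C S' B \<and> a \<cdot> e = v \<cdot> r"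
      using w(4) by (intro exI[of _ "Ident C S"] exI[of _ "m \<cdot> w"] exI[of _ S]) (simp add: comp_reduce[OF am] comp_reduce[OF hm])
  qed
  then show ?case unfolding gs' by simp
next
  case (Cons g gs)
  then obtain g' gs1' where gs': "gs' = g' # gs1'" "True" using ladder_length[OF Cons.prems(1)] by (cases gs') auto
  obtain b where b: "b \<in> Hom C (Dom C g) (Dom C g')" "a \<cdot> g = g' \<cdot> b"
    "ladder (\<lambda>_ _ c. c \<cdot> m = m') g gs g' gs1' b" using Cons.prems(1) unfolding gs'(1) ladder.simps by blast
  have "ladder iso_ker g gs g' gs1' b"
    by (rule Cons.IH[OF b(3)]) (use Cons.prems(2-4) b(1) gs'(1) in simp_all)
  then show ?case unfolding gs'(1) by (rule ladder_ConsI[OF b(1,2)])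
qed


text \<open>The trivial extension \<open>0 \<rightarrow> B = B \<rightarrow> 0 \<rightarrow> \<dots> \<rightarrow> 0\<close>.\<close>

fun zero_tail :: "'a \<Rightarrow> 'a \<Rightarrow> 'a \<Rightarrow> nat \<Rightarrow> 'b list" where
  "zero_tail B Z X 0 = [Zero C B X]"
| "zero_tail B Z X (Suc n) = Zero C Z X # zero_tail B Z Z n"

lemma length_zero_tail [simp]: "length (zero_tail B Z X n) = Suc n"
  by (induction n arbitrary: X) auto

lemma exct_zero_mono:
  assumes "Y \<in> Obj C" "h \<in> Hom C X W" "\<And>S u. \<lbrakk>u \<in> Hom C S X; h \<cdot> u = Zero C S W\<rbrakk> \<Longrightarrow> u = Zero C S X"
  shows "exct (Zero C Y X) h"
proof -
  note [simp] = HomD[OF assms(2)] assms(1)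
  show ?thesis
  proof (rule exctI[of _ Y X h W])
    fix u S assume u: "u \<in> Hom C S X" "h \<cdot> u = Zero C S W"
    note [simp] = HomD[OF u(1)]
    show "\<exists>r e S'. is_epi C r \<and> r \<in> Hom C S' S \<and> e \<in> Hom C S' Y \<and> Zero C Y X \<cdot> e = u \<cdot> r"
      using assms(3)[OF u] by (intro exI[of _ "Ident C S"] exI[of _ "Zero C S Y"] exI[of _ S]) simp
  qed simp_all
qed

lemma chain_zero_tail:
  assumes "h \<in> Hom C X W" "\<And>S u. \<lbrakk>u \<in> Hom C S X; h \<cdot> u = Zero C S W\<rbrakk> \<Longrightarrow> u = Zero C S X"
    "B \<in> Obj C" "Z \<in> Obj C" "\<And>f A. f \<in> Hom C A Z \<Longrightarrow> f = Zero C A Z"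
  shows "chain h (zero_tail B Z X n) \<and> is_kernel C (last (zero_tail B Z X n)) (Ident C B)"
  using assms(1,2)
proof (induction n arbitrary: h X W)
  case 0
  note [simp] = HomD[OF 0(1)] assms(3)
  have "is_kernel C (Zero C B X) (Ident C B)"
  proof (rule is_kernelI)
    show "is_mono C (Ident C B)" by (rule monoI[of _ B B]) auto
    fix h' assume h': "h' \<in> Arr C" "Cod C h' = Dom C (Zero C B X)"
    then have "Cod C h' = B" by simp
    then show "\<exists>u. u \<in> Hom C (Dom C h') (Dom C (Ident C B)) \<and> Ident C B \<cdot> u = h'"
      using h'(1) by (intro exI[of _ h']) simp
  qed simp_all
  then show ?case using exct_zero_mono[OF assms(3) 0] by simp
next
  case (Suc n)
  note [simp] = HomD[OF Suc.prems(1)] assms(4)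
  have "chain (Zero C Z X) (zero_tail B Z Z n) \<and> is_kernel C (last (zero_tail B Z Z n)) (Ident C B)"
    by (rule Suc.IH[of _ Z X]) (use assms(5) in simp_all)
  moreover have "exct (Zero C Z X) h" using exct_zero_mono[OF assms(4) Suc.prems] .
  moreover have "zero_tail B Z Z n \<noteq> []" by (metis length_zero_tail list.size(3) nat.distinct(1))
  ultimately show ?case by simp
qed

text \<open>A retraction of the left end onto \<open>B\<close> is enough to map to the trivial tail:
  between \<open>a\<close> and this retraction all vertical arrows go into a zero object.\<close>

lemma ladder_zero_tail:
  assumes "length gs = Suc n" "chain g gs" "a \<in> Hom C (Dom C g) X" "a \<cdot> hd gs = Zero C (Dom C (hd gs)) X"
    "B \<in> Obj C" "Z \<in> Obj C" "\<rho> \<in> Hom C (Dom C (last gs)) B" "\<rho> \<cdot> m = Ident C B"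
  shows "ladder (\<lambda>_ _ c. c \<cdot> m = Ident C B) g gs h (zero_tail B Z X n) a"
  using assms(1-4,7)
proof (induction n arbitrary: g gs X a h)
  case 0
  then obtain g2 where gs: "gs = [g2]" by (cases gs) auto
  have X: "X \<in> Obj C" using HomD[OF 0(3)] by simp
  note r = HomD[OF 0(5)]
  show ?case unfolding gs zero_tail.simps
    by (rule ladder_ConsI[of \<rho>]) (use 0 gs X assms(5,8) r in simp_all)
next
  case (Suc n)
  then obtain g2 gs2 where gs: "gs = g2 # gs2" by (cases gs) auto
  have ne: "gs2 \<noteq> []" using Suc.prems(1) gs by auto
  then obtain g3 gs3 where gs2: "gs2 = g3 # gs3" by (cases gs2) auto
  have X: "X \<in> Obj C" using HomD[OF Suc.prems(3)] by simp
  have ex: "exct g2 g" "exct g3 g2" using Suc.prems(2) gs gs2 by simp_all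
  obtain E2 where g2: "g2 \<in> Hom C E2 (Dom C g)" using exctD[OF ex(1)] by simp
  obtain E3 where g3: "g3 \<in> Hom C E3 E2" using exctD[OF ex(2)] HomD[OF g2] by simp
  note [simp] = HomD[OF g2] HomD[OF g3] X assms(6)
  have "ladder (\<lambda>_ _ c. c \<cdot> m = Ident C B) g2 gs2 (Zero C Z X) (zero_tail B Z Z n) (Zero C E2 Z)"
    by (rule Suc.IH) (use Suc.prems gs ne gs2 in simp_all)
  then show ?case unfolding gs zero_tail.simps
    by (rule ladder_ConsI[rotated 2]) (use Suc.prems(4) gs in simp_all)
qed

lemma ladder_const_head:
  "ladder (\<lambda>_ _. R) h gs h' gs' a \<longleftrightarrow> ladder (\<lambda>_ _. R) h2 gs h2' gs' a"
  by (cases gs; cases gs') simp_all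

text \<open>A witness unfolds into an actual sequence. At the left end it is the biproduct of
  \<open>B\<close> with the last kernel; at every earlier stage the sequence 0 -> K -> F -> T -> 0
  of the cover is spliced on. The result maps to the given chain over \<open>u\<close>, compatibly
  with \<open>B\<close>, and the projection of the biproduct splits its left end.\<close>

lemma vanishes_split:
  assumes "vanishes gs u" "gs \<noteq> []" "chain h gs" "h \<in> Hom C A D" "u \<in> Hom C T A" "h \<cdot> u = Zero C T D"
    "is_kernel C (last gs) m" "m \<in> Hom C B M" "Z \<in> Obj C"
  shows "\<exists>gs' m' \<rho>. chain (Zero C T Z) gs' \<and> length gs' = length gs \<and> is_kernel C (last gs') m' \<and>
    ladder (\<lambda>_ _ c. c \<cdot> m' = m) (Zero C T Z) gs' h gs u \<and> \<rho> \<in> Hom C (Cod C m') B \<and>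
    \<rho> \<cdot> m' = Ident C B \<and> Dom C m' = B"
  using assms(1-7)
proof (induction gs arbitrary: u h A D T)
  case (Cons g gs)
  note [simp] = HomD[OF Cons.prems(4)] HomD[OF Cons.prems(5)] assms(9) HomD[OF assms(8)]
  have ex: "exct g h" using Cons.prems(3) by simp
  obtain E where g: "g \<in> Hom C E A" using exctD[OF ex] by simp
  note [simp] = HomD[OF g]
  obtain p F f k K where 
    p: "is_epi C p" "p \<in> Arr C" "Dom C p = F" "Cod C p = Dom C u" "f \<in> Arr C"
    "Dom C f = F" "Cod C f = Dom C g" "g \<cdot> f = u \<cdot> p" "is_kernel C p k" "k \<in> Arr C" "Cod C k = F"
    "Dom C k = K" "p \<cdot> k = Zero C K (Dom C u)" "K \<in> Obj C" "F \<in> Obj C" "vanishes gs (f \<cdot> k)"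
    using vanishes_ConsE[OF Cons.prems(1)] .
  have pH: "p \<in> Hom C F T" and fH: "f \<in> Hom C F E" and kH: "k \<in> Hom C K F" using p by simp_all
  note [simp] = HomD[OF pH] HomD[OF fH] HomD[OF kH]
  have pk: "p \<cdot> k = Zero C K T" using p(13) by simp
  show ?case
  proof (cases gs)
    case Nil
    have km: "is_kernel C g m" using Cons.prems(7) Nil by simp
    have "M = E" using is_kernelD(3)[OF km] by simp
    note [simp] = this
    have gm: "g \<cdot> m = Zero C B A" using is_kernelD(4)[OF km] by simp
    have "f \<cdot> k = Zero C K E" using p(16) unfolding Nil using vanishes_Nil[of "f \<cdot> k" K E] by simp
    then obtain l where l: "l \<in> Arr C" "Dom C l = Cod C p" "Cod C l = Cod C f" "l \<cdot> p = f"
      using epi_factor[OF p(1,9), of f] HomD[OF fH] HomD[OF kH] HomD[OF pH] by metis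
    have lH: "l \<in> Hom C T E" using l by simp
    note [simp] = HomD[OF lH]
    have gl: "g \<cdot> l = u" by (rule is_epiD[OF p(1)]) (use l(4) p(8) in simp_all)
    obtain P i\<^sub>1 i\<^sub>2 p\<^sub>1 p\<^sub>2 where bp: "biprod B T P i\<^sub>1 i\<^sub>2 p\<^sub>1 p\<^sub>2"
      by (rule obtain_biprod[of B T]) simp_all
    note [simp] = biprodD[OF bp]
    have "is_epi C p\<^sub>2" by (rule is_epi_split[of p\<^sub>2 i\<^sub>2 T P]) simp_all
    then have "chain (Zero C T Z) [p\<^sub>2]" using exct_zero[of p\<^sub>2 P T Z] by simp
    moreover have "is_kernel C p\<^sub>2 i\<^sub>1"
    proof (rule is_kernelI)
      show "is_mono C i\<^sub>1" by (rule is_mono_split[of p\<^sub>1 _ B P]) simp_all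
      fix v assume v: "v \<in> Arr C" "Cod C v = Dom C p\<^sub>2" "p\<^sub>2 \<cdot> v = Zero C (Dom C v) (Cod C p\<^sub>2)"
      then have "v = i\<^sub>1 \<cdot> (p\<^sub>1 \<cdot> v)" 
        by (intro biprod_eqI[OF bp, of v "i\<^sub>1 \<cdot> (p\<^sub>1 \<cdot> v)"]) simp_all
      then show "\<exists>w. w \<in> Hom C (Dom C v) (Dom C i\<^sub>1) \<and> i\<^sub>1 \<cdot> w = v"
        using v(1,2) by (intro exI[of _ "p\<^sub>1 \<cdot> v"]) simp
    qed simp_all
    moreover have "ladder (\<lambda>_ _ c. c \<cdot> i\<^sub>1 = m) (Zero C T Z) [p\<^sub>2] h [g] u"
      by (rule ladder_ConsI[of "m \<cdot> p\<^sub>1 \<boxplus> l \<cdot> p\<^sub>2"])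
        (simp_all add: comp_reduce[OF gm] comp_reduce[OF gl])
    moreover have "p\<^sub>1 \<in> Hom C (Cod C i\<^sub>1) B" "p\<^sub>1 \<cdot> i\<^sub>1 = Ident C B" "Dom C i\<^sub>1 = B" by simp_all
    ultimately show ?thesis unfolding Nil
      by (intro exI[of _ "[p\<^sub>2]"] exI[of _ i\<^sub>1] exI[of _ p\<^sub>1]) simp
  next
    case (Cons g2 gs2)
    have "g \<cdot> (f \<cdot> k) = Zero C K A" using pk by (simp add: comp_reduce[OF p(8)])
    then obtain gs' m' \<rho> where IH: "chain (Zero C K Z) gs'" "length gs' = length gs"
      "is_kernel C (last gs') m'" "ladder (\<lambda>_ _ c. c \<cdot> m' = m) (Zero C K Z) gs' g gs (f \<cdot> k)"
      "\<rho> \<in> Hom C (Cod C m') B" "\<rho> \<cdot> m' = Ident C B" "Dom C m' = B"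
      using Cons.IH[OF p(16) _ _ g, of K] Cons Cons.prems(3,7) by auto
    obtain s ss where s: "gs' = s # ss" using IH(2) Cons by (cases gs') auto
    have sx: "exct s (Zero C K Z)" using IH(1) s by simp
    obtain S where sH: "s \<in> Hom C S K" using exctD[OF sx] by simp
    note [simp] = HomD[OF sH]
    have se: "is_epi C s" using sx exct_zero[OF sH assms(9)] by simp
    have 1: "exct p (Zero C T Z)" using exct_zero[OF pH assms(9)] p(1) by simp
    \<comment> \<open>The sequence for \<open>K\<close> ends in the epimorphism \<open>s\<close>.
      Composing \<open>s\<close> with the inclusion \<open>k\<close> splices it to the cover
      \<open>p\<close> without changing the kernel of \<open>s\<close>.\<close>
    have 2: "exct (k \<cdot> s) p" unfolding exct_iff using p(9) se by (intro exI[of _ k] exI[of _ s]) simp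
    have sk: "same_ker s (k \<cdot> s)"
      unfolding same_ker_def
    proof (intro conjI allI impI iffI)
      fix x Y assume "x \<in> Hom C Y (Dom C s)"
      then have x: "x \<in> Hom C Y S" by simp
      note [simp] = HomD[OF x]
      { assume "s \<cdot> x = Zero C Y (Cod C s)" then show "(k \<cdot> s) \<cdot> x = Zero C Y (Cod C (k \<cdot> s))" by simp }
      { assume "(k \<cdot> s) \<cdot> x = Zero C Y (Cod C (k \<cdot> s))"
        then have "k \<cdot> (s \<cdot> x) = Zero C Y F" by simp
        then have "s \<cdot> x = Zero C Y K" by (rule mono_zero[OF is_kernel_mono[OF p(9)] _ kH]) simp
        then show "s \<cdot> x = Zero C Y (Cod C s)" by simp }
    qed simp_all
    have 3: "chain (k \<cdot> s) ss" using chain_same_ker[OF sk] IH(1) s by simp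
    have 4: "is_kernel C (last ((k \<cdot> s) # ss)) m'"
    proof (cases ss)
      case Nil
      then have ks: "is_kernel C s m'" using IH(3) s by simp
      note D = is_kernelD[OF ks]
      have "exct m' (k \<cdot> s)" using chain_same_ker[OF sk, of "[m']"] exct_kernel[OF ks] by simp
      then show ?thesis unfolding Nil using kernel_exct is_kernel_mono[OF ks] by simp
    next
      case Cons then show ?thesis using IH(3) s by simp
    qed
    obtain b where b: "b \<in> Hom C (Dom C s) (Dom C g2)" "(f \<cdot> k) \<cdot> s = g2 \<cdot> b"
      "ladder (\<lambda>_ _ c. c \<cdot> m' = m) s ss g2 gs2 b"
      using IH(4) unfolding s Cons ladder.simps by blast
    have "ladder (\<lambda>_ _ c. c \<cdot> m' = m) p ((k \<cdot> s) # ss) g gs f"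
      unfolding Cons
    proof (rule ladder_ConsI[of b])
      show "ladder (\<lambda>_ _ c. c \<cdot> m' = m) (k \<cdot> s) ss g2 gs2 b"
        using b(3) ladder_const_head by blast
    qed (use b(1,2) in simp_all)
    then have "ladder (\<lambda>_ _ c. c \<cdot> m' = m) (Zero C T Z) (p # (k \<cdot> s) # ss) h (g # gs) u"
      by (rule ladder_ConsI[rotated 2]) (use p(8) in simp_all)
    then show ?thesis using 1 2 3 4 IH(2,5-7) s
      by (intro exI[of _ "p # (k \<cdot> s) # ss"] exI[of _ m'] exI[of _ \<rho>]) simp
  qed
qed simp

lemma chain_Arr: "\<lbrakk>chain h gs; g \<in> set gs\<rbrakk> \<Longrightarrow> g \<in> Arr C"
  by (induction gs arbitrary: h) (auto dest: exctD(1))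

text \<open>The extension \<open>\<tau>\<close> is the split one for \<open>n = 1\<close> and 0 -> B
  = B -> 0 -> ... -> 0 -> A = A -> 0 for larger \<open>n\<close>, where for \<open>n = 2\<close> the
  two identities are adjacent. The sequence unfolded by \<open>vanishes_split\<close> maps to the
  given extension and, by its retraction, also to \<open>\<tau>\<close>; so two morphisms in
  opposite directions connect them.\<close>

lemma extension_trivial:
  assumes n: "n > 0" and A: "A \<in> Obj C" and B: "B \<in> Obj C"
  obtains \<tau> where "is_extension C n A B \<tau>" "vanishes (rev (tl \<tau>)) (Ident C A)"
    "\<And>fs. \<lbrakk>is_extension C n A B fs; vanishes (rev (tl fs)) (Ident C A)\<rbrakk>
      \<Longrightarrow> equivclp (extension_map C n A B) fs \<tau>"
proof -
  obtain Z where Z: "Z \<in> Obj C" "\<And>f A. f \<in> Hom C A Z \<Longrightarrow> f = Zero C A Z"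
    "\<And>f A. f \<in> Hom C Z A \<Longrightarrow> f = Zero C Z A" by (rule obtain_zero) blast
  note [simp] = A B Z(1)
  have zA: "Zero C A Z \<in> Hom C A Z" by simp
  obtain ts m where t: "chain (Zero C A Z) ts" "length ts = n" "is_kernel C (last ts) m" "Dom C m = B"
    "vanishes ts (Ident C A)"
    and tt: "\<And>gs m' \<rho>. \<lbrakk>chain (Zero C A Z) gs; length gs = n; is_kernel C (last gs) m'; \<rho> \<in> Hom C (Cod C m') B;
      \<rho> \<cdot> m' = Ident C B; Dom C m' = B\<rbrakk> \<Longrightarrow> ladder (\<lambda>_ _ c. c \<cdot> m' = m) (Zero C A Z) gs (Zero C A Z) ts (Ident C A)"
  proof (cases "n = 1")
    case True
    obtain P i\<^sub>1 i\<^sub>2 p\<^sub>1 p\<^sub>2 where bp: "biprod B A P i\<^sub>1 i\<^sub>2 p\<^sub>1 p\<^sub>2"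
      by (rule obtain_biprod[OF B A])
    note [simp] = biprodD[OF bp]
    have "is_epi C p\<^sub>2" by (rule is_epi_split[of p\<^sub>2 i\<^sub>2 A P]) simp_all
    then have ch: "chain (Zero C A Z) [p\<^sub>2]" using exct_zero[of p\<^sub>2 P A Z] by simp
    have k: "is_kernel C p\<^sub>2 i\<^sub>1"
    proof (rule is_kernelI)
      show "is_mono C i\<^sub>1" by (rule is_mono_split[of p\<^sub>1 _ B P]) simp_all
      fix v assume v: "v \<in> Arr C" "Cod C v = Dom C p\<^sub>2" "p\<^sub>2 \<cdot> v = Zero C (Dom C v) (Cod C p\<^sub>2)"
      then have "v = i\<^sub>1 \<cdot> (p\<^sub>1 \<cdot> v)" 
        by (intro biprod_eqI[OF bp, of v "i\<^sub>1 \<cdot> (p\<^sub>1 \<cdot> v)"]) simp_all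
      then show "\<exists>w. w \<in> Hom C (Dom C v) (Dom C i\<^sub>1) \<and> i\<^sub>1 \<cdot> w = v"
        using v(1,2) by (intro exI[of _ "p\<^sub>1 \<cdot> v"]) simp
    qed simp_all
    show thesis
    proof (rule that[of "[p\<^sub>2]" i\<^sub>1])
      have "vanishes [p\<^sub>2] (p\<^sub>2 \<cdot> i\<^sub>2)" by (rule vanishes_exact[OF ch, of _ A]) simp
      then show "vanishes [p\<^sub>2] (Ident C A)" by simp
      fix gs m' \<rho> assume gs: "chain (Zero C A Z) gs" "length gs = n" "is_kernel C (last gs) m'" "\<rho> \<in> Hom C (Cod C m') B"
        "\<rho> \<cdot> m' = Ident C B" "Dom C m' = B"
      obtain g where g: "gs = [g]" using gs(2) True by (metis One_nat_def length_0_conv length_Suc_conv)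
      have gx: "exct g (Zero C A Z)" using gs(1) g by simp
      obtain E where gH: "g \<in> Hom C E A" using exctD[OF gx] by simp
      have km: "is_kernel C g m'" using gs(3) g by simp
      have mH: "m' \<in> Hom C B E" using is_kernelD[OF km] gs(6) HomD[OF gH] by simp
      note [simp] = HomD[OF gH] HomD[OF mH]
      have rH: "\<rho> \<in> Hom C E B" using gs(4) by simp
      note [simp] = HomD[OF rH]
      have gm: "g \<cdot> m' = Zero C B A" using is_kernelD(4)[OF km] by simp
      show "ladder (\<lambda>_ _ c. c \<cdot> m' = i\<^sub>1) (Zero C A Z) gs (Zero C A Z) [p\<^sub>2] (Ident C A)"
        unfolding g
        by (rule ladder_ConsI[of "i\<^sub>1 \<cdot> \<rho> \<boxplus> i\<^sub>2 \<cdot> g"]) (use gs(5) gm in simp_all)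
    qed (use True ch k in simp_all)
  next
    case False
    then obtain k where k: "n = Suc (Suc k)" using n by (metis One_nat_def not_gr_zero old.nat.exhaust)
    let ?ts = "Ident C A # zero_tail B Z A k"
    have iA: "Ident C A \<in> Hom C A A" by simp
    have zt: "chain (Ident C A) (zero_tail B Z A k) \<and> is_kernel C (last (zero_tail B Z A k)) (Ident C B)"
      by (rule chain_zero_tail[OF iA]) (use Z(2) in simp_all)
    have ne: "zero_tail B Z A k \<noteq> []" by (metis length_zero_tail list.size(3) nat.distinct(1))
    have ch: "chain (Zero C A Z) ?ts" using zt exct_zero[OF iA Z(1)] by simp
    show thesis
    proof (rule that[of ?ts "Ident C B"])
      have "vanishes ?ts (Ident C A \<cdot> Ident C A)" by (rule vanishes_exact[OF ch, of _ A]) simp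
      then show "vanishes ?ts (Ident C A)" by simp
      fix gs m' \<rho> assume gs: "chain (Zero C A Z) gs" "length gs = n" "is_kernel C (last gs) m'" "\<rho> \<in> Hom C (Cod C m') B"
        "\<rho> \<cdot> m' = Ident C B" "Dom C m' = B"
      obtain p gs1 where g: "gs = p # gs1" "length gs1 = Suc k" using gs(2) k by (cases gs) auto
      then obtain g2 gs2 where g2: "gs1 = g2 # gs2" by (cases gs1) auto
      have px: "exct p (Zero C A Z)" "exct g2 p" using gs(1) g g2 by simp_all
      obtain F where pH: "p \<in> Hom C F A" using exctD[OF px(1)] by simp
      note [simp] = HomD[OF pH]
      have km: "is_kernel C (last gs1) m'" using gs(3) g g2 by simp
      have "ladder (\<lambda>_ _ c. c \<cdot> m' = Ident C B) p gs1 (Ident C A) (zero_tail B Z A k) p"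
        by (rule ladder_zero_tail[OF g(2) _ _ _ B Z(1) _ gs(5)])
          (use gs(1,4) g(1) g2 exctD(4)[OF px(2)] is_kernelD(3)[OF km] in simp_all)
      then show "ladder (\<lambda>_ _ c. c \<cdot> m' = Ident C B) (Zero C A Z) gs (Zero C A Z) ?ts (Ident C A)"
        unfolding g(1) by (rule ladder_ConsI[rotated 2]) simp_all
    qed (use zt ch ne k in simp_all)
  qed
  have ext: "is_extension C n A B (m # rev ts)"
    using is_extension_iff[OF n t(2) A Z(1)] t by blast
  show thesis
  proof (rule that[OF ext])
    show "vanishes (rev (tl (m # rev ts))) (Ident C A)" using t(5) by simp
    fix fs assume fs: "is_extension C n A B fs" "vanishes (rev (tl fs)) (Ident C A)"
    obtain m0 gs where g: "fs = m0 # rev gs" "length gs = n" using extension_cases[OF fs(1) n] .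
    have gs: "chain (Zero C A Z) gs" "is_kernel C (last gs) m0" "Dom C m0 = B"
      using is_extension_iff[OF n g(2) A Z(1), of B m0] fs(1) g(1) by simp_all
    have v: "vanishes gs (Ident C A)" using fs(2) g(1) by simp
    obtain M where m0: "m0 \<in> Hom C B M" using is_kernelD[OF gs(2)] gs(3) by simp
    obtain gs' m' \<rho> where w: "chain (Zero C A Z) gs'" "length gs' = length gs" "is_kernel C (last gs') m'"
      "ladder (\<lambda>_ _ c. c \<cdot> m' = m0) (Zero C A Z) gs' (Zero C A Z) gs (Ident C A)" "\<rho> \<in> Hom C (Cod C m') B"
      "\<rho> \<cdot> m' = Ident C B" "Dom C m' = B"
      using vanishes_split[OF v _ gs(1) zA _ _ gs(2) m0 Z(1), of A] g(2) n by auto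
    have len: "length gs' = n" using w(2) g(2) by simp
    have e': "is_extension C n A B (m' # rev gs')"
      using is_extension_iff[OF n len A Z(1)] w by blast
    have "extension_map C n A B (m' # rev gs') fs"
      unfolding g(1) using extension_map_iff[OF n len g(2) e' fs(1)[unfolded g(1)]] w(4) by blast
    moreover have "extension_map C n A B (m' # rev gs') (m # rev ts)"
      using extension_map_iff[OF n len t(2) e' ext] tt[OF w(1) len w(3,5,6,7)] by blast
    ultimately show "equivclp (extension_map C n A B) fs (m # rev ts)"
      by (meson converse_r_into_equivclp equivclp_trans r_into_equivclp)
  qed
qed

text \<open>Vanishing goes forward along any ladder. It goes backward because a morphism of
  extensions is the identity on \<open>B\<close>, hence an isomorphism on the kernels at the left
  end.\<close>

lemma vanishes_extension_map:
  assumes n: "n > 0" and A: "A \<in> Obj C" and map: "extension_map C n A B fs fs'"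
  shows "vanishes (rev (tl fs)) (Ident C A) \<longleftrightarrow> vanishes (rev (tl fs')) (Ident C A)"
proof -
  obtain Z where Z: "Z \<in> Obj C" "\<And>f A. f \<in> Hom C A Z \<Longrightarrow> f = Zero C A Z"
    "\<And>f A. f \<in> Hom C Z A \<Longrightarrow> f = Zero C Z A" by (rule obtain_zero) blast
  note [simp] = A Z(1)
  have zA: "Zero C A Z \<in> Hom C A Z" and iA: "Ident C A \<in> Hom C A A" by simp_all
  have fs: "is_extension C n A B fs" "is_extension C n A B fs'" using map by (simp_all add: extension_map_def)
  obtain m gs where g: "fs = m # rev gs" "length gs = n" using extension_cases[OF fs(1) n] .
  obtain m' gs' where g': "fs' = m' # rev gs'" "length gs' = n" using extension_cases[OF fs(2) n] .
  have gs: "chain (Zero C A Z) gs" "is_kernel C (last gs) m" "Dom C m = B"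
    using is_extension_iff[OF n g(2) A Z(1), of B m] fs(1) g(1) by simp_all
  have gs': "chain (Zero C A Z) gs'" "is_kernel C (last gs') m'" "Dom C m' = B"
    using is_extension_iff[OF n g'(2) A Z(1), of B m'] fs(2) g'(1) by simp_all
  have ne: "gs \<noteq> []" "gs' \<noteq> []" using n g(2) g'(2) by auto
  have l: "ladder (\<lambda>_ _ c. c \<cdot> m = m') (Zero C A Z) gs (Zero C A Z) gs' (Ident C A)"
    using extension_map_iff[OF n g(2) g'(2)] fs map g(1) g'(1) by blast
  have l': "ladder iso_ker (Zero C A Z) gs (Zero C A Z) gs' (Ident C A)"
    by (rule ladder_iso_ker[OF l]) (use gs gs' ne in simp_all)
  have "vanishes gs' (Ident C A)" if "vanishes gs (Ident C A)"
    using vanishes_ladder[OF l that iA iA gs(1) gs'(1)] by simp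
  moreover have "vanishes gs (Ident C A)" if "vanishes gs' (Ident C A)"
  proof -
    have "vanishes gs' (Ident C A \<cdot> Ident C A)" using that by simp
    then show ?thesis by (rule vanishes_ladder_iso[OF l' _ iA iA _ zA zA gs(1) gs'(1)]) simp
  qed
  ultimately show ?thesis unfolding g(1) g'(1) by auto
qed

text \<open>Vanishing is invariant under equivalence, and all vanishing extensions are equivalent to
  \<open>\<tau>\<close>. They therefore make up exactly one class, the zero of Ext, and Ext is a
  single point when nothing else exists.\<close>

lemma Ext_singleton_iff:
  assumes n: "n > 0" and A: "A \<in> Obj C" and B: "B \<in> Obj C"
  shows "is_singleton (Ext C n A B) \<longleftrightarrow>
    (\<forall>fs. is_extension C n A B fs \<longrightarrow> vanishes (rev (tl fs)) (Ident C A))"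
proof
  let ?S = "{fs. is_extension C n A B fs}"
  let ?R = "{(fs, gs). is_extension C n A B fs \<and> is_extension C n A B gs \<and>
                equivclp (extension_map C n A B) fs gs}"
  obtain \<tau> where t: "is_extension C n A B \<tau>" "vanishes (rev (tl \<tau>)) (Ident C A)"
    "\<And>fs. \<lbrakk>is_extension C n A B fs; vanishes (rev (tl fs)) (Ident C A)\<rbrakk>
      \<Longrightarrow> equivclp (extension_map C n A B) fs \<tau>" using extension_trivial[OF n A B] by blast
  { assume a: "\<forall>fs. is_extension C n A B fs \<longrightarrow> vanishes (rev (tl fs)) (Ident C A)"
    have "equivclp (extension_map C n A B) fs gs" if "fs \<in> ?S" "gs \<in> ?S" for fs gs
      using t(3)[of fs] t(3)[of gs] a that by (metis equivclp_sym equivclp_trans mem_Collect_eq)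
    then have "?R `` {fs} = ?S" if "fs \<in> ?S" for fs using that by blast
    then have "?S // ?R = {?S}" unfolding quotient_def using t(1) by blast
    then show "is_singleton (Ext C n A B)" unfolding Ext_def by simp }
  { assume a: "is_singleton (Ext C n A B)"
    show "\<forall>fs. is_extension C n A B fs \<longrightarrow> vanishes (rev (tl fs)) (Ident C A)"
    proof (intro allI impI)
      fix fs assume fs: "is_extension C n A B fs"
      have "?R `` {fs} \<in> ?S // ?R" "?R `` {\<tau>} \<in> ?S // ?R"
        by (rule quotientI, simp add: fs t(1))+
      then have "?R `` {fs} = ?R `` {\<tau>}" using a unfolding Ext_def is_singleton_def by auto
      moreover have "fs \<in> ?R `` {fs}" using fs by auto
      ultimately have "equivclp (extension_map C n A B) \<tau> fs" by auto
      then show "vanishes (rev (tl fs)) (Ident C A)"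
        by (induction rule: equivclp_induct) (use t(2) vanishes_extension_map[OF n A] in blast)+
    qed }
qed

text \<open>Letting \<open>B\<close> range over all objects removes it from the statement: the left
  end of a chain is whatever kernel its last arrow has.\<close>

lemma Ext_singleton_iff_ext_vanish:
  assumes n: "n > 0" and A: "A \<in> Obj C"
  shows "(\<forall>B\<in>Obj C. is_singleton (Ext C n A B)) \<longleftrightarrow> ext_vanish n A"
proof -
  obtain Z where Z: "Z \<in> Obj C" "\<And>f A. f \<in> Hom C A Z \<Longrightarrow> f = Zero C A Z"
    "\<And>f A. f \<in> Hom C Z A \<Longrightarrow> f = Zero C Z A" by (rule obtain_zero) blast
  note [simp] = A Z(1)
  show ?thesis
  proof
    assume a: "\<forall>B\<in>Obj C. is_singleton (Ext C n A B)"
    show "ext_vanish n A"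
    proof (rule ext_vanishI[OF n A Z(1)])
      fix gs assume gs: "chain (Zero C A Z) gs" "length gs = n"
      have "gs \<noteq> []" using gs(2) n by auto
      then have "last gs \<in> Arr C" using chain_Arr[OF gs(1)] by simp
      then obtain m B where m: "is_kernel C (last gs) m" "m \<in> Arr C" "Dom C m = B" "Cod C m = Dom C (last gs)"
        "B \<in> Obj C" "last gs \<cdot> m = Zero C B (Cod C (last gs))" by (rule obtain_kernel)
      have "is_extension C n A B (m # rev gs)"
        using is_extension_iff[OF n gs(2) A Z(1)] gs(1) m(1,3) by blast
      then have "vanishes (rev (tl (m # rev gs))) (Ident C A)"
        using a m(5) Ext_singleton_iff[OF n A m(5)] by blast
      then show "vanishes gs (Ident C A)" by simp
    qed
  next
    assume a: "ext_vanish n A"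
    show "\<forall>B\<in>Obj C. is_singleton (Ext C n A B)"
    proof
      fix B assume B: "B \<in> Obj C"
      show "is_singleton (Ext C n A B)"
        unfolding Ext_singleton_iff[OF n A B]
      proof (intro allI impI)
        fix fs assume fs: "is_extension C n A B fs"
        obtain m gs where g: "fs = m # rev gs" "length gs = n" using extension_cases[OF fs n] .
        have gs: "chain (Zero C A Z) gs"
          using is_extension_iff[OF n g(2) A Z(1), of B m] fs g(1) by simp
        have "Zero C A Z \<in> Hom C A Z" "Ident C A \<in> Hom C A A" "Zero C A Z \<cdot> Ident C A = Zero C A Z"
          by simp_all
        then have "vanishes gs (Ident C A)" using a gs g(2) unfolding ext_vanish_def by blast
        then show "vanishes (rev (tl fs)) (Ident C A)" using g(1) by simp
      qed
    qed
  qed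
qed

lemma pd_le_iff: "A \<in> Obj C \<Longrightarrow> pd C A \<le> enat n \<longleftrightarrow> (\<forall>k>n. ext_vanish k A)"
proof -
  assume A: "A \<in> Obj C"
  define S where "S = {enat n |n. \<forall>k>n. \<forall>B\<in>Obj C. is_singleton (Ext C k A B)}"
  have S: "S = {enat n |n. \<forall>k>n. ext_vanish k A}"
  proof -
    have "(\<forall>k>n. \<forall>B\<in>Obj C. is_singleton (Ext C k A B)) \<longleftrightarrow> (\<forall>k>n. ext_vanish k A)" for n :: nat
    proof -
      have "(\<forall>B\<in>Obj C. is_singleton (Ext C k A B)) \<longleftrightarrow> ext_vanish k A" if "n < k" for k
      proof -
        have "0 < k" using that by simp
        then show ?thesis by (rule Ext_singleton_iff_ext_vanish[OF _ A])
      qed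
      then show ?thesis by blast
    qed
    then show ?thesis unfolding S_def by presburger
  qed
  have "pd C A \<le> enat n \<longleftrightarrow> (\<exists>s\<in>S. s \<le> enat n)"
  proof
    assume a: "pd C A \<le> enat n"
    \<comment> \<open>A finite infimum in \<open>enat\<close> forces the set to be nonempty, and
      then the infimum is attained.\<close>
    have "S \<noteq> {}"
    proof
      assume "S = {}"
      then have "pd C A = \<infinity>" unfolding pd_def S_def[symmetric] by (simp add: top_enat_def)
      then show False using a by simp
    qed
    then have "Inf S \<in> S" by (metis Inf_enat_def LeastI_ex ex_in_conv)
    then show "\<exists>s\<in>S. s \<le> enat n" using a unfolding pd_def S_def[symmetric] by blast
  next
    assume "\<exists>s\<in>S. s \<le> enat n"
    then show "pd C A \<le> enat n" unfolding pd_def S_def[symmetric] by (meson Inf_lower order_trans)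
  qed
  also have "\<dots> \<longleftrightarrow> (\<forall>k>n. ext_vanish k A)"
    unfolding S by (auto intro: order_less_le_trans)
  finally show ?thesis .
qed

lemma gldim_le_iff: "gldim C \<le> enat n \<longleftrightarrow> (\<forall>A\<in>Obj C. \<forall>k>n. ext_vanish k A)"
  unfolding gldim_def using pd_le_iff by (simp add: SUP_le_iff)

end

section \<open>The abelian category of representations\<close>

locale quiver_rep = abelian_cat +
  fixes Q :: "('v, 'e) pre_digraph"
  assumes wf: "wf_digraph Q"
begin

abbreviation R :: "(('v, 'e, 'a, 'b) repr, ('v, 'e, 'a, 'b) repr_map) precat" where "R \<equiv> Rep Q C"

abbreviation ob :: "'v \<Rightarrow> ('v, 'e, 'a, 'b) repr \<Rightarrow> 'a" where "ob v M \<equiv> fst M v"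

abbreviation ar :: "'e \<Rightarrow> ('v, 'e, 'a, 'b) repr \<Rightarrow> 'b" where "ar e M \<equiv> snd M e"

definition ev :: "'v \<Rightarrow> ('v, 'e, 'a, 'b) repr_map \<Rightarrow> 'b" where "ev v F = snd (snd F) v"

lemma tail_vert [simp]: "e \<in> arcs Q \<Longrightarrow> tail Q e \<in> verts Q"
  and head_vert [simp]: "e \<in> arcs Q \<Longrightarrow> head Q e \<in> verts Q"
  using wf by (simp_all add: wf_digraph_def)

lemma reprD:
  assumes "M \<in> reprs Q C"
  shows "v \<in> verts Q \<Longrightarrow> ob v M \<in> Obj C"
    and "e \<in> arcs Q \<Longrightarrow> ar e M \<in> Hom C (ob (tail Q e) M) (ob (head Q e) M)"
  using assms by (auto simp: reprs_def PiE_iff)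

text \<open>Hides the extensionality of representations: data are given on the vertices and arrows
  of the quiver, and values elsewhere are normalised.\<close>

lemma repr_ex:
  assumes "\<And>v. v \<in> verts Q \<Longrightarrow> X v \<in> Obj C"
    and "\<And>e. e \<in> arcs Q \<Longrightarrow> \<phi> e \<in> Hom C (X (tail Q e)) (X (head Q e))"
  obtains M where "M \<in> reprs Q C" "\<And>v. v \<in> verts Q \<Longrightarrow> ob v M = X v" "\<And>e. e \<in> arcs Q \<Longrightarrow> ar e M = \<phi> e"
proof (rule that[of "(restrict X (verts Q), restrict \<phi> (arcs Q))"])
  show "(restrict X (verts Q), restrict \<phi> (arcs Q)) \<in> reprs Q C"
    using assms unfolding reprs_def by (auto simp del: in_Hom)
qed simp_all

lemma Obj_R [simp]: "Obj R = reprs Q C"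
  by (simp add: Rep_def)

lemma Hom_R_iff:
  "F \<in> Hom R M N \<longleftrightarrow> (\<exists>f. F = (M, N, f) \<and> M \<in> reprs Q C \<and> N \<in> reprs Q C \<and> f \<in> extensional (verts Q) \<and>
    (\<forall>v\<in>verts Q. f v \<in> Hom C (ob v M) (ob v N)) \<and>
    (\<forall>e\<in>arcs Q. ar e N \<cdot> f (tail Q e) = f (head Q e) \<cdot> ar e M))"
proof (cases F)
  case (fields M' N' f)
  obtain X \<phi> Y \<psi> where M: "M' = (X, \<phi>)" "N' = (Y, \<psi>)" by (metis surj_pair)
  show ?thesis
    unfolding fields M
    by (auto simp: Rep_def Hom_def repr_maps_def PiE_def Pi_iff)
qed

lemma HomR_D:
  assumes "F \<in> Hom R M N"
  shows "M \<in> reprs Q C" "N \<in> reprs Q C" "v \<in> verts Q \<Longrightarrow> ev v F \<in> Hom C (ob v M) (ob v N)"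
    "e \<in> arcs Q \<Longrightarrow> ar e N \<cdot> ev (tail Q e) F = ev (head Q e) F \<cdot> ar e M"
  using assms unfolding Hom_R_iff ev_def by (auto simp del: in_Hom)

lemma HomR_ex:
  assumes "M \<in> reprs Q C" "N \<in> reprs Q C"
    and "\<And>v. v \<in> verts Q \<Longrightarrow> f v \<in> Hom C (ob v M) (ob v N)"
    and "\<And>e. e \<in> arcs Q \<Longrightarrow> ar e N \<cdot> f (tail Q e) = f (head Q e) \<cdot> ar e M"
  obtains F where "F \<in> Hom R M N" "\<And>v. v \<in> verts Q \<Longrightarrow> ev v F = f v"
proof (rule that[of "(M, N, restrict f (verts Q))"])
  show "(M, N, restrict f (verts Q)) \<in> Hom R M N"
    unfolding Hom_R_iff using assms by (auto simp del: in_Hom)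
qed (simp add: ev_def)

lemma HomR_eqI:
  assumes "F \<in> Hom R M N" "G \<in> Hom R M N" "\<And>v. v \<in> verts Q \<Longrightarrow> ev v F = ev v G"
  shows "F = G"
  using assms unfolding Hom_R_iff ev_def by (auto intro: extensionalityI)

lemma comp_R:
  assumes "F \<in> Hom R M N" "G \<in> Hom R N P"
  shows "G \<cdot>\<^bsub>R\<^esub> F \<in> Hom R M P" "v \<in> verts Q \<Longrightarrow> ev v (G \<cdot>\<^bsub>R\<^esub> F) = ev v G \<cdot> ev v F"
proof -
  obtain f g where f: "F = (M, N, f)" "G = (N, P, g)"
    using assms unfolding Hom_R_iff by blast
  have eq: "G \<cdot>\<^bsub>R\<^esub> F = (M, P, \<lambda>v\<in>verts Q. g v \<cdot> f v)" by (simp add: f Rep_def)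
  note F = HomR_D[OF assms(1)] and G = HomR_D[OF assms(2)]
  have e [simp]: "ev v F = f v" "ev v G = g v" for v by (simp_all add: f ev_def)
  show "v \<in> verts Q \<Longrightarrow> ev v (G \<cdot>\<^bsub>R\<^esub> F) = ev v G \<cdot> ev v F" by (simp add: eq) (simp add: ev_def)
  have "ar e P \<cdot> (g (tail Q e) \<cdot> f (tail Q e)) = (g (head Q e) \<cdot> f (head Q e)) \<cdot> ar e M" if a: "e \<in> arcs Q" for e
  proof -
    note [simp] = HomD[OF F(3)[of "tail Q e", simplified e]] HomD[OF G(3)[of "tail Q e", simplified e]]
      HomD[OF F(3)[of "head Q e", simplified e]] HomD[OF G(3)[of "head Q e", simplified e]]
      HomD[OF reprD(2)[OF F(1) a]] HomD[OF reprD(2)[OF F(2) a]] HomD[OF reprD(2)[OF G(2) a]]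
    have 1: "ar e N \<cdot> f (tail Q e) = f (head Q e) \<cdot> ar e M" using F(4)[OF a] by simp
    have 2: "ar e P \<cdot> g (tail Q e) = g (head Q e) \<cdot> ar e N" using G(4)[OF a] by simp
    show ?thesis using a 1 by (simp add: comp_reduce[OF 2])
  qed
  moreover have "g v \<cdot> f v \<in> Hom C (ob v M) (ob v P)" if "v \<in> verts Q" for v
    using F(3)[OF that] G(3)[OF that] by simp
  ultimately show "G \<cdot>\<^bsub>R\<^esub> F \<in> Hom R M P"
    unfolding Hom_R_iff eq using F(1) G(2) by (auto simp del: in_Hom)
qed

lemma ident_R:
  assumes "M \<in> reprs Q C"
  shows "Ident R M \<in> Hom R M M" "v \<in> verts Q \<Longrightarrow> ev v (Ident R M) = Ident C (ob v M)"
proof -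
  have eq: "Ident R M = (M, M, \<lambda>v\<in>verts Q. Ident C (ob v M))" by (simp add: Rep_def)
  show "v \<in> verts Q \<Longrightarrow> ev v (Ident R M) = Ident C (ob v M)" by (simp add: eq ev_def)
  have "ar e M \<cdot> Ident C (ob (tail Q e) M) = Ident C (ob (head Q e) M) \<cdot> ar e M" if a: "e \<in> arcs Q" for e
    using HomD[OF reprD(2)[OF assms a]] by simp
  moreover have "Ident C (ob v M) \<in> Hom C (ob v M) (ob v M)" if "v \<in> verts Q" for v
    using reprD(1)[OF assms that] by simp
  ultimately show "Ident R M \<in> Hom R M M"
    unfolding Hom_R_iff eq using assms by (auto simp del: in_Hom)
qed

lemma zero_R:
  assumes "M \<in> reprs Q C" "N \<in> reprs Q C"
  shows "Zero R M N \<in> Hom R M N" "v \<in> verts Q \<Longrightarrow> ev v (Zero R M N) = Zero C (ob v M) (ob v N)"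
proof -
  have eq: "Zero R M N = (M, N, \<lambda>v\<in>verts Q. Zero C (ob v M) (ob v N))" by (simp add: Rep_def)
  show "v \<in> verts Q \<Longrightarrow> ev v (Zero R M N) = Zero C (ob v M) (ob v N)" by (simp add: eq ev_def)
  have "ar e N \<cdot> Zero C (ob (tail Q e) M) (ob (tail Q e) N) = Zero C (ob (head Q e) M) (ob (head Q e) N) \<cdot> ar e M"
    if a: "e \<in> arcs Q" for e
    using HomD[OF reprD(2)[OF assms(1) a]] HomD[OF reprD(2)[OF assms(2) a]] by simp
  moreover have "Zero C (ob v M) (ob v N) \<in> Hom C (ob v M) (ob v N)" if "v \<in> verts Q" for v
    using reprD(1)[OF assms(1) that] reprD(1)[OF assms(2) that] by simp
  ultimately show "Zero R M N \<in> Hom R M N"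
    unfolding Hom_R_iff eq using assms by (auto simp del: in_Hom)
qed

lemma plus_R:
  assumes "F \<in> Hom R M N" "G \<in> Hom R M N"
  shows "Plus R F G \<in> Hom R M N" "v \<in> verts Q \<Longrightarrow> ev v (Plus R F G) = ev v F \<boxplus> ev v G"
proof -
  obtain f g where f: "F = (M, N, f)" "G = (M, N, g)"
    using assms unfolding Hom_R_iff by blast
  have eq: "Plus R F G = (M, N, \<lambda>v\<in>verts Q. f v \<boxplus> g v)" by (simp add: f Rep_def)
  note F = HomR_D[OF assms(1)] and G = HomR_D[OF assms(2)]
  have e [simp]: "ev v F = f v" "ev v G = g v" for v by (simp_all add: f ev_def)
  show "v \<in> verts Q \<Longrightarrow> ev v (Plus R F G) = ev v F \<boxplus> ev v G" by (simp add: eq) (simp add: ev_def)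
  have "ar e N \<cdot> (f (tail Q e) \<boxplus> g (tail Q e)) = (f (head Q e) \<boxplus> g (head Q e)) \<cdot> ar e M" if a: "e \<in> arcs Q" for e
    using HomD[OF F(3)[of "tail Q e", simplified e]] HomD[OF G(3)[of "tail Q e", simplified e]]
      HomD[OF F(3)[of "head Q e", simplified e]] HomD[OF G(3)[of "head Q e", simplified e]]
      HomD[OF reprD(2)[OF F(1) a]] HomD[OF reprD(2)[OF F(2) a]] F(4)[OF a] G(4)[OF a] a by simp
  moreover have "f v \<boxplus> g v \<in> Hom C (ob v M) (ob v N)" if "v \<in> verts Q" for v
    using F(3)[OF that] G(3)[OF that] by simp
  ultimately show "Plus R F G \<in> Hom R M N"
    unfolding Hom_R_iff eq using F(1,2) by (auto simp del: in_Hom)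
qed

lemma preadditive_R: "preadditive_cat R"
proof (intro preadditive_cat.intro cat.intro preadditive_cat_axioms.intro)
  fix F assume F: "F \<in> Arr R"
  have "F \<in> Hom R (Dom R F) (Cod R F)" using F by (simp add: Hom_def)
  then show "Dom R F \<in> Obj R" "Cod R F \<in> Obj R" using HomR_D(1,2) by auto
next
  fix M assume "M \<in> Obj R" then show "Ident R M \<in> Hom R M M" using ident_R(1) by simp
next
  fix F M N G P assume "F \<in> Hom R M N" "G \<in> Hom R N P"
  then show "G \<cdot>\<^bsub>R\<^esub> F \<in> Hom R M P" by (rule comp_R)
next
  fix F M N assume F: "F \<in> Hom R M N"
  note D = HomR_D[OF F]
  show "F \<cdot>\<^bsub>R\<^esub> Ident R M = F"
    by (rule HomR_eqI[OF comp_R(1)[OF ident_R(1)[OF D(1)] F] F])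
      (use D(3) in \<open>simp add: comp_R(2)[OF ident_R(1)[OF D(1)] F] ident_R(2)[OF D(1)]\<close>)
  show "Ident R N \<cdot>\<^bsub>R\<^esub> F = F"
    by (rule HomR_eqI[OF comp_R(1)[OF F ident_R(1)[OF D(2)]] F])
      (use D(3) in \<open>simp add: comp_R(2)[OF F ident_R(1)[OF D(2)]] ident_R(2)[OF D(2)]\<close>)
next
  fix F M N G P H S assume F: "F \<in> Hom R M N" and G: "G \<in> Hom R N P" and H: "H \<in> Hom R P S"
  note GF = comp_R[OF F G] and HG = comp_R[OF G H]
  show "H \<cdot>\<^bsub>R\<^esub> (G \<cdot>\<^bsub>R\<^esub> F) = H \<cdot>\<^bsub>R\<^esub> G \<cdot>\<^bsub>R\<^esub> F"
  proof (rule HomR_eqI[OF comp_R(1)[OF GF(1) H] comp_R(1)[OF F HG(1)]])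
    fix v assume v: "v \<in> verts Q"
    show "ev v (H \<cdot>\<^bsub>R\<^esub> (G \<cdot>\<^bsub>R\<^esub> F)) = ev v (H \<cdot>\<^bsub>R\<^esub> G \<cdot>\<^bsub>R\<^esub> F)"
      using HomD[OF HomR_D(3)[OF F v]] HomD[OF HomR_D(3)[OF G v]] HomD[OF HomR_D(3)[OF H v]]
      unfolding comp_R(2)[OF GF(1) H v] comp_R(2)[OF F HG(1) v] GF(2)[OF v] HG(2)[OF v] by simp
  qed
next
  fix M N assume MN: "M \<in> Obj R" "N \<in> Obj R"
  then have MN': "M \<in> reprs Q C" "N \<in> reprs Q C" by simp_all
  note z = zero_R[OF MN']
  show "comm_group (hom_group R M N)"
  proof (rule comm_groupI)
    fix F G assume "F \<in> carrier (hom_group R M N)" "G \<in> carrier (hom_group R M N)"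
    then have FG: "F \<in> Hom R M N" "G \<in> Hom R M N" by (simp_all add: hom_group_def)
    then show "F \<otimes>\<^bsub>hom_group R M N\<^esub> G \<in> carrier (hom_group R M N)"
      using plus_R(1) by (simp add: hom_group_def)
    have "Plus R F G = Plus R G F"
    proof (rule HomR_eqI[OF plus_R(1)[OF FG] plus_R(1)[OF FG(2,1)]])
      fix v assume v: "v \<in> verts Q"
      show "ev v (Plus R F G) = ev v (Plus R G F)"
        unfolding plus_R(2)[OF FG v] plus_R(2)[OF FG(2,1) v]
        by (rule plus_commute) (use HomD[OF HomR_D(3)[OF FG(1) v]] HomD[OF HomR_D(3)[OF FG(2) v]] in simp_all)
    qed
    then show "F \<otimes>\<^bsub>hom_group R M N\<^esub> G = G \<otimes>\<^bsub>hom_group R M N\<^esub> F" by (simp add: hom_group_def)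
    fix H assume "H \<in> carrier (hom_group R M N)"
    then have H: "H \<in> Hom R M N" by (simp add: hom_group_def)
    have "Plus R (Plus R F G) H = Plus R F (Plus R G H)"
    proof (rule HomR_eqI[OF plus_R(1)[OF plus_R(1)[OF FG] H] plus_R(1)[OF FG(1) plus_R(1)[OF FG(2) H]]])
      fix v assume v: "v \<in> verts Q"
      show "ev v (Plus R (Plus R F G) H) = ev v (Plus R F (Plus R G H))"
        unfolding plus_R(2)[OF plus_R(1)[OF FG] H v] plus_R(2)[OF FG v]
          plus_R(2)[OF FG(1) plus_R(1)[OF FG(2) H] v] plus_R(2)[OF FG(2) H v]
        by (rule plus_assoc) (use HomD[OF HomR_D(3)[OF FG(1) v]] HomD[OF HomR_D(3)[OF FG(2) v]]
            HomD[OF HomR_D(3)[OF H v]] in simp_all)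
    qed
    then show "F \<otimes>\<^bsub>hom_group R M N\<^esub> G \<otimes>\<^bsub>hom_group R M N\<^esub> H =
      F \<otimes>\<^bsub>hom_group R M N\<^esub> (G \<otimes>\<^bsub>hom_group R M N\<^esub> H)" by (simp add: hom_group_def)
  next
    fix F assume "F \<in> carrier (hom_group R M N)"
    then have F: "F \<in> Hom R M N" by (simp add: hom_group_def)
    have "Plus R (Zero R M N) F = F"
    proof (rule HomR_eqI[OF plus_R(1)[OF z(1) F] F])
      fix v assume v: "v \<in> verts Q"
      show "ev v (Plus R (Zero R M N) F) = ev v F"
        unfolding plus_R(2)[OF z(1) F v] z(2)[OF v] using HomD[OF HomR_D(3)[OF F v]] by simp
    qed
    then show "\<one>\<^bsub>hom_group R M N\<^esub> \<otimes>\<^bsub>hom_group R M N\<^esub> F = F" by (simp add: hom_group_def)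
    obtain G where G: "G \<in> Hom R M N" "\<And>v. v \<in> verts Q \<Longrightarrow> ev v G = neg (ev v F)"
    proof (rule HomR_ex[of M N "\<lambda>v. neg (ev v F)"])
      fix v assume v: "v \<in> verts Q"
      show "neg (ev v F) \<in> Hom C (ob v M) (ob v N)" using HomR_D(3)[OF F v] by simp
    next
      fix e assume e: "e \<in> arcs Q"
      note T = HomD[OF HomR_D(3)[OF F tail_vert[OF e]]] HomD[OF HomR_D(3)[OF F head_vert[OF e]]]
        HomD[OF reprD(2)[OF MN'(1) e]] HomD[OF reprD(2)[OF MN'(2) e]]
      show "ar e N \<cdot> neg (ev (tail Q e) F) = neg (ev (head Q e) F) \<cdot> ar e M"
        using HomR_D(4)[OF F e] T by simp
    qed (use MN' in blast)+
    have "Plus R G F = Zero R M N"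
    proof (rule HomR_eqI[OF plus_R(1)[OF G(1) F] z(1)])
      fix v assume v: "v \<in> verts Q"
      show "ev v (Plus R G F) = ev v (Zero R M N)"
        unfolding plus_R(2)[OF G(1) F v] z(2)[OF v] G(2)[OF v] using HomD[OF HomR_D(3)[OF F v]] by simp
    qed
    then show "\<exists>G\<in>carrier (hom_group R M N). G \<otimes>\<^bsub>hom_group R M N\<^esub> F = \<one>\<^bsub>hom_group R M N\<^esub>"
      using G(1) by (intro bexI[of _ G]) (simp_all add: hom_group_def)
  qed (use z(1) in \<open>simp add: hom_group_def\<close>)
next
  fix F M N G H P assume F: "F \<in> Hom R M N" and G: "G \<in> Hom R M N" and H: "H \<in> Hom R N P"
  note FG = plus_R[OF F G] and HF = comp_R[OF F H] and HG = comp_R[OF G H]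
  show "H \<cdot>\<^bsub>R\<^esub> Plus R F G = Plus R (H \<cdot>\<^bsub>R\<^esub> F) (H \<cdot>\<^bsub>R\<^esub> G)"
  proof (rule HomR_eqI[OF comp_R(1)[OF FG(1) H] plus_R(1)[OF HF(1) HG(1)]])
    fix v assume v: "v \<in> verts Q"
    show "ev v (H \<cdot>\<^bsub>R\<^esub> Plus R F G) = ev v (Plus R (H \<cdot>\<^bsub>R\<^esub> F) (H \<cdot>\<^bsub>R\<^esub> G))"
      unfolding comp_R(2)[OF FG(1) H v] FG(2)[OF v] plus_R(2)[OF HF(1) HG(1) v] HF(2)[OF v] HG(2)[OF v]
      using HomD[OF HomR_D(3)[OF F v]] HomD[OF HomR_D(3)[OF G v]] HomD[OF HomR_D(3)[OF H v]] by simp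
  qed
next
  fix H M N F P G assume H: "H \<in> Hom R M N" and F: "F \<in> Hom R N P" and G: "G \<in> Hom R N P"
  note FG = plus_R[OF F G] and HF = comp_R[OF H F] and HG = comp_R[OF H G]
  show "Plus R F G \<cdot>\<^bsub>R\<^esub> H = Plus R (F \<cdot>\<^bsub>R\<^esub> H) (G \<cdot>\<^bsub>R\<^esub> H)"
  proof (rule HomR_eqI[OF comp_R(1)[OF H FG(1)] plus_R(1)[OF HF(1) HG(1)]])
    fix v assume v: "v \<in> verts Q"
    show "ev v (Plus R F G \<cdot>\<^bsub>R\<^esub> H) = ev v (Plus R (F \<cdot>\<^bsub>R\<^esub> H) (G \<cdot>\<^bsub>R\<^esub> H))"
      unfolding comp_R(2)[OF H FG(1) v] FG(2)[OF v] plus_R(2)[OF HF(1) HG(1) v] HF(2)[OF v] HG(2)[OF v]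
      using HomD[OF HomR_D(3)[OF F v]] HomD[OF HomR_D(3)[OF G v]] HomD[OF HomR_D(3)[OF H v]] by simp
  qed
qed

section \<open>Kernels, cokernels and biproducts vertex by vertex\<close>

interpretation Rp: preadditive_cat R by (rule preadditive_R)

text \<open>By naturality of \<open>F\<close>, an arrow of \<open>M\<close> maps the kernel at its
  tail into the kernel at its head; the induced arrows make the chosen kernels a
  representation.\<close>

lemma rep_kernel:
  assumes F: "F \<in> Hom R M N"
  obtains K \<kappa> where "\<kappa> \<in> Hom R K M" "\<And>v. v \<in> verts Q \<Longrightarrow> is_kernel C (ev v F) (ev v \<kappa>)"
proof -
  define k where "k v = (SOME k. is_kernel C (ev v F) k)" for v
  define X where "X v = Dom C (k v)" for v
  have kv: "is_kernel C (ev v F) (k v)" if "v \<in> verts Q" for v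
    unfolding k_def using HomD(1)[OF HomR_D(3)[OF F that]] ex_kernel someI_ex by metis
  have kH: "k v \<in> Hom C (X v) (ob v M)" if "v \<in> verts Q" for v
    using is_kernelD(2,3)[OF kv[OF that]] HomD[OF HomR_D(3)[OF F that]] by (simp add: X_def)
  have "\<exists>u. u \<in> Hom C (X (tail Q e)) (X (head Q e)) \<and> k (head Q e) \<cdot> u = ar e M \<cdot> k (tail Q e)"
    if e: "e \<in> arcs Q" for e
  proof -
    note t = tail_vert[OF e] and h = head_vert[OF e]
    note [simp] = HomD[OF kH[OF t]] HomD[OF kH[OF h]] HomD[OF HomR_D(3)[OF F t]] HomD[OF HomR_D(3)[OF F h]]
      HomD[OF reprD(2)[OF HomR_D(1)[OF F] e]] HomD[OF reprD(2)[OF HomR_D(2)[OF F] e]]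
    have 0: "ev (tail Q e) F \<cdot> k (tail Q e) = Zero C (X (tail Q e)) (ob (tail Q e) N)"
      using is_kernelD(4)[OF kv[OF t]] by simp
    have "ev (head Q e) F \<cdot> (ar e M \<cdot> k (tail Q e)) = Zero C (X (tail Q e)) (ob (head Q e) N)"
      using 0 by (simp add: comp_reduce[OF HomR_D(4)[OF F e, symmetric]])
    then obtain u where "u \<in> Arr C" "Dom C u = X (tail Q e)" "Cod C u = Dom C (k (head Q e))"
      "k (head Q e) \<cdot> u = ar e M \<cdot> k (tail Q e)"
      by (rule kernel_lift[OF kv[OF h]]) simp_all
    then show ?thesis by (intro exI[of _ u]) simp
  qed
  then obtain \<phi> where \<phi>: "\<phi> e \<in> Hom C (X (tail Q e)) (X (head Q e))"
    "k (head Q e) \<cdot> \<phi> e = ar e M \<cdot> k (tail Q e)" if "e \<in> arcs Q" for e by metis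
  have XO: "X v \<in> Obj C" if "v \<in> verts Q" for v using HomD[OF kH[OF that]] by simp
  obtain K where K: "K \<in> reprs Q C" "\<And>v. v \<in> verts Q \<Longrightarrow> ob v K = X v" "\<And>e. e \<in> arcs Q \<Longrightarrow> ar e K = \<phi> e"
    using repr_ex[of X \<phi>, OF XO \<phi>(1)] by blast
  obtain \<kappa> where "\<kappa> \<in> Hom R K M" "\<And>v. v \<in> verts Q \<Longrightarrow> ev v \<kappa> = k v"
  proof (rule HomR_ex[OF K(1) HomR_D(1)[OF F], of k])
    show "k v \<in> Hom C (ob v K) (ob v M)" if "v \<in> verts Q" for v
      unfolding K(2)[OF that] by (rule kH[OF that])
    show "ar e M \<cdot> k (tail Q e) = k (head Q e) \<cdot> ar e K" if "e \<in> arcs Q" for e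
      unfolding K(3)[OF that] \<phi>(2)[OF that] ..
  qed blast
  then show thesis using that kv by metis
qed

lemma rep_cokernel:
  assumes F: "F \<in> Hom R M N"
  obtains K \<kappa> where "\<kappa> \<in> Hom R N K" "\<And>v. v \<in> verts Q \<Longrightarrow> is_cokernel C (ev v F) (ev v \<kappa>)"
proof -
  define k where "k v = (SOME k. is_cokernel C (ev v F) k)" for v
  define X where "X v = Cod C (k v)" for v
  have kv: "is_cokernel C (ev v F) (k v)" if "v \<in> verts Q" for v
    unfolding k_def using HomD(1)[OF HomR_D(3)[OF F that]] ex_cokernel someI_ex by metis
  have kH: "k v \<in> Hom C (ob v N) (X v)" if "v \<in> verts Q" for v
    using is_cokernelD(2,3)[OF kv[OF that]] HomD[OF HomR_D(3)[OF F that]] by (simp add: X_def)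
  have "\<exists>u. u \<in> Hom C (X (tail Q e)) (X (head Q e)) \<and> u \<cdot> k (tail Q e) = k (head Q e) \<cdot> ar e N"
    if e: "e \<in> arcs Q" for e
  proof -
    note t = tail_vert[OF e] and h = head_vert[OF e]
    note [simp] = HomD[OF kH[OF t]] HomD[OF kH[OF h]] HomD[OF HomR_D(3)[OF F t]] HomD[OF HomR_D(3)[OF F h]]
      HomD[OF reprD(2)[OF HomR_D(1)[OF F] e]] HomD[OF reprD(2)[OF HomR_D(2)[OF F] e]]
    have 0: "k (head Q e) \<cdot> ev (head Q e) F = Zero C (ob (head Q e) M) (X (head Q e))"
      using is_cokernelD(4)[OF kv[OF h]] by simp
    have "(k (head Q e) \<cdot> ar e N) \<cdot> ev (tail Q e) F = Zero C (ob (tail Q e) M) (X (head Q e))"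
      using HomR_D(4)[OF F e] by (simp add: comp_reduce[OF 0])
    then obtain u where "u \<in> Arr C" "Dom C u = Cod C (k (tail Q e))" "Cod C u = X (head Q e)"
      "u \<cdot> k (tail Q e) = k (head Q e) \<cdot> ar e N"
      by (rule cokernel_factor[OF kv[OF t]]) simp_all
    then show ?thesis by (intro exI[of _ u]) simp
  qed
  then obtain \<phi> where \<phi>: "\<phi> e \<in> Hom C (X (tail Q e)) (X (head Q e))"
    "\<phi> e \<cdot> k (tail Q e) = k (head Q e) \<cdot> ar e N" if "e \<in> arcs Q" for e by metis
  have XO: "X v \<in> Obj C" if "v \<in> verts Q" for v using HomD[OF kH[OF that]] by simp
  obtain K where K: "K \<in> reprs Q C" "\<And>v. v \<in> verts Q \<Longrightarrow> ob v K = X v" "\<And>e. e \<in> arcs Q \<Longrightarrow> ar e K = \<phi> e"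
    using repr_ex[of X \<phi>, OF XO \<phi>(1)] by blast
  obtain \<kappa> where "\<kappa> \<in> Hom R N K" "\<And>v. v \<in> verts Q \<Longrightarrow> ev v \<kappa> = k v"
  proof (rule HomR_ex[OF HomR_D(2)[OF F] K(1), of k])
    show "k v \<in> Hom C (ob v N) (ob v K)" if "v \<in> verts Q" for v
      unfolding K(2)[OF that] by (rule kH[OF that])
    show "ar e K \<cdot> k (tail Q e) = k (head Q e) \<cdot> ar e N" if "e \<in> arcs Q" for e
      unfolding K(3)[OF that] \<phi>(2)[OF that] ..
  qed blast
  then show thesis using that kv by metis
qed

text \<open>Lifts exist at each vertex, and they commute with the arrows of the quiver because the
  kernel at the head is a monomorphism.\<close>

lemma rep_kernelI:
  assumes F: "F \<in> Hom R M N" and \<kappa>: "\<kappa> \<in> Hom R K M"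
    and k: "\<And>v. v \<in> verts Q \<Longrightarrow> is_kernel C (ev v F) (ev v \<kappa>)"
  shows "is_kernel R F \<kappa>"
proof -
  note FD = Rp.HomD[OF F] and KD = Rp.HomD[OF \<kappa>]
  note FR = HomR_D[OF F] and KR = HomR_D[OF \<kappa>]
  have 0: "F \<cdot>\<^bsub>R\<^esub> \<kappa> = Zero R K N"
  proof (rule HomR_eqI[OF comp_R(1)[OF \<kappa> F] zero_R(1)[OF KR(1) FR(2)]])
    fix v assume v: "v \<in> verts Q"
    show "ev v (F \<cdot>\<^bsub>R\<^esub> \<kappa>) = ev v (Zero R K N)"
      unfolding comp_R(2)[OF \<kappa> F v] zero_R(2)[OF KR(1) FR(2) v]
      using is_kernelD(4)[OF k[OF v]] HomD[OF KR(3)[OF v]] HomD[OF FR(3)[OF v]] by simp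
  qed
  have ex: "\<exists>!u. u \<in> Hom R T K \<and> \<kappa> \<cdot>\<^bsub>R\<^esub> u = h"
    if h: "h \<in> Hom R T M" "F \<cdot>\<^bsub>R\<^esub> h = Zero R T N" for T h
  proof -
    note hR = HomR_D[OF h(1)]
    have "\<exists>u. u \<in> Hom C (ob v T) (ob v K) \<and> ev v \<kappa> \<cdot> u = ev v h" if v: "v \<in> verts Q" for v
    proof -
      have "ev v F \<cdot> ev v h = Zero C (ob v T) (ob v N)"
        using comp_R(2)[OF h(1) F v] zero_R(2)[OF hR(1) FR(2) v] h(2) by simp
      then obtain u where "u \<in> Arr C" "Dom C u = ob v T" "Cod C u = Dom C (ev v \<kappa>)" "ev v \<kappa> \<cdot> u = ev v h"
        by (rule kernel_lift[OF k[OF v]]) (use HomD[OF hR(3)[OF v]] HomD[OF FR(3)[OF v]] in simp_all)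
      then show ?thesis using HomD[OF KR(3)[OF v]] by (intro exI[of _ u]) simp
    qed
    then obtain u where u: "u v \<in> Hom C (ob v T) (ob v K)" "ev v \<kappa> \<cdot> u v = ev v h" if "v \<in> verts Q" for v
      by metis
    obtain U where U: "U \<in> Hom R T K" "\<And>v. v \<in> verts Q \<Longrightarrow> ev v U = u v"
    proof (rule HomR_ex[OF hR(1) KR(1), of u])
      fix e assume e: "e \<in> arcs Q"
      note t = tail_vert[OF e] and hd = head_vert[OF e]
      note [simp] = HomD[OF u(1)[OF t]] HomD[OF u(1)[OF hd]] HomD[OF KR(3)[OF t]] HomD[OF KR(3)[OF hd]]
        HomD[OF reprD(2)[OF KR(1) e]] HomD[OF reprD(2)[OF hR(1) e]] HomD[OF reprD(2)[OF FR(1) e]]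
      show "ar e K \<cdot> u (tail Q e) = u (head Q e) \<cdot> ar e T"
      proof (rule is_kernel_unique[OF k[OF hd], of _ _ "ob (tail Q e) T"])
        have "ev (head Q e) \<kappa> \<cdot> (ar e K \<cdot> u (tail Q e)) = ar e M \<cdot> ev (tail Q e) h"
          using u(2)[OF t] by (simp add: comp_reduce[OF KR(4)[OF e, symmetric]])
        also have "\<dots> = ev (head Q e) \<kappa> \<cdot> (u (head Q e) \<cdot> ar e T)"
          using hR(4)[OF e] by (simp add: comp_reduce[OF u(2)[OF hd]])
        finally show "ev (head Q e) \<kappa> \<cdot> (ar e K \<cdot> u (tail Q e)) = ev (head Q e) \<kappa> \<cdot> (u (head Q e) \<cdot> ar e T)" .
      qed simp_all
    qed (use u(1) in blast)+
    show ?thesis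
    proof (rule ex1I[of _ U])
      have "\<kappa> \<cdot>\<^bsub>R\<^esub> U = h"
        by (rule HomR_eqI[OF comp_R(1)[OF U(1) \<kappa>] h(1)]) (simp add: comp_R(2)[OF U(1) \<kappa>] U(2) u(2))
      then show "U \<in> Hom R T K \<and> \<kappa> \<cdot>\<^bsub>R\<^esub> U = h" using U(1) by blast
      fix W assume W: "W \<in> Hom R T K \<and> \<kappa> \<cdot>\<^bsub>R\<^esub> W = h"
      then have WH: "W \<in> Hom R T K" by blast
      show "W = U"
      proof (rule HomR_eqI[OF WH U(1)])
        fix v assume v: "v \<in> verts Q"
        have "ev v \<kappa> \<cdot> ev v W = ev v \<kappa> \<cdot> ev v U"
          using comp_R(2)[OF WH \<kappa> v] W U(2)[OF v] u(2)[OF v] by simp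
        then show "ev v W = ev v U"
          by (rule is_kernel_unique[OF k[OF v], of _ _ "ob v T"])
            (use HomR_D(3)[OF WH v] HomR_D(3)[OF U(1) v] HomD[OF KR(3)[OF v]] in simp_all)
      qed
    qed
  qed
  show ?thesis
    unfolding is_kernel_def FD(2,3) KD(2,3) using FD(1) KD(1) 0 ex by blast
qed

lemma rep_cokernelI:
  assumes F: "F \<in> Hom R M N" and \<kappa>: "\<kappa> \<in> Hom R N K"
    and k: "\<And>v. v \<in> verts Q \<Longrightarrow> is_cokernel C (ev v F) (ev v \<kappa>)"
  shows "is_cokernel R F \<kappa>"
proof -
  note FD = Rp.HomD[OF F] and KD = Rp.HomD[OF \<kappa>]
  note FR = HomR_D[OF F] and KR = HomR_D[OF \<kappa>]
  have 0: "\<kappa> \<cdot>\<^bsub>R\<^esub> F = Zero R M K"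
  proof (rule HomR_eqI[OF comp_R(1)[OF F \<kappa>] zero_R(1)[OF FR(1) KR(2)]])
    fix v assume v: "v \<in> verts Q"
    show "ev v (\<kappa> \<cdot>\<^bsub>R\<^esub> F) = ev v (Zero R M K)"
      unfolding comp_R(2)[OF F \<kappa> v] zero_R(2)[OF FR(1) KR(2) v]
      using is_cokernelD(4)[OF k[OF v]] HomD[OF KR(3)[OF v]] HomD[OF FR(3)[OF v]] by simp
  qed
  have ex: "\<exists>!u. u \<in> Hom R K T \<and> u \<cdot>\<^bsub>R\<^esub> \<kappa> = h"
    if h: "h \<in> Hom R N T" "h \<cdot>\<^bsub>R\<^esub> F = Zero R M T" for T h
  proof -
    note hR = HomR_D[OF h(1)]
    have "\<exists>u. u \<in> Hom C (ob v K) (ob v T) \<and> u \<cdot> ev v \<kappa> = ev v h" if v: "v \<in> verts Q" for v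
    proof -
      have "ev v h \<cdot> ev v F = Zero C (ob v M) (ob v T)"
        using comp_R(2)[OF F h(1) v] zero_R(2)[OF FR(1) hR(2) v] h(2) by simp
      then obtain u where "u \<in> Arr C" "Dom C u = Cod C (ev v \<kappa>)" "Cod C u = ob v T" "u \<cdot> ev v \<kappa> = ev v h"
        by (rule cokernel_factor[OF k[OF v]]) (use HomD[OF hR(3)[OF v]] HomD[OF FR(3)[OF v]] in simp_all)
      then show ?thesis using HomD[OF KR(3)[OF v]] by (intro exI[of _ u]) simp
    qed
    then obtain u where u: "u v \<in> Hom C (ob v K) (ob v T)" "u v \<cdot> ev v \<kappa> = ev v h" if "v \<in> verts Q" for v
      by metis
    obtain U where U: "U \<in> Hom R K T" "\<And>v. v \<in> verts Q \<Longrightarrow> ev v U = u v"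
    proof (rule HomR_ex[OF KR(2) hR(2), of u])
      fix e assume e: "e \<in> arcs Q"
      note t = tail_vert[OF e] and hd = head_vert[OF e]
      note [simp] = HomD[OF u(1)[OF t]] HomD[OF u(1)[OF hd]] HomD[OF KR(3)[OF t]] HomD[OF KR(3)[OF hd]]
        HomD[OF reprD(2)[OF KR(2) e]] HomD[OF reprD(2)[OF hR(2) e]] HomD[OF reprD(2)[OF FR(2) e]]
      show "ar e T \<cdot> u (tail Q e) = u (head Q e) \<cdot> ar e K"
      proof (rule is_epiD[OF is_cokernel_epi[OF k[OF t]]])
        have "(u (head Q e) \<cdot> ar e K) \<cdot> ev (tail Q e) \<kappa> = ev (head Q e) h \<cdot> ar e N"
          using KR(4)[OF e] by (simp add: comp_reduce[OF u(2)[OF hd]])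
        also have "\<dots> = (ar e T \<cdot> u (tail Q e)) \<cdot> ev (tail Q e) \<kappa>"
          using hR(4)[OF e] u(2)[OF t] by simp
        finally show "(ar e T \<cdot> u (tail Q e)) \<cdot> ev (tail Q e) \<kappa> = (u (head Q e) \<cdot> ar e K) \<cdot> ev (tail Q e) \<kappa>"
          by (rule sym)
      qed simp_all
    qed (use u(1) in blast)+
    show ?thesis
    proof (rule ex1I[of _ U])
      have "U \<cdot>\<^bsub>R\<^esub> \<kappa> = h"
        by (rule HomR_eqI[OF comp_R(1)[OF \<kappa> U(1)] h(1)]) (simp add: comp_R(2)[OF \<kappa> U(1)] U(2) u(2))
      then show "U \<in> Hom R K T \<and> U \<cdot>\<^bsub>R\<^esub> \<kappa> = h" using U(1) by blast
      fix W assume W: "W \<in> Hom R K T \<and> W \<cdot>\<^bsub>R\<^esub> \<kappa> = h"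
      then have WH: "W \<in> Hom R K T" by blast
      show "W = U"
      proof (rule HomR_eqI[OF WH U(1)])
        fix v assume v: "v \<in> verts Q"
        have "ev v W \<cdot> ev v \<kappa> = ev v U \<cdot> ev v \<kappa>"
          using comp_R(2)[OF \<kappa> WH v] W U(2)[OF v] u(2)[OF v] by simp
        then show "ev v W = ev v U"
          by (rule is_epiD[OF is_cokernel_epi[OF k[OF v]]])
            (use HomR_D(3)[OF WH v] HomR_D(3)[OF U(1) v] HomD[OF KR(3)[OF v]] in simp_all)
      qed
    qed
  qed
  show ?thesis
    unfolding is_cokernel_def FD(2,3) KD(2,3) using FD(1) KD(1) 0 ex by blast
qed

text \<open>The vertexwise kernel of \<open>F\<close> is a kernel in \<open>R\<close>, so it is zero
  when \<open>F\<close> is mono; and an arrow of \<open>C\<close> with zero kernel is mono.\<close>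

lemma rep_mono_ev:
  assumes F: "F \<in> Hom R M N" and m: "is_mono R F" and v: "v \<in> verts Q"
  shows "is_mono C (ev v F)"
proof -
  obtain K \<kappa> where \<kappa>: "\<kappa> \<in> Hom R K M" "\<And>v. v \<in> verts Q \<Longrightarrow> is_kernel C (ev v F) (ev v \<kappa>)"
    using rep_kernel[OF F] by blast
  have "is_kernel R F \<kappa>" by (rule rep_kernelI[OF F \<kappa>])
  note D = Rp.is_kernelD[OF this]
  have "F \<cdot>\<^bsub>R\<^esub> \<kappa> = Zero R K N" using D(4) Rp.HomD[OF F] Rp.HomD[OF \<kappa>(1)] by simp
  then have "\<kappa> = Zero R K (Dom R F)"
    by (rule Rp.is_mono_zeroD[OF m]) (use Rp.HomD[OF F] Rp.HomD[OF \<kappa>(1)] in simp_all)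
  then have k0: "ev v \<kappa> = Zero C (ob v K) (ob v M)"
    using zero_R(2)[OF HomR_D(1)[OF \<kappa>(1)] HomR_D(1)[OF F] v] Rp.HomD(2)[OF F] by simp
  note [simp] = HomD[OF HomR_D(3)[OF F v]] HomD[OF HomR_D(3)[OF \<kappa>(1) v]]
  show ?thesis
  proof (rule monoI[OF HomR_D(3)[OF F v]])
    fix x S assume x: "x \<in> Hom C S (ob v M)" "ev v F \<cdot> x = Zero C S (ob v N)"
    note [simp] = HomD[OF x(1)]
    obtain w where w: "w \<in> Arr C" "Dom C w = S" "Cod C w = Dom C (ev v \<kappa>)" "ev v \<kappa> \<cdot> w = x"
      by (rule kernel_lift[OF \<kappa>(2)[OF v] x(2)]) simp_all
    then show "x = Zero C S (ob v M)" unfolding k0 by simp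
  qed
qed

lemma rep_epi_ev:
  assumes F: "F \<in> Hom R M N" and m: "is_epi R F" and v: "v \<in> verts Q"
  shows "is_epi C (ev v F)"
proof -
  obtain K \<kappa> where \<kappa>: "\<kappa> \<in> Hom R N K" "\<And>v. v \<in> verts Q \<Longrightarrow> is_cokernel C (ev v F) (ev v \<kappa>)"
    using rep_cokernel[OF F] by blast
  have "is_cokernel R F \<kappa>" by (rule rep_cokernelI[OF F \<kappa>])
  note D = Rp.is_cokernelD[OF this]
  have "\<kappa> \<cdot>\<^bsub>R\<^esub> F = Zero R M K" using D(4) Rp.HomD[OF F] Rp.HomD[OF \<kappa>(1)] by simp
  then have "\<kappa> = Zero R (Cod R F) K"
    by (rule Rp.is_epi_zeroD[OF m]) (use Rp.HomD[OF F] Rp.HomD[OF \<kappa>(1)] in simp_all)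
  then have k0: "ev v \<kappa> = Zero C (ob v N) (ob v K)"
    using zero_R(2)[OF HomR_D(2)[OF F] HomR_D(2)[OF \<kappa>(1)] v] Rp.HomD(3)[OF F] by simp
  note [simp] = HomD[OF HomR_D(3)[OF F v]] HomD[OF HomR_D(3)[OF \<kappa>(1) v]]
  show ?thesis
  proof (rule epiI[OF HomR_D(3)[OF F v]])
    fix x S assume x: "x \<in> Hom C (ob v N) S" "x \<cdot> ev v F = Zero C (ob v M) S"
    note [simp] = HomD[OF x(1)]
    obtain w where w: "w \<in> Arr C" "Dom C w = Cod C (ev v \<kappa>)" "Cod C w = S" "w \<cdot> ev v \<kappa> = x"
      by (rule cokernel_factor[OF \<kappa>(2)[OF v] x(2)]) simp_all
    then show "x = Zero C (ob v N) S" unfolding k0 by simp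
  qed
qed

lemma rep_biprod:
  assumes M: "M \<in> reprs Q C" and N: "N \<in> reprs Q C"
  shows "\<exists>P \<pi>. is_product R (UNIV :: bool set) (\<lambda>b. if b then M else N) P \<pi>"
proof -
  have "\<forall>v. \<exists>P i\<^sub>1 i\<^sub>2 p\<^sub>1 p\<^sub>2. v \<in> verts Q \<longrightarrow> biprod (ob v M) (ob v N) P i\<^sub>1 i\<^sub>2 p\<^sub>1 p\<^sub>2"
    using obtain_biprod reprD(1)[OF M] reprD(1)[OF N] by metis
  then obtain P i\<^sub>1 i\<^sub>2 p\<^sub>1 p\<^sub>2 where bp:
    "\<And>v. v \<in> verts Q \<Longrightarrow> biprod (ob v M) (ob v N) (P v) (i\<^sub>1 v) (i\<^sub>2 v) (p\<^sub>1 v) (p\<^sub>2 v)" by metis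
  define \<phi> where "\<phi> e = i\<^sub>1 (head Q e) \<cdot> (ar e M \<cdot> p\<^sub>1 (tail Q e)) \<boxplus> i\<^sub>2 (head Q e) \<cdot> (ar e N \<cdot> p\<^sub>2 (tail Q e))" for e
  have PO: "P v \<in> Obj C" if "v \<in> verts Q" for v using biprodD[OF bp[OF that]] by simp
  have \<phi>H: "\<phi> e \<in> Hom C (P (tail Q e)) (P (head Q e))" if e: "e \<in> arcs Q" for e
    unfolding \<phi>_def using biprodD[OF bp[OF tail_vert[OF e]]] biprodD[OF bp[OF head_vert[OF e]]]
      HomD[OF reprD(2)[OF M e]] HomD[OF reprD(2)[OF N e]] by simp
  obtain PR where PR: "PR \<in> reprs Q C" "\<And>v. v \<in> verts Q \<Longrightarrow> ob v PR = P v" "\<And>e. e \<in> arcs Q \<Longrightarrow> ar e PR = \<phi> e"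
    using repr_ex[of P \<phi>, OF PO \<phi>H] by blast
  obtain p where p: "p \<in> Hom R PR M" "\<And>v. v \<in> verts Q \<Longrightarrow> ev v p = p\<^sub>1 v"
  proof (rule HomR_ex[OF PR(1) M, of p\<^sub>1])
    fix e assume e: "e \<in> arcs Q"
    note [simp] = biprodD[OF bp[OF tail_vert[OF e]]] biprodD[OF bp[OF head_vert[OF e]]]
      HomD[OF reprD(2)[OF M e]] HomD[OF reprD(2)[OF N e]]
    show "ar e M \<cdot> p\<^sub>1 (tail Q e) = p\<^sub>1 (head Q e) \<cdot> ar e PR" unfolding PR(3)[OF e] \<phi>_def by simp
  next
    fix v assume v: "v \<in> verts Q"
    show "p\<^sub>1 v \<in> Hom C (ob v PR) (ob v M)" unfolding PR(2)[OF v] using biprodD[OF bp[OF v]] by simp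
  qed blast
  obtain q where q: "q \<in> Hom R PR N" "\<And>v. v \<in> verts Q \<Longrightarrow> ev v q = p\<^sub>2 v"
  proof (rule HomR_ex[OF PR(1) N, of p\<^sub>2])
    fix e assume e: "e \<in> arcs Q"
    note [simp] = biprodD[OF bp[OF tail_vert[OF e]]] biprodD[OF bp[OF head_vert[OF e]]]
      HomD[OF reprD(2)[OF M e]] HomD[OF reprD(2)[OF N e]]
    show "ar e N \<cdot> p\<^sub>2 (tail Q e) = p\<^sub>2 (head Q e) \<cdot> ar e PR" unfolding PR(3)[OF e] \<phi>_def by simp
  next
    fix v assume v: "v \<in> verts Q"
    show "p\<^sub>2 v \<in> Hom C (ob v PR) (ob v N)" unfolding PR(2)[OF v] using biprodD[OF bp[OF v]] by simp
  qed blast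
  have ex: "\<exists>!u. u \<in> Hom R T PR \<and> p \<cdot>\<^bsub>R\<^esub> u = f \<and> q \<cdot>\<^bsub>R\<^esub> u = g"
    if f: "f \<in> Hom R T M" and g: "g \<in> Hom R T N" for T f g
  proof -
    obtain u where u: "u \<in> Hom R T PR" "\<And>v. v \<in> verts Q \<Longrightarrow> ev v u = i\<^sub>1 v \<cdot> ev v f \<boxplus> i\<^sub>2 v \<cdot> ev v g"
    proof (rule HomR_ex[OF HomR_D(1)[OF f] PR(1), of "\<lambda>v. i\<^sub>1 v \<cdot> ev v f \<boxplus> i\<^sub>2 v \<cdot> ev v g"])
      fix v assume v: "v \<in> verts Q"
      show "i\<^sub>1 v \<cdot> ev v f \<boxplus> i\<^sub>2 v \<cdot> ev v g \<in> Hom C (ob v T) (ob v PR)"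
        using biprodD[OF bp[OF v]] HomD[OF HomR_D(3)[OF f v]] HomD[OF HomR_D(3)[OF g v]] PR(2)[OF v] by simp
    next
      fix e assume e: "e \<in> arcs Q"
      note t = tail_vert[OF e] and hd = head_vert[OF e]
      note [simp] = biprodD[OF bp[OF t]] biprodD[OF bp[OF hd]]
        HomD[OF reprD(2)[OF M e]] HomD[OF reprD(2)[OF N e]] HomD[OF reprD(2)[OF HomR_D(1)[OF f] e]]
        HomD[OF HomR_D(3)[OF f t]] HomD[OF HomR_D(3)[OF g t]] HomD[OF HomR_D(3)[OF f hd]] HomD[OF HomR_D(3)[OF g hd]]
      show "ar e PR \<cdot> (i\<^sub>1 (tail Q e) \<cdot> ev (tail Q e) f \<boxplus> i\<^sub>2 (tail Q e) \<cdot> ev (tail Q e) g) =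
        (i\<^sub>1 (head Q e) \<cdot> ev (head Q e) f \<boxplus> i\<^sub>2 (head Q e) \<cdot> ev (head Q e) g) \<cdot> ar e T"
        unfolding PR(3)[OF e] \<phi>_def using HomR_D(4)[OF f e] HomR_D(4)[OF g e] by simp
    qed blast
    show ?thesis
    proof (rule ex1I[of _ u])
      have "p \<cdot>\<^bsub>R\<^esub> u = f"
      proof (rule HomR_eqI[OF comp_R(1)[OF u(1) p(1)] f])
        fix v assume v: "v \<in> verts Q"
        show "ev v (p \<cdot>\<^bsub>R\<^esub> u) = ev v f"
          unfolding comp_R(2)[OF u(1) p(1) v] u(2)[OF v] p(2)[OF v]
          using biprodD[OF bp[OF v]] HomD[OF HomR_D(3)[OF f v]] HomD[OF HomR_D(3)[OF g v]] by simp
      qed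
      moreover have "q \<cdot>\<^bsub>R\<^esub> u = g"
      proof (rule HomR_eqI[OF comp_R(1)[OF u(1) q(1)] g])
        fix v assume v: "v \<in> verts Q"
        show "ev v (q \<cdot>\<^bsub>R\<^esub> u) = ev v g"
          unfolding comp_R(2)[OF u(1) q(1) v] u(2)[OF v] q(2)[OF v]
          using biprodD[OF bp[OF v]] HomD[OF HomR_D(3)[OF f v]] HomD[OF HomR_D(3)[OF g v]] by simp
      qed
      ultimately show "u \<in> Hom R T PR \<and> p \<cdot>\<^bsub>R\<^esub> u = f \<and> q \<cdot>\<^bsub>R\<^esub> u = g" using u(1) by blast
      fix w assume w: "w \<in> Hom R T PR \<and> p \<cdot>\<^bsub>R\<^esub> w = f \<and> q \<cdot>\<^bsub>R\<^esub> w = g"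
      then have wH: "w \<in> Hom R T PR" by blast
      show "w = u"
      proof (rule HomR_eqI[OF wH u(1)])
        fix v assume v: "v \<in> verts Q"
        have 1: "p\<^sub>1 v \<cdot> ev v w = ev v f" "p\<^sub>2 v \<cdot> ev v w = ev v g"
          using comp_R(2)[OF wH p(1) v] comp_R(2)[OF wH q(1) v] w p(2)[OF v] q(2)[OF v] by simp_all
        have 2: "ev v w \<in> Arr C" "Cod C (ev v w) = P v"
          using HomD[OF HomR_D(3)[OF wH v]] PR(2)[OF v] by simp_all
        show "ev v w = ev v u"
          using biprod_decomp[OF bp[OF v] 2] unfolding u(2)[OF v] 1 .
      qed
    qed
  qed
  have "is_product R (UNIV :: bool set) (\<lambda>b. if b then M else N) PR (\<lambda>b. if b then p else q)"
    unfolding is_product_def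
  proof (intro conjI ballI allI impI)
    fix T and f :: "bool \<Rightarrow> _" assume f: "\<forall>i\<in>UNIV. f i \<in> Hom R T (if i then M else N)"
    have f': "f True \<in> Hom R T M" "f False \<in> Hom R T N"
      using f[rule_format, of True] f[rule_format, of False] by (simp_all only: UNIV_I if_True if_False)
    have "(\<forall>i\<in>UNIV. (if i then p else q) \<cdot>\<^bsub>R\<^esub> u = f i) \<longleftrightarrow> p \<cdot>\<^bsub>R\<^esub> u = f True \<and> q \<cdot>\<^bsub>R\<^esub> u = f False" for u
      by (auto simp: all_bool_eq)
    then show "\<exists>!u. u \<in> Hom R T PR \<and> (\<forall>i\<in>UNIV. (if i then p else q) \<cdot>\<^bsub>R\<^esub> u = f i)"
      using ex[OF f'] by simp
  next
    show "(if i then p else q) \<in> Hom R PR (if i then M else N)" for i using p(1) q(1) by presburger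
  qed (use PR(1) in simp)
  then show ?thesis by (intro exI)
qed

text \<open>Normality is inherited from the vertices: a monomorphism of representations is mono at
  each vertex and there the kernel of its cokernel, and these cokernels form a
  representation.\<close>

lemma abelian_R: "abelian_cat R"
proof (intro abelian_cat.intro abelian_cat_axioms.intro preadditive_R)
  obtain Z where Z: "Z \<in> Obj C" "\<And>f A. f \<in> Hom C A Z \<Longrightarrow> f = Zero C A Z"
    "\<And>f A. f \<in> Hom C Z A \<Longrightarrow> f = Zero C Z A" by (rule obtain_zero) blast
  obtain ZR where ZR: "ZR \<in> reprs Q C" "\<And>v. v \<in> verts Q \<Longrightarrow> ob v ZR = Z"
  proof (rule repr_ex[of "\<lambda>_. Z" "\<lambda>_. Zero C Z Z"])
    show "Zero C Z Z \<in> Hom C Z Z" using Z(1) by simp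
  qed (use Z(1) in blast)+
  have "\<exists>!f. f \<in> Hom R M ZR" if M: "M \<in> reprs Q C" for M
  proof (rule ex1I[of _ "Zero R M ZR"])
    fix f assume f: "f \<in> Hom R M ZR"
    show "f = Zero R M ZR"
    proof (rule HomR_eqI[OF f zero_R(1)[OF M ZR(1)]])
      fix v assume v: "v \<in> verts Q"
      show "ev v f = ev v (Zero R M ZR)"
        unfolding zero_R(2)[OF M ZR(1) v] using Z(2) HomR_D(3)[OF f v] unfolding ZR(2)[OF v] by blast
    qed
  qed (rule zero_R(1)[OF M ZR(1)])
  note to = this
  have from_: "\<exists>!f. f \<in> Hom R ZR M" if M: "M \<in> reprs Q C" for M
  proof (rule ex1I[of _ "Zero R ZR M"])
    fix f assume f: "f \<in> Hom R ZR M"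
    show "f = Zero R ZR M"
    proof (rule HomR_eqI[OF f zero_R(1)[OF ZR(1) M]])
      fix v assume v: "v \<in> verts Q"
      show "ev v f = ev v (Zero R ZR M)"
        unfolding zero_R(2)[OF ZR(1) M v] using Z(3) HomR_D(3)[OF f v] unfolding ZR(2)[OF v] by blast
    qed
  qed (rule zero_R(1)[OF ZR(1) M])
  have "is_zero_obj R ZR"
    unfolding is_zero_obj_def Obj_R by (intro conjI ballI ZR(1) to from_)
  then show "\<exists>Z. is_zero_obj R Z" by (rule exI)
next
  fix M N assume "M \<in> Obj R" "N \<in> Obj R"
  then show "\<exists>P \<pi>. is_product R (UNIV :: bool set) (\<lambda>b. if b then M else N) P \<pi>"
    using rep_biprod by simp
next
  fix F assume "F \<in> Arr R"
  then have F: "F \<in> Hom R (Dom R F) (Cod R F)" by simp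
  obtain M N where F': "F \<in> Hom R M N" using F by blast
  obtain K \<kappa> where k: "\<kappa> \<in> Hom R K M" "\<And>v. v \<in> verts Q \<Longrightarrow> is_kernel C (ev v F) (ev v \<kappa>)"
    using rep_kernel[OF F'] by blast
  show "\<exists>k. is_kernel R F k" by (rule exI) (rule rep_kernelI[OF F' k])
  obtain K' \<kappa>' where k': "\<kappa>' \<in> Hom R N K'" "\<And>v. v \<in> verts Q \<Longrightarrow> is_cokernel C (ev v F) (ev v \<kappa>')"
    using rep_cokernel[OF F'] by blast
  show "\<exists>k. is_cokernel R F k" by (rule exI) (rule rep_cokernelI[OF F' k'])
next
  fix F assume m: "is_mono R F"
  then have F: "F \<in> Hom R (Dom R F) (Cod R F)" by simp
  obtain K \<kappa> where \<kappa>: "\<kappa> \<in> Hom R (Cod R F) K" "\<And>v. v \<in> verts Q \<Longrightarrow> is_cokernel C (ev v F) (ev v \<kappa>)"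
    using rep_cokernel[OF F] by blast
  have "is_kernel R \<kappa> F"
    by (rule rep_kernelI[OF \<kappa>(1) F]) (rule mono_is_kernel[OF rep_mono_ev[OF F m] \<kappa>(2)])
  then show "\<exists>g. is_kernel R g F" by blast
next
  fix F assume m: "is_epi R F"
  then have F: "F \<in> Hom R (Dom R F) (Cod R F)" by simp
  obtain K \<kappa> where \<kappa>: "\<kappa> \<in> Hom R K (Dom R F)" "\<And>v. v \<in> verts Q \<Longrightarrow> is_kernel C (ev v F) (ev v \<kappa>)"
    using rep_kernel[OF F] by blast
  have "is_cokernel R \<kappa> F"
    by (rule rep_cokernelI[OF \<kappa>(1) F]) (rule epi_is_cokernel[OF rep_epi_ev[OF F m] \<kappa>(2)])
  then show "\<exists>g. is_cokernel R g F" by blast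
qed

end

section \<open>Coproducts of bounded size\<close>

lemma ex1_uniq: "\<lbrakk>\<exists>!x. P x; P a; P b\<rbrakk> \<Longrightarrow> a = b"
  by blast

context cat
begin

lemma coproduct_ex1:
  assumes "is_coproduct C I X S \<iota>" "T \<in> Obj C" "\<And>i. i \<in> I \<Longrightarrow> f i \<in> Hom C (X i) T"
  shows "\<exists>!u. u \<in> Hom C S T \<and> (\<forall>i\<in>I. u \<cdot> \<iota> i = f i)"
proof -
  have "\<forall>T\<in>Obj C. \<forall>f. (\<forall>i\<in>I. f i \<in> Hom C (X i) T) \<longrightarrow>
       (\<exists>!u. u \<in> Hom C S T \<and> (\<forall>i\<in>I. u \<cdot> \<iota> i = f i))"
    using assms(1) unfolding is_coproduct_def by (elim conjE)
  from this[rule_format, OF assms(2), of f, OF assms(3)] show ?thesis .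
qed

lemma coproduct_desc:
  assumes "is_coproduct C I X S \<iota>" "T \<in> Obj C" "\<And>i. i \<in> I \<Longrightarrow> f i \<in> Hom C (X i) T"
  obtains u where "u \<in> Hom C S T" "\<And>i. i \<in> I \<Longrightarrow> u \<cdot> \<iota> i = f i"
proof -
  have "\<exists>!u. u \<in> Hom C S T \<and> (\<forall>i\<in>I. u \<cdot> \<iota> i = f i)"
    by (rule coproduct_ex1[OF assms(1,2)]) (rule assms(3))
  then obtain u where "u \<in> Hom C S T" "\<forall>i\<in>I. u \<cdot> \<iota> i = f i" by (elim ex1E conjE)
  then show thesis by (intro that[of u]) (auto simp del: in_Hom)
qed

lemma coproduct_eqI:
  assumes "is_coproduct C I X S \<iota>" "u \<in> Hom C S T" "v \<in> Hom C S T" "\<And>i. i \<in> I \<Longrightarrow> u \<cdot> \<iota> i = v \<cdot> \<iota> i"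
  shows "u = v"
proof -
  have "\<iota> i \<in> Hom C (X i) S" if "i \<in> I" for i using assms(1) that unfolding is_coproduct_def by blast
  then have "v \<cdot> \<iota> i \<in> Hom C (X i) T" if "i \<in> I" for i using Comp_Hom that assms(3) by blast
  moreover have "T \<in> Obj C" using HomD[OF assms(2)] by blast
  ultimately have "\<exists>!w. w \<in> Hom C S T \<and> (\<forall>i\<in>I. w \<cdot> \<iota> i = v \<cdot> \<iota> i)"
    by (intro coproduct_ex1[OF assms(1)])
  moreover have "u \<in> Hom C S T \<and> (\<forall>i\<in>I. u \<cdot> \<iota> i = v \<cdot> \<iota> i)" "v \<in> Hom C S T \<and> (\<forall>i\<in>I. v \<cdot> \<iota> i = v \<cdot> \<iota> i)"
    using assms(2-4) by (simp_all del: in_Hom)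
  ultimately show ?thesis by (rule ex1_uniq)
qed

lemma coproduct_inj:
  assumes "is_coproduct C I X S \<iota>" "i \<in> I" shows "\<iota> i \<in> Hom C (X i) S"
  using assms unfolding is_coproduct_def by blast

lemma coproduct_reindex:
  assumes g: "bij_betw g I I'" and S: "is_coproduct C I' X S \<iota>" and X: "\<And>i. i \<in> I \<Longrightarrow> X (g i) = Y i"
  shows "is_coproduct C I Y S (\<lambda>i. \<iota> (g i))"
  unfolding is_coproduct_def
proof (intro conjI ballI allI impI)
  have gI: "g i \<in> I'" if "i \<in> I" for i using g that by (auto simp: bij_betw_def)
  show "S \<in> Obj C" using S by (simp add: is_coproduct_def)
  show "\<iota> (g i) \<in> Hom C (Y i) S" if "i \<in> I" for i
    using coproduct_inj[OF S gI[OF that]] X[OF that] by simp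
  fix T f assume T: "T \<in> Obj C" and f: "\<forall>i\<in>I. f i \<in> Hom C (Y i) T"
  let ?h = "inv_into I g"
  have h: "?h i \<in> I" "g (?h i) = i" if "i \<in> I'" for i
    using g that by (auto simp: bij_betw_def f_inv_into_f inv_into_into)
  have hg: "?h (g i) = i" if "i \<in> I" for i using g that by (simp add: bij_betw_def)
  have "f (?h i) \<in> Hom C (X i) T" if "i \<in> I'" for i using f h[OF that] X by metis
  then have "\<exists>!u. u \<in> Hom C S T \<and> (\<forall>i\<in>I'. u \<cdot> \<iota> i = f (?h i))"
    by (intro coproduct_ex1[OF S T])
  moreover have "(\<forall>i\<in>I'. u \<cdot> \<iota> i = f (?h i)) \<longleftrightarrow> (\<forall>i\<in>I. u \<cdot> \<iota> (g i) = f i)" for u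
    using gI h hg by metis
  ultimately show "\<exists>!u. u \<in> Hom C S T \<and> (\<forall>i\<in>I. u \<cdot> \<iota> (g i) = f i)" by simp
qed

end

text \<open>\<open>AB3\<close> and \<open>AB4\<close> speak of index sets on the type of
  \<open>\<kappa>\<close>, whereas the coproducts needed here are indexed by generators and paths.
  Such index sets are moved to the type of \<open>\<kappa>\<close> by a bijection and back by
  \<open>coproduct_reindex\<close>.\<close>

lemma small_index:
  fixes \<kappa> :: "'k rel"
  assumes "card_of (I :: 'i set) <o \<kappa>" "Card_order \<kappa>"
  obtains g and I' :: "'k set" where "bij_betw g I I'" "card_of I' <o \<kappa>"
proof -
  have "card_of I \<le>o card_of (Field \<kappa>)"
    using assms card_of_Field_ordIso ordIso_symmetric ordLeq_ordIso_trans ordLess_imp_ordLeq by blast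
  then obtain g where "inj_on g I" "g ` I \<subseteq> Field \<kappa>" using card_of_ordLeq[of I "Field \<kappa>"] by blast
  then have b: "bij_betw g I (g ` I)" by (simp add: bij_betw_def)
  then have "card_of (g ` I) =o card_of I" using card_of_ordIso ordIso_symmetric by blast
  then show thesis using that[OF b] assms(1) ordIso_ordLess_trans by blast
qed

context abelian_cat
begin

lemma small_coproduct:
  fixes \<kappa> :: "'k rel"
  assumes "AB4 \<kappa> C" "Card_order \<kappa>" "card_of (I :: 'i set) <o \<kappa>" "\<And>i. i \<in> I \<Longrightarrow> X i \<in> Obj C"
  shows "\<exists>S \<iota>. is_coproduct C I X S \<iota>"
proof -
  obtain g and I' :: "'k set" where g: "bij_betw g I I'" "card_of I' <o \<kappa>"
    using small_index[OF assms(3,2)] by blast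
  have "inv_into I g i \<in> I" if "i \<in> I'" for i using g(1) that by (auto simp: bij_betw_def inv_into_into)
  then have "\<forall>i\<in>I'. X (inv_into I g i) \<in> Obj C" using assms(4) by blast
  then obtain S \<iota> where S: "is_coproduct C I' (\<lambda>i. X (inv_into I g i)) S \<iota>"
    using assms(1) g(2) unfolding AB4_def AB3_def by meson
  have "is_coproduct C I X S (\<lambda>i. \<iota> (g i))"
    by (rule coproduct_reindex[OF g(1) S]) (use g(1) in \<open>simp add: bij_betw_def\<close>)
  then show ?thesis by (intro exI)
qed

lemma small_coproduct_exact:
  fixes \<kappa> :: "'k rel"
  assumes AB4: "AB4 \<kappa> C" "Card_order \<kappa>" and I: "card_of (I :: 'i set) <o \<kappa>"
    and k: "\<And>i. i \<in> I \<Longrightarrow> is_kernel C (p i) (k i)" "\<And>i. i \<in> I \<Longrightarrow> is_epi C (p i)"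
    and kH: "\<And>i. i \<in> I \<Longrightarrow> k i \<in> Hom C (K i) (F i)" and pH: "\<And>i. i \<in> I \<Longrightarrow> p i \<in> Hom C (F i) (A i)"
    and S: "is_coproduct C I K S\<^sub>1 \<iota>\<^sub>1" "is_coproduct C I F S\<^sub>2 \<iota>\<^sub>2" "is_coproduct C I A S\<^sub>3 \<iota>\<^sub>3"
    and u: "u \<in> Hom C S\<^sub>1 S\<^sub>2" "\<And>i. i \<in> I \<Longrightarrow> u \<cdot> \<iota>\<^sub>1 i = \<iota>\<^sub>2 i \<cdot> k i"
    and v: "v \<in> Hom C S\<^sub>2 S\<^sub>3" "\<And>i. i \<in> I \<Longrightarrow> v \<cdot> \<iota>\<^sub>2 i = \<iota>\<^sub>3 i \<cdot> p i"
  shows "is_kernel C v u" "is_epi C v"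
proof -
  obtain g and I' :: "'k set" where g: "bij_betw g I I'" "card_of I' <o \<kappa>"
    using small_index[OF I AB4(2)] by blast
  define h where "h = inv_into I g"
  have hI: "h i \<in> I" if "i \<in> I'" for i using g(1) that by (auto simp: bij_betw_def inv_into_into h_def)
  have b: "bij_betw h I' I" unfolding h_def by (rule bij_betw_inv_into[OF g(1)])
  have "short_exact C (k (h i)) (p (h i))" if "i \<in> I'" for i
    unfolding short_exact_def exact_at_iff
    using is_kernel_mono[OF k(1)] exct_kernel[OF k(1)] k(2) hI[OF that] by blast
  moreover have "is_coproduct C I' (\<lambda>i. Dom C (k (h i))) S\<^sub>1 (\<lambda>i. \<iota>\<^sub>1 (h i))"
    by (rule coproduct_reindex[OF b S(1)]) (use HomD(2)[OF kH] hI in simp)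
  moreover have "is_coproduct C I' (\<lambda>i. Cod C (k (h i))) S\<^sub>2 (\<lambda>i. \<iota>\<^sub>2 (h i))"
    by (rule coproduct_reindex[OF b S(2)]) (use HomD(3)[OF kH] hI in simp)
  moreover have "is_coproduct C I' (\<lambda>i. Cod C (p (h i))) S\<^sub>3 (\<lambda>i. \<iota>\<^sub>3 (h i))"
    by (rule coproduct_reindex[OF b S(3)]) (use HomD(3)[OF pH] hI in simp)
  moreover have "is_coproduct_map C I' S\<^sub>1 (\<lambda>i. \<iota>\<^sub>1 (h i)) S\<^sub>2 (\<lambda>i. \<iota>\<^sub>2 (h i)) (\<lambda>i. k (h i)) u"
    "is_coproduct_map C I' S\<^sub>2 (\<lambda>i. \<iota>\<^sub>2 (h i)) S\<^sub>3 (\<lambda>i. \<iota>\<^sub>3 (h i)) (\<lambda>i. p (h i)) v"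
    unfolding is_coproduct_map_def using u v hI by blast+
  ultimately have prem: "card_of I' <o \<kappa> \<and> (\<forall>i\<in>I'. short_exact C (k (h i)) (p (h i))) \<and>
      is_coproduct C I' (\<lambda>i. Dom C (k (h i))) S\<^sub>1 (\<lambda>i. \<iota>\<^sub>1 (h i)) \<and>
      is_coproduct C I' (\<lambda>i. Cod C (k (h i))) S\<^sub>2 (\<lambda>i. \<iota>\<^sub>2 (h i)) \<and>
      is_coproduct C I' (\<lambda>i. Cod C (p (h i))) S\<^sub>3 (\<lambda>i. \<iota>\<^sub>3 (h i)) \<and>
      is_coproduct_map C I' S\<^sub>1 (\<lambda>i. \<iota>\<^sub>1 (h i)) S\<^sub>2 (\<lambda>i. \<iota>\<^sub>2 (h i)) (\<lambda>i. k (h i)) u \<and>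
      is_coproduct_map C I' S\<^sub>2 (\<lambda>i. \<iota>\<^sub>2 (h i)) S\<^sub>3 (\<lambda>i. \<iota>\<^sub>3 (h i)) (\<lambda>i. p (h i)) v"
    using g(2) by (intro conjI ballI)
  have "short_exact C u v"
    by (rule AB4(1)[unfolded AB4_def, THEN conjunct2, THEN spec, THEN spec, THEN spec, THEN spec,
          THEN spec, THEN spec, THEN spec, THEN spec, THEN spec, THEN spec, THEN spec, THEN mp, OF prem])
  then show "is_kernel C v u" "is_epi C v"
    unfolding short_exact_def exact_at_iff using kernel_exct by blast+
qed

end

section \<open>Exactness of representations at each vertex\<close>

context quiver_rep
begin

interpretation Rp: abelian_cat R by (rule abelian_R)

lemma rep_monoI:
  assumes F: "F \<in> Hom R M N" and m: "\<And>v. v \<in> verts Q \<Longrightarrow> is_mono C (ev v F)"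
  shows "is_mono R F"
proof (rule Rp.monoI[OF F])
  fix x S assume x: "x \<in> Hom R S M" "F \<cdot>\<^bsub>R\<^esub> x = Zero R S N"
  note S = HomR_D(1)[OF x(1)] and M = HomR_D(1)[OF F] and N = HomR_D(2)[OF F]
  show "x = Zero R S M"
  proof (rule HomR_eqI[OF x(1) zero_R(1)[OF S M]])
    fix v assume v: "v \<in> verts Q"
    have "ev v F \<cdot> ev v x = Zero C (ob v S) (ob v N)"
      using comp_R(2)[OF x(1) F v] x(2) zero_R(2)[OF S N v] by simp
    then show "ev v x = ev v (Zero R S M)"
      unfolding zero_R(2)[OF S M v] by (rule mono_zero[OF m[OF v] _ HomR_D(3)[OF F v] HomR_D(3)[OF x(1) v]])
  qed
qed

lemma rep_epiI:
  assumes F: "F \<in> Hom R M N" and m: "\<And>v. v \<in> verts Q \<Longrightarrow> is_epi C (ev v F)"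
  shows "is_epi R F"
proof (rule Rp.epiI[OF F])
  fix x S assume x: "x \<in> Hom R N S" "x \<cdot>\<^bsub>R\<^esub> F = Zero R M S"
  note S = HomR_D(2)[OF x(1)] and M = HomR_D(1)[OF F] and N = HomR_D(2)[OF F]
  show "x = Zero R N S"
  proof (rule HomR_eqI[OF x(1) zero_R(1)[OF N S]])
    fix v assume v: "v \<in> verts Q"
    have "ev v x \<cdot> ev v F = Zero C (ob v M) (ob v S)"
      using comp_R(2)[OF F x(1) v] x(2) zero_R(2)[OF M S v] by simp
    then show "ev v x = ev v (Zero R N S)"
      unfolding zero_R(2)[OF N S v] by (rule epi_zero[OF m[OF v] _ HomR_D(3)[OF F v] HomR_D(3)[OF x(1) v]])
  qed
qed

lemma rep_zero_ev:
  assumes "G \<cdot>\<^bsub>R\<^esub> F = Zero R M P" "F \<in> Hom R M N" "G \<in> Hom R N P" "v \<in> verts Q"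
  shows "ev v G \<cdot> ev v F = Zero C (ob v M) (ob v P)"
  using comp_R(2)[OF assms(2,3,4)] assms(1) zero_R(2)[OF HomR_D(1)[OF assms(2)] HomR_D(2)[OF assms(3)] assms(4)]
  by simp

text \<open>An arbitrary kernel receives an arrow \<open>j\<close> from the vertexwise one, so at
  each vertex it lifts whatever the vertexwise kernel lifts; it is mono there by
  \<open>rep_mono_ev\<close>.\<close>

lemma rep_kernel_ev:
  assumes F: "F \<in> Hom R M N" and \<kappa>: "\<kappa> \<in> Hom R K M" and k: "is_kernel R F \<kappa>" and v: "v \<in> verts Q"
  shows "is_kernel C (ev v F) (ev v \<kappa>)"
proof -
  obtain K' \<kappa>' where \<kappa>': "\<kappa>' \<in> Hom R K' M" "\<And>v. v \<in> verts Q \<Longrightarrow> is_kernel C (ev v F) (ev v \<kappa>')"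
    using rep_kernel[OF F] by blast
  have k': "is_kernel R F \<kappa>'" by (rule rep_kernelI[OF F \<kappa>'])
  note T = Rp.HomD[OF F] Rp.HomD[OF \<kappa>] Rp.HomD[OF \<kappa>'(1)]
  obtain j where j: "j \<in> Arr R" "Dom R j = K'" "Cod R j = Dom R \<kappa>" "\<kappa> \<cdot>\<^bsub>R\<^esub> j = \<kappa>'"
    by (rule Rp.is_kernel_lift[OF k, of \<kappa>']) (use T Rp.is_kernelD(4)[OF k'] in simp_all)
  have jH: "j \<in> Hom R K' K" using j T by simp
  note [simp] = HomD[OF HomR_D(3)[OF F v]] HomD[OF HomR_D(3)[OF \<kappa> v]] HomD[OF HomR_D(3)[OF \<kappa>'(1) v]]
    HomD[OF HomR_D(3)[OF jH v]]
  have kj: "ev v \<kappa> \<cdot> ev v j = ev v \<kappa>'" using comp_R(2)[OF jH \<kappa> v] j(4) by simp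
  have z: "F \<cdot>\<^bsub>R\<^esub> \<kappa> = Zero R K N" using Rp.is_kernelD(4)[OF k] T by simp
  show ?thesis
  proof (rule is_kernelI)
    show "is_mono C (ev v \<kappa>)" by (rule rep_mono_ev[OF \<kappa> Rp.is_kernel_mono[OF k] v])
    show "ev v F \<cdot> ev v \<kappa> = Zero C (Dom C (ev v \<kappa>)) (Cod C (ev v F))"
      using rep_zero_ev[OF z \<kappa> F v] by simp
    fix h assume h: "h \<in> Arr C" "Cod C h = Dom C (ev v F)" "ev v F \<cdot> h = Zero C (Dom C h) (Cod C (ev v F))"
    obtain w where w: "w \<in> Arr C" "Dom C w = Dom C h" "Cod C w = Dom C (ev v \<kappa>')" "ev v \<kappa>' \<cdot> w = h"
      by (rule is_kernel_lift[OF \<kappa>'(2)[OF v] h])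
    then show "\<exists>u. u \<in> Hom C (Dom C h) (Dom C (ev v \<kappa>)) \<and> ev v \<kappa> \<cdot> u = h"
      by (intro exI[of _ "ev v j \<cdot> w"]) (simp add: comp_reduce[OF kj])
  qed simp_all
qed

lemma rep_exct_ev:
  assumes "Rp.exct F G" "F \<in> Hom R M N" "G \<in> Hom R N P" "v \<in> verts Q"
  shows "exct (ev v F) (ev v G)"
proof -
  obtain m e where m: "is_kernel R G m" and e: "is_epi R e" "Cod R e = Dom R m" "F = m \<cdot>\<^bsub>R\<^esub> e"
    using assms(1) unfolding Rp.exct_iff by blast
  obtain K where mH: "m \<in> Hom R K N" using Rp.is_kernelD[OF m] Rp.HomD[OF assms(3)] by simp
  have eH: "e \<in> Hom R M K"
    using e(1,2) Rp.HomD[OF mH] Rp.HomD[OF assms(2)] Rp.comp_typing(2)[of e m] e(3) by simp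
  have 1: "is_kernel C (ev v G) (ev v m)" by (rule rep_kernel_ev[OF assms(3) mH m assms(4)])
  have 2: "is_epi C (ev v e)" by (rule rep_epi_ev[OF eH e(1) assms(4)])
  have "ev v F = ev v m \<cdot> ev v e" using comp_R(2)[OF eH mH assms(4)] e(3) by simp
  then show ?thesis unfolding exct_iff
    using 1 2 HomD(3)[OF HomR_D(3)[OF eH assms(4)]] HomD(2)[OF HomR_D(3)[OF mH assms(4)]] by metis
qed

text \<open>\<open>F\<close> factors through the vertexwise kernel of \<open>G\<close> by an arrow
  \<open>E\<close>. Exactness at a vertex makes \<open>E\<close> epi there, and epimorphisms are
  detected at the vertices.\<close>

lemma rep_exctI:
  assumes F: "F \<in> Hom R M N" and G: "G \<in> Hom R N P" and ex: "\<And>v. v \<in> verts Q \<Longrightarrow> exct (ev v F) (ev v G)"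
  shows "Rp.exct F G"
proof -
  obtain K \<kappa> where \<kappa>: "\<kappa> \<in> Hom R K N" "\<And>v. v \<in> verts Q \<Longrightarrow> is_kernel C (ev v G) (ev v \<kappa>)"
    using rep_kernel[OF G] by blast
  have k: "is_kernel R G \<kappa>" by (rule rep_kernelI[OF G \<kappa>])
  have z: "G \<cdot>\<^bsub>R\<^esub> F = Zero R M P"
  proof (rule HomR_eqI[OF comp_R(1)[OF F G] zero_R(1)[OF HomR_D(1)[OF F] HomR_D(2)[OF G]]])
    fix v assume v: "v \<in> verts Q"
    show "ev v (G \<cdot>\<^bsub>R\<^esub> F) = ev v (Zero R M P)"
      unfolding comp_R(2)[OF F G v] zero_R(2)[OF HomR_D(1)[OF F] HomR_D(2)[OF G] v]
      using exctD(4)[OF ex[OF v]] HomD[OF HomR_D(3)[OF F v]] HomD[OF HomR_D(3)[OF G v]] by simp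
  qed
  obtain E where E: "E \<in> Arr R" "Dom R E = M" "Cod R E = Dom R \<kappa>" "\<kappa> \<cdot>\<^bsub>R\<^esub> E = F"
    by (rule Rp.kernel_lift[OF k z]) (use Rp.HomD[OF F] Rp.HomD[OF G] in simp_all)
  have EH: "E \<in> Hom R M K" using E Rp.HomD[OF \<kappa>(1)] by simp
  have "is_epi R E"
  proof (rule rep_epiI[OF EH])
    fix v assume v: "v \<in> verts Q"
    note [simp] = HomD[OF HomR_D(3)[OF F v]] HomD[OF HomR_D(3)[OF G v]] HomD[OF HomR_D(3)[OF \<kappa>(1) v]]
      HomD[OF HomR_D(3)[OF EH v]]
    have kE: "ev v \<kappa> \<cdot> ev v E = ev v F" using comp_R(2)[OF EH \<kappa>(1) v] E(4) by simp
    have 0: "ev v G \<cdot> ev v \<kappa> = Zero C (ob v K) (ob v P)" using is_kernelD(4)[OF \<kappa>(2)[OF v]] by simp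
    obtain r e S where r: "is_epi C r" "r \<in> Hom C S (ob v K)" "e \<in> Hom C S (ob v M)" "ev v F \<cdot> e = ev v \<kappa> \<cdot> r"
      using exct_local_lift[OF ex[OF v] HomR_D(3)[OF \<kappa>(1) v] HomR_D(3)[OF F v] HomR_D(3)[OF G v] 0] .
    note [simp] = HomD[OF r(2)] HomD[OF r(3)]
    have "ev v \<kappa> \<cdot> (ev v E \<cdot> e) = ev v \<kappa> \<cdot> r" using r(4) by (simp add: comp_reduce[OF kE])
    then have "ev v E \<cdot> e = r" by (rule is_kernel_unique[OF \<kappa>(2)[OF v], of _ _ S]) simp_all
    then show "is_epi C (ev v E)" using is_epi_cancel[of "ev v E" e] r(1) by simp
  qed
  then show ?thesis unfolding Rp.exct_iff using k E by metis
qed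

lemma chain_ev:
  assumes "Rp.chain H gs" "H \<in> Hom R M N" "v \<in> verts Q"
  shows "chain (ev v H) (map (ev v) gs)"
  using assms(1,2)
proof (induction gs arbitrary: H M N)
  case (Cons G gs)
  have ex: "Rp.exct G H" using Cons.prems by simp
  obtain K where G: "G \<in> Hom R K M" using Rp.exctD[OF ex] Rp.HomD[OF Cons.prems(2)] by simp
  show ?case using rep_exct_ev[OF ex G Cons.prems(2) assms(3)] Cons.IH[OF _ G] Cons.prems(1) by simp
qed simp

section \<open>Free representations and the standard resolution\<close>

lemma paths_Nil: "[] \<in> paths Q i j \<longleftrightarrow> i = j \<and> i \<in> verts Q"
  by (auto simp: paths_def pre_digraph.awalk_def pre_digraph.cas.simps)

lemma paths_Cons: "e # p \<in> paths Q i j \<longleftrightarrow> e \<in> arcs Q \<and> tail Q e = i \<and> p \<in> paths Q (head Q e) j"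
  by (auto simp: paths_def pre_digraph.awalk_def pre_digraph.cas.simps)

lemma paths_verts: "p \<in> paths Q i j \<Longrightarrow> i \<in> verts Q \<and> j \<in> verts Q"
  by (induction p arbitrary: i) (auto simp: paths_Nil paths_Cons)

lemma paths_snoc: "p @ [e] \<in> paths Q i j \<longleftrightarrow> p \<in> paths Q i (tail Q e) \<and> e \<in> arcs Q \<and> head Q e = j"
  by (induction p arbitrary: i) (auto simp: paths_Nil paths_Cons)

text \<open>The action of a path on a representation. The head of the list is the arrow traversed
  first; the vertex argument names the start, which an empty list does not determine.\<close>

primrec pm :: "('v, 'e, 'a, 'b) repr \<Rightarrow> 'v \<Rightarrow> 'e list \<Rightarrow> 'b" where
  "pm M v [] = Ident C (ob v M)"
| "pm M v (e # p) = pm M (head Q e) p \<cdot> ar e M"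

lemma pm_Hom:
  assumes "M \<in> reprs Q C" "p \<in> paths Q v j"
  shows "pm M v p \<in> Hom C (ob v M) (ob j M)"
  using assms(2)
proof (induction p arbitrary: v)
  case Nil
  then have "v = j" "ob v M \<in> Obj C" using reprD(1)[OF assms(1)] by (auto simp: paths_Nil)
  then show ?case by simp
next
  case (Cons e p)
  then have e: "e \<in> arcs Q" "tail Q e = v" "p \<in> paths Q (head Q e) j" by (simp_all add: paths_Cons)
  show ?case using HomD[OF Cons.IH[OF e(3)]] HomD[OF reprD(2)[OF assms(1) e(1)]] e(2) by simp
qed

lemma pm_natural:
  assumes U: "U \<in> Hom R M N" and "p \<in> paths Q v j"
  shows "ev j U \<cdot> pm M v p = pm N v p \<cdot> ev v U"
  using assms(2)
proof (induction p arbitrary: v)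
  case Nil
  then have "v = j" "v \<in> verts Q" by (auto simp: paths_Nil)
  then show ?case using HomD[OF HomR_D(3)[OF U]] by simp
next
  case (Cons e p)
  then have e: "e \<in> arcs Q" "tail Q e = v" "p \<in> paths Q (head Q e) j" by (simp_all add: paths_Cons)
  have j: "j \<in> verts Q" using paths_verts[OF e(3)] by simp
  note M = HomR_D(1)[OF U] and N = HomR_D(2)[OF U]
  note [simp] = HomD[OF pm_Hom[OF M e(3)]] HomD[OF pm_Hom[OF N e(3)]]
    HomD[OF reprD(2)[OF M e(1), unfolded e(2)]] HomD[OF reprD(2)[OF N e(1), unfolded e(2)]]
    HomD[OF HomR_D(3)[OF U j]] HomD[OF HomR_D(3)[OF U head_vert[OF e(1)]]]
    HomD[OF HomR_D(3)[OF U tail_vert[OF e(1)], unfolded e(2)]]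
  show ?case using HomR_D(4)[OF U e(1)] unfolding e(2) by (simp add: comp_reduce[OF Cons.IH[OF e(3)]])
qed

definition gen_paths :: "'g set \<Rightarrow> ('g \<Rightarrow> 'v) \<Rightarrow> 'v \<Rightarrow> ('g \<times> 'e list) set" where
  "gen_paths J s j = {(g, p). g \<in> J \<and> p \<in> paths Q (s g) j}"

text \<open>
  \<open>S\<close> is the coproduct of the values at \<open>A g\<close> of the left adjoints to evaluation at \<open>s g\<close>, so at a
  vertex \<open>j\<close> it has one copy of \<open>A g\<close> for each path from \<open>s g\<close> to \<open>j\<close>.
\<close>

definition is_free :: "'g set \<Rightarrow> ('g \<Rightarrow> 'v) \<Rightarrow> ('g \<Rightarrow> 'a) \<Rightarrow> ('v, 'e, 'a, 'b) repr \<Rightarrow>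
    ('v \<Rightarrow> 'g \<times> 'e list \<Rightarrow> 'b) \<Rightarrow> bool" where
  "is_free J s A S \<iota> \<longleftrightarrow> S \<in> reprs Q C \<and> (\<forall>g\<in>J. s g \<in> verts Q) \<and>
    (\<forall>j\<in>verts Q. is_coproduct C (gen_paths J s j) (\<lambda>x. A (fst x)) (ob j S) (\<iota> j)) \<and>
    (\<forall>e\<in>arcs Q. \<forall>g\<in>J. \<forall>p\<in>paths Q (s g) (tail Q e).
       ar e S \<cdot> \<iota> (tail Q e) (g, p) = \<iota> (head Q e) (g, p @ [e]))"

lemma is_freeD:
  assumes "is_free J s A S \<iota>"
  shows "S \<in> reprs Q C" "g \<in> J \<Longrightarrow> s g \<in> verts Q"
    "j \<in> verts Q \<Longrightarrow> is_coproduct C (gen_paths J s j) (\<lambda>x. A (fst x)) (ob j S) (\<iota> j)"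
    "\<lbrakk>e \<in> arcs Q; g \<in> J; p \<in> paths Q (s g) (tail Q e)\<rbrakk>
      \<Longrightarrow> ar e S \<cdot> \<iota> (tail Q e) (g, p) = \<iota> (head Q e) (g, p @ [e])"
  using assms unfolding is_free_def by blast+

lemma free_inj:
  assumes "is_free J s A S \<iota>" "g \<in> J" "p \<in> paths Q (s g) j"
  shows "\<iota> j (g, p) \<in> Hom C (A g) (ob j S)"
  using coproduct_inj[OF is_freeD(3)[OF assms(1)], of j "(g, p)"] paths_verts[OF assms(3)] assms(2,3)
  by (simp add: gen_paths_def)

lemma free_pm:
  assumes S: "is_free J s A S \<iota>" and g: "g \<in> J" and "q \<in> paths Q (s g) v" "p \<in> paths Q v j"
  shows "pm S v p \<cdot> \<iota> v (g, q) = \<iota> j (g, q @ p)"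
  using assms(3,4)
proof (induction p arbitrary: v q)
  case Nil
  then have "v = j" by (simp add: paths_Nil)
  then show ?case using HomD[OF free_inj[OF S g Nil(1)]] by simp
next
  case (Cons e p)
  then have e: "e \<in> arcs Q" "tail Q e = v" "p \<in> paths Q (head Q e) j" by (simp_all add: paths_Cons)
  have q': "q @ [e] \<in> paths Q (s g) (head Q e)" using Cons.prems(1) e paths_snoc by simp
  note [simp] = HomD[OF pm_Hom[OF is_freeD(1)[OF S] e(3)]] HomD[OF reprD(2)[OF is_freeD(1)[OF S] e(1), unfolded e(2)]]
    HomD[OF free_inj[OF S g Cons.prems(1)]]
  have "ar e S \<cdot> \<iota> v (g, q) = \<iota> (head Q e) (g, q @ [e])"
    using is_freeD(4)[OF S e(1) g, of q] Cons.prems(1) e(2) by simp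
  then show ?case using Cons.IH[OF q' e(3)] by simp
qed

lemma free_inj_pm:
  assumes S: "is_free J s A S \<iota>" and g: "g \<in> J" and p: "p \<in> paths Q (s g) j"
  shows "\<iota> j (g, p) = pm S (s g) p \<cdot> \<iota> (s g) (g, [])"
  using free_pm[OF S g _ p, of "[]"] is_freeD(2)[OF S g] by (simp add: paths_Nil)

lemma free_gen: "\<lbrakk>is_free J s A S \<iota>; g \<in> J\<rbrakk> \<Longrightarrow> \<iota> (s g) (g, []) \<in> Hom C (A g) (ob (s g) S)"
  by (rule free_inj) (auto simp: paths_Nil dest: is_freeD(2))

text \<open>The copy of \<open>A g\<close> indexed by \<open>p\<close> is the generator moved along
  \<open>p\<close>, and \<open>U\<close> commutes with the action of paths. So a map out of a free
  representation is determined on the generators.\<close>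

lemma free_map_path:
  assumes S: "is_free J s A S \<iota>" and U: "U \<in> Hom R S X" and g: "g \<in> J" and p: "p \<in> paths Q (s g) j"
  shows "ev j U \<cdot> \<iota> j (g, p) = pm X (s g) p \<cdot> (ev (s g) U \<cdot> \<iota> (s g) (g, []))"
proof -
  have j: "j \<in> verts Q" and v: "s g \<in> verts Q" using paths_verts[OF p] by simp_all
  note [simp] = HomD[OF HomR_D(3)[OF U j]] HomD[OF HomR_D(3)[OF U v]] HomD[OF free_gen[OF S g]]
    HomD[OF pm_Hom[OF HomR_D(1)[OF U] p]] HomD[OF pm_Hom[OF HomR_D(2)[OF U] p]]
  show ?thesis unfolding free_inj_pm[OF S g p] by (simp add: comp_reduce[OF pm_natural[OF U p]])
qed

lemma free_eqI:
  assumes S: "is_free J s A S \<iota>" and U: "U \<in> Hom R S X" "U' \<in> Hom R S X"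
    and eq: "\<And>g. g \<in> J \<Longrightarrow> ev (s g) U \<cdot> \<iota> (s g) (g, []) = ev (s g) U' \<cdot> \<iota> (s g) (g, [])"
  shows "U = U'"
proof (rule HomR_eqI[OF U])
  fix j assume j: "j \<in> verts Q"
  show "ev j U = ev j U'"
  proof (rule coproduct_eqI[OF is_freeD(3)[OF S j] HomR_D(3)[OF U(1) j] HomR_D(3)[OF U(2) j]])
    fix x assume "x \<in> gen_paths J s j"
    then obtain g p where x: "x = (g, p)" "g \<in> J" "p \<in> paths Q (s g) j" by (auto simp: gen_paths_def)
    show "ev j U \<cdot> \<iota> j x = ev j U' \<cdot> \<iota> j x"
      unfolding x(1) free_map_path[OF S U(1) x(2,3)] free_map_path[OF S U(2) x(2,3)] eq[OF x(2)] ..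
  qed
qed

text \<open>On the copy of \<open>A g\<close> indexed by \<open>p\<close> the only possible value is
  \<open>pm X (s g) p \<cdot> u g\<close>, and this choice is natural because an arrow
  \<open>e\<close> prolongs the path on both sides. Together with \<open>free_eqI\<close> this is
  the adjunction with evaluation at the vertices.\<close>

lemma free_map:
  assumes S: "is_free J s A S \<iota>" and X: "X \<in> reprs Q C"
    and u: "\<And>g. g \<in> J \<Longrightarrow> u g \<in> Hom C (A g) (ob (s g) X)"
  obtains U where "U \<in> Hom R S X" "\<And>g. g \<in> J \<Longrightarrow> ev (s g) U \<cdot> \<iota> (s g) (g, []) = u g"
proof -
  have pH: "pm X (s (fst x)) (snd x) \<cdot> u (fst x) \<in> Hom C (A (fst x)) (ob j X)" if "x \<in> gen_paths J s j" for x j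
  proof -
    have "fst x \<in> J" "snd x \<in> paths Q (s (fst x)) j" using that by (auto simp: gen_paths_def)
    then show ?thesis using HomD[OF pm_Hom[OF X]] HomD[OF u] by simp
  qed
  have "\<exists>w. w \<in> Hom C (ob j S) (ob j X) \<and>
      (\<forall>x\<in>gen_paths J s j. w \<cdot> \<iota> j x = pm X (s (fst x)) (snd x) \<cdot> u (fst x))" if j: "j \<in> verts Q" for j
  proof -
    obtain w where "w \<in> Hom C (ob j S) (ob j X)"
      "\<And>x. x \<in> gen_paths J s j \<Longrightarrow> w \<cdot> \<iota> j x = pm X (s (fst x)) (snd x) \<cdot> u (fst x)"
      using coproduct_desc[OF is_freeD(3)[OF S j] reprD(1)[OF X j], of "\<lambda>x. pm X (s (fst x)) (snd x) \<cdot> u (fst x)", OF pH]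
      by blast
    then show ?thesis by blast
  qed
  then obtain w where w: "\<And>j. j \<in> verts Q \<Longrightarrow> w j \<in> Hom C (ob j S) (ob j X)"
    "\<And>j x. \<lbrakk>j \<in> verts Q; x \<in> gen_paths J s j\<rbrakk> \<Longrightarrow> w j \<cdot> \<iota> j x = pm X (s (fst x)) (snd x) \<cdot> u (fst x)"
    by metis
  have wp: "w j \<cdot> \<iota> j (g, p) = pm X (s g) p \<cdot> u g" if "g \<in> J" "p \<in> paths Q (s g) j" for g p j
    using w(2)[of j "(g, p)"] paths_verts[OF that(2)] that by (simp add: gen_paths_def)
  have pms: "pm X v (p @ [e]) = ar e X \<cdot> pm X v p" if "p @ [e] \<in> paths Q v (head Q e)" for v p e
    using that
  proof (induction p arbitrary: v)
    case Nil
    then have e: "e \<in> arcs Q" "tail Q e = v" by (simp_all add: paths_Cons)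
    show ?case using HomD[OF reprD(2)[OF X e(1)]] e(2) by simp
  next
    case (Cons a p)
    then have a: "a \<in> arcs Q" "tail Q a = v" "p @ [e] \<in> paths Q (head Q a) (head Q e)"
      by (simp_all add: paths_Cons)
    then have b: "p \<in> paths Q (head Q a) (tail Q e)" "e \<in> arcs Q" by (simp_all add: paths_snoc)
    note [simp] = HomD[OF pm_Hom[OF X b(1)]] HomD[OF reprD(2)[OF X b(2)]] HomD[OF reprD(2)[OF X a(1)]]
    show ?case using Cons.IH[OF a(3)] by simp
  qed
  obtain U where U: "U \<in> Hom R S X" "\<And>j. j \<in> verts Q \<Longrightarrow> ev j U = w j"
  proof (rule HomR_ex[OF is_freeD(1)[OF S] X, of w])
    fix e assume e: "e \<in> arcs Q"
    note t = tail_vert[OF e] and h = head_vert[OF e]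
    note SR = is_freeD(1)[OF S]
    note [simp] = HomD[OF w(1)[OF t]] HomD[OF w(1)[OF h]] HomD[OF reprD(2)[OF X e]] HomD[OF reprD(2)[OF SR e]]
    have H: "ar e X \<cdot> w (tail Q e) \<in> Hom C (ob (tail Q e) S) (ob (head Q e) X)"
      "w (head Q e) \<cdot> ar e S \<in> Hom C (ob (tail Q e) S) (ob (head Q e) X)" by simp_all
    show "ar e X \<cdot> w (tail Q e) = w (head Q e) \<cdot> ar e S"
    proof (rule coproduct_eqI[OF is_freeD(3)[OF S t] H])
      fix x assume "x \<in> gen_paths J s (tail Q e)"
      then obtain g p where x: "x = (g, p)" "g \<in> J" "p \<in> paths Q (s g) (tail Q e)" by (auto simp: gen_paths_def)
      have p': "p @ [e] \<in> paths Q (s g) (head Q e)" using x(3) e by (simp add: paths_snoc)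
      note [simp] = HomD[OF free_inj[OF S x(2,3)]] HomD[OF pm_Hom[OF X x(3)]] HomD[OF u[OF x(2)]]
      have "(ar e X \<cdot> w (tail Q e)) \<cdot> \<iota> (tail Q e) (g, p) = pm X (s g) (p @ [e]) \<cdot> u g"
        using wp[OF x(2,3)] by (simp add: pms[OF p'])
      also have "\<dots> = (w (head Q e) \<cdot> ar e S) \<cdot> \<iota> (tail Q e) (g, p)"
        using is_freeD(4)[OF S e x(2,3)] wp[OF x(2) p'] by simp
      finally show "(ar e X \<cdot> w (tail Q e)) \<cdot> \<iota> (tail Q e) x = (w (head Q e) \<cdot> ar e S) \<cdot> \<iota> (tail Q e) x"
        unfolding x(1) .
    qed
  qed (use w(1) in blast)+
  have "ev (s g) U \<cdot> \<iota> (s g) (g, []) = u g" if g: "g \<in> J" for g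
    using wp[OF g, of "[]" "s g"] U(2) is_freeD(2)[OF S g] HomD[OF u[OF g]] by (simp add: paths_Nil)
  then show thesis using that[OF U(1)] by blast
qed

end

section \<open>Small families of generators and Ext out of free representations\<close>

locale quiver_rep_AB4 = quiver_rep C Q
  for C :: "('a, 'b) precat" (structure) and Q :: "('v, 'e) pre_digraph" +
  fixes \<kappa> :: "'k rel"
  assumes AB4: "AB4 \<kappa> C" "Card_order \<kappa>"
    and small: "j \<in> verts Q \<Longrightarrow> card_of (paths_to Q j) <o \<kappa>"
begin

interpretation Rp: abelian_cat R by (rule abelian_R)

text \<open>At a vertex \<open>j\<close> a free representation is a coproduct indexed by
  \<open>gen_paths J s j\<close>; these are the index sets to which AB4 is applied, so they must be
  smaller than \<open>\<kappa>\<close>.\<close>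

definition small_gens :: "'g set \<Rightarrow> ('g \<Rightarrow> 'v) \<Rightarrow> bool" where
  "small_gens J s \<longleftrightarrow> (\<forall>g\<in>J. s g \<in> verts Q) \<and> (\<forall>j\<in>verts Q. card_of (gen_paths J s j) <o \<kappa>)"

lemma small_gensI:
  assumes "\<And>g. g \<in> J \<Longrightarrow> s g \<in> verts Q"
    and "\<And>j. j \<in> verts Q \<Longrightarrow> \<exists>f. inj_on f (gen_paths J s j) \<and> f ` gen_paths J s j \<subseteq> paths_to Q j"
  shows "small_gens J s"
proof -
  have "card_of (gen_paths J s j) <o \<kappa>" if "j \<in> verts Q" for j
  proof -
    have "card_of (gen_paths J s j) \<le>o card_of (paths_to Q j)"
      using assms(2)[OF that] card_of_ordLeq by blast
    then show ?thesis using small[OF that] ordLeq_ordLess_trans by blast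
  qed
  then show ?thesis using assms(1) by (simp add: small_gens_def)
qed

text \<open>A list of arrows ending at \<open>j\<close> determines its starting vertex, the empty
  list starting at \<open>j\<close> itself; so pairs of a vertex and a path from it to
  \<open>j\<close> inject into the paths to \<open>j\<close>.\<close>

lemma small_verts: "small_gens (verts Q) (\<lambda>v. v)"
proof (rule small_gensI)
  fix j assume j: "j \<in> verts Q"
  have "i = i'" if "p \<in> paths Q i j" "p \<in> paths Q i' j" for p i i'
    using that by (cases p) (auto simp: paths_Nil paths_Cons)
  then have "inj_on snd (gen_paths (verts Q) (\<lambda>v. v) j)" by (auto simp: gen_paths_def inj_on_def)
  moreover have "snd ` gen_paths (verts Q) (\<lambda>v. v) j \<subseteq> paths_to Q j"
    by (auto simp: gen_paths_def paths_to_def)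
  ultimately show "\<exists>f. inj_on f (gen_paths (verts Q) (\<lambda>v. v) j) \<and>
      f ` gen_paths (verts Q) (\<lambda>v. v) j \<subseteq> paths_to Q j" by blast
qed

text \<open>An arrow \<open>e\<close> with a path from its head to \<open>j\<close> is the same as a
  nonempty path to \<open>j\<close>.\<close>

lemma small_arcs: "small_gens (arcs Q) (head Q)"
proof (rule small_gensI)
  fix j assume j: "j \<in> verts Q"
  have "inj_on (\<lambda>(e, p). e # p) (gen_paths (arcs Q) (head Q) j)" by (auto simp: inj_on_def)
  moreover have "(\<lambda>(e, p). e # p) ` gen_paths (arcs Q) (head Q) j \<subseteq> paths_to Q j"
  proof (clarsimp simp: gen_paths_def paths_to_def)
    fix e p assume "e \<in> arcs Q" "p \<in> paths Q (head Q e) j"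
    then show "\<exists>i\<in>verts Q. e # p \<in> paths Q i j" by (intro bexI[of _ "tail Q e"]) (simp_all add: paths_Cons)
  qed
  ultimately show "\<exists>f. inj_on f (gen_paths (arcs Q) (head Q) j) \<and>
      f ` gen_paths (arcs Q) (head Q) j \<subseteq> paths_to Q j" by blast
qed simp

lemma free_ex:
  assumes J: "small_gens J s" and A: "\<And>g. g \<in> J \<Longrightarrow> A g \<in> Obj C"
  obtains S \<iota> where "is_free J s A S \<iota>"
proof -
  have "\<exists>S \<iota>. is_coproduct C (gen_paths J s j) (\<lambda>x. A (fst x)) S \<iota>" if j: "j \<in> verts Q" for j
  proof (rule small_coproduct[OF AB4])
    show "card_of (gen_paths J s j) <o \<kappa>" using J j by (simp add: small_gens_def)
    show "A (fst x) \<in> Obj C" if "x \<in> gen_paths J s j" for x using that A by (auto simp: gen_paths_def)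
  qed
  then obtain X \<iota> where X: "\<And>j. j \<in> verts Q \<Longrightarrow> is_coproduct C (gen_paths J s j) (\<lambda>x. A (fst x)) (X j) (\<iota> j)"
    by metis
  have XO: "X j \<in> Obj C" if "j \<in> verts Q" for j using X[OF that] by (simp add: is_coproduct_def)
  have "\<exists>w. w \<in> Hom C (X (tail Q e)) (X (head Q e)) \<and>
    (\<forall>x\<in>gen_paths J s (tail Q e). w \<cdot> \<iota> (tail Q e) x = \<iota> (head Q e) (fst x, snd x @ [e]))" if e: "e \<in> arcs Q" for e
  proof -
    have "\<iota> (head Q e) (fst x, snd x @ [e]) \<in> Hom C (A (fst x)) (X (head Q e))" if "x \<in> gen_paths J s (tail Q e)" for x
    proof -
      have "(fst x, snd x @ [e]) \<in> gen_paths J s (head Q e)"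
        using that e by (auto simp: gen_paths_def paths_snoc)
      from coproduct_inj[OF X[OF head_vert[OF e]] this] show ?thesis by simp
    qed
    from coproduct_desc[OF X[OF tail_vert[OF e]] XO[OF head_vert[OF e]], OF this]
    show ?thesis by metis
  qed
  then obtain \<phi> where \<phi>: "\<And>e. e \<in> arcs Q \<Longrightarrow> \<phi> e \<in> Hom C (X (tail Q e)) (X (head Q e))"
    "\<And>e x. \<lbrakk>e \<in> arcs Q; x \<in> gen_paths J s (tail Q e)\<rbrakk> \<Longrightarrow> \<phi> e \<cdot> \<iota> (tail Q e) x = \<iota> (head Q e) (fst x, snd x @ [e])"
    by metis
  obtain S where S: "S \<in> reprs Q C" "\<And>v. v \<in> verts Q \<Longrightarrow> ob v S = X v" "\<And>e. e \<in> arcs Q \<Longrightarrow> ar e S = \<phi> e"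
    using repr_ex[of X \<phi>, OF XO \<phi>(1)] by blast
  have "is_free J s A S \<iota>"
    unfolding is_free_def
  proof (intro conjI ballI)
    show "s g \<in> verts Q" if "g \<in> J" for g using J that by (simp add: small_gens_def)
    show "is_coproduct C (gen_paths J s j) (\<lambda>x. A (fst x)) (ob j S) (\<iota> j)" if "j \<in> verts Q" for j
      unfolding S(2)[OF that] by (rule X[OF that])
    fix e g p assume a: "e \<in> arcs Q" "g \<in> J" "p \<in> paths Q (s g) (tail Q e)"
    show "ar e S \<cdot> \<iota> (tail Q e) (g, p) = \<iota> (head Q e) (g, p @ [e])"
      unfolding S(3)[OF a(1)] using \<phi>(2)[OF a(1), of "(g, p)"] a by (simp add: gen_paths_def)
  qed (rule S(1))
  then show thesis by (rule that)
qed

text \<open>At each vertex the sequence is a coproduct, indexed by paths, of copies of the sequences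
  given at the generators. Exactness of small coproducts applies there.\<close>

lemma free_exact:
  assumes J: "small_gens J s"
    and S: "is_free J s K S\<^sub>1 \<iota>\<^sub>1" "is_free J s F S\<^sub>2 \<iota>\<^sub>2" "is_free J s A S\<^sub>3 \<iota>\<^sub>3"
    and k: "\<And>g. g \<in> J \<Longrightarrow> is_kernel C (p g) (k g)" "\<And>g. g \<in> J \<Longrightarrow> is_epi C (p g)"
    and kH: "\<And>g. g \<in> J \<Longrightarrow> k g \<in> Hom C (K g) (F g)" and pH: "\<And>g. g \<in> J \<Longrightarrow> p g \<in> Hom C (F g) (A g)"
    and U: "U \<in> Hom R S\<^sub>1 S\<^sub>2" "\<And>g. g \<in> J \<Longrightarrow> ev (s g) U \<cdot> \<iota>\<^sub>1 (s g) (g, []) = \<iota>\<^sub>2 (s g) (g, []) \<cdot> k g"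
    and W: "W \<in> Hom R S\<^sub>2 S\<^sub>3" "\<And>g. g \<in> J \<Longrightarrow> ev (s g) W \<cdot> \<iota>\<^sub>2 (s g) (g, []) = \<iota>\<^sub>3 (s g) (g, []) \<cdot> p g"
  shows "is_kernel R W U" "is_epi R W"
proof -
  have main: "is_kernel C (ev j W) (ev j U) \<and> is_epi C (ev j W)" if j: "j \<in> verts Q" for j
  proof -
    have u: "ev j U \<cdot> \<iota>\<^sub>1 j x = \<iota>\<^sub>2 j x \<cdot> k (fst x)" if xg: "x \<in> gen_paths J s j" for x
    proof -
      obtain g q where x: "x = (g, q)" "g \<in> J" "q \<in> paths Q (s g) j"
        using xg by (cases x) (simp add: gen_paths_def)
      note [simp] = HomD[OF pm_Hom[OF is_freeD(1)[OF S(2)] x(3)]] HomD[OF kH[OF x(2)]] HomD[OF free_gen[OF S(2) x(2)]]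
      show ?thesis unfolding x(1) free_map_path[OF S(1) U(1) x(2,3)] U(2)[OF x(2)] fst_conv
          free_inj_pm[OF S(2) x(2,3)] by simp
    qed
    have w: "ev j W \<cdot> \<iota>\<^sub>2 j x = \<iota>\<^sub>3 j x \<cdot> p (fst x)" if xg: "x \<in> gen_paths J s j" for x
    proof -
      obtain g q where x: "x = (g, q)" "g \<in> J" "q \<in> paths Q (s g) j"
        using xg by (cases x) (simp add: gen_paths_def)
      note [simp] = HomD[OF pm_Hom[OF is_freeD(1)[OF S(3)] x(3)]] HomD[OF pH[OF x(2)]] HomD[OF free_gen[OF S(3) x(2)]]
      show ?thesis unfolding x(1) free_map_path[OF S(2) W(1) x(2,3)] W(2)[OF x(2)] fst_conv
          free_inj_pm[OF S(3) x(2,3)] by simp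
    qed
    have xJ: "fst x \<in> J" if "x \<in> gen_paths J s j" for x using that by (auto simp: gen_paths_def)
    have c: "card_of (gen_paths J s j) <o \<kappa>" using J j by (simp add: small_gens_def)
    note ex = small_coproduct_exact[OF AB4 c k(1)[OF xJ] k(2)[OF xJ] kH[OF xJ] pH[OF xJ]
      is_freeD(3)[OF S(1) j] is_freeD(3)[OF S(2) j] is_freeD(3)[OF S(3) j]
      HomR_D(3)[OF U(1) j] u HomR_D(3)[OF W(1) j] w]
    show ?thesis using ex by blast
  qed
  show "is_kernel R W U" by (rule rep_kernelI[OF W(1) U(1)]) (use main in blast)
  show "is_epi R W" by (rule rep_epiI[OF W(1)]) (use main in blast)
qed

text \<open>Choose a witness at every generator. Covers, kernels and lifts assemble into maps of
  free representations; by \<open>free_exact\<close> the assembled cover is epi and the assembled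
  kernel is its kernel. The recursion continues on the free representation over the kernels.
  Exactness of coproducts, as opposed to their existence, enters here.\<close>

lemma free_vanishes:
  assumes J: "small_gens J s" and "Rp.chain H gs" "H \<in> Hom R X Y" "is_free J s A S \<iota>" "U \<in> Hom R S X"
    "\<And>g. g \<in> J \<Longrightarrow> vanishes (map (ev (s g)) gs) (ev (s g) U \<cdot> \<iota> (s g) (g, []))"
    "\<And>g. g \<in> J \<Longrightarrow> A g \<in> Obj C"
  shows "Rp.vanishes gs U"
  using assms(2-7)
proof (induction gs arbitrary: H X Y A S \<iota> U)
  case Nil
  note S = Nil(3) and U = Nil(4)
  note X = HomR_D(2)[OF U] and SR = HomR_D(1)[OF U]
  have "U = Zero R S X"
  proof (rule free_eqI[OF S U zero_R(1)[OF SR X]])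
    fix g assume g: "g \<in> J"
    have v: "s g \<in> verts Q" by (rule is_freeD(2)[OF S g])
    note [simp] = HomD[OF free_gen[OF S g]] HomD[OF HomR_D(3)[OF U v]]
    have "ev (s g) U \<cdot> \<iota> (s g) (g, []) = Zero C (A g) (ob (s g) X)"
      using Nil(5)[OF g] vanishes_Nil[of "ev (s g) U \<cdot> \<iota> (s g) (g, [])" "A g" "ob (s g) X"] by simp
    then show "ev (s g) U \<cdot> \<iota> (s g) (g, []) = ev (s g) (Zero R S X) \<cdot> \<iota> (s g) (g, [])"
      unfolding zero_R(2)[OF SR X v] by simp
  qed
  then show ?case using Rp.vanishes_Nil[OF U] by blast
next
  case (Cons G gs)
  note H = Cons.prems(2) and S = Cons.prems(3) and U = Cons.prems(4) and AO = Cons.prems(6)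
  have ex: "Rp.exct G H" and ch: "Rp.chain G gs" using Cons.prems(1) by simp_all
  obtain E where G: "G \<in> Hom R E X" using Rp.exctD[OF ex] Rp.HomD[OF H] by simp
  note X = HomR_D(2)[OF U] and SR = HomR_D(1)[OF U] and ER = HomR_D(1)[OF G]
  have "\<exists>p f k F K. is_epi C p \<and> p \<in> Hom C F (A g) \<and> f \<in> Hom C F (ob (s g) E) \<and>
      ev (s g) G \<cdot> f = (ev (s g) U \<cdot> \<iota> (s g) (g, [])) \<cdot> p \<and> is_kernel C p k \<and> k \<in> Hom C K F \<and>
      vanishes (map (ev (s g)) gs) (f \<cdot> k)" if g: "g \<in> J" for g
  proof -
    have v: "s g \<in> verts Q" by (rule is_freeD(2)[OF S g])
    note [simp] = HomD[OF free_gen[OF S g]] HomD[OF HomR_D(3)[OF U v]] HomD[OF HomR_D(3)[OF G v]]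
    have "vanishes (ev (s g) G # map (ev (s g)) gs) (ev (s g) U \<cdot> \<iota> (s g) (g, []))"
      using Cons.prems(5)[OF g] by simp
    then obtain p F f k K where p: "is_epi C p" "p \<in> Arr C" "Dom C p = F" "Cod C p = Dom C (ev (s g) U \<cdot> \<iota> (s g) (g, []))" "f \<in> Arr C"
    "Dom C f = F" "Cod C f = Dom C (ev (s g) G)" "ev (s g) G \<cdot> f = (ev (s g) U \<cdot> \<iota> (s g) (g, [])) \<cdot> p" "is_kernel C p k" "k \<in> Arr C" "Cod C k = F"
    "Dom C k = K" "vanishes (map (ev (s g)) gs) (f \<cdot> k)"
      by (rule vanishes_ConsE)
    have "p \<in> Hom C F (A g)" "f \<in> Hom C F (ob (s g) E)" "k \<in> Hom C K F" using p by simp_all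
    then show ?thesis using p(1,8,9,13) by blast
  qed
  then have "\<forall>g\<in>J. \<exists>p f k F K. is_epi C p \<and> p \<in> Hom C F (A g) \<and> f \<in> Hom C F (ob (s g) E) \<and>
      ev (s g) G \<cdot> f = (ev (s g) U \<cdot> \<iota> (s g) (g, [])) \<cdot> p \<and> is_kernel C p k \<and> k \<in> Hom C K F \<and>
      vanishes (map (ev (s g)) gs) (f \<cdot> k)" by (intro ballI)
  then obtain p f k F K where all: "\<forall>g\<in>J. is_epi C (p g) \<and> p g \<in> Hom C (F g) (A g) \<and>
      f g \<in> Hom C (F g) (ob (s g) E) \<and>
      ev (s g) G \<cdot> f g = (ev (s g) U \<cdot> \<iota> (s g) (g, [])) \<cdot> p g \<and> is_kernel C (p g) (k g) \<and>
      k g \<in> Hom C (K g) (F g) \<and> vanishes (map (ev (s g)) gs) (f g \<cdot> k g)"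
    unfolding bchoice_iff by (elim exE)
  then have p: "is_epi C (p g)" "p g \<in> Hom C (F g) (A g)" "f g \<in> Hom C (F g) (ob (s g) E)"
      "ev (s g) G \<cdot> f g = (ev (s g) U \<cdot> \<iota> (s g) (g, [])) \<cdot> p g" "is_kernel C (p g) (k g)"
      "k g \<in> Hom C (K g) (F g)" "vanishes (map (ev (s g)) gs) (f g \<cdot> k g)" if "g \<in> J" for g
    using that by blast+
  have FO: "F g \<in> Obj C" and KO: "K g \<in> Obj C" if "g \<in> J" for g using HomD[OF p(6)[OF that]] by simp_all
  obtain SF \<iota>F where SF: "is_free J s F SF \<iota>F" using free_ex[OF J, of F, OF FO] by blast
  obtain SK \<iota>K where SK: "is_free J s K SK \<iota>K" using free_ex[OF J, of K, OF KO] by blast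
  have iH: "\<iota> (s g) (g, []) \<cdot> p g \<in> Hom C (F g) (ob (s g) S)" if "g \<in> J" for g
    using HomD[OF free_gen[OF S that]] HomD[OF p(2)[OF that]] by simp
  have iFH: "\<iota>F (s g) (g, []) \<cdot> k g \<in> Hom C (K g) (ob (s g) SF)" if "g \<in> J" for g
    using HomD[OF free_gen[OF SF that]] HomD[OF p(6)[OF that]] by simp
  obtain W where W: "W \<in> Hom R SF S" "\<And>g. g \<in> J \<Longrightarrow> ev (s g) W \<cdot> \<iota>F (s g) (g, []) = \<iota> (s g) (g, []) \<cdot> p g"
    using free_map[OF SF SR iH] by blast
  obtain V where V: "V \<in> Hom R SK SF" "\<And>g. g \<in> J \<Longrightarrow> ev (s g) V \<cdot> \<iota>K (s g) (g, []) = \<iota>F (s g) (g, []) \<cdot> k g"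
    using free_map[OF SK is_freeD(1)[OF SF] iFH] by blast
  obtain \<Phi> where \<Phi>: "\<Phi> \<in> Hom R SF E" "\<And>g. g \<in> J \<Longrightarrow> ev (s g) \<Phi> \<cdot> \<iota>F (s g) (g, []) = f g"
    using free_map[OF SF ER p(3)] by blast
  note ex = free_exact[OF J SK SF S p(5,1,6,2) V W]
  have GP: "G \<cdot>\<^bsub>R\<^esub> \<Phi> = U \<cdot>\<^bsub>R\<^esub> W"
  proof (rule free_eqI[OF SF comp_R(1)[OF \<Phi>(1) G] comp_R(1)[OF W(1) U]])
    fix g assume g: "g \<in> J"
    have v: "s g \<in> verts Q" by (rule is_freeD(2)[OF S g])
    note [simp] = HomD[OF free_gen[OF SF g]] HomD[OF free_gen[OF S g]] HomD[OF HomR_D(3)[OF \<Phi>(1) v]]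
      HomD[OF HomR_D(3)[OF G v]] HomD[OF HomR_D(3)[OF U v]] HomD[OF HomR_D(3)[OF W(1) v]] HomD[OF p(2)[OF g]]
    show "ev (s g) (G \<cdot>\<^bsub>R\<^esub> \<Phi>) \<cdot> \<iota>F (s g) (g, []) = ev (s g) (U \<cdot>\<^bsub>R\<^esub> W) \<cdot> \<iota>F (s g) (g, [])"
      unfolding comp_R(2)[OF \<Phi>(1) G v] comp_R(2)[OF W(1) U v] using \<Phi>(2)[OF g] W(2)[OF g] p(4)[OF g] by simp
  qed
  have "Rp.vanishes gs (\<Phi> \<cdot>\<^bsub>R\<^esub> V)"
  proof (rule Cons.IH[OF ch G SK comp_R(1)[OF V(1) \<Phi>(1)] _ KO])
    fix g assume g: "g \<in> J"
    have v: "s g \<in> verts Q" by (rule is_freeD(2)[OF S g])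
    note [simp] = HomD[OF free_gen[OF SF g]] HomD[OF free_gen[OF SK g]] HomD[OF HomR_D(3)[OF \<Phi>(1) v]]
      HomD[OF HomR_D(3)[OF V(1) v]] HomD[OF p(6)[OF g]]
    have "ev (s g) (\<Phi> \<cdot>\<^bsub>R\<^esub> V) \<cdot> \<iota>K (s g) (g, []) = f g \<cdot> k g"
      unfolding comp_R(2)[OF V(1) \<Phi>(1) v] using V(2)[OF g] by (simp add: comp_reduce[OF \<Phi>(2)[OF g]])
    then show "vanishes (map (ev (s g)) gs) (ev (s g) (\<Phi> \<cdot>\<^bsub>R\<^esub> V) \<cdot> \<iota>K (s g) (g, []))"
      using p(7)[OF g] by simp
  qed
  then show ?case
    unfolding Rp.vanishes.simps using ex GP Rp.HomD[OF G] Rp.HomD[OF U] Rp.HomD[OF W(1)] \<Phi>(1)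
    by (intro conjI exI[of _ W] exI[of _ \<Phi>] exI[of _ V]) simp_all
qed

text \<open>Evaluation at a vertex is exact, so at \<open>s g\<close> a chain of representations
  becomes a chain in \<open>C\<close>, where the class on \<open>A g\<close> vanishes by
  assumption.\<close>

lemma free_ext_vanish:
  assumes J: "small_gens J s" and S: "is_free J s A S \<iota>" and A: "\<And>g. g \<in> J \<Longrightarrow> A g \<in> Obj C"
    and van: "\<And>B. B \<in> Obj C \<Longrightarrow> ext_vanish n B"
  shows "Rp.ext_vanish n S"
  unfolding Rp.ext_vanish_def
proof (intro allI impI, elim conjE)
  fix H gs X Y U
  assume H: "H \<in> Hom R X Y" and gs: "Rp.chain H gs" "length gs = n" and U: "U \<in> Hom R S X"
    and z: "H \<cdot>\<^bsub>R\<^esub> U = Zero R S Y"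
  show "Rp.vanishes gs U"
  proof (rule free_vanishes[OF J gs(1) H S U _ A])
    fix g assume g: "g \<in> J"
    have v: "s g \<in> verts Q" by (rule is_freeD(2)[OF S g])
    note [simp] = HomD[OF free_gen[OF S g]] HomD[OF HomR_D(3)[OF H v]] HomD[OF HomR_D(3)[OF U v]]
    have 1: "chain (ev (s g) H) (map (ev (s g)) gs)" by (rule chain_ev[OF gs(1) H v])
    have 2: "ev (s g) H \<cdot> (ev (s g) U \<cdot> \<iota> (s g) (g, [])) = Zero C (A g) (ob (s g) Y)"
      by (simp add: comp_reduce[OF rep_zero_ev[OF z U H v]])
    have 3: "ev (s g) U \<cdot> \<iota> (s g) (g, []) \<in> Hom C (A g) (ob (s g) X)" by simp
    have "length (map (ev (s g)) gs) = n" using gs(2) by simp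
    then show "vanishes (map (ev (s g)) gs) (ev (s g) U \<cdot> \<iota> (s g) (g, []))"
      using van[OF A[OF g]] HomR_D(3)[OF H v] 1 2 3 unfolding ext_vanish_def by blast
  qed
qed

end

section \<open>Arrows of free representations; splitting of the resolution at a vertex\<close>

context quiver_rep
begin

text \<open>Appending \<open>e\<close> is injective on paths. A retraction undoes it on the copies
  indexed by paths that end in \<open>e\<close> and is zero on all others.\<close>

lemma free_arrow_mono:
  assumes S: "is_free J s A S \<iota>" and e: "e \<in> arcs Q"
  shows "is_mono C (ar e S)"
proof -
  note t = tail_vert[OF e] and h = head_vert[OF e] and SR = is_freeD(1)[OF S]
  note [simp] = HomD[OF reprD(2)[OF SR e]]
  define f where "f x = (if snd x \<noteq> [] \<and> last (snd x) = e then \<iota> (tail Q e) (fst x, butlast (snd x))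
    else Zero C (A (fst x)) (ob (tail Q e) S))" for x
  have fH: "f x \<in> Hom C (A (fst x)) (ob (tail Q e) S)" if "x \<in> gen_paths J s (head Q e)" for x
  proof -
    obtain g q where x: "x = (g, q)" "g \<in> J" "q \<in> paths Q (s g) (head Q e)" 
      using \<open>x \<in> gen_paths J s (head Q e)\<close> by (cases x) (simp add: gen_paths_def)
    show ?thesis
    proof (cases "q \<noteq> [] \<and> last q = e")
      case True
      then have "butlast q @ [e] \<in> paths Q (s g) (head Q e)" using x(3) by (metis append_butlast_last_id)
      then have "butlast q \<in> paths Q (s g) (tail Q e)" by (simp add: paths_snoc)
      from free_inj[OF S x(2) this] show ?thesis using True unfolding f_def x(1) by simp
    next
      case False
      then show ?thesis using HomD(4)[OF free_gen[OF S x(2)]] unfolding f_def x(1) by auto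
    qed
  qed
  obtain r where r: "r \<in> Hom C (ob (head Q e) S) (ob (tail Q e) S)"
    "\<And>x. x \<in> gen_paths J s (head Q e) \<Longrightarrow> r \<cdot> \<iota> (head Q e) x = f x"
    using coproduct_desc[OF is_freeD(3)[OF S h] reprD(1)[OF SR t], of f, OF fH] by blast
  note [simp] = HomD[OF r(1)]
  have "r \<cdot> ar e S = Ident C (ob (tail Q e) S)"
  proof (rule coproduct_eqI[OF is_freeD(3)[OF S t], of _ "ob (tail Q e) S"])
    fix x assume "x \<in> gen_paths J s (tail Q e)"
    then obtain g q where x: "x = (g, q)" "g \<in> J" "q \<in> paths Q (s g) (tail Q e)"
      by (cases x) (simp add: gen_paths_def)
    note [simp] = HomD[OF free_inj[OF S x(2,3)]]
    have q': "(g, q @ [e]) \<in> gen_paths J s (head Q e)" using x(2,3) e by (simp add: gen_paths_def paths_snoc)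
    have "(r \<cdot> ar e S) \<cdot> \<iota> (tail Q e) (g, q) = \<iota> (tail Q e) (g, q)"
      using is_freeD(4)[OF S e x(2,3)] r(2)[OF q'] by (simp add: f_def)
    then show "(r \<cdot> ar e S) \<cdot> \<iota> (tail Q e) x = Ident C (ob (tail Q e) S) \<cdot> \<iota> (tail Q e) x"
      unfolding x(1) by simp
  qed simp_all
  then show ?thesis by (rule is_mono_split[OF _ reprD(2)[OF SR e] r(1)])
qed

text \<open>At a fixed vertex \<open>j\<close> the sequence has a contraction: the generator
  \<open>\<sigma>\<close> at \<open>j\<close> is a section of \<open>\<epsilon>\<close>, and there
  is a retraction \<open>\<tau>\<close> of \<open>d\<close> with
  \<open>d \<cdot> \<tau> \<boxplus> \<sigma> \<cdot> \<epsilon>\<close> the identity. An arrow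
  \<open>h\<close> killed by \<open>\<epsilon>\<close> is then \<open>d\<close> applied to
  \<open>\<tau> \<cdot> h\<close>. The contraction depends on \<open>j\<close> and need not be a map
  of representations.\<close>

lemma standard_split:
  assumes M: "M \<in> reprs Q C" and P0: "is_free (verts Q) (\<lambda>v. v) (\<lambda>v. ob v M) P\<^sub>0 \<iota>\<^sub>0"
    and P1: "is_free (arcs Q) (head Q) (\<lambda>e. ob (tail Q e) M) P\<^sub>1 \<iota>\<^sub>1"
    and \<epsilon>: "\<epsilon> \<in> Hom R P\<^sub>0 M" "\<And>v. v \<in> verts Q \<Longrightarrow> ev v \<epsilon> \<cdot> \<iota>\<^sub>0 v (v, []) = Ident C (ob v M)"
    and d: "d \<in> Hom R P\<^sub>1 P\<^sub>0" "\<And>e. e \<in> arcs Q \<Longrightarrow> ev (head Q e) d \<cdot> \<iota>\<^sub>1 (head Q e) (e, []) =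
      \<iota>\<^sub>0 (head Q e) (tail Q e, [e]) \<boxminus> \<iota>\<^sub>0 (head Q e) (head Q e, []) \<cdot> ar e M"
    and j: "j \<in> verts Q"
  shows "is_epi C (ev j \<epsilon>) \<and> is_kernel C (ev j \<epsilon>) (ev j d)"
proof -
  note PR = is_freeD(1)[OF P0] is_freeD(1)[OF P1]
  note [simp] = HomD[OF HomR_D(3)[OF \<epsilon>(1) j]] HomD[OF HomR_D(3)[OF d(1) j]] reprD(1)[OF M j]
  have i0: "\<iota>\<^sub>0 j (i, p) \<in> Hom C (ob i M) (ob j P\<^sub>0)" if "p \<in> paths Q i j" for i p
    using free_inj[OF P0, of i p j] paths_verts[OF that] that by simp
  have i1: "\<iota>\<^sub>1 j (e, p) \<in> Hom C (ob (tail Q e) M) (ob j P\<^sub>1)" if "e \<in> arcs Q" "p \<in> paths Q (head Q e) j" for e p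
    using free_inj[OF P1 that] .
  have nil: "[] \<in> paths Q v v" if "v \<in> verts Q" for v using that by (simp add: paths_Nil)
  have eps: "ev j \<epsilon> \<cdot> \<iota>\<^sub>0 j (i, p) = pm M i p" if p: "p \<in> paths Q i j" for i p
  proof -
    have i: "i \<in> verts Q" using paths_verts[OF p] by simp
    show ?thesis using free_map_path[OF P0 \<epsilon>(1) i, of p j] p \<epsilon>(2)[OF i] HomD[OF pm_Hom[OF M p]] by simp
  qed
  have dd: "ev j d \<cdot> \<iota>\<^sub>1 j (e, p) = \<iota>\<^sub>0 j (tail Q e, e # p) \<boxminus> \<iota>\<^sub>0 j (head Q e, p) \<cdot> ar e M"
    if e: "e \<in> arcs Q" and p: "p \<in> paths Q (head Q e) j" for e p
  proof -
    note t = tail_vert[OF e] and h = head_vert[OF e]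
    have ee: "[e] \<in> paths Q (tail Q e) (head Q e)" using e by (simp add: paths_Cons paths_Nil)
    have 1: "pm P\<^sub>0 (head Q e) p \<cdot> \<iota>\<^sub>0 (head Q e) (tail Q e, [e]) = \<iota>\<^sub>0 j (tail Q e, e # p)"
      using free_pm[OF P0 t ee p] by simp
    have 2: "pm P\<^sub>0 (head Q e) p \<cdot> \<iota>\<^sub>0 (head Q e) (head Q e, []) = \<iota>\<^sub>0 j (head Q e, p)"
      using free_pm[OF P0 h nil[OF h] p] by simp
    note [simp] = HomD[OF pm_Hom[OF PR(1) p]] HomD[OF free_inj[OF P0 t ee]] HomD[OF free_inj[OF P0 h nil[OF h]]]
      HomD[OF reprD(2)[OF M e]]
    show ?thesis unfolding free_map_path[OF P1 d(1) e p] d(2)[OF e] using 1 by (simp add: comp_reduce[OF 2])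
  qed
  let ?\<sigma> = "\<iota>\<^sub>0 j (j, [])"
  note sH = i0[OF nil[OF j]]
  note [simp] = HomD[OF sH]
  have es: "ev j \<epsilon> \<cdot> ?\<sigma> = Ident C (ob j M)" by (rule \<epsilon>(2)[OF j])
  have ed: "ev j \<epsilon> \<cdot> ev j d = Zero C (ob j P\<^sub>1) (ob j M)"
  proof (rule coproduct_eqI[OF is_freeD(3)[OF P1 j], of _ "ob j M"])
    fix x assume "x \<in> gen_paths (arcs Q) (head Q) j"
    then obtain e p where x: "x = (e, p)" "e \<in> arcs Q" "p \<in> paths Q (head Q e) j"
      by (cases x) (simp add: gen_paths_def)
    have ep: "e # p \<in> paths Q (tail Q e) j" using x by (simp add: paths_Cons)
    note [simp] = HomD[OF i1[OF x(2,3)]] HomD[OF i0[OF ep]] HomD[OF i0[OF x(3)]] HomD[OF reprD(2)[OF M x(2)]]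
      HomD[OF pm_Hom[OF M x(3)]]
    have "(ev j \<epsilon> \<cdot> ev j d) \<cdot> \<iota>\<^sub>1 j (e, p) = Zero C (ob (tail Q e) M) (ob j M)"
      using dd[OF x(2,3)] eps[OF ep] by (simp add: comp_reduce[OF eps[OF x(3)]])
    then show "(ev j \<epsilon> \<cdot> ev j d) \<cdot> \<iota>\<^sub>1 j x = Zero C (ob j P\<^sub>1) (ob j M) \<cdot> \<iota>\<^sub>1 j x" unfolding x(1) by simp
  qed simp_all
  \<comment> \<open>The retraction \<open>\<tau>\<close> of \<open>d\<close> at \<open>j\<close> telescopes along a path: \<open>d\<close> maps its value to the difference of the
    generator of the path and its image under \<open>\<sigma> \<cdot> \<epsilon>\<close>.\<close>
  define \<theta> where "\<theta> = rec_list (Zero C (ob j M) (ob j P\<^sub>1)) (\<lambda>e p t. \<iota>\<^sub>1 j (e, p) \<boxplus> t \<cdot> ar e M)"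
  have \<theta>s: "\<theta> [] = Zero C (ob j M) (ob j P\<^sub>1)" "\<And>e p. \<theta> (e # p) = \<iota>\<^sub>1 j (e, p) \<boxplus> \<theta> p \<cdot> ar e M"
    by (simp_all add: \<theta>_def)
  have \<theta>H: "\<theta> p \<in> Hom C (ob i M) (ob j P\<^sub>1)" if "p \<in> paths Q i j" for p i
    using that
  proof (induction p arbitrary: i)
    case Nil
    then have "i = j" by (simp add: paths_Nil)
    then show ?case by (simp add: \<theta>s)
  next
    case (Cons e p)
    then have e: "e \<in> arcs Q" "tail Q e = i" "p \<in> paths Q (head Q e) j" by (simp_all add: paths_Cons)
    show ?case unfolding \<theta>s
      using HomD[OF i1[OF e(1,3)]] HomD[OF Cons.IH[OF e(3)]] HomD[OF reprD(2)[OF M e(1)]] e(2) by simp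
  qed
  have \<theta>H': "\<theta> (snd x) \<in> Hom C (ob (fst x) M) (ob j P\<^sub>1)" if "x \<in> gen_paths (verts Q) (\<lambda>v. v) j" for x
    using \<theta>H that by (auto simp: gen_paths_def simp del: in_Hom)
  obtain \<tau> where \<tau>: "\<tau> \<in> Hom C (ob j P\<^sub>0) (ob j P\<^sub>1)"
    "\<And>x. x \<in> gen_paths (verts Q) (\<lambda>v. v) j \<Longrightarrow> \<tau> \<cdot> \<iota>\<^sub>0 j x = \<theta> (snd x)"
    using coproduct_desc[OF is_freeD(3)[OF P0 j] reprD(1)[OF PR(2) j], of "\<lambda>x. \<theta> (snd x)", OF \<theta>H'] by blast
  have \<tau>p: "\<tau> \<cdot> \<iota>\<^sub>0 j (i, p) = \<theta> p" if "p \<in> paths Q i j" for i p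
    using \<tau>(2)[of "(i, p)"] that paths_verts[OF that] by (simp add: gen_paths_def)
  note [simp] = HomD[OF \<tau>(1)]
  have td: "\<tau> \<cdot> ev j d = Ident C (ob j P\<^sub>1)"
  proof (rule coproduct_eqI[OF is_freeD(3)[OF P1 j], of _ "ob j P\<^sub>1"])
    fix x assume "x \<in> gen_paths (arcs Q) (head Q) j"
    then obtain e p where x: "x = (e, p)" "e \<in> arcs Q" "p \<in> paths Q (head Q e) j"
      by (cases x) (simp add: gen_paths_def)
    have ep: "e # p \<in> paths Q (tail Q e) j" using x by (simp add: paths_Cons)
    note [simp] = HomD[OF i1[OF x(2,3)]] HomD[OF i0[OF ep]] HomD[OF i0[OF x(3)]] HomD[OF reprD(2)[OF M x(2)]]
      HomD[OF \<theta>H[OF x(3)]]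
    have "(\<tau> \<cdot> ev j d) \<cdot> \<iota>\<^sub>1 j (e, p) = \<theta> (e # p) \<boxminus> \<theta> p \<cdot> ar e M"
      using dd[OF x(2,3)] \<tau>p[OF ep] by (simp add: comp_reduce[OF \<tau>p[OF x(3)]])
    also have "\<dots> = \<iota>\<^sub>1 j (e, p)" unfolding \<theta>s by (simp add: plus_assoc)
    finally show "(\<tau> \<cdot> ev j d) \<cdot> \<iota>\<^sub>1 j x = Ident C (ob j P\<^sub>1) \<cdot> \<iota>\<^sub>1 j x" unfolding x(1) by simp
  qed simp_all
  have dt: "ev j d \<cdot> \<tau> \<boxplus> ?\<sigma> \<cdot> ev j \<epsilon> = Ident C (ob j P\<^sub>0)"
  proof (rule coproduct_eqI[OF is_freeD(3)[OF P0 j], of _ "ob j P\<^sub>0"])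
    have main: "ev j d \<cdot> \<theta> p \<boxplus> ?\<sigma> \<cdot> pm M i p = \<iota>\<^sub>0 j (i, p)" if "p \<in> paths Q i j" for i p
      using that
    proof (induction p arbitrary: i)
      case Nil
      then have "i = j" by (simp add: paths_Nil)
      then show ?case by (simp add: \<theta>s)
    next
      case (Cons e p)
      then have e: "e \<in> arcs Q" "tail Q e = i" "p \<in> paths Q (head Q e) j" by (simp_all add: paths_Cons)
      note [simp] = HomD[OF i1[OF e(1,3), unfolded e(2)]] HomD[OF i0[OF Cons.prems]] HomD[OF i0[OF e(3)]]
        HomD[OF reprD(2)[OF M e(1), unfolded e(2)]] HomD[OF \<theta>H[OF e(3)]] HomD[OF pm_Hom[OF M e(3)]]
      have IH: "(ev j d \<cdot> \<theta> p \<boxplus> ?\<sigma> \<cdot> pm M (head Q e) p) \<cdot> ar e M = \<iota>\<^sub>0 j (head Q e, p) \<cdot> ar e M"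
        unfolding Cons.IH[OF e(3)] ..
      have dd': "ev j d \<cdot> \<iota>\<^sub>1 j (e, p) = \<iota>\<^sub>0 j (i, e # p) \<boxminus> \<iota>\<^sub>0 j (head Q e, p) \<cdot> ar e M"
        using dd[OF e(1,3)] e(2) by simp
      have "ev j d \<cdot> \<theta> (e # p) \<boxplus> ?\<sigma> \<cdot> pm M i (e # p) =
        ev j d \<cdot> \<iota>\<^sub>1 j (e, p) \<boxplus> (ev j d \<cdot> \<theta> p \<boxplus> ?\<sigma> \<cdot> pm M (head Q e) p) \<cdot> ar e M"
        unfolding \<theta>s pm.simps by (simp add: plus_assoc)
      also have "\<dots> = \<iota>\<^sub>0 j (i, e # p)" unfolding IH dd' by (simp add: plus_assoc)
      finally show ?case .
    qed
    fix x assume "x \<in> gen_paths (verts Q) (\<lambda>v. v) j"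
    then obtain i p where x: "x = (i, p)" "p \<in> paths Q i j" by (cases x) (simp add: gen_paths_def)
    note [simp] = HomD[OF i0[OF x(2)]]
    show "(ev j d \<cdot> \<tau> \<boxplus> ?\<sigma> \<cdot> ev j \<epsilon>) \<cdot> \<iota>\<^sub>0 j x = Ident C (ob j P\<^sub>0) \<cdot> \<iota>\<^sub>0 j x"
      unfolding x(1) using main[OF x(2)] \<tau>p[OF x(2)] eps[OF x(2)] by simp
  qed simp_all
  have "is_kernel C (ev j \<epsilon>) (ev j d)"
  proof (rule is_kernelI)
    show "is_mono C (ev j d)" by (rule is_mono_split[OF td HomR_D(3)[OF d(1) j] \<tau>(1)])
    fix h assume h: "h \<in> Arr C" "Cod C h = Dom C (ev j \<epsilon>)" "ev j \<epsilon> \<cdot> h = Zero C (Dom C h) (Cod C (ev j \<epsilon>))"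
    then have h': "Cod C h = ob j P\<^sub>0" "ev j \<epsilon> \<cdot> h = Zero C (Dom C h) (ob j M)" by simp_all
    have "h = (ev j d \<cdot> \<tau> \<boxplus> ?\<sigma> \<cdot> ev j \<epsilon>) \<cdot> h" unfolding dt using h(1) h'(1) by simp
    also have "\<dots> = ev j d \<cdot> (\<tau> \<cdot> h)" using h(1) h' by simp
    finally show "\<exists>u. u \<in> Hom C (Dom C h) (Dom C (ev j d)) \<and> ev j d \<cdot> u = h"
      using h(1) h'(1) by (intro exI[of _ "\<tau> \<cdot> h"]) simp
  qed (use ed in simp_all)
  moreover have "is_epi C (ev j \<epsilon>)" by (rule is_epi_split[OF es HomR_D(3)[OF \<epsilon>(1) j] sH])
  ultimately show ?thesis by blast
qed

end

section \<open>The standard resolution, the upper bound and free covers\<close>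

context quiver_rep_AB4
begin

interpretation Rp: abelian_cat R by (rule abelian_R)

lemma standard_resolution:
  assumes M: "M \<in> reprs Q C"
  obtains P\<^sub>0 \<iota>\<^sub>0 P\<^sub>1 \<iota>\<^sub>1 \<epsilon> d where "is_free (verts Q) (\<lambda>v. v) (\<lambda>v. ob v M) P\<^sub>0 \<iota>\<^sub>0"
    "is_free (arcs Q) (head Q) (\<lambda>e. ob (tail Q e) M) P\<^sub>1 \<iota>\<^sub>1" "\<epsilon> \<in> Hom R P\<^sub>0 M" "is_epi R \<epsilon>"
    "d \<in> Hom R P\<^sub>1 P\<^sub>0" "is_kernel R \<epsilon> d"
proof -
  obtain P\<^sub>0 \<iota>\<^sub>0 where P0: "is_free (verts Q) (\<lambda>v. v) (\<lambda>v. ob v M) P\<^sub>0 \<iota>\<^sub>0"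
    using free_ex[OF small_verts, of "\<lambda>v. ob v M"] reprD(1)[OF M] by blast
  obtain P\<^sub>1 \<iota>\<^sub>1 where P1: "is_free (arcs Q) (head Q) (\<lambda>e. ob (tail Q e) M) P\<^sub>1 \<iota>\<^sub>1"
    using free_ex[OF small_arcs, of "\<lambda>e. ob (tail Q e) M"] reprD(1)[OF M] tail_vert by blast
  have iH: "Ident C (ob v M) \<in> Hom C (ob v M) (ob v M)" if "v \<in> verts Q" for v
    using reprD(1)[OF M that] by simp
  obtain \<epsilon> where \<epsilon>: "\<epsilon> \<in> Hom R P\<^sub>0 M" "\<And>v. v \<in> verts Q \<Longrightarrow> ev v \<epsilon> \<cdot> \<iota>\<^sub>0 v (v, []) = Ident C (ob v M)"
    using free_map[OF P0 M, of "\<lambda>v. Ident C (ob v M)", OF iH] by blast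
  \<comment> \<open>On the generator belonging to \<open>e\<close> the differential compares two
    ways to reach the head of \<open>e\<close>: moving the generator at the tail along
    \<open>e\<close> in the free representation, or applying \<open>e\<close> in \<open>M\<close>
    before entering the free representation.\<close>
  have dH: "\<iota>\<^sub>0 (head Q e) (tail Q e, [e]) \<boxminus> \<iota>\<^sub>0 (head Q e) (head Q e, []) \<cdot> ar e M
      \<in> Hom C (ob (tail Q e) M) (ob (head Q e) P\<^sub>0)" if e: "e \<in> arcs Q" for e
  proof -
    note t = tail_vert[OF e] and h = head_vert[OF e]
    have p: "[e] \<in> paths Q (tail Q e) (head Q e)" "[] \<in> paths Q (head Q e) (head Q e)"
      using e by (simp_all add: paths_Cons paths_Nil)
    show ?thesis
      using HomD[OF free_inj[OF P0 t p(1)]] HomD[OF free_inj[OF P0 h p(2)]] HomD[OF reprD(2)[OF M e]] by simp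
  qed
  obtain d where d: "d \<in> Hom R P\<^sub>1 P\<^sub>0" "\<And>e. e \<in> arcs Q \<Longrightarrow> ev (head Q e) d \<cdot> \<iota>\<^sub>1 (head Q e) (e, []) =
      \<iota>\<^sub>0 (head Q e) (tail Q e, [e]) \<boxminus> \<iota>\<^sub>0 (head Q e) (head Q e, []) \<cdot> ar e M"
    using free_map[OF P1 is_freeD(1)[OF P0], of "\<lambda>e. \<iota>\<^sub>0 (head Q e) (tail Q e, [e]) \<boxminus>
      \<iota>\<^sub>0 (head Q e) (head Q e, []) \<cdot> ar e M", OF dH] by blast
  note split = standard_split[OF M P0 P1 \<epsilon> d]
  have "is_epi R \<epsilon>" by (rule rep_epiI[OF \<epsilon>(1)]) (use split in blast)
  moreover have "is_kernel R \<epsilon> d" by (rule rep_kernelI[OF \<epsilon>(1) d(1)]) (use split in blast)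
  ultimately show thesis using that[OF P0 P1 \<epsilon>(1) _ d(1)] by blast
qed

lemma ext_vanish_Rep:
  assumes M: "M \<in> reprs Q C" and n: "n > 0"
    and van: "\<And>B. B \<in> Obj C \<Longrightarrow> ext_vanish n B" "\<And>B. B \<in> Obj C \<Longrightarrow> ext_vanish (Suc n) B"
  shows "Rp.ext_vanish (Suc n) M"
proof -
  obtain P\<^sub>0 \<iota>\<^sub>0 P\<^sub>1 \<iota>\<^sub>1 \<epsilon> d where r: "is_free (verts Q) (\<lambda>v. v) (\<lambda>v. ob v M) P\<^sub>0 \<iota>\<^sub>0"
    "is_free (arcs Q) (head Q) (\<lambda>e. ob (tail Q e) M) P\<^sub>1 \<iota>\<^sub>1" "\<epsilon> \<in> Hom R P\<^sub>0 M" "is_epi R \<epsilon>"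
    "d \<in> Hom R P\<^sub>1 P\<^sub>0" "is_kernel R \<epsilon> d" using standard_resolution[OF M] by blast
  have 0: "Rp.ext_vanish (Suc n) P\<^sub>0"
    by (rule free_ext_vanish[OF small_verts r(1) reprD(1)[OF M] van(2)])
  have 1: "Rp.ext_vanish n P\<^sub>1"
    by (rule free_ext_vanish[OF small_arcs r(2) reprD(1)[OF M tail_vert] van(1)])
  show ?thesis by (rule Rp.ext_vanish_quotient[OF r(4,3,6,5) 0 1 n])
qed

text \<open>The new kernel is a subrepresentation of the free cover of \<open>F\<close>, so
  \<open>\<rho>\<close> is mono on it as well. It maps to the old kernel, from which the remaining
  vanishing class is pulled back.\<close>

lemma vanishes_cover:
  assumes van: "Rp.vanishes (G # Gs) u" and u: "u \<in> Hom R T X" and G: "G \<in> Hom R E X" and \<rho>: "\<rho> \<in> arcs Q"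
  obtains p f k F K where "p \<in> Hom R F T" "is_epi R p" "f \<in> Hom R F E" "G \<cdot>\<^bsub>R\<^esub> f = u \<cdot>\<^bsub>R\<^esub> p"
    "is_kernel R p k" "k \<in> Hom R K F" "Rp.vanishes Gs (f \<cdot>\<^bsub>R\<^esub> k)" "is_mono C (ar \<rho> F)" "is_mono C (ar \<rho> K)"
proof -
  obtain p F f k K where p: "is_epi R p" "p \<in> Arr R" "Dom R p = F" "Cod R p = Dom R u" "f \<in> Arr R"
    "Dom R f = F" "Cod R f = Dom R G" "G \<cdot>\<^bsub>R\<^esub> f = u \<cdot>\<^bsub>R\<^esub> p" "is_kernel R p k" "k \<in> Arr R" "Cod R k = F"
    "Dom R k = K" "Rp.vanishes Gs (f \<cdot>\<^bsub>R\<^esub> k)"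
    by (rule Rp.vanishes_ConsE[OF van])
  have pH: "p \<in> Hom R F T" and fH: "f \<in> Hom R F E" and kH: "k \<in> Hom R K F"
    using p Rp.HomD[OF u] Rp.HomD[OF G] by simp_all
  obtain P \<iota> P\<^sub>1 \<iota>\<^sub>1 \<epsilon> d where r: "is_free (verts Q) (\<lambda>v. v) (\<lambda>v. ob v F) P \<iota>"
    "is_free (arcs Q) (head Q) (\<lambda>e. ob (tail Q e) F) P\<^sub>1 \<iota>\<^sub>1" "\<epsilon> \<in> Hom R P F" "is_epi R \<epsilon>"
    "d \<in> Hom R P\<^sub>1 P" "is_kernel R \<epsilon> d" using standard_resolution[OF HomR_D(1)[OF pH]] by blast
  have pe: "p \<cdot>\<^bsub>R\<^esub> \<epsilon> \<in> Hom R P T" and fe: "f \<cdot>\<^bsub>R\<^esub> \<epsilon> \<in> Hom R P E"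
    using comp_R(1)[OF r(3) pH] comp_R(1)[OF r(3) fH] .
  obtain K' k' where k': "k' \<in> Hom R K' P" "\<And>v. v \<in> verts Q \<Longrightarrow> is_kernel C (ev v (p \<cdot>\<^bsub>R\<^esub> \<epsilon>)) (ev v k')"
    using rep_kernel[OF pe] by blast
  have kk: "is_kernel R (p \<cdot>\<^bsub>R\<^esub> \<epsilon>) k'" by (rule rep_kernelI[OF pe k'])
  note T = Rp.HomD[OF pH] Rp.HomD[OF fH] Rp.HomD[OF kH] Rp.HomD[OF r(3)] Rp.HomD[OF k'(1)] Rp.HomD[OF u] Rp.HomD[OF G]
  have "p \<cdot>\<^bsub>R\<^esub> (\<epsilon> \<cdot>\<^bsub>R\<^esub> k') = Zero R K' T" using Rp.is_kernelD(4)[OF kk] T by simp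
  then obtain m where m: "m \<in> Arr R" "Dom R m = K'" "Cod R m = Dom R k" "k \<cdot>\<^bsub>R\<^esub> m = \<epsilon> \<cdot>\<^bsub>R\<^esub> k'"
    by (rule Rp.kernel_lift[OF p(9)]) (use T in simp_all)
  have "Rp.vanishes Gs ((f \<cdot>\<^bsub>R\<^esub> k) \<cdot>\<^bsub>R\<^esub> m)"
    by (rule Rp.vanishes_comp[OF p(13) comp_R(1)[OF kH fH], of _ K']) (use m T in simp)
  then have van': "Rp.vanishes Gs ((f \<cdot>\<^bsub>R\<^esub> \<epsilon>) \<cdot>\<^bsub>R\<^esub> k')" using m T by simp
  have Gf: "G \<cdot>\<^bsub>R\<^esub> (f \<cdot>\<^bsub>R\<^esub> \<epsilon>) = u \<cdot>\<^bsub>R\<^esub> (p \<cdot>\<^bsub>R\<^esub> \<epsilon>)" using T by (simp add: Rp.comp_reduce[OF p(8)])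
  have mF: "is_mono C (ar \<rho> P)" by (rule free_arrow_mono[OF r(1) \<rho>])
  note t = tail_vert[OF \<rho>] and h = head_vert[OF \<rho>]
  have kt: "is_mono C (ev (tail Q \<rho>) k')" by (rule is_kernel_mono[OF k'(2)[OF t]])
  note [simp] = HomD[OF HomR_D(3)[OF k'(1) t]] HomD[OF HomR_D(3)[OF k'(1) h]]
    HomD[OF reprD(2)[OF HomR_D(1)[OF k'(1)] \<rho>]] HomD[OF reprD(2)[OF HomR_D(2)[OF k'(1)] \<rho>]]
  have "is_mono C (ar \<rho> P \<cdot> ev (tail Q \<rho>) k')" by (rule is_mono_comp[OF kt mF]) simp
  then have "is_mono C (ev (head Q \<rho>) k' \<cdot> ar \<rho> K')" unfolding HomR_D(4)[OF k'(1) \<rho>] .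
  then have mK: "is_mono C (ar \<rho> K')" by (rule is_mono_cancel) simp_all
  have "is_epi R (p \<cdot>\<^bsub>R\<^esub> \<epsilon>)" by (rule Rp.epi_compH[OF r(4) p(1) r(3) pH])
  then show thesis using that[OF pe _ fe Gf kk k'(1) van' mF mK] by blast
qed

end

section \<open>The lower bound\<close>

context abelian_cat
begin

lemma exct_cokernel:
  assumes "is_cokernel C f c" shows "exct f c"
proof -
  obtain m where m: "is_kernel C c m" using ex_kernel[OF is_cokernelD(2)[OF assms]] by blast
  obtain e where "is_epi C e" "Cod C e = Dom C m" "f = m \<cdot> e" "Dom C e = Dom C f"
    using is_image_epi[OF assms m] .
  then show ?thesis unfolding exct_iff using m by blast
qed

text \<open>A piece of the snake lemma for the vertical arrows \<open>\<kappa>\<close>,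
  \<open>\<phi>\<close> and \<open>t\<close>: the connecting map into the cokernel of
  \<open>\<kappa>\<close> starts at the kernel of \<open>t\<close>, which is zero, so the induced
  arrow \<open>kb\<close> is mono. That \<open>p\<^sub>1\<close> is epi gives exactness in the
  middle.\<close>

lemma cokernels_exact:
  assumes t: "is_mono C t" "t \<in> Hom C T\<^sub>1 T\<^sub>2" and \<phi>: "\<phi> \<in> Hom C F\<^sub>1 F\<^sub>2" and \<kappa>: "\<kappa> \<in> Hom C K\<^sub>1 K\<^sub>2"
    and p: "is_epi C p\<^sub>1" "p\<^sub>1 \<in> Hom C F\<^sub>1 T\<^sub>1" "p\<^sub>2 \<in> Hom C F\<^sub>2 T\<^sub>2"
    and k: "is_kernel C p\<^sub>1 k\<^sub>1" "k\<^sub>1 \<in> Hom C K\<^sub>1 F\<^sub>1" "is_kernel C p\<^sub>2 k\<^sub>2" "k\<^sub>2 \<in> Hom C K\<^sub>2 F\<^sub>2"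
    and sq: "t \<cdot> p\<^sub>1 = p\<^sub>2 \<cdot> \<phi>" "k\<^sub>2 \<cdot> \<kappa> = \<phi> \<cdot> k\<^sub>1"
    and cF: "is_cokernel C \<phi> cF" "cF \<in> Hom C F\<^sub>2 F" and cK: "is_cokernel C \<kappa> cK" "cK \<in> Hom C K\<^sub>2 K"
    and cT: "is_cokernel C t cT" "cT \<in> Hom C T\<^sub>2 T"
    and kb: "kb \<in> Hom C K F" "kb \<cdot> cK = cF \<cdot> k\<^sub>2" and pb: "pb \<in> Hom C F T" "pb \<cdot> cF = cT \<cdot> p\<^sub>2"
  shows "is_kernel C pb kb"
proof -
  note [simp] = HomD[OF t(2)] HomD[OF \<phi>] HomD[OF \<kappa>] HomD[OF p(2)] HomD[OF p(3)] HomD[OF k(2)] HomD[OF k(4)]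
    HomD[OF cF(2)] HomD[OF cK(2)] HomD[OF cT(2)] HomD[OF kb(1)] HomD[OF pb(1)]
  note cFe = is_cokernel_epi[OF cF(1)] and cKe = is_cokernel_epi[OF cK(1)]
  have pk1: "p\<^sub>1 \<cdot> k\<^sub>1 = Zero C K\<^sub>1 T\<^sub>1" and pk2: "p\<^sub>2 \<cdot> k\<^sub>2 = Zero C K\<^sub>2 T\<^sub>2"
    using is_kernelD(4)[OF k(1)] is_kernelD(4)[OF k(3)] by simp_all
  have c\<phi>: "cF \<cdot> \<phi> = Zero C F\<^sub>1 F" and c\<kappa>: "cK \<cdot> \<kappa> = Zero C K\<^sub>1 K"
    using is_cokernelD(4)[OF cF(1)] is_cokernelD(4)[OF cK(1)] by simp_all
  \<comment> \<open>A local lift \<open>w\<close> of \<open>x\<close> to \<open>K\<^sub>2\<close>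
    has an image in \<open>F\<^sub>2\<close> that comes from some \<open>z\<close> in
    \<open>F\<^sub>1\<close>. As \<open>t\<close> is mono, \<open>p\<^sub>1\<close> kills
    \<open>z\<close>, so \<open>z\<close> lies in \<open>K\<^sub>1\<close> and \<open>w\<close>
    comes from \<open>\<kappa>\<close>.\<close>
  have mono: "is_mono C kb"
  proof (rule monoI[OF kb(1)])
    fix x S assume x: "x \<in> Hom C S K" "kb \<cdot> x = Zero C S F"
    note [simp] = HomD[OF x(1)]
    obtain r w S1 where w: "is_epi C r" "r \<in> Hom C S1 S" "w \<in> Hom C S1 K\<^sub>2" "cK \<cdot> w = x \<cdot> r"
      using epi_local_lift[OF cKe cK(2) x(1)] .
    note [simp] = HomD[OF w(2)] HomD[OF w(3)]
    have "cF \<cdot> (k\<^sub>2 \<cdot> w) = kb \<cdot> (cK \<cdot> w)" by (simp add: comp_reduce[OF kb(2)])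
    also have "\<dots> = Zero C S1 F" unfolding w(4) by (simp add: comp_reduce[OF x(2)])
    finally have 0: "cF \<cdot> (k\<^sub>2 \<cdot> w) = Zero C S1 F" .
    have kwH: "k\<^sub>2 \<cdot> w \<in> Hom C S1 F\<^sub>2" by simp
    obtain r' z S2 where z: "is_epi C r'" "r' \<in> Hom C S2 S1" "z \<in> Hom C S2 F\<^sub>1" "\<phi> \<cdot> z = (k\<^sub>2 \<cdot> w) \<cdot> r'"
      using exct_local_lift[OF exct_cokernel[OF cF(1)] kwH \<phi> cF(2) 0] .
    note [simp] = HomD[OF z(2)] HomD[OF z(3)]
    have "t \<cdot> (p\<^sub>1 \<cdot> z) = p\<^sub>2 \<cdot> (\<phi> \<cdot> z)" by (simp add: comp_reduce[OF sq(1)])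
    also have "\<dots> = Zero C S2 T\<^sub>2" unfolding z(4) by (simp add: comp_reduce[OF pk2])
    finally have "p\<^sub>1 \<cdot> z = Zero C S2 T\<^sub>1" by (rule mono_zero[OF t(1) _ t(2)]) simp
    then obtain v where v: "v \<in> Arr C" "Dom C v = S2" "Cod C v = Dom C k\<^sub>1" "k\<^sub>1 \<cdot> v = z"
      by (rule kernel_lift[OF k(1)]) simp_all
    have vH: "v \<in> Hom C S2 K\<^sub>1" using v by simp
    note [simp] = HomD[OF vH]
    have "k\<^sub>2 \<cdot> (\<kappa> \<cdot> v) = k\<^sub>2 \<cdot> (w \<cdot> r')" using v(4) z(4) by (simp add: comp_reduce[OF sq(2)])
    then have kv: "\<kappa> \<cdot> v = w \<cdot> r'" by (rule is_kernel_unique[OF k(3), of _ _ S2]) simp_all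
    have "x \<cdot> (r \<cdot> r') = cK \<cdot> (w \<cdot> r')" by (simp add: comp_reduce[OF w(4)])
    also have "\<dots> = Zero C S2 K" unfolding kv[symmetric] by (simp add: comp_reduce[OF c\<kappa>])
    finally show "x = Zero C S K"
      by (rule epi_zero[OF epi_compH[OF z(1) w(1) z(2) w(2)]]) (use x(1) in simp_all)
  qed
  \<comment> \<open>A local lift \<open>y\<close> of \<open>x\<close> to \<open>F\<^sub>2\<close> is
    sent by \<open>p\<^sub>2\<close> into the image of \<open>t\<close>. Lifting the preimage under
    \<open>t\<close> to \<open>z'\<close> in \<open>F\<^sub>1\<close> and subtracting
    \<open>\<phi> \<cdot> z'\<close> moves \<open>y\<close> into \<open>K\<^sub>2\<close> without
    changing its image in the cokernel.\<close>
  have "exct kb pb"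
  proof (rule exctI[OF kb(1) pb(1)])
    have "(pb \<cdot> kb) \<cdot> cK = Zero C K\<^sub>2 T" using kb(2) by (simp add: comp_reduce[OF pb(2)] pk2)
    then show "pb \<cdot> kb = Zero C K T" by (rule epi_zero[OF cKe _ cK(2)]) simp
    fix x S assume x: "x \<in> Hom C S F" "pb \<cdot> x = Zero C S T"
    note [simp] = HomD[OF x(1)]
    obtain r y S1 where y: "is_epi C r" "r \<in> Hom C S1 S" "y \<in> Hom C S1 F\<^sub>2" "cF \<cdot> y = x \<cdot> r"
      using epi_local_lift[OF cFe cF(2) x(1)] .
    note [simp] = HomD[OF y(2)] HomD[OF y(3)]
    have "cT \<cdot> (p\<^sub>2 \<cdot> y) = pb \<cdot> (cF \<cdot> y)" by (simp add: comp_reduce[OF pb(2)])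
    also have "\<dots> = Zero C S1 T" unfolding y(4) by (simp add: comp_reduce[OF x(2)])
    finally have 0: "cT \<cdot> (p\<^sub>2 \<cdot> y) = Zero C S1 T" .
    have pyH: "p\<^sub>2 \<cdot> y \<in> Hom C S1 T\<^sub>2" by simp
    obtain r1 z S2 where z: "is_epi C r1" "r1 \<in> Hom C S2 S1" "z \<in> Hom C S2 T\<^sub>1" "t \<cdot> z = (p\<^sub>2 \<cdot> y) \<cdot> r1"
      using exct_local_lift[OF exct_cokernel[OF cT(1)] pyH t(2) cT(2) 0] .
    note [simp] = HomD[OF z(2)] HomD[OF z(3)]
    obtain r2 z' S3 where z': "is_epi C r2" "r2 \<in> Hom C S3 S2" "z' \<in> Hom C S3 F\<^sub>1" "p\<^sub>1 \<cdot> z' = z \<cdot> r2"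
      using epi_local_lift[OF p(1,2) z(3)] .
    note [simp] = HomD[OF z'(2)] HomD[OF z'(3)]
    have "p\<^sub>2 \<cdot> (\<phi> \<cdot> z') = t \<cdot> (p\<^sub>1 \<cdot> z')" by (simp add: comp_reduce[OF sq(1)])
    also have "\<dots> = p\<^sub>2 \<cdot> (y \<cdot> (r1 \<cdot> r2))" unfolding z'(4) by (simp add: comp_reduce[OF z(4)])
    finally have "p\<^sub>2 \<cdot> (y \<cdot> (r1 \<cdot> r2) \<boxminus> \<phi> \<cdot> z') = Zero C S3 T\<^sub>2" by simp
    then obtain w where w: "w \<in> Arr C" "Dom C w = S3" "Cod C w = Dom C k\<^sub>2" "k\<^sub>2 \<cdot> w = y \<cdot> (r1 \<cdot> r2) \<boxminus> \<phi> \<cdot> z'"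
      by (rule kernel_lift[OF k(3)]) simp_all
    have wH: "w \<in> Hom C S3 K\<^sub>2" using w by simp
    note [simp] = HomD[OF wH]
    have "kb \<cdot> (cK \<cdot> w) = cF \<cdot> (k\<^sub>2 \<cdot> w)" by (simp add: comp_reduce[OF kb(2)])
    also have "\<dots> = x \<cdot> (r \<cdot> (r1 \<cdot> r2))" unfolding w(4) by (simp add: comp_reduce[OF y(4)] comp_reduce[OF c\<phi>])
    finally have "kb \<cdot> (cK \<cdot> w) = x \<cdot> (r \<cdot> (r1 \<cdot> r2))" .
    moreover have "is_epi C (r \<cdot> (r1 \<cdot> r2))"
      by (intro is_epi_comp z'(1) z(1) y(1)) simp_all
    ultimately show "\<exists>r e S'. is_epi C r \<and> r \<in> Hom C S' S \<and> e \<in> Hom C S' K \<and> kb \<cdot> e = x \<cdot> r"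
      by (intro exI[of _ "r \<cdot> (r1 \<cdot> r2)"] exI[of _ "cK \<cdot> w"] exI[of _ S3]) simp
  qed
  then show ?thesis using kernel_exct mono by blast
qed

lemma biprod_kernel:
  assumes bp: "biprod A B P i\<^sub>1 i\<^sub>2 p\<^sub>1 p\<^sub>2" shows "is_kernel C p\<^sub>1 i\<^sub>2" "is_epi C p\<^sub>1"
proof -
  note [simp] = biprodD[OF bp]
  show "is_kernel C p\<^sub>1 i\<^sub>2"
  proof (rule is_kernelI)
    show "is_mono C i\<^sub>2" by (rule is_mono_split[of p\<^sub>2 _ B P]) simp_all
    fix v assume v: "v \<in> Arr C" "Cod C v = Dom C p\<^sub>1" "p\<^sub>1 \<cdot> v = Zero C (Dom C v) (Cod C p\<^sub>1)"
    then have "v = i\<^sub>2 \<cdot> (p\<^sub>2 \<cdot> v)" by (intro biprod_eqI[OF bp, of v "i\<^sub>2 \<cdot> (p\<^sub>2 \<cdot> v)"]) simp_all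
    then show "\<exists>w. w \<in> Hom C (Dom C v) (Dom C i\<^sub>2) \<and> i\<^sub>2 \<cdot> w = v"
      using v(1,2) by (intro exI[of _ "p\<^sub>2 \<cdot> v"]) simp
  qed simp_all
  show "is_epi C p\<^sub>1" by (rule is_epi_split[of p\<^sub>1 i\<^sub>1 A P]) simp_all
qed

end

context quiver_rep_AB4
begin

interpretation Rp: abelian_cat R by (rule abelian_R)

text \<open>
  The arrow \<open>\<rho>\<close> acts by zero on all terms of \<open>Gs\<close> except possibly \<open>X\<close>, and at its head \<open>Gs\<close> maps to \<open>gs\<close>,
  starting with \<open>w\<close>. So an arrow into such a term induces one on the cokernel of \<open>\<rho>\<close>.
\<close>

fun supported_over :: "'e \<Rightarrow> 'b \<Rightarrow> ('v, 'e, 'a, 'b) repr \<Rightarrow> 'a \<Rightarrow> ('v, 'e, 'a, 'b) repr_map list \<Rightarrow> 'b list \<Rightarrow> bool" where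
  "supported_over \<rho> w X A [] [] \<longleftrightarrow> True"
| "supported_over \<rho> w X A (G # Gs) (g # gs) \<longleftrightarrow> (\<exists>E' E w'. G \<in> Hom R E' X \<and> g \<in> Hom C E A \<and>
     w' \<in> Hom C (ob (head Q \<rho>) E') E \<and> ar \<rho> E' = Zero C (ob (tail Q \<rho>) E') (ob (head Q \<rho>) E') \<and>
     w \<cdot> ev (head Q \<rho>) G = g \<cdot> w' \<and> supported_over \<rho> w' E' E Gs gs)"
| "supported_over \<rho> w X A _ _ \<longleftrightarrow> False"

text \<open>Taking cokernels of \<open>\<rho>\<close> is only right exact, but where
  \<open>\<rho>\<close> is mono it keeps the kernel of a cover (\<open>cokernels_exact\<close>);
  thus cover and kernel of the witness descend. The lift descends because \<open>\<rho>\<close> acts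
  by zero on its target \<open>E'\<close>. Each cover is refined first, so that the hypothesis on
  \<open>\<rho>\<close> is available for the next kernel.\<close>

lemma vanishes_coker:
  assumes "\<rho> \<in> arcs Q" "supported_over \<rho> w X A Gs gs" "w \<in> Hom C (ob (head Q \<rho>) X) A"
    "Rp.vanishes Gs u" "u \<in> Hom R T X" "is_mono C (ar \<rho> T)"
    "is_cokernel C (ar \<rho> T) c" "c \<in> Hom C (ob (head Q \<rho>) T) T'" "ub \<in> Hom C T' A"
    "ub \<cdot> c = w \<cdot> ev (head Q \<rho>) u"
  shows "vanishes gs ub"
  using assms
proof (induction \<rho> w X A Gs gs arbitrary: u T c T' ub rule: supported_over.induct)
  case (1 \<rho> w X A)
  note \<rho> = 1(1) and w = 1(3) and u = 1(5) and c = 1(7,8) and ub = 1(9,10)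
  have h: "head Q \<rho> \<in> verts Q" using \<rho> by simp
  have "u = Zero R T X" using 1(4) Rp.vanishes_Nil[OF u] by blast
  then have "ev (head Q \<rho>) u = Zero C (ob (head Q \<rho>) T) (ob (head Q \<rho>) X)"
    using zero_R(2)[OF HomR_D(1,2)[OF u] h] by simp
  then have "ub \<cdot> c = Zero C (ob (head Q \<rho>) T) A"
    unfolding ub(2) using HomD[OF w] reprD(1)[OF HomR_D(1)[OF u] h] by simp
  then have "ub = Zero C T' A" by (rule epi_zero[OF is_cokernel_epi[OF c(1)] _ c(2) ub(1)])
  then show ?case using vanishes_Nil[OF ub(1)] by simp
next
  case (2 \<rho> w X A G Gs g gs)
  note \<rho> = 2(2) and w = 2(4) and u = 2(6) and mT = 2(7) and c = 2(8,9) and ub = 2(10,11)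
  obtain E' E w' where G: "G \<in> Hom R E' X" and g: "g \<in> Hom C E A"
    and w': "w' \<in> Hom C (ob (head Q \<rho>) E') E" and E0: "ar \<rho> E' = Zero C (ob (tail Q \<rho>) E') (ob (head Q \<rho>) E')"
    and wG: "w \<cdot> ev (head Q \<rho>) G = g \<cdot> w'" and sup: "supported_over \<rho> w' E' E Gs gs"
    using 2(3) unfolding supported_over.simps by blast
  obtain p f k F K where p: "p \<in> Hom R F T" "is_epi R p" and f: "f \<in> Hom R F E'" and Gf: "G \<cdot>\<^bsub>R\<^esub> f = u \<cdot>\<^bsub>R\<^esub> p"
    and k: "is_kernel R p k" "k \<in> Hom R K F" and van: "Rp.vanishes Gs (f \<cdot>\<^bsub>R\<^esub> k)"
    and mF: "is_mono C (ar \<rho> F)" and mK: "is_mono C (ar \<rho> K)"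
    by (rule vanishes_cover[OF 2(5) u G \<rho>])
  note t = tail_vert[OF \<rho>] and h = head_vert[OF \<rho>]
  note FR = HomR_D(1)[OF p(1)] and TR = HomR_D(1)[OF u] and KR = HomR_D(1)[OF k(2)] and ER = HomR_D(1)[OF G]
  note aF = reprD(2)[OF FR \<rho>] and aT = reprD(2)[OF TR \<rho>] and aK = reprD(2)[OF KR \<rho>]
  note ph = HomR_D(3)[OF p(1) h] and pt = HomR_D(3)[OF p(1) t] and kh = HomR_D(3)[OF k(2) h]
    and kt = HomR_D(3)[OF k(2) t] and fh = HomR_D(3)[OF f h] and ft = HomR_D(3)[OF f t]
    and uh = HomR_D(3)[OF u h] and Gh = HomR_D(3)[OF G h]
  note [simp] = HomD[OF aF] HomD[OF aT] HomD[OF aK] HomD[OF ph] HomD[OF pt] HomD[OF kh] HomD[OF kt]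
    HomD[OF fh] HomD[OF ft] HomD[OF uh] HomD[OF Gh] HomD[OF w] HomD[OF w'] HomD[OF g] HomD[OF c(2)] HomD[OF ub(1)]
    reprD(1)[OF ER t] reprD(1)[OF ER h]
  obtain cF F' where cF: "is_cokernel C (ar \<rho> F) cF" "cF \<in> Arr C" "Cod C cF = F'" "Dom C cF = Cod C (ar \<rho> F)"
    "F' \<in> Obj C" "cF \<cdot> ar \<rho> F = Zero C (Dom C (ar \<rho> F)) F'" by (rule obtain_cokernel[OF HomD(1)[OF aF]])
  obtain cK K' where cK: "is_cokernel C (ar \<rho> K) cK" "cK \<in> Arr C" "Cod C cK = K'" "Dom C cK = Cod C (ar \<rho> K)"
    "K' \<in> Obj C" "cK \<cdot> ar \<rho> K = Zero C (Dom C (ar \<rho> K)) K'" by (rule obtain_cokernel[OF HomD(1)[OF aK]])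
  have cFH: "cF \<in> Hom C (ob (head Q \<rho>) F) F'" and cKH: "cK \<in> Hom C (ob (head Q \<rho>) K) K'"
    using cF cK by simp_all
  note [simp] = HomD[OF cFH] HomD[OF cKH]
  have cF0: "cF \<cdot> ar \<rho> F = Zero C (ob (tail Q \<rho>) F) F'" using cF(6) by simp
  have cT0: "c \<cdot> ar \<rho> T = Zero C (ob (tail Q \<rho>) T) T'" using is_cokernelD(4)[OF c(1)] by simp
  note pn = HomR_D(4)[OF p(1) \<rho>] and kn = HomR_D(4)[OF k(2) \<rho>] and fn = HomR_D(4)[OF f \<rho>]
  have "(c \<cdot> ev (head Q \<rho>) p) \<cdot> ar \<rho> F = Zero C (ob (tail Q \<rho>) F) T'"
    by (simp add: pn[symmetric] comp_reduce[OF cT0])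
  then obtain pb where pb: "pb \<in> Arr C" "Dom C pb = Cod C cF" "Cod C pb = T'" "pb \<cdot> cF = c \<cdot> ev (head Q \<rho>) p"
    by (rule cokernel_factor[OF cF(1)]) simp_all
  have pbH: "pb \<in> Hom C F' T'" using pb by simp
  have "(cF \<cdot> ev (head Q \<rho>) k) \<cdot> ar \<rho> K = Zero C (ob (tail Q \<rho>) K) F'"
    by (simp add: kn[symmetric] comp_reduce[OF cF0])
  then obtain kb where kb: "kb \<in> Arr C" "Dom C kb = Cod C cK" "Cod C kb = F'" "kb \<cdot> cK = cF \<cdot> ev (head Q \<rho>) k"
    by (rule cokernel_factor[OF cK(1)]) simp_all
  have kbH: "kb \<in> Hom C K' F'" using kb by simp
  have f0: "ev (head Q \<rho>) f \<cdot> ar \<rho> F = Zero C (ob (tail Q \<rho>) F) (ob (head Q \<rho>) E')"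
    unfolding fn[symmetric] E0 by simp
  then have "(w' \<cdot> ev (head Q \<rho>) f) \<cdot> ar \<rho> F = Zero C (ob (tail Q \<rho>) F) E" by simp
  then obtain fb where fb: "fb \<in> Arr C" "Dom C fb = Cod C cF" "Cod C fb = E" "fb \<cdot> cF = w' \<cdot> ev (head Q \<rho>) f"
    by (rule cokernel_factor[OF cF(1)]) simp_all
  have fbH: "fb \<in> Hom C F' E" using fb by simp
  note [simp] = HomD[OF pbH] HomD[OF kbH] HomD[OF fbH]
  have pbe: "is_epi C pb"
  proof (rule is_epi_cancel[of pb cF])
    show "is_epi C (pb \<cdot> cF)" unfolding pb(4)
      by (rule epi_compH[OF rep_epi_ev[OF p h] is_cokernel_epi[OF c(1)] ph c(2)])
  qed simp_all
  have ker: "is_kernel C pb kb"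
    by (rule cokernels_exact[OF mT aT aF aK rep_epi_ev[OF p t] pt ph rep_kernel_ev[OF p(1) k(2,1) t] kt
          rep_kernel_ev[OF p(1) k(2,1) h] kh pn kn[symmetric] cF(1) cFH cK(1) cKH c kbH kb(4) pbH pb(4)])
  have Guh: "ev (head Q \<rho>) G \<cdot> ev (head Q \<rho>) f = ev (head Q \<rho>) u \<cdot> ev (head Q \<rho>) p"
    using comp_R(2)[OF f G h] comp_R(2)[OF p(1) u h] Gf by simp
  have gf: "g \<cdot> fb = ub \<cdot> pb"
  proof (rule is_epiD[OF is_cokernel_epi[OF cF(1)]])
    have "(g \<cdot> fb) \<cdot> cF = w \<cdot> (ev (head Q \<rho>) u \<cdot> ev (head Q \<rho>) p)"
      using fb(4) Guh by (simp add: comp_reduce[OF wG[symmetric]])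
    also have "\<dots> = (ub \<cdot> pb) \<cdot> cF" using pb(4) by (simp add: comp_reduce[OF ub(2)])
    finally show "(g \<cdot> fb) \<cdot> cF = (ub \<cdot> pb) \<cdot> cF" .
  qed simp_all
  have "(fb \<cdot> kb) \<cdot> cK = w' \<cdot> ev (head Q \<rho>) (f \<cdot>\<^bsub>R\<^esub> k)"
    unfolding comp_R(2)[OF k(2) f h] using kb(4) by (simp add: comp_reduce[OF fb(4)])
  then have "vanishes gs (fb \<cdot> kb)"
    by (intro 2(1)[OF \<rho> sup w' van comp_R(1)[OF k(2) f] mK cK(1) cKH]) simp_all
  then show ?case
    unfolding vanishes.simps using pbe gf ker
    by (intro conjI exI[of _ pb] exI[of _ fb] exI[of _ kb]) simp_all
qed simp_all

end

context abelian_cat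
begin

lemma same_ker_mono:
  assumes "is_mono C m" "m \<in> Hom C A B" "g \<in> Hom C E A"
  shows "same_ker g (m \<cdot> g)"
  unfolding same_ker_def
proof (intro conjI allI impI iffI)
  note [simp] = HomD[OF assms(2)] HomD[OF assms(3)]
  show "g \<in> Arr C" "m \<cdot> g \<in> Arr C" "Dom C g = Dom C (m \<cdot> g)" by simp_all
  fix x S assume "x \<in> Hom C S (Dom C g)"
  then have x: "x \<in> Hom C S E" by simp
  note [simp] = HomD[OF x]
  { assume "g \<cdot> x = Zero C S (Cod C g)" then show "(m \<cdot> g) \<cdot> x = Zero C S (Cod C (m \<cdot> g))" by simp }
  { assume "(m \<cdot> g) \<cdot> x = Zero C S (Cod C (m \<cdot> g))"
    then have "m \<cdot> (g \<cdot> x) = Zero C S B" by simp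
    then have "g \<cdot> x = Zero C S A" by (rule mono_zero[OF assms(1) _ assms(2)]) simp
    then show "g \<cdot> x = Zero C S (Cod C g)" by simp }
qed

end

section \<open>Representations concentrated at one vertex\<close>

context quiver_rep
begin

interpretation Rp: abelian_cat R by (rule abelian_R)

text \<open>All arrows act by zero, including loops at \<open>z\<close>. The object \<open>Z\<close>
  at the other vertices is a parameter to be instantiated by a fixed zero object.\<close>

definition stalk :: "'a \<Rightarrow> 'v \<Rightarrow> 'a \<Rightarrow> ('v, 'e, 'a, 'b) repr" where
  "stalk Z z A = (\<lambda>v\<in>verts Q. if v = z then A else Z,
     \<lambda>e\<in>arcs Q. Zero C (if tail Q e = z then A else Z) (if head Q e = z then A else Z))"

definition stalk_map :: "'a \<Rightarrow> 'v \<Rightarrow> 'b \<Rightarrow> ('v, 'e, 'a, 'b) repr_map" where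
  "stalk_map Z z g = (stalk Z z (Dom C g), stalk Z z (Cod C g),
     \<lambda>v\<in>verts Q. if v = z then g else Zero C Z Z)"

lemma ob_stalk: "v \<in> verts Q \<Longrightarrow> ob v (stalk Z z A) = (if v = z then A else Z)"
  and ar_stalk: "e \<in> arcs Q \<Longrightarrow> ar e (stalk Z z A) =
    Zero C (ob (tail Q e) (stalk Z z A)) (ob (head Q e) (stalk Z z A))"
  by (simp_all add: stalk_def)

lemma stalk_repr: "\<lbrakk>A \<in> Obj C; Z \<in> Obj C\<rbrakk> \<Longrightarrow> stalk Z z A \<in> reprs Q C"
  unfolding stalk_def reprs_def by auto

lemma stalk_map_Hom:
  assumes g: "g \<in> Hom C E A" and Z: "Z \<in> Obj C"
  shows "stalk_map Z z g \<in> Hom R (stalk Z z E) (stalk Z z A)"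
    "v \<in> verts Q \<Longrightarrow> ev v (stalk_map Z z g) = (if v = z then g else Zero C Z Z)"
proof -
  note [simp] = HomD[OF g] Z
  show "v \<in> verts Q \<Longrightarrow> ev v (stalk_map Z z g) = (if v = z then g else Zero C Z Z)"
    by (simp add: ev_def stalk_map_def)
  have "ar e (stalk Z z A) \<cdot> (if tail Q e = z then g else Zero C Z Z) =
    (if head Q e = z then g else Zero C Z Z) \<cdot> ar e (stalk Z z E)" if e: "e \<in> arcs Q" for e
    unfolding ar_stalk[OF e] ob_stalk[OF tail_vert[OF e]] ob_stalk[OF head_vert[OF e]] by simp
  then show "stalk_map Z z g \<in> Hom R (stalk Z z E) (stalk Z z A)"
    unfolding Hom_R_iff stalk_map_def using stalk_repr by (simp add: ob_stalk)
qed

text \<open>At \<open>z\<close> the sequence is the given one; at every other vertex it consists of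
  zero objects.\<close>

lemma stalk_exct:
  assumes ex: "exct f g" and f: "f \<in> Hom C X Y" and g: "g \<in> Hom C Y W"
    and Z: "Z \<in> Obj C" "\<And>f A. f \<in> Hom C A Z \<Longrightarrow> f = Zero C A Z"
  shows "Rp.exct (stalk_map Z z f) (stalk_map Z z g)"
proof (rule rep_exctI[OF stalk_map_Hom(1)[OF f Z(1)] stalk_map_Hom(1)[OF g Z(1)]])
  fix v assume v: "v \<in> verts Q"
  have "exct (Zero C Z Z) (Zero C Z Z)"
    by (rule exct_zero_mono[OF Z(1), of _ Z Z]) (use Z in simp_all)
  then show "exct (ev v (stalk_map Z z f)) (ev v (stalk_map Z z g))"
    unfolding stalk_map_Hom(2)[OF f Z(1) v] stalk_map_Hom(2)[OF g Z(1) v] using ex by simp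
qed

lemma stalk_chain:
  assumes "chain g gs" "g \<in> Hom C E A" and Z: "Z \<in> Obj C" "\<And>f A. f \<in> Hom C A Z \<Longrightarrow> f = Zero C A Z"
  shows "Rp.chain (stalk_map Z z g) (map (stalk_map Z z) gs)"
  using assms(1,2)
proof (induction gs arbitrary: g E A)
  case (Cons g2 gs)
  have ex: "exct g2 g" using Cons.prems(1) by simp
  obtain E2 where g2: "g2 \<in> Hom C E2 E" using exctD[OF ex] HomD[OF Cons.prems(2)] by simp
  show ?case using Cons.IH[OF _ g2] Cons.prems(1) stalk_exct[OF ex g2 Cons.prems(2) Z] by simp
qed simp

end

section \<open>The splice at an arrow and the comparison of global dimensions\<close>

context quiver_rep_AB4
begin

interpretation Rp: abelian_cat R by (rule abelian_R)

lemma supported_over_stalk: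
  assumes "chain g gs" "g \<in> Hom C E A" and Z: "Z \<in> Obj C" and \<rho>: "\<rho> \<in> arcs Q"
  shows "supported_over \<rho> (Ident C E) (stalk Z (head Q \<rho>) E) E (map (stalk_map Z (head Q \<rho>)) gs) gs"
  using assms(1,2)
proof (induction gs arbitrary: g E A)
  case (Cons g2 gs)
  have ex: "exct g2 g" using Cons.prems(1) by simp
  obtain E2 where g2: "g2 \<in> Hom C E2 E" using exctD[OF ex] HomD[OF Cons.prems(2)] by simp
  note h = head_vert[OF \<rho>]
  have "supported_over \<rho> (Ident C E2) (stalk Z (head Q \<rho>) E2) E2 (map (stalk_map Z (head Q \<rho>)) gs) gs"
    using Cons.IH[OF _ g2] Cons.prems(1) by simp
  moreover have "Ident C E2 \<in> Hom C (ob (head Q \<rho>) (stalk Z (head Q \<rho>) E2)) E2"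
    "Ident C E \<cdot> ev (head Q \<rho>) (stalk_map Z (head Q \<rho>) g2) = g2 \<cdot> Ident C E2"
    unfolding ob_stalk[OF h] stalk_map_Hom(2)[OF g2 Z h] using HomD[OF g2] by simp_all
  ultimately show ?case
    unfolding list.map supported_over.simps
    using g2 stalk_map_Hom(1)[OF g2 Z] ar_stalk[OF \<rho>] by blast
qed simp

text \<open>A witness for the spliced sequence has a cover \<open>p\<close> of \<open>SX\<close>
  with kernel \<open>K\<close>. On the cokernel of \<open>\<rho>\<close> on \<open>K\<close> it
  induces an arrow \<open>ub\<close> to \<open>A\<close> whose class vanishes. The snake lemma
  provides an arrow \<open>a\<close> from \<open>A\<close> to this cokernel with
  \<open>ub \<cdot> a\<close> the identity, and vanishing is stable under precomposition.\<close>

lemma vanishes_of_Rep: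
  assumes \<rho>: "\<rho> \<in> arcs Q" and A: "A \<in> Obj C"
    and Z: "Z \<in> Obj C" "\<And>f A. f \<in> Hom C A Z \<Longrightarrow> f = Zero C A Z" "\<And>f A. f \<in> Hom C Z A \<Longrightarrow> f = Zero C Z A"
    and van: "\<And>M. M \<in> reprs Q C \<Longrightarrow> Rp.ext_vanish (Suc n) M"
    and gs: "chain (Zero C A Z) gs" "length gs = n"
  shows "vanishes gs (Ident C A)"
proof -
  define x y where "x = tail Q \<rho>" and "y = head Q \<rho>"
  have xv: "x \<in> verts Q" and yv: "y \<in> verts Q" using \<rho> by (simp_all add: x_def y_def)
  define SX SY where "SX = stalk Z x A" and "SY = stalk Z y A"
  have SX: "SX \<in> reprs Q C" and SY: "SY \<in> reprs Q C"
    using stalk_repr[OF A Z(1)] by (simp_all add: SX_def SY_def)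
  have SXx: "ob x SX = A" and SYy: "ob y SY = A"
    using ob_stalk[OF xv] ob_stalk[OF yv] by (simp_all add: SX_def SY_def)
  have aX: "ar e SX = Zero C (ob (tail Q e) SX) (ob (head Q e) SX)"
    and aY: "ar e SY = Zero C (ob (tail Q e) SY) (ob (head Q e) SY)" if "e \<in> arcs Q" for e
    using ar_stalk[OF that] by (simp_all add: SX_def SY_def)
  \<comment> \<open>The biproduct is taken at every vertex. If \<open>\<rho>\<close> is a loop, its
    vertex carries A \<oplus> A and \<open>\<rho>\<close> acts there with square zero.\<close>
  have "\<forall>v. \<exists>P i\<^sub>1 i\<^sub>2 p\<^sub>1 p\<^sub>2. v \<in> verts Q \<longrightarrow> biprod (ob v SX) (ob v SY) P i\<^sub>1 i\<^sub>2 p\<^sub>1 p\<^sub>2"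
    using obtain_biprod reprD(1)[OF SX] reprD(1)[OF SY] by metis
  then obtain P i\<^sub>1 i\<^sub>2 p\<^sub>1 p\<^sub>2 where bp:
    "\<And>v. v \<in> verts Q \<Longrightarrow> biprod (ob v SX) (ob v SY) (P v) (i\<^sub>1 v) (i\<^sub>2 v) (p\<^sub>1 v) (p\<^sub>2 v)" by metis
  \<comment> \<open>Only \<open>\<rho>\<close> acts: it carries the summand \<open>SX\<close> at
    \<open>x\<close> identically onto the summand \<open>SY\<close> at \<open>y\<close>, both being
    \<open>A\<close>.\<close>
  define \<phi> where "\<phi> e = (if e = \<rho> then i\<^sub>2 y \<cdot> p\<^sub>1 x else Zero C (P (tail Q e)) (P (head Q e)))" for e
  have PO: "P v \<in> Obj C" if "v \<in> verts Q" for v using biprodD[OF bp[OF that]] by simp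
  have \<phi>H: "\<phi> e \<in> Hom C (P (tail Q e)) (P (head Q e))" if e: "e \<in> arcs Q" for e
    unfolding \<phi>_def using biprodD[OF bp[OF xv]] biprodD[OF bp[OF yv]] PO[OF tail_vert[OF e]] PO[OF head_vert[OF e]]
      SXx SYy by (simp add: x_def y_def)
  obtain B where B: "B \<in> reprs Q C" "\<And>v. v \<in> verts Q \<Longrightarrow> ob v B = P v" "\<And>e. e \<in> arcs Q \<Longrightarrow> ar e B = \<phi> e"
    using repr_ex[of P \<phi>, OF PO \<phi>H] by blast
  have pr1: "p\<^sub>1 (head Q e) \<cdot> \<phi> e = Zero C (P (tail Q e)) (ob (head Q e) SX)" if e: "e \<in> arcs Q" for e
  proof (cases "e = \<rho>")
    case True
    have "p\<^sub>1 y \<cdot> (i\<^sub>2 y \<cdot> p\<^sub>1 x) = Zero C (P x) (ob y SX)"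
      using biprodD[OF bp[OF xv]] biprodD[OF bp[OF yv]] SXx SYy by simp
    then show ?thesis using True by (simp add: \<phi>_def x_def y_def)
  next
    case False
    then show ?thesis using biprodD[OF bp[OF head_vert[OF e]]] PO[OF tail_vert[OF e]] by (simp add: \<phi>_def)
  qed
  have in2: "\<phi> e \<cdot> i\<^sub>2 (tail Q e) = Zero C (ob (tail Q e) SY) (P (head Q e))" if e: "e \<in> arcs Q" for e
  proof (cases "e = \<rho>")
    case True
    have "(i\<^sub>2 y \<cdot> p\<^sub>1 x) \<cdot> i\<^sub>2 x = Zero C (ob x SY) (P y)"
      using biprodD[OF bp[OF xv]] biprodD[OF bp[OF yv]] SXx SYy by simp
    then show ?thesis using True by (simp add: \<phi>_def x_def y_def)
  next
    case False
    then show ?thesis using biprodD[OF bp[OF tail_vert[OF e]]] PO[OF head_vert[OF e]] by (simp add: \<phi>_def)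
  qed
  obtain r where r: "r \<in> Hom R B SX" "\<And>v. v \<in> verts Q \<Longrightarrow> ev v r = p\<^sub>1 v"
  proof (rule HomR_ex[OF B(1) SX, of p\<^sub>1])
    fix e assume e: "e \<in> arcs Q"
    show "ar e SX \<cdot> p\<^sub>1 (tail Q e) = p\<^sub>1 (head Q e) \<cdot> ar e B"
      unfolding B(3)[OF e] pr1[OF e] aX[OF e]
      using biprodD[OF bp[OF tail_vert[OF e]]] reprD(1)[OF SX head_vert[OF e]] by simp
  next
    fix v assume v: "v \<in> verts Q"
    show "p\<^sub>1 v \<in> Hom C (ob v B) (ob v SX)" unfolding B(2)[OF v] using biprodD[OF bp[OF v]] by simp
  qed blast
  obtain jj where jj: "jj \<in> Hom R SY B" "\<And>v. v \<in> verts Q \<Longrightarrow> ev v jj = i\<^sub>2 v"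
  proof (rule HomR_ex[OF SY B(1), of i\<^sub>2])
    fix e assume e: "e \<in> arcs Q"
    show "ar e B \<cdot> i\<^sub>2 (tail Q e) = i\<^sub>2 (head Q e) \<cdot> ar e SY"
      unfolding B(3)[OF e] in2[OF e] aY[OF e]
      using biprodD[OF bp[OF head_vert[OF e]]] reprD(1)[OF SY tail_vert[OF e]] by simp
  next
    fix v assume v: "v \<in> verts Q"
    show "i\<^sub>2 v \<in> Hom C (ob v SY) (ob v B)" unfolding B(2)[OF v] using biprodD[OF bp[OF v]] by simp
  qed blast
  have re: "is_epi R r" by (rule rep_epiI[OF r(1)]) (use r(2) biprod_kernel(2)[OF bp] in simp)
  have jm: "is_mono R jj"
    by (rule rep_monoI[OF jj(1)]) (use jj(2) is_kernel_mono[OF biprod_kernel(1)[OF bp]] in simp)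
  let ?Sm = "stalk_map Z y"
  \<comment> \<open>The splice: the first arrow of the extension, placed at \<open>y\<close>, is
    continued by the inclusion \<open>jj\<close> of \<open>SY\<close>. For empty \<open>gs\<close>,
    which is \<open>n = 0\<close>, only the extension of \<open>SX\<close> by \<open>SY\<close>
    remains.\<close>
  define Gs where "Gs = (case gs of [] \<Rightarrow> [] | g # gs1 \<Rightarrow> (jj \<cdot>\<^bsub>R\<^esub> ?Sm g) # map ?Sm gs1)"
  have p2H: "p\<^sub>2 y \<in> Hom C (ob y B) A" using biprodD[OF bp[OF yv]] B(2)[OF yv] SYy by simp
  have Gs: "Rp.chain r Gs \<and> supported_over \<rho> (p\<^sub>2 y) B A Gs gs \<and> length Gs = n"
  proof (cases gs)
    case Nil then show ?thesis using gs(2) by (simp add: Gs_def)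
  next
    case (Cons g gs1)
    have ex: "exct g (Zero C A Z)" and ch: "chain g gs1" using gs(1) Cons by simp_all
    obtain E where g: "g \<in> Hom C E A" using exctD[OF ex] A Z(1) by simp
    have ge: "is_epi C g" using ex exct_zero[OF g Z(1)] by simp
    have Sg: "?Sm g \<in> Hom R (stalk Z y E) SY" using stalk_map_Hom(1)[OF g Z(1)] unfolding SY_def .
    note jS = comp_R[OF Sg jj(1)]
    have "Rp.exct (jj \<cdot>\<^bsub>R\<^esub> ?Sm g) r"
    proof (rule rep_exctI[OF jS(1) r(1)])
      fix v assume v: "v \<in> verts Q"
      have "is_epi C (Zero C Z Z)"
        by (rule epiI[of _ Z Z]) (use Z in simp_all)
      then have "is_epi C (ev v (?Sm g))" using ge stalk_map_Hom(2)[OF g Z(1) v] by simp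
      moreover have "Cod C (ev v (?Sm g)) = Dom C (i\<^sub>2 v)"
        using HomD(3)[OF HomR_D(3)[OF Sg v]] biprodD[OF bp[OF v]] by simp
      ultimately show "exct (ev v (jj \<cdot>\<^bsub>R\<^esub> ?Sm g)) (ev v r)"
        unfolding exct_iff jS(2)[OF v] r(2)[OF v] jj(2)[OF v] using biprod_kernel(1)[OF bp[OF v]] by blast
    qed
    moreover have "Rp.chain (jj \<cdot>\<^bsub>R\<^esub> ?Sm g) (map ?Sm gs1)"
      by (rule Rp.chain_same_ker[OF Rp.same_ker_mono[OF jm jj(1) Sg] stalk_chain[OF ch g Z(1,2)]])
    moreover have "supported_over \<rho> (p\<^sub>2 y) B A ((jj \<cdot>\<^bsub>R\<^esub> ?Sm g) # map ?Sm gs1) (g # gs1)"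
    proof -
      have 1: "supported_over \<rho> (Ident C E) (stalk Z y E) E (map ?Sm gs1) gs1"
        using supported_over_stalk[OF ch g Z(1) \<rho>] unfolding y_def .
      have 2: "ar \<rho> (stalk Z y E) = Zero C (ob (tail Q \<rho>) (stalk Z y E)) (ob (head Q \<rho>) (stalk Z y E))"
        by (rule ar_stalk[OF \<rho>])
      have 3: "Ident C E \<in> Hom C (ob (head Q \<rho>) (stalk Z y E)) E"
        using ob_stalk[OF yv, of Z y E] HomD[OF g] by (simp add: y_def)
      have "p\<^sub>2 y \<cdot> ev y (jj \<cdot>\<^bsub>R\<^esub> ?Sm g) = g \<cdot> Ident C E"
        unfolding jS(2)[OF yv] jj(2)[OF yv] stalk_map_Hom(2)[OF g Z(1) yv]
        using biprodD[OF bp[OF yv]] HomD[OF g] SYy by simp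
      then have 4: "p\<^sub>2 y \<cdot> ev (head Q \<rho>) (jj \<cdot>\<^bsub>R\<^esub> ?Sm g) = g \<cdot> Ident C E" by (simp add: y_def)
      show ?thesis unfolding supported_over.simps using jS(1) g 1 2 3 4 by blast
    qed
    ultimately show ?thesis using gs(2) Cons by (simp add: Gs_def)
  qed
  have zX: "Zero R SX SX \<in> Hom R SX SX" by (rule zero_R(1)[OF SX SX])
  have "Rp.exct r (Zero R SX SX)" using Rp.exct_zero[OF r(1), of SX] re SX by simp
  then have "Rp.vanishes (r # Gs) (Ident R SX)"
    using van[OF SX] zX Gs ident_R(1)[OF SX] Rp.comp_ident[of "Zero R SX SX" SX] Rp.HomD[OF zX]
    unfolding Rp.ext_vanish_def
    by (elim allE[of _ "Zero R SX SX"] allE[of _ "r # Gs"] allE[of _ SX] allE[of _ SX] allE[of _ "Ident R SX"]) simp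
  then obtain p f k F K where p: "p \<in> Hom R F SX" "is_epi R p" and f: "f \<in> Hom R F B"
    and rf: "r \<cdot>\<^bsub>R\<^esub> f = Ident R SX \<cdot>\<^bsub>R\<^esub> p"
    and k: "is_kernel R p k" "k \<in> Hom R K F" and vank: "Rp.vanishes Gs (f \<cdot>\<^bsub>R\<^esub> k)"
    and mF: "is_mono C (ar \<rho> F)" and mK: "is_mono C (ar \<rho> K)"
    by (rule vanishes_cover[OF _ ident_R(1)[OF SX] r(1) \<rho>])
  have rf': "r \<cdot>\<^bsub>R\<^esub> f = p" using rf Rp.HomD[OF p(1)] by simp
  note FR = HomR_D(1)[OF p(1)] and KR = HomR_D(1)[OF k(2)]
  note aF = reprD(2)[OF FR \<rho>, folded x_def y_def] and aK = reprD(2)[OF KR \<rho>, folded x_def y_def]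
  note py = HomR_D(3)[OF p(1) yv] and px = HomR_D(3)[OF p(1) xv, unfolded SXx] and ky = HomR_D(3)[OF k(2) yv]
    and kx = HomR_D(3)[OF k(2) xv] and fy = HomR_D(3)[OF f yv, unfolded B(2)[OF yv]]
    and fx = HomR_D(3)[OF f xv, unfolded B(2)[OF xv]]
  note [simp] = HomD[OF aF] HomD[OF aK] HomD[OF py] HomD[OF px] HomD[OF ky] HomD[OF kx] HomD[OF fy] HomD[OF fx]
    biprodD[OF bp[OF xv], unfolded SXx] biprodD[OF bp[OF yv], unfolded SYy]
  note pn = HomR_D(4)[OF p(1) \<rho>, folded x_def y_def] and kn = HomR_D(4)[OF k(2) \<rho>, folded x_def y_def]
    and fn = HomR_D(4)[OF f \<rho>, folded x_def y_def]
  have aB: "ar \<rho> B = i\<^sub>2 y \<cdot> p\<^sub>1 x" unfolding B(3)[OF \<rho>] \<phi>_def by simp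
  have pf: "p\<^sub>1 x \<cdot> ev x f = ev x p" using comp_R(2)[OF f r(1) xv] rf' r(2)[OF xv] by simp
  \<comment> \<open>The arrow \<open>f\<close> lifts \<open>p\<close> to \<open>B\<close>, where
    \<open>\<rho>\<close> moves the component in \<open>SX\<close> at \<open>x\<close> to the
    component in \<open>SY\<close> at \<open>y\<close>; so \<open>p\<close> at \<open>x\<close>
    reappears as the second component after one application of \<open>\<rho>\<close>.\<close>
  have w0: "p\<^sub>2 y \<cdot> (ev y f \<cdot> ar \<rho> F) = ev x p" unfolding fn[symmetric] aB using pf by simp
  have pkx: "ev x p \<cdot> ev x k = Zero C (ob x K) A"
    using is_kernelD(4)[OF rep_kernel_ev[OF p(1) k(2,1) xv]] by simp
  obtain cK K' where cK: "is_cokernel C (ar \<rho> K) cK" "cK \<in> Arr C" "Cod C cK = K'" "Dom C cK = Cod C (ar \<rho> K)"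
    "K' \<in> Obj C" "cK \<cdot> ar \<rho> K = Zero C (Dom C (ar \<rho> K)) K'" by (rule obtain_cokernel[OF HomD(1)[OF aK]])
  have cKH: "cK \<in> Hom C (ob y K) K'" using cK by simp
  note [simp] = HomD[OF cKH]
  have w0': "(p\<^sub>2 y \<cdot> ev y f) \<cdot> ar \<rho> F = ev x p" using w0 by simp
  \<comment> \<open>Restricted to \<open>K\<close> the same composite is zero, since
    \<open>p\<close> kills \<open>K\<close>; hence it induces \<open>ub\<close> on the
    cokernel.\<close>
  have "(p\<^sub>2 y \<cdot> (ev y f \<cdot> ev y k)) \<cdot> ar \<rho> K = (p\<^sub>2 y \<cdot> ev y f) \<cdot> (ar \<rho> F \<cdot> ev x k)"
    unfolding kn by simp
  also have "\<dots> = ev x p \<cdot> ev x k" by (rule comp_reduce[OF w0']) simp_all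
  also note pkx
  finally obtain ub where ub: "ub \<in> Arr C" "Dom C ub = Cod C cK" "Cod C ub = A" "ub \<cdot> cK = p\<^sub>2 y \<cdot> (ev y f \<cdot> ev y k)"
    by (rule cokernel_factor[OF cK(1)]) simp_all
  have ubH: "ub \<in> Hom C K' A" using ub by simp
  note [simp] = HomD[OF ubH]
  have fkH: "f \<cdot>\<^bsub>R\<^esub> k \<in> Hom R K B" by (rule comp_R(1)[OF k(2) f])
  have "ub \<cdot> cK = p\<^sub>2 y \<cdot> ev y (f \<cdot>\<^bsub>R\<^esub> k)" unfolding comp_R(2)[OF k(2) f yv] by (rule ub(4))
  then have vub: "vanishes gs ub"
    using vanishes_coker[OF \<rho> conjunct1[OF conjunct2[OF Gs]] _ vank fkH mK cK(1) _ ubH] p2H cKH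
    unfolding y_def by blast
  \<comment> \<open>As \<open>\<rho>\<close> acts by zero on \<open>SX\<close>, it maps
    \<open>F\<close> at \<open>x\<close> into \<open>K\<close> at \<open>y\<close>.\<close>
  have "ev y p \<cdot> ar \<rho> F = Zero C (ob x F) (ob y SX)"
    unfolding pn[symmetric] aX[OF \<rho>, folded x_def y_def] using reprD(1)[OF SX yv] SXx by simp
  then obtain m where m: "m \<in> Arr C" "Dom C m = ob x F" "Cod C m = Dom C (ev y k)" "ev y k \<cdot> m = ar \<rho> F"
    by (rule kernel_lift[OF rep_kernel_ev[OF p(1) k(2,1) yv]]) simp_all
  have mH: "m \<in> Hom C (ob x F) (ob y K)" using m by simp
  note [simp] = HomD[OF mH]
  have "ev y k \<cdot> (m \<cdot> ev x k) = ev y k \<cdot> ar \<rho> K" by (simp add: comp_reduce[OF m(4)] kn)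
  then have mk: "m \<cdot> ev x k = ar \<rho> K"
    by (rule is_kernel_unique[OF rep_kernel_ev[OF p(1) k(2,1) yv], of _ _ "ob x K"]) simp_all
  \<comment> \<open>Modulo the image of \<open>\<rho>\<close> on \<open>K\<close>, this map is
    defined on \<open>F\<close> at \<open>x\<close> modulo \<open>K\<close>, which is
    \<open>A\<close>. The induced arrow \<open>a\<close> is the connecting map of the snake
    lemma.\<close>
  have "(cK \<cdot> m) \<cdot> ev x k = Zero C (Dom C (ev x k)) (Cod C (cK \<cdot> m))" using mk cK(6) by simp
  then obtain a where a: "a \<in> Arr C" "Dom C a = Cod C (ev x p)" "Cod C a = Cod C (cK \<cdot> m)" "a \<cdot> ev x p = cK \<cdot> m"
    by (rule epi_factor[OF rep_epi_ev[OF p xv] rep_kernel_ev[OF p(1) k(2,1) xv], rotated 2]) simp_all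
  have aH: "a \<in> Hom C A K'" using a by simp
  note [simp] = HomD[OF aH]
  have "ub \<cdot> a = Ident C A"
  proof (rule is_epiD[OF rep_epi_ev[OF p xv]])
    have "(ub \<cdot> a) \<cdot> ev x p = ub \<cdot> (cK \<cdot> m)" using a(4) by simp
    also have "\<dots> = p\<^sub>2 y \<cdot> (ev y f \<cdot> (ev y k \<cdot> m))" by (simp add: comp_reduce[OF ub(4)])
    also have "\<dots> = ev x p" unfolding m(4) by (rule w0)
    finally show "(ub \<cdot> a) \<cdot> ev x p = Ident C A \<cdot> ev x p" by simp
  qed simp_all
  then show ?thesis using vanishes_comp[OF vub ubH aH] by simp
qed

text \<open>An element of \<open>enat\<close> is determined by its finite upper bounds, so it
  suffices to compare these. \<open>ext_vanish_Rep\<close> and \<open>vanishes_of_Rep\<close> shift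
  vanishing by one degree, up and down respectively.\<close>

lemma gldim_Rep:
  assumes \<rho>: "\<rho> \<in> arcs Q" and A: "A \<in> Obj C" "\<not> is_zero_obj C A"
  shows "gldim R = gldim C + 1"
proof -
  obtain Z where Z: "Z \<in> Obj C" "\<And>f A. f \<in> Hom C A Z \<Longrightarrow> f = Zero C A Z"
    "\<And>f A. f \<in> Hom C Z A \<Longrightarrow> f = Zero C Z A" by (rule obtain_zero) blast
  have eq: "gldim R \<le> enat n \<longleftrightarrow> gldim C + 1 \<le> enat n" for n
  proof (cases n)
    \<comment> \<open>The bound 0 never holds for representations: with the empty chain,
      \<open>vanishes_of_Rep\<close> would make the identity of the nonzero object \<open>A\<close>
      zero.\<close>
    case 0
    have "\<not> gldim R \<le> enat 0"
    proof
      assume "gldim R \<le> enat 0"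
      then have "Rp.ext_vanish (Suc 0) M" if "M \<in> reprs Q C" for M using Rp.gldim_le_iff that by simp
      then have "vanishes [] (Ident C A)" by (intro vanishes_of_Rep[OF \<rho> A(1) Z]) simp_all
      then have i0: "Ident C A = Zero C A A" using vanishes_Nil[of "Ident C A" A A] A(1) by simp
      have 1: "f = Zero C B A" if "f \<in> Hom C B A" for f B
      proof -
        note [simp] = HomD[OF that]
        have "f = Ident C A \<cdot> f" by simp
        then show ?thesis unfolding i0 by simp
      qed
      have 2: "f = Zero C A B" if "f \<in> Hom C A B" for f B
      proof -
        note [simp] = HomD[OF that]
        have "f = f \<cdot> Ident C A" by simp
        then show ?thesis unfolding i0 by simp
      qed
      have "is_zero_obj C A"
        unfolding is_zero_obj_def
      proof (intro conjI ballI)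
        fix B assume B: "B \<in> Obj C"
        have z: "Zero C B A \<in> Hom C B A" "Zero C A B \<in> Hom C A B" using A(1) B by simp_all
        show "\<exists>!f. f \<in> Hom C B A" using z(1) 1 by (rule ex1I)
        show "\<exists>!f. f \<in> Hom C A B" using z(2) 2 by (rule ex1I)
      qed (rule A(1))
      then show False using A(2) by blast
    qed
    moreover have "\<not> gldim C + 1 \<le> enat 0" by (simp flip: zero_enat_def)
    ultimately show ?thesis using 0 by blast
  next
    case (Suc m)
    have "gldim C + 1 \<le> enat (Suc m) \<longleftrightarrow> gldim C \<le> enat m"
      by (simp flip: eSuc_enat add: plus_1_eSuc)
    moreover have "gldim R \<le> enat (Suc m) \<longleftrightarrow> gldim C \<le> enat m"
    proof
      assume a: "gldim R \<le> enat (Suc m)"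
      show "gldim C \<le> enat m"
        unfolding gldim_le_iff
      proof (intro ballI allI impI)
        fix D k assume D: "D \<in> Obj C" and k: "m < k"
        have "Rp.ext_vanish (Suc k) M" if "M \<in> reprs Q C" for M
          using a that k unfolding Rp.gldim_le_iff by simp
        then show "ext_vanish k D"
          using k by (intro ext_vanishI[OF _ D Z(1)] vanishes_of_Rep[OF \<rho> D Z]) simp_all
      qed
    next
      assume a: "gldim C \<le> enat m"
      show "gldim R \<le> enat (Suc m)"
        unfolding Rp.gldim_le_iff
      proof (intro ballI allI impI)
        fix M k assume M: "M \<in> Obj R" and k: "Suc m < k"
        then obtain k' where k': "k = Suc k'" "m < k'" by (cases k) simp_all
        show "Rp.ext_vanish k M"
          unfolding k'(1) by (rule ext_vanish_Rep) (use a M k'(2) gldim_le_iff in auto)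
      qed
    qed
    ultimately show ?thesis using Suc by blast
  qed
  show ?thesis
  proof (rule antisym)
    show "gldim R \<le> gldim C + 1" using eq by (cases "gldim C + 1") auto
    show "gldim C + 1 \<le> gldim R" using eq by (cases "gldim R") auto
  qed
qed

end

section \<open>Sizes of sets of cardinals and the conclusion\<close>

lemma card_less_csize:
  assumes "x \<in> X" "\<And>x. x \<in> X \<Longrightarrow> Card_order x"
  shows "x <o csize X"
proof -
  have s: "Card_order (csup X)" "x \<le>o csup X"
    using is_csup_csup[of X] assms unfolding is_csup_def by blast+
  show ?thesis
  \<comment> \<open>A size exceeds each member strictly: either the supremum already does, or its
    successor is taken. In the first case the passage to singletons changes only the underlying
    type.\<close>
  proof (cases "\<forall>x\<in>X. x <o csup X")
    case True
    have "inj_on (\<lambda>a. {a}) (Field (csup X))" by (simp add: inj_on_def)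
    then have "card_of (Field (csup X)) =o card_of ((\<lambda>a. {a}) ` Field (csup X))"
      using card_of_ordIso bij_betw_imageI by blast
    then have "csup X =o card_of ((\<lambda>a. {a}) ` Field (csup X))"
      using card_of_Field_ordIso[OF s(1)] ordIso_symmetric ordIso_transitive by blast
    moreover have "csize X = card_of ((\<lambda>a. {a}) ` Field (csup X))"
      unfolding csize_def using True by (rule if_P)
    moreover have "x <o csup X" using True assms(1) by blast
    ultimately show ?thesis using ordLess_ordIso_trans by metis
  next
    case False
    then have "csize X = cardSuc (csup X)" unfolding csize_def by (rule if_not_P)
    then show ?thesis using ordLeq_ordLess_trans[OF s(2) cardSuc_greater[OF s(1)]] by simp
  qed
qed

theorem theorem3p25:
  fixes Q :: "('v, 'e) pre_digraph"
    and \<rho>\<^sub>0 :: 'e and x y :: 'v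
    and \<kappa> :: "'k rel"
    and C :: "('o, 'm) precat"
  assumes "wf_digraph Q"
    and "\<rho>\<^sub>0 \<in> arcs Q" "tail Q \<rho>\<^sub>0 = x" "head Q \<rho>\<^sub>0 = y"
    and "Cinfinite \<kappa>"
    and "rccn Q \<le>o \<kappa>" "ltccn Q \<le>o \<kappa>"
    and "card_of (verts Q) <o \<kappa>" "card_of (arcs Q) <o \<kappa>"
    and "abelian_cat C" "AB4 \<kappa> C"
    and "\<exists>A\<in>Obj C. \<not> is_zero_obj C A"
    and "x \<noteq> y \<or> (x = y \<and> AB3_star aleph1 C)"
  shows "gldim (Rep Q C) = gldim C + 1"
proof -
  have \<kappa>: "Card_order \<kappa>" using assms(5) by simp
  \<comment> \<open>The bound of \<open>ltccn Q\<close> by \<open>\<kappa>\<close> is not strict,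
    but a size strictly exceeds its members, so every set of paths to a vertex is smaller than
    \<open>\<kappa>\<close>.\<close>
  have small: "card_of (paths_to Q j) <o \<kappa>" if j: "j \<in> verts Q" for j
  proof -
    have "card_of (paths_to Q j) <o ltccn Q"
      unfolding ltccn_def by (rule card_less_csize) (use j card_of_Card_order in blast)+
    then show ?thesis using assms(7) ordLess_ordLeq_trans by blast
  qed
  have "quiver_rep_AB4 C Q \<kappa>"
    by (intro quiver_rep_AB4.intro quiver_rep.intro quiver_rep_axioms.intro quiver_rep_AB4_axioms.intro
        assms(1,10,11) \<kappa> small)
  from quiver_rep_AB4.gldim_Rep[OF this assms(2)] show ?thesis using assms(12) by blast
qed

end
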